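(* Let $\lambda$ be a partition of a positive integer $d$. Then the $\mathfrak{so}_\infty$-module $\boldsymbol\Gamma_{\lambda;0}$ is indecomposable, and the layers of its socle filtration satisfy, for every integer $r\ge0$, $$\overline{\operatorname{soc}}^{(r+1)}\boldsymbol\Gamma_{\lambda;0}\;\cong\;\bigoplus_{\mu}\Big(\sum_{|\gamma|=r}\mathrm N_{\mu,2\gamma}^{\lambda}\Big)\ \boldsymbol\Gamma_{[\mu]},$$ where $\mu,\gamma$ run over partitions and the coefficient in parentheses is a multiplicity.
   Context: $\Bbbk$ is an algebraically closed field of characteristic zero; everything is over $\Bbbk$. Let $\mathbf V$ be a countably infinite-dimensional vector space with a non-degenerate symmetric bilinear form $Q:\mathbf V\otimes\mathbf V\to\Bbbk$. $\mathfrak{gl}_\infty$ is the Lie algebra of operators on $\mathbf V$ spanned by $u\otimes w:\ v\mapsto Q(v,w)u$ ($u,w\in\mathbf V$), and $\mathfrak{so}_\infty=\{X\in\mathfrak{gl}_\infty:Q(Xu,v)+Q(u,Xv)=0\ \forall u,v\in\mathbf V\}$. Both act on $\mathbf V^{\otimes d}$ by the Leibniz rule. For $I=(i,j)$ with $1\le i<j\le d$, $\Phi_{[I]}:\mathbf V^{\otimes d}\to\mathbf V^{\otimes(d-2)}$ sends $v_1\otimes\dots\otimes v_d$ to $Q(v_i,v_j)$ times the tensor with $v_i,v_j$ omitted. $\mathbf V^{[0]}=\Bbbk$, $\mathbf V^{[1]}=\mathbf V$, and $\mathbf V^{[d]}=\bigcap_I\ker\Phi_{[I]}$ for $d\ge2$.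 A partition is a finite nonincreasing sequence of positive integers; $|\lambda|$ is the sum of its parts; $2\gamma$ is the partition with parts $2\gamma_i$. For $|\lambda|=d$, $c_\lambda\in\Bbbk[\mathfrak S_d]$ is the Young symmetrizer of the standard tableau of shape $\lambda$ (numbered consecutively along rows), $\mathbb S_\lambda\mathbf V=\operatorname{im}(c_\lambda:\mathbf V^{\otimes d}\to\mathbf V^{\otimes d})$. Set $\boldsymbol\Gamma_{\lambda;0}=\mathbb S_\lambda\mathbf V$ (a $\mathfrak{gl}_\infty$-module, regarded as an $\mathfrak{so}_\infty$-module by restriction) and $\boldsymbol\Gamma_{[\lambda]}=\mathbf V^{[d]}\cap\mathbb S_\lambda\mathbf V$. $\mathrm N_{\lambda,\mu}^\nu$ are the Littlewood–Richardson coefficients: $S_\lambda S_\mu=\sum_\nu\mathrm N_{\lambda,\mu}^\nu S_\nu$ for Schur symmetric functions. For a finite length module $M$, $\operatorname{soc}M$ is the sum of all simple submodules; $\operatorname{soc}^{(0)}M=0$, $\operatorname{soc}^{(i+1)}M/\operatorname{soc}^{(i)}M=\operatorname{soc}(M/\operatorname{soc}^{(i)}M)$, and $\overline{\operatorname{soc}}^{(i)}M=\operatorname{soc}^{(i)}M/\operatorname{soc}^{(i-1)}M$. *)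

theory Defs
  imports
    Complex_Main
    "HOL-Library.FuncSet"
    "HOL-Library.Function_Algebras"
    "HOL-Library.Multiset"
    "HOL-Library.Poly_Mapping"
    "HOL-Computational_Algebra.Polynomial"
    "HOL-Combinatorics.Permutations"
begin

section \<open>Modules over a set of operators\<close>

text \<open>
  The axioms of a Lie algebra module are not part of the record.  The Lie algebra enters the
  notions below as the set \<open>g\<close> of those elements of \<open>'g\<close> that are allowed to act;
  restricting a module to a subalgebra means passing to a smaller \<open>g\<close>.
\<close>

record ('k, 'g, 'm) rep =
  rcarr :: "'m set"
  radd :: "'m \<Rightarrow> 'm \<Rightarrow> 'm"
  rzero :: "'m"
  rscale :: "'k \<Rightarrow> 'm \<Rightarrow> 'm"
  ract :: "'g \<Rightarrow> 'm \<Rightarrow> 'm"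

definition submod :: "'g set \<Rightarrow> ('k, 'g, 'm) rep \<Rightarrow> 'm set \<Rightarrow> bool" where
  "submod g M S \<longleftrightarrow>
     S \<subseteq> rcarr M \<and> rzero M \<in> S \<and>
     (\<forall>x\<in>S. \<forall>y\<in>S. radd M x y \<in> S) \<and>
     (\<forall>c. \<forall>x\<in>S. rscale M c x \<in> S) \<and>
     (\<forall>X\<in>g. \<forall>x\<in>S. ract M X x \<in> S)"

abbreviation sub_rep :: "('k, 'g, 'm) rep \<Rightarrow> 'm set \<Rightarrow> ('k, 'g, 'm) rep" where
  "sub_rep M S \<equiv> M\<lparr>rcarr := S\<rparr>"

definition simple_rep :: "'g set \<Rightarrow> ('k, 'g, 'm) rep \<Rightarrow> bool" where
  "simple_rep g M \<longleftrightarrow>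
     rcarr M \<noteq> {rzero M} \<and> (\<forall>S. submod g M S \<longrightarrow> S = {rzero M} \<or> S = rcarr M)"

definition indecomposable_rep :: "'g set \<Rightarrow> ('k, 'g, 'm) rep \<Rightarrow> bool" where
  "indecomposable_rep g M \<longleftrightarrow>
     rcarr M \<noteq> {rzero M} \<and>
     \<not> (\<exists>A B. submod g M A \<and> submod g M B \<and> A \<noteq> {rzero M} \<and> B \<noteq> {rzero M} \<and>
             A \<inter> B = {rzero M} \<and> rcarr M = {radd M a b |a b. a \<in> A \<and> b \<in> B})"

definition rep_iso :: "'g set \<Rightarrow> ('k, 'g, 'm) rep \<Rightarrow> ('k, 'g, 'n) rep \<Rightarrow> bool" where
  "rep_iso g M N \<longleftrightarrow>
     (\<exists>f. bij_betw f (rcarr M) (rcarr N) \<and>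
          (\<forall>x\<in>rcarr M. \<forall>y\<in>rcarr M. f (radd M x y) = radd N (f x) (f y)) \<and>
          (\<forall>c. \<forall>x\<in>rcarr M. f (rscale M c x) = rscale N c (f x)) \<and>
          (\<forall>X\<in>g. \<forall>x\<in>rcarr M. f (ract M X x) = ract N X (f x)))"

definition rcoset :: "('k, 'g, 'm) rep \<Rightarrow> 'm set \<Rightarrow> 'm \<Rightarrow> 'm set" where
  "rcoset M N x = radd M x ` N"

text \<open>
  Operations on cosets are computed on all representatives; for well-defined operations the
  unions below are unions of equal cosets.
\<close>

definition quot_rep :: "('k, 'g, 'm) rep \<Rightarrow> 'm set \<Rightarrow> ('k, 'g, 'm set) rep" where
  "quot_rep M N =
     \<lparr> rcarr = rcoset M N ` rcarr M,
       radd = (\<lambda>A B. \<Union>a\<in>A. \<Union>b\<in>B. rcoset M N (radd M a b)),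
       rzero = N,
       rscale = (\<lambda>c A. \<Union>a\<in>A. rcoset M N (rscale M c a)),
       ract = (\<lambda>X A. \<Union>a\<in>A. rcoset M N (ract M X a)) \<rparr>"

definition direct_sum_rep :: "'i set \<Rightarrow> ('i \<Rightarrow> ('k, 'g, 'm) rep) \<Rightarrow> ('k, 'g, 'i \<Rightarrow> 'm) rep" where
  "direct_sum_rep I M =
     \<lparr> rcarr = {f \<in> (\<Pi>\<^sub>E i\<in>I. rcarr (M i)). finite {i \<in> I. f i \<noteq> rzero (M i)}},
       radd = (\<lambda>f h. \<lambda>i\<in>I. radd (M i) (f i) (h i)),
       rzero = (\<lambda>i\<in>I. rzero (M i)),
       rscale = (\<lambda>c f. \<lambda>i\<in>I. rscale (M i) c (f i)),
       ract = (\<lambda>X f. \<lambda>i\<in>I. ract (M i) X (f i)) \<rparr>"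


section \<open>Socle filtration\<close>

definition soc :: "'g set \<Rightarrow> ('k, 'g, 'm) rep \<Rightarrow> 'm set" where
  "soc g M = {foldr (radd M) xs (rzero M) |xs.
                set xs \<subseteq> \<Union> {S. submod g M S \<and> simple_rep g (sub_rep M S)}}"

primrec soc_filt :: "'g set \<Rightarrow> ('k, 'g, 'm) rep \<Rightarrow> nat \<Rightarrow> 'm set" where
  "soc_filt g M 0 = {rzero M}"
| "soc_filt g M (Suc i) =
     {x \<in> rcarr M. rcoset M (soc_filt g M i) x \<in> soc g (quot_rep M (soc_filt g M i))}"

text \<open>Meaningful for \<open>i \<ge> 1\<close> only.\<close>

definition soc_layer :: "'g set \<Rightarrow> ('k, 'g, 'm) rep \<Rightarrow> nat \<Rightarrow> ('k, 'g, 'm set) rep" where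
  "soc_layer g M i = quot_rep (sub_rep M (soc_filt g M i)) (soc_filt g M (i - 1))"


section \<open>The orthogonal space and its Lie algebras\<close>

locale countable_orthogonal_space = vector_space scale
  for scale :: "'k::{alg_closed_field, field_char_0} \<Rightarrow> 'v::ab_group_add \<Rightarrow> 'v" +
  fixes Q :: "'v \<Rightarrow> 'v \<Rightarrow> 'k"
  assumes countable_basis:
      "\<exists>B. countable B \<and> infinite B \<and> \<not> module.dependent scale B \<and> module.span scale B = UNIV"
    and Q_linear_left: "\<And>w. Vector_Spaces.linear scale (*) (\<lambda>v. Q v w)"
    and Q_linear_right: "\<And>v. Vector_Spaces.linear scale (*) (\<lambda>w. Q v w)"
    and Q_symmetric: "\<And>v w. Q v w = Q w v"
    and Q_nondegenerate: "\<And>v. (\<And>w. Q v w = 0) \<Longrightarrow> v = 0"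

definition gl_inf :: "('k::field \<Rightarrow> 'v::ab_group_add \<Rightarrow> 'v) \<Rightarrow> ('v \<Rightarrow> 'v \<Rightarrow> 'k) \<Rightarrow> ('v \<Rightarrow> 'v) set" where
  "gl_inf scale Q = module.span (\<lambda>c X v. scale c (X v)) {(\<lambda>v. scale (Q v w) u) |u w. True}"

definition so_inf :: "('k::field \<Rightarrow> 'v::ab_group_add \<Rightarrow> 'v) \<Rightarrow> ('v \<Rightarrow> 'v \<Rightarrow> 'k) \<Rightarrow> ('v \<Rightarrow> 'v) set" where
  "so_inf scale Q = {X \<in> gl_inf scale Q. \<forall>u v. Q (X u) v + Q u (X v) = 0}"


section \<open>Tensor powers\<close>

text \<open>
  The \<open>d\<close>-th tensor power is the free vector space on the lists of length \<open>d\<close>, modulo the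
  multilinearity relations; the class of \<open>Poly_Mapping.single [v\<^sub>1, \<dots>, v\<^sub>d] 1\<close> is the pure tensor
  of \<open>v\<^sub>1, \<dots>, v\<^sub>d\<close>.  Tensor positions are numbered from 0.
\<close>

definition fscale :: "'k::field \<Rightarrow> ('a \<Rightarrow>\<^sub>0 'k) \<Rightarrow> ('a \<Rightarrow>\<^sub>0 'k)" where
  "fscale c t = Poly_Mapping.map ((*) c) t"

definition lin_ext :: "('a \<Rightarrow> ('b \<Rightarrow>\<^sub>0 'k)) \<Rightarrow> ('a \<Rightarrow>\<^sub>0 'k::field) \<Rightarrow> ('b \<Rightarrow>\<^sub>0 'k)" where
  "lin_ext f t = (\<Sum>a\<in>Poly_Mapping.keys t. fscale (Poly_Mapping.lookup t a) (f a))"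

definition leibniz :: "('v \<Rightarrow> 'v) \<Rightarrow> 'v list \<Rightarrow> ('v list \<Rightarrow>\<^sub>0 'k::field)" where
  "leibniz X vs = (\<Sum>i<length vs. Poly_Mapping.single (vs[i := X (vs ! i)]) 1)"

text \<open>
  The action of operators on the free space is only an auxiliary datum: it becomes linear in
  the operator after passing to the quotient.
\<close>

definition free_rep :: "nat \<Rightarrow> ('k::field, 'v \<Rightarrow> 'v, 'v list \<Rightarrow>\<^sub>0 'k) rep" where
  "free_rep d =
     \<lparr> rcarr = {t. \<forall>vs\<in>Poly_Mapping.keys t. length vs = d},
       radd = (+),
       rzero = 0,
       rscale = fscale,
       ract = (\<lambda>X. lin_ext (leibniz X)) \<rparr>"

definition tensor_rels ::
    "('k::field \<Rightarrow> 'v::ab_group_add \<Rightarrow> 'v) \<Rightarrow> nat \<Rightarrow> ('v list \<Rightarrow>\<^sub>0 'k) set" where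
  "tensor_rels scale d = module.span fscale
     ({Poly_Mapping.single (vs[i := u + w]) 1
         - Poly_Mapping.single (vs[i := u]) 1 - Poly_Mapping.single (vs[i := w]) 1
         |vs i u w. length vs = d \<and> i < d} \<union>
      {Poly_Mapping.single (vs[i := scale c u]) 1 - Poly_Mapping.single (vs[i := u]) c
         |vs i c u. length vs = d \<and> i < d})"

type_synonym ('k, 'v) tensor = "('v list \<Rightarrow>\<^sub>0 'k) set"

definition tpow ::
    "('k::field \<Rightarrow> 'v::ab_group_add \<Rightarrow> 'v) \<Rightarrow> nat \<Rightarrow> ('k, 'v \<Rightarrow> 'v, ('k, 'v) tensor) rep" where
  "tpow scale d = quot_rep (free_rep d) (tensor_rels scale d)"

text \<open>
  The map into the \<open>e\<close>-th tensor power whose value at the pure tensor of \<open>vs\<close> is the class of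
  \<open>f vs\<close>, for \<open>f\<close> multilinear modulo the relations.
\<close>

definition tmap ::
    "('k::field \<Rightarrow> 'v::ab_group_add \<Rightarrow> 'v) \<Rightarrow> nat \<Rightarrow> ('v list \<Rightarrow> ('v list \<Rightarrow>\<^sub>0 'k))
      \<Rightarrow> ('k, 'v) tensor \<Rightarrow> ('k, 'v) tensor" where
  "tmap scale e f A = (\<Union>t\<in>A. rcoset (free_rep e) (tensor_rels scale e) (lin_ext f t))"

definition contraction ::
    "('k::field \<Rightarrow> 'v::ab_group_add \<Rightarrow> 'v) \<Rightarrow> ('v \<Rightarrow> 'v \<Rightarrow> 'k) \<Rightarrow> nat \<Rightarrow> nat \<Rightarrow> nat
      \<Rightarrow> ('k, 'v) tensor \<Rightarrow> ('k, 'v) tensor" where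
  "contraction scale Q d i j =
     tmap scale (d - 2) (\<lambda>vs. Poly_Mapping.single (nths vs (- {i, j})) (Q (vs ! i) (vs ! j)))"

text \<open>For \<open>d < 2\<close> there are no contractions, and this is the whole tensor power.\<close>

definition traceless ::
    "('k::field \<Rightarrow> 'v::ab_group_add \<Rightarrow> 'v) \<Rightarrow> ('v \<Rightarrow> 'v \<Rightarrow> 'k) \<Rightarrow> nat \<Rightarrow> ('k, 'v) tensor set" where
  "traceless scale Q d =
     {x \<in> rcarr (tpow scale d).
        \<forall>i j. i < j \<and> j < d \<longrightarrow> contraction scale Q d i j x = rzero (tpow scale (d - 2))}"


section \<open>Partitions, Young symmetrizers and Schur functors\<close>

definition is_partition :: "nat list \<Rightarrow> bool" where
  "is_partition p \<longleftrightarrow> sorted_wrt (\<ge>) p \<and> 0 \<notin> set p"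

text \<open>
  The (row, column) position of the number \<open>n\<close> in the tableau filled consecutively along rows;
  numbers, rows and columns all start from 0.
\<close>

fun tableau_cell :: "nat list \<Rightarrow> nat \<Rightarrow> nat \<times> nat" where
  "tableau_cell [] n = (0, n)"
| "tableau_cell (l # ls) n =
     (if n < l then (0, n) else (case tableau_cell ls (n - l) of (r, c) \<Rightarrow> (Suc r, c)))"

definition row_stabilizer :: "nat list \<Rightarrow> (nat \<Rightarrow> nat) set" where
  "row_stabilizer p = {\<sigma>. \<sigma> permutes {..<sum_list p} \<and>
     (\<forall>n<sum_list p. fst (tableau_cell p (\<sigma> n)) = fst (tableau_cell p n))}"

definition col_stabilizer :: "nat list \<Rightarrow> (nat \<Rightarrow> nat) set" where
  "col_stabilizer p = {\<sigma>. \<sigma> permutes {..<sum_list p} \<and>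
     (\<forall>n<sum_list p. snd (tableau_cell p (\<sigma> n)) = snd (tableau_cell p n))}"

text \<open>An element of the group algebra: row symmetrizer times column antisymmetrizer.\<close>

definition young_symmetrizer :: "nat list \<Rightarrow> ((nat \<Rightarrow> nat) \<Rightarrow>\<^sub>0 'k::field)" where
  "young_symmetrizer p =
     (\<Sum>\<sigma>\<in>row_stabilizer p. \<Sum>\<tau>\<in>col_stabilizer p.
        Poly_Mapping.single (\<sigma> \<circ> \<tau>) (of_int (sign \<tau>)))"

text \<open>The left action: \<open>\<sigma>\<close> moves the factor at position \<open>i\<close> to position \<open>\<sigma> i\<close>.\<close>

definition permute_tensor :: "((nat \<Rightarrow> nat) \<Rightarrow>\<^sub>0 'k::field) \<Rightarrow> 'v list \<Rightarrow> ('v list \<Rightarrow>\<^sub>0 'k)" where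
  "permute_tensor c vs =
     (\<Sum>\<sigma>\<in>Poly_Mapping.keys c.
        Poly_Mapping.single (map (\<lambda>j. vs ! inv \<sigma> j) [0..<length vs]) (Poly_Mapping.lookup c \<sigma>))"

definition schur_functor ::
    "('k::field \<Rightarrow> 'v::ab_group_add \<Rightarrow> 'v) \<Rightarrow> nat list \<Rightarrow> ('k, 'v) tensor set" where
  "schur_functor scale p =
     tmap scale (sum_list p) (permute_tensor (young_symmetrizer p)) ` rcarr (tpow scale (sum_list p))"

definition Gamma_gl ::
    "('k::field \<Rightarrow> 'v::ab_group_add \<Rightarrow> 'v) \<Rightarrow> nat list \<Rightarrow> ('k, 'v \<Rightarrow> 'v, ('k, 'v) tensor) rep" where
  "Gamma_gl scale p = sub_rep (tpow scale (sum_list p)) (schur_functor scale p)"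

definition Gamma_so ::
    "('k::field \<Rightarrow> 'v::ab_group_add \<Rightarrow> 'v) \<Rightarrow> ('v \<Rightarrow> 'v \<Rightarrow> 'k) \<Rightarrow> nat list
      \<Rightarrow> ('k, 'v \<Rightarrow> 'v, ('k, 'v) tensor) rep" where
  "Gamma_so scale Q p =
     sub_rep (tpow scale (sum_list p)) (traceless scale Q (sum_list p) \<inter> schur_functor scale p)"


section \<open>Schur functions and Littlewood--Richardson coefficients\<close>

definition semistandard :: "nat list \<Rightarrow> nat list list \<Rightarrow> bool" where
  "semistandard p T \<longleftrightarrow>
     map length T = p \<and> (\<forall>row\<in>set T. sorted row) \<and>
     (\<forall>i j. Suc i < length T \<and> j < length (T ! Suc i) \<longrightarrow> T ! i ! j < T ! Suc i ! j)"

text \<open>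
  A symmetric function in variables indexed by \<open>nat\<close> is given by its coefficients; the multiset
  \<open>m\<close> stands for the monomial in which the \<open>i\<close>-th variable has exponent \<open>count m i\<close>.
\<close>

definition schur_function :: "nat list \<Rightarrow> nat multiset \<Rightarrow> nat" where
  "schur_function p m = card {T. semistandard p T \<and> mset (concat T) = m}"

definition symfun_mult :: "(nat multiset \<Rightarrow> nat) \<Rightarrow> (nat multiset \<Rightarrow> nat) \<Rightarrow> nat multiset \<Rightarrow> nat" where
  "symfun_mult f h m = (\<Sum>a\<in>{a. a \<subseteq># m}. f a * h (m - a))"

text \<open>\<open>lr_coeff \<lambda> \<mu> \<nu>\<close> is the coefficient with lower indices \<open>\<lambda>\<close>, \<open>\<mu>\<close> and upper index \<open>\<nu>\<close>.\<close>

definition lr_coeff :: "nat list \<Rightarrow> nat list \<Rightarrow> nat list \<Rightarrow> nat" where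
  "lr_coeff p q = (THE N.
     finite {s. N s \<noteq> 0} \<and> (\<forall>s. N s \<noteq> 0 \<longrightarrow> is_partition s) \<and>
     symfun_mult (schur_function p) (schur_function q) =
       (\<lambda>m. \<Sum>s\<in>{s. N s \<noteq> 0}. N s * schur_function s m))"

end

theory Submission
  imports Defs "HOL-Library.Countable_Set"
begin

text \<open>
 A hyperbolic basis identifies the \<open>d\<close>-th tensor power with the span of the words of length \<open>d\<close>,
 on which permutations of the positions act from the right; the Schur functor becomes the set of
 right multiples of a Young symmetrizer. Let \<open>F r\<close> consist of the tensors killed by all
 \<open>r\<close>-fold contractions. Replacing letters, one after the other, by letters that occur nowhere
 else is done by elements of the orthogonal Lie algebra. It shows that a submodule not contained in
 \<open>F r\<close> meets \<open>F (r + 1)\<close> outside \<open>F r\<close>, and, reversing the replacement, that a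
 nonzero submodule generates all traceless tensors of a given symmetry. Hence the traceless Schur
 functors are simple, and the \<open>F r\<close> form the socle filtration as soon as \<open>F (r + 1) / F r\<close>
 is semisimple. The latter holds as \<open>r\<close>-fold contractions embed it into a sum of
 traceless Schur functors, and a traceless tensor lifts along a contraction by filling the contracted
 positions with letters that do not occur in it. The multiplicity is the dimension of
 \<open>c A e\<close> for the group algebra \<open>A\<close>, the Young symmetrizer \<open>c\<close> of the shape and the
 product \<open>e\<close> of a Young symmetrizer with the symmetrizer of a hyperoctahedral group; the
 representation induced from the trivial one of the hyperoctahedral group is the sum over the
 partitions with even parts.
\<close>

section \<open>The monoid algebra of self-maps of the naturals\<close>

text \<open>The obstacle is that traces cannot be split off: in infinite dimension there is no
  invariant tensor, hence no projection onto the traceless tensors. Letters come in pairs exchanged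
  by \<open>star\<close>, and for even \<open>n\<close> above all letters in use, the letters
  \<open>n + 2 * j\<close> are partners neither of each other nor of old ones, while
  \<open>n\<close> and \<open>n + 1\<close> contract to one. The group algebra is controlled by the
  coefficient of the identity, \<open>tau\<close>. It is a nondegenerate trace, so it yields dual
  bases and from these matrix units; that they exhaust the algebra is a count, the sum of the
  squares of the numbers of standard tableaux being \<open>fact d\<close>. The even partitions come
  from a count as well: a left ideal of dimension at most \<open>dfact r\<close> has a nonzero
  corner for every even partition, and the tableaux of even shape already number
  \<open>dfact r\<close>. Multiplicities are compared through weight spaces. These have bases of
  semistandard words, so the independence of Schur functions identifies the Littlewood-Richardson
  coefficients without a combinatorial rule.\<close>

hide_const (open) Poly_Mapping.range

abbreviation lookup :: "('a \<Rightarrow>\<^sub>0 'b::zero) => 'a => 'b" where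
 "lookup \<equiv> Poly_Mapping.lookup"

abbreviation keys :: "('a \<Rightarrow>\<^sub>0 'b::zero) => 'a set" where
 "keys \<equiv> Poly_Mapping.keys"

abbreviation single :: "'a => 'b => ('a \<Rightarrow>\<^sub>0 'b::zero)" where
 "single \<equiv> Poly_Mapping.single"

section \<open>Linear algebra of finitely supported functions\<close>

lemma lookup_fscale [simp]: "lookup (fscale c t) a = c * lookup t a"
 by (simp add: fscale_def Poly_Mapping.map.rep_eq when_def)

global_interpretation fs: vector_space "fscale :: 'k::field => ('a \<Rightarrow>\<^sub>0 'k) => ('a \<Rightarrow>\<^sub>0 'k)"
 by unfold_locales (auto intro!: poly_mapping_eqI simp: lookup_add algebra_simps)

abbreviation klin :: "(('a \<Rightarrow>\<^sub>0 'k::field) => ('b \<Rightarrow>\<^sub>0 'k)) => bool" where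
 "klin \<equiv> Vector_Spaces.linear fscale fscale"

global_interpretation fs2: vector_space_pair
 "fscale :: 'k::field => ('a \<Rightarrow>\<^sub>0 'k) => ('a \<Rightarrow>\<^sub>0 'k)"
 "fscale :: 'k::field => ('b \<Rightarrow>\<^sub>0 'k) => ('b \<Rightarrow>\<^sub>0 'k)"
 by unfold_locales

lemma klinI:
 assumes "!!x y. F (x + y) = F x + F y" "!!c x. F (fscale c x) = fscale c (F x)"
 shows "klin F"
 using assms by (simp add: Vector_Spaces.linear_iff fs.vector_space_axioms)

lemma klinD:
 assumes "klin F"
 shows "F (x + y) = F x + F y" "F (fscale c x) = fscale c (F x)" "F 0 = 0" "F (- x) = - F x"
 "F (x - y) = F x - F y" "F (sum g I) = (\<Sum>i\<in>I. F (g i))"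
 using assms by (simp_all add: fs2.linear_add fs2.linear_scale fs2.linear_0 fs2.linear_neg
 fs2.linear_diff fs2.linear_sum)

lemma fscale_single [simp]: "fscale c (single a b) = single a (c * b)"
 by (rule poly_mapping_eqI) (simp add: lookup_single when_def)

lemma sum_singles: "x = (\<Sum>a\<in>keys x. fscale (lookup x a) (single a 1))"
proof (rule poly_mapping_eqI)
 fix k
 have "lookup x k = (\<Sum>a\<in>keys x. if a = k then lookup x a else 0)"
 by (simp add: sum.delta in_keys_iff)
 then show "lookup x k = lookup (\<Sum>a\<in>keys x. fscale (lookup x a) (single a 1)) k"
 by (auto simp: lookup_sum lookup_single when_def intro!: sum.cong)
qed

lemma klin_expand:
 assumes "klin F"
 shows "F x = (\<Sum>a\<in>keys x. fscale (lookup x a) (F (single a 1)))"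
 by (subst sum_singles[of x]) (simp add: klinD[OF assms] del: fscale_single)

lemma klin_eqI:
 assumes "klin F" "klin G" "!!a. a : keys x ==> F (single a 1) = G (single a 1)"
 shows "F x = G x"
 by (subst klin_expand[OF assms(1)], subst klin_expand[OF assms(2)]) (simp add: assms(3))

lemma lin_ext_superset:
 assumes "finite S" "keys t \<subseteq> S"
 shows "lin_ext f t = (\<Sum>a\<in>S. fscale (lookup t a) (f a))"
 unfolding lin_ext_def
 by (rule sum.mono_neutral_left) (use assms in \<open>auto simp: in_keys_iff\<close>)

lemma klin_lin_ext:
 fixes f :: "'a => ('b \<Rightarrow>\<^sub>0 'k::field)"
 shows "klin (lin_ext f)"
proof (rule klinI)
 fix x y :: "'a \<Rightarrow>\<^sub>0 'k" and c
 let ?S = "keys x \<union> keys y"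
 have "finite ?S" "keys (x + y) \<subseteq> ?S" using keys_add[of x y] by auto
 then show "lin_ext f (x + y) = lin_ext f x + lin_ext f y"
 by (simp add: lin_ext_superset[of ?S] lookup_add fs.scale_left_distrib sum.distrib)
 have "keys (fscale c x) \<subseteq> keys x" by (auto simp: in_keys_iff)
 then show "lin_ext f (fscale c x) = fscale c (lin_ext f x)"
 by (simp add: lin_ext_superset[of "keys x"] fs.scale_sum_right)
qed

lemma lin_ext_single [simp]: "lin_ext f (single a c) = fscale c (f a)"
 by (simp add: lin_ext_def)

lemma klin_comp: "klin F ==> klin G ==> klin (%x. F (G x))"
 by (auto intro!: klinI simp: klinD)

lemma klin_add: "klin F ==> klin G ==> klin (%x. F x + G x)"
 by (auto intro!: klinI simp: klinD fs.scale_right_distrib)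

lemma klin_sum: "(!!i. i : I ==> klin (F i)) ==> klin (%x. \<Sum>i\<in>I. F i x)"
 by (auto intro!: klinI sum.cong simp: klinD sum.distrib fs.scale_sum_right)

lemma klin_scale: "klin F ==> klin (%x. fscale c (F x))"
 by (auto intro!: klinI simp: klinD fs.scale_right_distrib mult.commute)

lemma klin_id: "klin (%x. x)"
 by (auto intro!: klinI)

lemma klin_zero: "klin (%x. 0)"
 by (auto intro!: klinI)

definition supp_on :: "'a set => ('a \<Rightarrow>\<^sub>0 'k::field) set" where
 "supp_on S = {x. keys x \<subseteq> S}"

lemma supp_onD: "x : supp_on S ==> a : keys x ==> a : S"
 by (auto simp: supp_on_def)

lemma lookup_supp_on: "x : supp_on S ==> a \<notin> S ==> lookup x a = 0"
 by (auto simp: supp_on_def in_keys_iff)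

lemma supp_onI: "(!!a. a \<notin> S ==> lookup x a = 0) ==> x : supp_on S"
 by (auto simp: supp_on_def in_keys_iff)

lemma subspace_supp_on: "fs.subspace (supp_on S)"
 by (auto simp: fs.subspace_def lookup_add lookup_supp_on intro!: supp_onI)

lemma supp_on_closed [simp]:
 "0 : supp_on S" "x : supp_on S ==> y : supp_on S ==> x + y : supp_on S"
 "x : supp_on S ==> fscale c x : supp_on S" "(!!i. i : I ==> g i : supp_on S) ==> sum g I : supp_on S"
 "x : supp_on S ==> y : supp_on S ==> x - y : supp_on S" "x : supp_on S ==> - x : supp_on S"
 by (simp_all add: subspace_supp_on fs.subspace_0 fs.subspace_add fs.subspace_scale
 fs.subspace_sum fs.subspace_diff fs.subspace_neg)

lemma single_supp_on [simp]: "a : S ==> single a c : supp_on S"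
 by (auto simp: supp_on_def split: if_splits)

lemma supp_on_mono: "S \<subseteq> S' ==> x : supp_on S ==> x : supp_on S'"
 by (auto simp: supp_on_def)

lemma supp_on_span: "(supp_on S :: ('a \<Rightarrow>\<^sub>0 'k::field) set) = fs.span ((%a. single a 1) ` S)"
proof
 show "(supp_on S :: ('a \<Rightarrow>\<^sub>0 'k) set) \<subseteq> fs.span ((%a. single a 1) ` S)"
 proof
 fix x :: "'a \<Rightarrow>\<^sub>0 'k" assume "x : supp_on S"
 then show "x : fs.span ((%a. single a 1) ` S)"
 by (subst sum_singles, intro fs.span_sum fs.span_scale fs.span_base) (auto dest: supp_onD)
 qed
 show "fs.span ((%a. single a 1) ` S) \<subseteq> (supp_on S :: ('a \<Rightarrow>\<^sub>0 'k) set)"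
 by (rule fs.span_minimal) (auto simp: subspace_supp_on)
qed

text \<open>A copy of the self-maps whose addition can be composition; on the function type itself
  addition is pointwise. The product of finitely supported functions convolves along addition, so
  here it is the product of the monoid algebra.\<close>

typedef fn = "UNIV :: (nat => nat) set" morphisms app Fn
 by simp

lemma app_Fn [simp]: "app (Fn f) = f"
 by (simp add: Fn_inverse)

lemma Fn_app [simp]: "Fn (app f) = f"
 by (simp add: app_inverse)

lemma fn_eqI: "(!!i. app f i = app g i) ==> f = g"
 by (metis app_inject ext)

type_synonym 'k fna = "fn \<Rightarrow>\<^sub>0 'k"

section \<open>The monoid of self-maps and its algebra\<close>

instantiation fn :: monoid_add
begin
definition "0 = Fn id"
definition "f + g = Fn (app f \<circ> app g)"
instance by standard (auto simp: zero_fn_def plus_fn_def comp_assoc)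
end

lemma app_zero [simp]: "app 0 = id"
 by (simp add: zero_fn_def)

lemma app_plus [simp]: "app (f + g) = app f \<circ> app g"
 by (simp add: plus_fn_def)

lemma fscale_mult_left: "fscale c x * y = fscale c (x * y)"
 for x y :: "'a::monoid_add \<Rightarrow>\<^sub>0 'k::field"
 by (simp add: fscale_def mult_map_scale_conv_mult mult.assoc)

lemma single_0_commute: "single 0 c * x = x * single 0 c"
 for x :: "'a::monoid_add \<Rightarrow>\<^sub>0 'k::field"
proof -
 have "x * single 0 c = (\<Sum>a\<in>keys x. fscale (lookup x a) (single a 1)) * single 0 c"
 by (subst sum_singles[of x]) simp
 also have "\<dots> = fscale c (\<Sum>a\<in>keys x. fscale (lookup x a) (single a 1))"
 by (simp add: sum_distrib_right mult_single fs.scale_sum_right mult.commute)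
 also have "\<dots> = fscale c x" by (subst sum_singles[of x]) simp
 finally show ?thesis by (simp add: fscale_def mult_map_scale_conv_mult)
qed

lemma fscale_mult_right: "x * fscale c y = fscale c (x * y)"
 for x y :: "'a::monoid_add \<Rightarrow>\<^sub>0 'k::field"
 unfolding fscale_def mult_map_scale_conv_mult
 by (metis mult.assoc single_0_commute)

lemma klin_mult_left: "klin (%y. x * y)" for x :: "'a::monoid_add \<Rightarrow>\<^sub>0 'k::field"
 by (rule klinI) (simp_all add: distrib_left fscale_mult_right)

lemma klin_mult_right: "klin (%x. x * y)" for y :: "'a::monoid_add \<Rightarrow>\<^sub>0 'k::field"
 by (rule klinI) (simp_all add: distrib_right fscale_mult_left)

lemma supp_on_mult:
 fixes x y :: "'a::monoid_add \<Rightarrow>\<^sub>0 'k::field"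
 assumes "x : supp_on S" "y : supp_on S'" "!!a b. a : S ==> b : S' ==> a + b : U"
 shows "x * y : supp_on U"
 using assms keys_mult[of x y] by (fastforce simp: supp_on_def)

lemma mult_expand_right:
 fixes x y :: "'a::monoid_add \<Rightarrow>\<^sub>0 'k::field"
 shows "x * y = (\<Sum>b\<in>keys y. fscale (lookup y b) (x * single b 1))"
 by (rule klin_expand[OF klin_mult_left])

lemma mult_expand_left:
 fixes x y :: "'a::monoid_add \<Rightarrow>\<^sub>0 'k::field"
 shows "x * y = (\<Sum>a\<in>keys x. fscale (lookup x a) (single a 1 * y))"
 by (rule klin_expand[OF klin_mult_right])

text \<open>
 A word of length \<open>d\<close> is a self-map of the naturals that is the identity from \<open>d\<close> on.
 The right action of a permutation of the positions is then multiplication in the monoid algebra.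
\<close>

definition Wd :: "nat => fn set" where
 "Wd d = {w. \<forall>j\<ge>d. app w j = j}"

definition Pm :: "nat => fn set" where
 "Pm d = {s. app s permutes {..<d}}"

abbreviation Tn :: "nat => ('k::field) fna set" where
 "Tn d \<equiv> supp_on (Wd d)"

abbreviation An :: "nat => ('k::field) fna set" where
 "An d \<equiv> supp_on (Pm d)"

definition pinv :: "fn => fn" where
 "pinv s = Fn (inv (app s))"

lemma app_pinv: "app (pinv s) = inv (app s)"
 by (simp add: pinv_def)

abbreviation sg :: "fn => ('k::field) fna" where
 "sg w \<equiv> single w 1"

lemma Pm_app: "s : Pm d ==> app s permutes {..<d}"
 by (simp add: Pm_def)

lemma Pm_0 [simp]: "0 : Pm d"
 by (simp add: Pm_def permutes_id)

lemma Pm_add [simp]: "s : Pm d ==> t : Pm d ==> s + t : Pm d"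
 by (simp add: Pm_def permutes_compose)

lemma Pm_pinv [simp]: "s : Pm d ==> pinv s : Pm d"
 by (simp add: Pm_def app_pinv permutes_inv)

lemma pinv_right [simp]: "s : Pm d ==> s + pinv s = 0"
 by (rule fn_eqI) (simp add: app_pinv permutes_inverses[OF Pm_app])

lemma pinv_left [simp]: "s : Pm d ==> pinv s + s = 0"
 by (rule fn_eqI) (simp add: app_pinv permutes_inverses[OF Pm_app])

lemma pinv_pinv [simp]: "s : Pm d ==> pinv (pinv s) = s"
 by (rule fn_eqI) (simp add: app_pinv permutes_inv_inv[OF Pm_app])

lemma pinv_add: "s : Pm d ==> t : Pm d ==> pinv (s + t) = pinv t + pinv s"
 by (rule fn_eqI) (simp add: app_pinv o_inv_distrib[OF permutes_bij[OF Pm_app] permutes_bij[OF Pm_app]])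

lemma finite_Pm [simp]: "finite (Pm d)"
proof -
 have "Pm d \<subseteq> Fn ` {p. p permutes {..<d}}"
 by (auto simp: Pm_def intro: image_eqI[where x="app _"])
 then show ?thesis by (rule finite_subset) (simp add: finite_permutations)
qed

lemma card_Pm: "card (Pm d) = fact d"
proof -
 have "Pm d = Fn ` {p. p permutes {..<d}}"
 by (auto simp: Pm_def intro: image_eqI[where x="app _"])
 moreover have "inj_on Fn {p. p permutes {..<d}}"
 by (auto simp: inj_on_def Fn_inject)
 ultimately show ?thesis by (simp add: card_image card_permutations)
qed

lemma Wd_0 [simp]: "0 : Wd d"
 by (simp add: Wd_def)

lemma Pm_Wd: "s : Pm d ==> s : Wd d"
 by (simp add: Wd_def Pm_def permutes_not_in)

lemma Wd_add [simp]: "w : Wd d ==> s : Pm d ==> w + s : Wd d"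
 by (simp add: Wd_def Pm_def permutes_not_in)

lemma An_mult [simp]: "x : An d ==> y : An d ==> x * y : An d"
 by (rule supp_on_mult) auto

lemma Tn_mult [simp]: "x : Tn d ==> y : An d ==> x * y : Tn d"
 by (rule supp_on_mult) auto

lemma An_1 [simp]: "1 : An d"
 by (simp add: supp_on_def)

lemma sg_mult: "sg w * sg s = sg (w + s)"
 by (simp add: mult_single)

lemma sg_0 [simp]: "sg 0 = 1"
 by simp

lemma lookup_mult_sg:
 assumes "s : Pm d"
 shows "lookup (x * sg s) w = lookup x (w + pinv s)"
proof -
 have eq: "a + s = w \<longleftrightarrow> a = w + pinv s" for a
 by (metis add.assoc add_0_right assms pinv_left pinv_right)
 have "x * sg s = (\<Sum>a\<in>keys x. fscale (lookup x a) (sg a * sg s))"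
 by (rule mult_expand_left)
 also have "\<dots> = (\<Sum>a\<in>keys x. single (a + s) (lookup x a))"
 by (simp add: mult_single)
 finally have "lookup (x * sg s) w =
 (\<Sum>a\<in>keys x. if a = w + pinv s then lookup x a else 0)"
 by (auto simp: lookup_sum lookup_single when_def eq intro!: sum.cong)
 then show ?thesis by (simp add: in_keys_iff)
qed

lemma lookup_sg_mult:
 assumes "s : Pm d"
 shows "lookup (sg s * x) w = lookup x (pinv s + w)"
proof -
 have eq: "s + a = w \<longleftrightarrow> a = pinv s + w" for a
 by (metis add.assoc add_0_left assms pinv_left pinv_right)
 have "sg s * x = (\<Sum>a\<in>keys x. fscale (lookup x a) (sg s * sg a))"
 by (rule mult_expand_right)
 also have "\<dots> = (\<Sum>a\<in>keys x. single (s + a) (lookup x a))"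
 by (simp add: mult_single)
 finally have "lookup (sg s * x) w =
 (\<Sum>a\<in>keys x. if a = pinv s + w then lookup x a else 0)"
 by (auto simp: lookup_sum lookup_single when_def eq intro!: sum.cong)
 then show ?thesis by (simp add: in_keys_iff)
qed

text \<open>Up to a factor the trace of the regular representation. Its symmetry and nondegeneracy
  on the group algebra provide all dual bases below.\<close>

definition tau :: "('k::field) fna => 'k" where
 "tau x = lookup x 0"

lemma tau_linear [simp]: "tau (x + y) = tau x + tau y" "tau (fscale c x) = c * tau x" "tau 0 = 0"
 "tau (sum g I) = (\<Sum>i\<in>I. tau (g i))" "tau (x - y) = tau x - tau y" "tau (- x) = - tau x"
 by (simp_all add: tau_def lookup_add lookup_sum lookup_minus)

lemma tau_1 [simp]: "tau 1 = 1"
 by (simp add: tau_def lookup_one)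

lemma tau_mult_sg: "s : Pm d ==> tau (x * sg s) = lookup x (pinv s)"
 by (simp add: tau_def lookup_mult_sg)

lemma tau_commute:
 assumes "x : An d" "y : An d"
 shows "tau (x * y) = tau (y * x)"
proof -
 have *: "tau (x * sg s) = tau (sg s * x)" if "s : Pm d" for s
 unfolding tau_def lookup_mult_sg[OF that] lookup_sg_mult[OF that] by simp
 have "tau (x * y) = (\<Sum>b\<in>keys y. lookup y b * tau (x * sg b))"
 by (subst mult_expand_right[of x y]) simp
 also have "\<dots> = (\<Sum>b\<in>keys y. lookup y b * tau (sg b * x))"
 using assms(2) by (intro sum.cong refl) (use supp_onD[OF assms(2)] in \<open>simp add: *\<close>)
 also have "\<dots> = tau (y * x)"
 by (subst mult_expand_left[of y x]) simp
 finally show ?thesis .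
qed

text \<open>The coefficient at a permutation is the trace against its inverse.\<close>

lemma tau_nondegenerate:
 assumes "x : An d" "x ~= 0"
 obtains y where "y : An d" "tau (x * y) ~= 0"
proof -
 obtain s where s: "lookup x s ~= 0"
 using assms(2) poly_mapping_eqI[of x 0] by auto
 then have "s : Pm d" using lookup_supp_on[OF assms(1)] by auto
 then have "tau (x * sg (pinv s)) ~= 0" using s by (simp add: tau_mult_sg[OF Pm_pinv])
 with \<open>s : Pm d\<close> show ?thesis by (intro that[of "sg (pinv s)"]) auto
qed

section \<open>Young symmetrizers\<close>

text \<open>Rows past the end have length zero, so shapes with different numbers of rows are
  compared as functions on all of \<open>nat\<close>.\<close>

definition sh :: "nat list => nat => nat" where
 "sh p i = (if i < length p then p ! i else 0)"

abbreviation rw :: "nat list => nat => nat" where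
 "rw p n \<equiv> fst (tableau_cell p n)"

abbreviation cl :: "nat list => nat => nat" where
 "cl p n \<equiv> snd (tableau_cell p n)"

section \<open>Cells of the diagram numbered along rows\<close>

lemma tableau_cell_range:
 "n < sum_list p ==> rw p n < length p & cl p n < p ! rw p n & n = sum_list (take (rw p n) p) + cl p n"
proof (induction p arbitrary: n)
 case (Cons l ls)
 show ?case
 proof (cases "n < l")
 case False
 then have "n - l < sum_list ls" using Cons.prems by auto
 from Cons.IH[OF this] show ?thesis using False by (auto split: prod.split)
 qed simp
qed simp

lemma tableau_cell_number:
 "r < length p ==> c < p ! r ==>
 sum_list (take r p) + c < sum_list p & tableau_cell p (sum_list (take r p) + c) = (r, c)"
proof (induction p arbitrary: r)
 case (Cons l ls)
 show ?case
 proof (cases r)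
 case 0
 then show ?thesis using Cons.prems by simp
 next
 case (Suc r')
 then show ?thesis using Cons.IH[of r'] Cons.prems by simp
 qed
qed simp

lemma sh_partition_mono:
 assumes "is_partition p" "i <= j"
 shows "sh p j <= sh p i"
 using assms sorted_wrt_nth_less[of "(\<ge>)" p i j]
 by (cases "i = j") (auto simp: sh_def is_partition_def)

lemma cl_less_sh: "n < sum_list p ==> cl p n < sh p (rw p n)"
 using tableau_cell_range[of n p] by (simp add: sh_def)

lemma cell_exists:
 assumes "c < sh p r"
 obtains n where "n < sum_list p" "rw p n = r" "cl p n = c"
 using tableau_cell_number[of r p c] assms by (auto simp: sh_def split: if_splits)

lemma cell_inj: "x < sum_list p ==> y < sum_list p ==> rw p x = rw p y ==> cl p x = cl p y ==> x = y"
 using tableau_cell_range[of x p] tableau_cell_range[of y p] by metis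

lemma cell_above:
 assumes "is_partition p" "x < sum_list p" "j <= rw p x"
 obtains y where "y < sum_list p" "rw p y = j" "cl p y = cl p x"
 using cell_exists[of "cl p x" p j] cl_less_sh[OF assms(2)] sh_partition_mono[OF assms(1,3)]
 by (metis le_trans not_le)

lemma card_row: "card {x. x < sum_list p & rw p x = i} = sh p i"
proof -
 have "bij_betw (cl p) {x. x < sum_list p & rw p x = i} {..<sh p i}"
 proof (rule bij_betwI')
 fix y assume "y : {..<sh p i}"
 then show "\<exists>x\<in>{x. x < sum_list p & rw p x = i}. y = cl p x"
 using cell_exists[of y p i] by auto
 qed (use cell_inj cl_less_sh in \<open>auto\<close>)
 then show ?thesis by (simp add: bij_betw_same_card)
qed

lemma shape_eqI:
 assumes "is_partition p" "is_partition q" "!!i. sh p i = sh q i"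
 shows "p = q"
proof -
 have *: "sh r i > 0 \<longleftrightarrow> i < length r" if "is_partition r" for r i
 using that by (auto simp: sh_def is_partition_def) (metis gr0I nth_mem)
 have "length p = length q"
 using *[OF assms(1)] *[OF assms(2)] assms(3) by (metis linorder_neqE_nat nat_neq_iff)
 then show ?thesis
 proof (rule nth_equalityI)
 fix i assume "i < length p"
 then show "p ! i = q ! i" using assms(3)[of i] \<open>length p = length q\<close> by (simp add: sh_def)
 qed
qed

section \<open>Partial row sums and the dominance order\<close>

definition rc :: "nat list => nat => nat" where
 "rc p i = card {x. x < sum_list p & rw p x < i}"

lemma rc_Suc: "rc p (Suc i) = rc p i + sh p i"
proof -
 have "{x. x < sum_list p & rw p x < Suc i} =
 {x. x < sum_list p & rw p x < i} \<union> {x. x < sum_list p & rw p x = i}" by auto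
 then show ?thesis unfolding rc_def
 by (simp add: card_Un_disjoint disjoint_iff card_row)
qed

lemma rc_eq_imp_eq:
 assumes "is_partition p" "is_partition q" "!!i. rc p i = rc q i"
 shows "p = q"
 using assms rc_Suc by (metis add_left_cancel shape_eqI)

definition dom_le :: "nat list => nat list => bool" where
 "dom_le p q \<longleftrightarrow> (\<forall>i. rc p i <= rc q i)"

lemma dom_antisym: "is_partition p ==> is_partition q ==> dom_le p q ==> dom_le q p ==> p = q"
 by (meson dom_le_def le_antisym rc_eq_imp_eq)

text \<open>The condition under which a filling survives antisymmetrization along the
  columns.\<close>

definition col_distinct :: "nat list => (nat => nat) => bool" where
 "col_distinct p f \<longleftrightarrow>
 (\<forall>x y. x < sum_list p & y < sum_list p & cl p x = cl p y & f x = f y --> x = y)"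

lemma col_distinctD:
 "col_distinct p f ==> x < sum_list p ==> y < sum_list p ==> cl p x = cl p y ==> f x = f y ==> x = y"
 unfolding col_distinct_def by blast

text \<open>A column that reaches row \<open>i\<close> has a cell in each of the \<open>i\<close>
  rows above it, while distinct values below \<open>i\<close> number at most \<open>i\<close>; a
  shorter column is counted in full on the right.\<close>

lemma col_distinct_column_count:
 assumes p: "is_partition p" and f: "col_distinct p f"
 shows "card {x. x < sum_list p & cl p x = c & f x < i}
 <= card {x. x < sum_list p & cl p x = c & rw p x < i}" (is "card ?F <= card ?R")
proof (cases "\<exists>x<sum_list p. cl p x = c & rw p x \<ge> i")
 case True
 then obtain x where x: "x < sum_list p" "cl p x = c" "rw p x \<ge> i" by blast
 have "inj_on f ?F" by (rule inj_onI) (simp add: col_distinctD[OF f])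
 then have 1: "card ?F <= card {..<i}" by (rule card_inj_on_le) auto
 have "{..<i} \<subseteq> rw p ` ?R"
 proof
 fix j assume "j : {..<i}"
 then have "j <= rw p x" using x(3) by auto
 with p x(1) obtain y where "y < sum_list p" "rw p y = j" "cl p y = cl p x" by (rule cell_above)
 then show "j : rw p ` ?R" using x \<open>j : {..<i}\<close> by auto
 qed
 then have "card {..<i} <= card (rw p ` ?R)" by (rule card_mono[rotated]) simp
 also have "\<dots> <= card ?R" by (rule card_image_le) simp
 finally show ?thesis using 1 by simp
next
 case False
 then have "?F \<subseteq> ?R" by (auto simp: not_le)
 then show ?thesis by (simp add: card_mono)
qed

lemma card_split_columns:
 "card {x. x < sum_list p & P x} = (\<Sum>c<Suc (sum_list p). card {x. x < sum_list p & cl p x = c & P x})"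
proof -
 have c: "cl p x < Suc (sum_list p)" if "x < sum_list p" for x
 using tableau_cell_range[OF that] that by (auto simp: less_Suc_eq_le)
 have "{x. x < sum_list p & P x} = (\<Union>c\<in>{..<Suc (sum_list p)}. {x. x < sum_list p & cl p x = c & P x})"
 using c by auto
 then show ?thesis by (simp only:) (subst card_UN_disjoint, auto)
qed

lemma col_distinct_dominance:
 assumes "is_partition p" "col_distinct p f"
 shows "card {x. x < sum_list p & f x < i} <= rc p i"
 unfolding rc_def card_split_columns[of p "%x. f x < i"] card_split_columns[of p "%x. rw p x < i"] by (intro sum_mono col_distinct_column_count assms)

text \<open>Equal totals force equality in every single column. Comparing the thresholds
  \<open>rw p x\<close> and its successor then shows that the value \<open>rw p x\<close> is taken
  in the column of \<open>x\<close>.\<close>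

lemma col_distinct_tight:
 assumes p: "is_partition p" and f: "col_distinct p f"
 and eq: "!!i. card {x. x < sum_list p & f x < i} = rc p i"
 and x: "x < sum_list p"
 shows "\<exists>y<sum_list p. cl p y = cl p x & f y = rw p x"
proof -
 let ?F = "%c i. {x. x < sum_list p & cl p x = c & f x < i}"
 let ?R = "%c i. {x. x < sum_list p & cl p x = c & rw p x < i}"
 have cx: "cl p x < Suc (sum_list p)"
 using tableau_cell_range[OF x] x by auto
 have *: "card (?F (cl p x) i) = card (?R (cl p x) i)" for i
 proof (rule ccontr)
 assume "card (?F (cl p x) i) ~= card (?R (cl p x) i)"
 then have "card (?F (cl p x) i) < card (?R (cl p x) i)"
 using col_distinct_column_count[OF p f] by (simp add: le_neq_implies_less)
 then have "(\<Sum>c<Suc (sum_list p). card (?F c i)) < (\<Sum>c<Suc (sum_list p). card (?R c i))"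
 by (intro sum_strict_mono_ex1) (use cx col_distinct_column_count[OF p f] in auto)
 then show False using eq[of i] unfolding rc_def card_split_columns[of p "%x. f x < i"] card_split_columns[of p "%x. rw p x < i"] by simp
 qed
 let ?i = "rw p x"
 have "?R (cl p x) ?i \<subset> ?R (cl p x) (Suc ?i)" using x by auto
 then have "card (?R (cl p x) ?i) < card (?R (cl p x) (Suc ?i))" by (intro psubset_card_mono) auto
 then have "card (?F (cl p x) ?i) < card (?F (cl p x) (Suc ?i))" by (simp add: *)
 then have "\<not> ?F (cl p x) (Suc ?i) \<subseteq> ?F (cl p x) ?i"
 using card_mono[of "?F (cl p x) ?i" "?F (cl p x) (Suc ?i)"] by auto
 then show ?thesis by (auto simp: less_Suc_eq)
qed

section \<open>Subgroups of the symmetric group and their character sums\<close>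

definition subgrp :: "nat => fn set => bool" where
 "subgrp d H \<longleftrightarrow> H \<subseteq> Pm d & 0 : H & (\<forall>s\<in>H. \<forall>t\<in>H. s + t : H) & (\<forall>s\<in>H. pinv s : H)"

lemma subgrpD:
 assumes "subgrp d H"
 shows "s : H ==> s : Pm d" "0 : H" "s : H ==> t : H ==> s + t : H" "s : H ==> pinv s : H" "finite H"
 using assms finite_subset[of H "Pm d"] by (auto simp: subgrp_def)

definition gsum :: "(fn => 'k::field) => fn set => 'k fna" where
 "gsum ch H = (\<Sum>s\<in>H. fscale (ch s) (sg s))"

definition sgnf :: "fn => 'k::field" where
 "sgnf s = of_int (sign (app s))"

lemma Pm_permutation: "s : Pm d ==> permutation (app s)"
 by (auto simp: Pm_def intro: permutation_permutes[THEN iffD2])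

lemma sgnf_add: "s : Pm d ==> t : Pm d ==> sgnf (s + t) = sgnf s * sgnf t"
 by (simp add: sgnf_def sign_compose Pm_permutation)

lemma sgnf_0 [simp]: "sgnf 0 = 1"
 by (simp add: sgnf_def)

lemma sgnf_sq [simp]: "sgnf s * sgnf s = 1"
 by (simp add: sgnf_def sign_def)

lemma sgnf_pinv: "s : Pm d ==> sgnf (pinv s) = sgnf s"
 by (simp add: sgnf_def app_pinv sign_inverse Pm_permutation)

text \<open>The trivial and the sign character. A value of square one is its own inverse, so
  translation on either side multiplies a character sum by that same value.\<close>

definition chr :: "nat => (fn => 'k::field) => bool" where
 "chr d ch \<longleftrightarrow> (\<forall>s\<in>Pm d. \<forall>t\<in>Pm d. ch (s + t) = ch s * ch t) & (\<forall>s. ch s * ch s = 1)"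

lemma chr_sgnf [simp]: "chr d sgnf"
 by (simp add: chr_def sgnf_add)

lemma chr_1 [simp]: "chr d (%s. 1)"
 by (simp add: chr_def)

lemma gsum_An [simp]: "subgrp d H ==> gsum ch H : An d"
 unfolding gsum_def by (intro supp_on_closed(4) supp_on_closed(3) single_supp_on subgrpD)

lemma bij_translate_left:
 assumes "subgrp d H" "t : H"
 shows "bij_betw (%s. t + s) H H"
 by (rule bij_betwI[where g="%s. pinv t + s"])
 (use assms in \<open>auto simp: subgrpD[OF assms(1)] add.assoc[symmetric] pinv_left[OF subgrpD(1)[OF assms]] pinv_right[OF subgrpD(1)[OF assms]]\<close>)

lemma bij_translate_right:
 assumes "subgrp d H" "t : H"
 shows "bij_betw (%s. s + t) H H"
 by (rule bij_betwI[where g="%s. s + pinv t"])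
 (use assms in \<open>auto simp: subgrpD[OF assms(1)] add.assoc pinv_left[OF subgrpD(1)[OF assms]] pinv_right[OF subgrpD(1)[OF assms]]\<close>)

lemma gsum_left:
 assumes H: "subgrp d H" and ch: "chr d ch" and t: "t : H"
 shows "sg t * gsum ch H = fscale (ch t) (gsum ch H)"
proof -
 have "sg t * gsum ch H = (\<Sum>s\<in>H. fscale (ch s) (sg (t + s)))"
 by (simp add: gsum_def sum_distrib_left mult_single)
 also have "\<dots> = (\<Sum>s\<in>H. fscale (ch t) (fscale (ch (t + s)) (sg (t + s))))"
 proof (intro sum.cong refl)
 fix s assume "s : H"
 then have "ch (t + s) = ch t * ch s" using subgrpD(1)[OF H] t ch by (simp add: chr_def)
 then have "ch t * ch (t + s) = ch s" using ch by (simp add: chr_def mult.assoc[symmetric])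
 then show "fscale (ch s) (sg (t + s)) = fscale (ch t) (fscale (ch (t + s)) (sg (t + s)))"
 by simp
 qed
 also have "\<dots> = (\<Sum>s\<in>H. fscale (ch t) (fscale (ch s) (sg s)))"
 by (rule sum.reindex_bij_betw[OF bij_translate_left[OF H t]])
 finally show ?thesis by (simp add: gsum_def fs.scale_sum_right)
qed

lemma gsum_right:
 assumes H: "subgrp d H" and ch: "chr d ch" and t: "t : H"
 shows "gsum ch H * sg t = fscale (ch t) (gsum ch H)"
proof -
 have "gsum ch H * sg t = (\<Sum>s\<in>H. fscale (ch s) (sg (s + t)))"
 by (simp add: gsum_def sum_distrib_right mult_single)
 also have "\<dots> = (\<Sum>s\<in>H. fscale (ch t) (fscale (ch (s + t)) (sg (s + t))))"
 proof (intro sum.cong refl)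
 fix s assume "s : H"
 then have "ch (s + t) = ch s * ch t" using subgrpD(1)[OF H] t ch by (simp add: chr_def)
 then have "ch t * ch (s + t) = ch s" using ch by (simp add: chr_def mult.commute mult.left_commute)
 then show "fscale (ch s) (sg (s + t)) = fscale (ch t) (fscale (ch (s + t)) (sg (s + t)))"
 by simp
 qed
 also have "\<dots> = (\<Sum>s\<in>H. fscale (ch t) (fscale (ch s) (sg s)))"
 by (rule sum.reindex_bij_betw[OF bij_translate_right[OF H t]])
 finally show ?thesis by (simp add: gsum_def fs.scale_sum_right)
qed

lemma gsum_square:
 assumes H: "subgrp d H" and ch: "chr d ch"
 shows "gsum ch H * gsum ch H = fscale (of_nat (card H)) (gsum ch H)"
proof -
 have "gsum ch H * gsum ch H = (\<Sum>s\<in>H. fscale (ch s) (sg s * gsum ch H))"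
 unfolding gsum_def[of ch H] by (simp only: sum_distrib_right fscale_mult_left)
 also have "\<dots> = (\<Sum>s\<in>H. gsum ch H)"
 by (intro sum.cong refl) (use ch in \<open>simp add: gsum_left[OF H ch] chr_def del: fscale_single\<close>)
 also have "\<dots> = fscale (of_nat (card H)) (gsum ch H)"
 using fs.scale_sum_left[of "%_. 1" H "gsum ch H"] unfolding fs.scale_one by simp
 finally show ?thesis .
qed

definition rowg :: "nat list => fn set" where
 "rowg p = {s : Pm (sum_list p). \<forall>n<sum_list p. rw p (app s n) = rw p n}"

definition colg :: "nat list => fn set" where
 "colg p = {s : Pm (sum_list p). \<forall>n<sum_list p. cl p (app s n) = cl p n}"

lemma Pm_less: "s : Pm d ==> n < d ==> app s n < d"
 by (metis Pm_app lessThan_iff permutes_in_image)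

lemma app_pinv_app [simp]: "s : Pm d ==> app s (app (pinv s) n) = n"
 by (simp add: app_pinv permutes_inverses[OF Pm_app])

lemma pinv_app_app [simp]: "s : Pm d ==> app (pinv s) (app s n) = n"
 by (simp add: app_pinv permutes_inverses[OF Pm_app])

lemma subgrp_fibre: "subgrp d {s : Pm d. \<forall>n<d. f (app s n) = f n}"
proof -
 have "f (app (pinv s) n) = f n" if "s : Pm d" "\<forall>n<d. f (app s n) = f n" "n < d" for s n
 using that Pm_less[OF Pm_pinv[OF that(1)] that(3)] by (metis app_pinv_app)
 then show ?thesis by (auto simp: subgrp_def Pm_less)
qed

lemma subgrp_rowg [simp]: "subgrp (sum_list p) (rowg p)"
 unfolding rowg_def by (rule subgrp_fibre)

lemma subgrp_colg [simp]: "subgrp (sum_list p) (colg p)"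
 unfolding colg_def by (rule subgrp_fibre)

definition aS :: "nat list => ('k::field) fna" where
 "aS p = gsum (%s. 1) (rowg p)"

definition bS :: "nat list => ('k::field) fna" where
 "bS p = gsum sgnf (colg p)"

text \<open>The column factor comes first: words are acted on from the right, and the passage from
  the left action behind \<open>young_symmetrizer\<close> inverts permutations and so reverses the
  product of the row and the column sum.\<close>

definition cS :: "nat list => ('k::field) fna" where
 "cS p = bS p * aS p"

lemma aS_An [simp]: "aS p : An (sum_list p)" by (simp add: aS_def)
lemma bS_An [simp]: "bS p : An (sum_list p)" by (simp add: bS_def)
lemma cS_An [simp]: "cS p : An (sum_list p)" by (simp add: cS_def)

lemma aS_left: "s : rowg p ==> sg s * aS p = aS p"
 unfolding aS_def by (subst gsum_left[OF subgrp_rowg chr_1]) auto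

lemma aS_right: "s : rowg p ==> aS p * sg s = aS p"
 unfolding aS_def by (subst gsum_right[OF subgrp_rowg chr_1]) auto

lemma bS_left: "s : colg p ==> sg s * bS p = fscale (sgnf s) (bS p)"
 unfolding bS_def by (rule gsum_left[OF subgrp_colg chr_sgnf])

lemma bS_right: "s : colg p ==> bS p * sg s = fscale (sgnf s) (bS p)"
 unfolding bS_def by (rule gsum_right[OF subgrp_colg chr_sgnf])

section \<open>Products of column and row sums\<close>

abbreviation tr :: "nat => nat => fn" where
 "tr a b \<equiv> Fn (transpose a b)"

lemma tr_Pm [simp]: "a < d ==> b < d ==> tr a b : Pm d"
 by (simp add: Pm_def permutes_swap_id)

lemma sgnf_tr: "a ~= b ==> sgnf (tr a b) = - 1"
 by (simp add: sgnf_def sign_swap_id)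

lemma tr_rowg: "x < sum_list p ==> y < sum_list p ==> rw p x = rw p y ==> tr x y : rowg p"
 by (auto simp: rowg_def transpose_def)

lemma tr_colg: "x < sum_list p ==> y < sum_list p ==> cl p x = cl p y ==> tr x y : colg p"
 by (auto simp: colg_def transpose_def)

lemma conj_tr:
 assumes "g : Pm d"
 shows "g + tr x y = tr (app g x) (app g y) + g"
proof -
 have "inj (app g)" using permutes_inj[OF Pm_app[OF assms]] .
 then show ?thesis by (intro fn_eqI) (auto simp: transpose_def inj_eq)
qed

lemma eq_neg_imp_zero:
 fixes x :: "'a \<Rightarrow>\<^sub>0 'k::{field, field_char_0}"
 assumes "x = - x"
 shows "x = 0"
proof (rule poly_mapping_eqI)
 fix i
 have "lookup x i = - lookup x i"
 by (subst assms) simp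
 then show "lookup x i = lookup 0 i"
 by (simp add: eq_neg_iff_add_eq_0 flip: mult_2)
qed

text \<open>The transposition of the two cells is absorbed by the row sum; carried across
  \<open>g\<close>, it changes the sign of the column sum. The product is its own negative.\<close>

lemma b_g_a_zero:
 fixes p q :: "nat list"
 assumes "sum_list p = d" "sum_list q = d" "g : Pm d" "x < d" "y < d" "x ~= y"
 "rw q x = rw q y" "cl p (app g x) = cl p (app g y)"
 shows "bS p * sg g * aS q = (0 :: ('k::{field, field_char_0}) fna)"
proof -
 have ne: "app g x ~= app g y"
 using assms(3,6) by (metis pinv_app_app)
 have "bS p * sg g * aS q = bS p * sg g * (sg (tr x y) * aS q)"
 using assms by (simp add: aS_left tr_rowg)
 also have "\<dots> = bS p * sg (tr (app g x) (app g y)) * sg g * aS q"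
 by (simp add: mult.assoc[symmetric]) (simp add: mult.assoc mult_single conj_tr[OF assms(3)])
 also have "\<dots> = - (bS p * sg g * aS q)"
 using assms ne by (simp add: bS_right tr_colg Pm_less sgnf_tr fscale_mult_left)
 finally show ?thesis by (rule eq_neg_imp_zero)
qed

lemma a_g_b_zero:
 fixes p q :: "nat list"
 assumes "sum_list p = d" "sum_list q = d" "g : Pm d" "x < d" "y < d" "x ~= y"
 "cl p x = cl p y" "rw q (app g x) = rw q (app g y)"
 shows "aS q * sg g * bS p = (0 :: ('k::{field, field_char_0}) fna)"
proof -
 have "aS q * sg g * bS p = - (aS q * sg g * (sg (tr x y) * bS p))"
 using assms by (simp add: bS_left tr_colg sgnf_tr fscale_mult_right)
 also have "\<dots> = - (aS q * sg (tr (app g x) (app g y)) * sg g * bS p)"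
 by (simp add: mult.assoc[symmetric]) (simp add: mult.assoc mult_single conj_tr[OF assms(3)])
 also have "\<dots> = - (aS q * sg g * bS p)"
 using assms by (simp add: aS_right tr_rowg Pm_less)
 finally show ?thesis by (rule eq_neg_imp_zero)
qed

lemma card_perm_reindex:
 assumes "g : Pm d"
 shows "card {x. x < d & P (app g x)} = card {x. x < d & P x}"
proof -
 have "bij_betw (app g) {x. x < d & P (app g x)} {x. x < d & P x}"
 by (rule bij_betwI[where g="app (pinv g)"]) (use assms Pm_less[OF assms] Pm_less[OF Pm_pinv[OF assms]] in auto)
 then show ?thesis by (rule bij_betw_same_card)
qed

text \<open>By \<open>b_g_a_zero\<close> the rows of \<open>q\<close> from which \<open>g\<close>
  brings the cells of one column of \<open>p\<close> are distinct; counting the cells that come from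
  the first rows gives dominance.\<close>

lemma b_g_a_dom:
 assumes "is_partition p" "sum_list p = d" "sum_list q = d" "g : Pm d"
 "bS p * sg g * aS q ~= (0 :: ('k::{field, field_char_0}) fna)"
 shows "dom_le q p" "col_distinct p (%z. rw q (app (pinv g) z))"
proof -
 show cd: "col_distinct p (%z. rw q (app (pinv g) z))"
 unfolding col_distinct_def
 proof (intro allI impI, rule ccontr)
 fix x y assume h: "x < sum_list p & y < sum_list p & cl p x = cl p y & rw q (app (pinv g) x) = rw q (app (pinv g) y)" "x ~= y"
 then have "app (pinv g) x ~= app (pinv g) y" using assms(4) by (metis app_pinv_app)
 then have "bS p * sg g * aS q = (0 :: 'k fna)"
 using h assms Pm_less[OF Pm_pinv[OF assms(4)]]
 by (intro b_g_a_zero[of p d q g "app (pinv g) x" "app (pinv g) y"]) auto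
 then show False using assms by simp
 qed
 show "dom_le q p"
 unfolding dom_le_def
 proof
 fix i
 have "rc q i = card {z. z < d & rw q (app (pinv g) z) < i}"
 unfolding rc_def using card_perm_reindex[OF Pm_pinv[OF assms(4)], of "%z. rw q z < i"] assms by simp
 then show "rc q i <= rc p i" using col_distinct_dominance[OF assms(1) cd, of i] assms by simp
 qed
qed

lemma a_g_b_dom:
 assumes "is_partition p" "sum_list p = d" "sum_list q = d" "g : Pm d"
 "aS q * sg g * bS p ~= (0 :: ('k::{field, field_char_0}) fna)"
 shows "dom_le q p"
proof -
 have cd: "col_distinct p (%z. rw q (app g z))"
 unfolding col_distinct_def
 proof (intro allI impI, rule ccontr)
 fix x y assume h: "x < sum_list p & y < sum_list p & cl p x = cl p y & rw q (app g x) = rw q (app g y)" "x ~= y"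
 then have "aS q * sg g * bS p = (0 :: 'k fna)"
 using assms by (intro a_g_b_zero[of p d q g x y]) auto
 then show False using assms by simp
 qed
 show "dom_le q p"
 unfolding dom_le_def
 proof
 fix i
 have "rc q i = card {z. z < d & rw q (app g z) < i}"
 unfolding rc_def using card_perm_reindex[OF assms(4), of "%z. rw q z < i"] assms by simp
 then show "rc q i <= rc p i" using col_distinct_dominance[OF assms(1) cd, of i] assms by simp
 qed
qed

lemma sandwich_expand:
 assumes "x : An d"
 shows "u * x * v = (\<Sum>s\<in>keys x. fscale (lookup x s) (u * sg s * v))"
 and "!!s. s : keys x ==> s : Pm d"
proof -
 have "klin (%x. u * x * v)"
 by (rule klin_comp[OF klin_mult_right klin_mult_left])
 from klin_expand[OF this] show "u * x * v = (\<Sum>s\<in>keys x. fscale (lookup x s) (u * sg s * v))" .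
qed (rule supp_onD[OF assms])

lemma b_x_a_dom:
 assumes "is_partition p" "sum_list p = d" "sum_list q = d" "x : An d"
 "bS p * x * aS q ~= (0 :: ('k::{field, field_char_0}) fna)"
 shows "dom_le q p"
proof (rule ccontr)
 assume "\<not> dom_le q p"
 then have z: "bS p * sg s * aS q = (0 :: 'k fna)" if "s : Pm d" for s
 using b_g_a_dom(1)[OF assms(1-3) that] by auto
 have "bS p * x * aS q = 0"
 unfolding sandwich_expand(1)[OF assms(4)]
 by (intro sum.neutral ballI) (simp add: z[OF sandwich_expand(2)[OF assms(4)]])
 then show False using assms by simp
qed

lemma a_x_b_dom:
 assumes "is_partition p" "sum_list p = d" "sum_list q = d" "x : An d"
 "aS q * x * bS p ~= (0 :: ('k::{field, field_char_0}) fna)"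
 shows "dom_le q p"
proof (rule ccontr)
 assume "\<not> dom_le q p"
 then have z: "aS q * sg s * bS p = (0 :: 'k fna)" if "s : Pm d" for s
 using a_g_b_dom[OF assms(1-3) that] by auto
 have "aS q * x * bS p = 0"
 unfolding sandwich_expand(1)[OF assms(4)]
 by (intro sum.neutral ballI) (simp add: z[OF sandwich_expand(2)[OF assms(4)]])
 then show False using assms by simp
qed

text \<open>In a nonzero product, the two outer factors and the two inner factors give dominance in
  opposite directions.\<close>

lemma cS_orthogonal:
 assumes "is_partition p" "is_partition q" "sum_list p = d" "sum_list q = d" "x : An d" "p ~= q"
 shows "cS p * x * cS q = (0 :: ('k::{field, field_char_0}) fna)"
proof (rule ccontr)
 assume *: "cS p * x * cS q ~= (0 :: 'k fna)"
 have eq: "cS p * x * cS q = bS p * (aS p * x * bS q) * aS q"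
 by (simp add: cS_def mult.assoc)
 have "aS p * x * bS q ~= 0" using * eq by auto
 then have "dom_le p q" using a_x_b_dom[of q d p x] assms by simp
 moreover have "aS p * x * bS q : An d"
 using assms aS_An[of p] bS_An[of q] by (auto intro!: An_mult)
 then have "dom_le q p" using b_x_a_dom[of p d q "aS p * x * bS q"] assms * eq by simp
 ultimately show False using dom_antisym assms by blast
qed

text \<open>For equal shapes the dominance inequality is an equality. The tight case factors
  \<open>g\<close> as \<open>t + pinv s\<close> with a column permutation \<open>t\<close> and a row
  permutation \<open>s\<close>, and these are absorbed up to a sign.\<close>

lemma b_g_a_scalar:
 assumes p: "is_partition p" and g: "g : Pm (sum_list p)"
 shows "\<exists>ka. bS p * sg g * aS p = fscale ka (cS p :: ('k::{field, field_char_0}) fna)"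
proof (cases "bS p * sg g * aS p = (0 :: 'k fna)")
 case True
 then show ?thesis by (intro exI[of _ 0]) simp
next
 case False
 let ?d = "sum_list p"
 let ?f = "%z. rw p (app (pinv g) z)"
 have f: "col_distinct p ?f" using b_g_a_dom(2)[OF p refl refl g False] .
 have "card {x. x < ?d & ?f x < i} = rc p i" for i
 unfolding rc_def using card_perm_reindex[OF Pm_pinv[OF g], of "%z. rw p z < i"] by simp
 note t = col_distinct_tight[OF p f this]
 \<comment> \<open>\<open>h x\<close> is the cell in the column of \<open>x\<close> that
   \<open>g\<close> brings from the row of \<open>x\<close>; this is the column factor of
   \<open>g\<close>.\<close>
 define h where "h x = (if x < ?d then (SOME y. y < ?d & cl p y = cl p x & ?f y = rw p x) else x)" for x
 have h: "h x < ?d" "cl p (h x) = cl p x" "?f (h x) = rw p x" if "x < ?d" for x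
 using someI_ex[OF t[OF that, unfolded Bex_def]] that by (auto simp: h_def)
 have "inj_on h {..<?d}"
 proof (rule inj_onI)
 fix x y assume xy: "x : {..<?d}" "y : {..<?d}" "h x = h y"
 then have "rw p x = rw p y" "cl p x = cl p y" using h[of x] h[of y] by auto
 then show "x = y" using xy by (auto intro: cell_inj)
 qed
 then have "bij_betw h {..<?d} {..<?d}"
 using h(1) endo_inj_surj[of "{..<?d}" h] by (simp add: bij_betw_def image_subset_iff)
 then have hp: "h permutes {..<?d}"
 by (rule bij_imp_permutes) (simp add: h_def)
 define t where "t = Fn h"
 have t: "t : colg p" using hp h by (simp add: t_def colg_def Pm_def)
 then have tP: "t : Pm ?d" by (simp add: colg_def)
 define s where "s = pinv g + t"
 have s: "s : rowg p" using h g tP by (simp add: s_def rowg_def t_def)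
 have "g = t + pinv s"
 unfolding s_def by (simp add: pinv_add[OF Pm_pinv[OF g] tP] pinv_pinv[OF g] pinv_right[OF tP] add.assoc[symmetric])
 then have "bS p * sg g * aS p = (bS p * sg t) * (sg (pinv s) * aS p)"
 by (simp add: mult.assoc) (simp add: mult.assoc[symmetric] mult_single)
 also have "\<dots> = fscale (sgnf t) (cS p)"
 using t s by (simp add: bS_right aS_left subgrpD(4)[OF subgrp_rowg] cS_def fscale_mult_left)
 finally show ?thesis by blast
qed

lemma b_x_a_scalar:
 assumes p: "is_partition p" and x: "x : An (sum_list p)"
 shows "\<exists>ka. bS p * x * aS p = fscale ka (cS p :: ('k::{field, field_char_0}) fna)"
proof -
 have "\<forall>g. \<exists>ka :: 'k. g : Pm (sum_list p) --> bS p * sg g * aS p = fscale ka (cS p)"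
 using b_g_a_scalar[OF p] by blast
 then obtain ka :: "fn => 'k" where
 k: "!!g. g : Pm (sum_list p) ==> bS p * sg g * aS p = fscale (ka g) (cS p)"
 using choice[of "%g ka. g : Pm (sum_list p) --> bS p * sg g * aS p = fscale ka (cS p)"] by blast
 have "bS p * x * aS p = (\<Sum>s\<in>keys x. fscale (lookup x s * ka s) (cS p))"
 unfolding sandwich_expand(1)[OF x]
 by (intro sum.cong refl) (simp add: k[OF sandwich_expand(2)[OF x]])
 then show ?thesis unfolding fs.scale_sum_left[symmetric] by blast
qed

text \<open>The corner of one shape is a line. This is the form in which Schur's lemma
  enters.\<close>

lemma cS_x_cS:
 assumes p: "is_partition p" and x: "x : An (sum_list p)"
 shows "\<exists>ka. cS p * x * cS p = fscale ka (cS p :: ('k::{field, field_char_0}) fna)"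
proof -
 have "aS p * x * bS p : An (sum_list p)" using x by (auto intro!: An_mult)
 from b_x_a_scalar[OF p this] show ?thesis by (simp add: cS_def mult.assoc)
qed

section \<open>Inversion of permutations and positivity\<close>

definition ast :: "('k::field) fna => 'k fna" where
 "ast = lin_ext (%s. sg (pinv s))"

lemma klin_ast: "klin ast"
 by (simp add: ast_def klin_lin_ext)

lemma ast_sg: "ast (single s c) = single (pinv s) c"
 by (simp add: ast_def)

lemma ast_mult:
 assumes "x : An d" "y : An d"
 shows "ast (x * y) = ast y * ast x"
proof (rule klin_eqI[of "%x. ast (x * y)" "%x. ast y * ast x"])
 fix s assume "s : keys x"
 then have s: "s : Pm d" by (rule supp_onD[OF assms(1)])
 show "ast (sg s * y) = ast y * ast (sg s)"
 proof (rule klin_eqI[of "%y. ast (sg s * y)" "%y. ast y * ast (sg s)"])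
 fix t assume "t : keys y"
 then have t: "t : Pm d" by (rule supp_onD[OF assms(2)])
 show "ast (sg s * sg t) = ast (sg t) * ast (sg s)"
 by (simp add: mult_single ast_sg pinv_add[OF s t])
 qed (rule klin_comp[OF klin_ast klin_mult_left], rule klin_comp[OF klin_mult_right klin_ast])
qed (rule klin_comp[OF klin_ast klin_mult_right], rule klin_comp[OF klin_mult_left klin_ast])

lemma ast_gsum:
 assumes H: "subgrp d H" and ch: "!!s. s : H ==> ch (pinv s) = ch s"
 shows "ast (gsum ch H) = gsum ch H"
proof -
 have b: "bij_betw pinv H H"
 by (rule bij_betwI[where g=pinv]) (auto simp: subgrpD[OF H] pinv_pinv[OF subgrpD(1)[OF H]])
 have "ast (gsum ch H) = (\<Sum>s\<in>H. fscale (ch (pinv s)) (sg (pinv s)))"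
 by (simp add: gsum_def klinD(6)[OF klin_ast] ast_sg ch)
 also have "\<dots> = gsum ch H"
 unfolding gsum_def by (rule sum.reindex_bij_betw[OF b])
 finally show ?thesis .
qed

lemma ast_aS: "ast (aS p) = aS p"
 unfolding aS_def by (rule ast_gsum[OF subgrp_rowg]) simp

lemma ast_bS: "ast (bS p) = bS p"
 unfolding bS_def by (rule ast_gsum[OF subgrp_colg]) (rule sgnf_pinv[OF subgrpD(1)[OF subgrp_colg]])

text \<open>The field carries no order, so positivity is argued with integer coefficients.\<close>

definition zco :: "('k::field) fna => bool" where
 "zco x \<longleftrightarrow> (\<forall>s. lookup x s : \<int>)"

lemma zco_mult:
 assumes "zco x" "zco y" "y : An d"
 shows "zco (x * y)"
 unfolding zco_def
proof
 fix s
 have "lookup (x * y) s = (\<Sum>b\<in>keys y. lookup y b * lookup (x * sg b) s)"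
 by (subst mult_expand_right) (simp add: lookup_sum)
 also have "\<dots> : \<int>"
 proof (intro Ints_sum Ints_mult)
 fix b assume "b : keys y"
 then have "b : Pm d" by (rule supp_onD[OF assms(3)])
 then show "lookup (x * sg b) s : \<int>" using assms(1) by (simp add: lookup_mult_sg zco_def)
 show "lookup y b : \<int>" using assms(2) by (simp add: zco_def)
 qed
 finally show "lookup (x * y) s : \<int>" .
qed

lemma zco_gsum: "(!!s. s : H ==> ch s : \<int>) ==> zco (gsum ch H)"
 by (auto simp: zco_def gsum_def lookup_sum lookup_single when_def intro!: Ints_sum)

text \<open>The coefficient of the identity in \<open>x * ast x\<close> is the sum of the squares of
  the coefficients of \<open>x\<close>, a positive integer.\<close>

lemma tau_ast_nonzero:
 fixes x :: "('k::{field, field_char_0}) fna"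
 assumes x: "x : An d" "zco x" "x ~= 0"
 shows "x * ast x ~= 0"
proof
 assume "x * ast x = 0"
 then have 0: "tau (x * ast x) = 0" by simp
 have "\<forall>s. \<exists>z. lookup x s = of_int z"
 using x(2) by (auto simp: zco_def Ints_def)
 then obtain z where z: "!!s. lookup x s = of_int (z s)"
 using choice[of "%s z. lookup x s = of_int z"] by blast
 have "ast x = (\<Sum>s\<in>keys x. fscale (lookup x s) (sg (pinv s)))"
 by (simp add: ast_def lin_ext_def)
 then have "tau (x * ast x) = (\<Sum>s\<in>keys x. lookup x s * tau (x * sg (pinv s)))"
 by (simp add: sum_distrib_left fscale_mult_right del: fscale_single)
 also have "\<dots> = (\<Sum>s\<in>keys x. lookup x s * lookup x s)"
 by (intro sum.cong refl) (simp add: tau_mult_sg[OF Pm_pinv[OF supp_onD[OF x(1)]]] pinv_pinv[OF supp_onD[OF x(1)]])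
 also have "\<dots> = of_int (\<Sum>s\<in>keys x. z s * z s)"
 by (simp add: z)
 finally have "(\<Sum>s\<in>keys x. z s * z s) = 0"
 using 0 by (simp del: of_int_sum of_int_mult)
 then have "\<forall>s\<in>keys x. z s = 0"
 by (subst (asm) sum_nonneg_eq_0_iff) auto
 then have "lookup x s = 0" for s
 using z[of s] by (cases "s : keys x") (auto simp: in_keys_iff)
 then have "x = 0" by (intro poly_mapping_eqI) simp
 then show False using x(3) by simp
qed

text \<open>A row permutation that is also a column permutation fixes every cell, so only the
  trivial factorization of the identity contributes.\<close>

lemma tau_cS [simp]: "tau (cS p) = (1 :: 'k::field)"
proof -
 have "tau (cS p) = (\<Sum>t\<in>colg p. \<Sum>s\<in>rowg p. sgnf t * (if t + s = 0 then 1 else (0::'k)))"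
 by (simp add: cS_def aS_def bS_def gsum_def sum_distrib_left sum_distrib_right mult_single)
 (simp add: tau_def lookup_single when_def sum.swap[of _ "rowg p"], intro sum.cong refl, simp)
 also have "\<dots> = (\<Sum>t\<in>colg p. \<Sum>s\<in>rowg p. if t = 0 & s = 0 then 1 else 0)"
 proof (intro sum.cong refl)
 fix t s assume ts: "t : colg p" "s : rowg p"
 then have tP: "t : Pm (sum_list p)" and sP: "s : Pm (sum_list p)" by (auto simp: colg_def rowg_def)
 have "t = 0 & s = 0" if "t + s = 0"
 proof -
 have "s = pinv t" using that pinv_left[OF tP] by (metis add.assoc add.right_neutral add_0)
 then have "s : colg p" using subgrpD(4)[OF subgrp_colg ts(1)] by simp
 have "s = 0"
 proof (rule fn_eqI)
 fix i
 show "app s i = app 0 i"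
 proof (cases "i < sum_list p")
 case True
 then have "rw p (app s i) = rw p i" "cl p (app s i) = cl p i"
 using \<open>s : colg p\<close> ts(2) by (auto simp: rowg_def colg_def)
 then show ?thesis using cell_inj[OF Pm_less[OF sP True] True] by simp
 next
 case False
 then show ?thesis using permutes_not_in[OF Pm_app[OF sP]] by simp
 qed
 qed
 then show ?thesis using that by simp
 qed
 then show "sgnf t * (if t + s = 0 then 1 else 0) = (if t = 0 & s = 0 then 1 else (0::'k))" by auto
 qed
 also have "\<dots> = (\<Sum>t\<in>colg p. if t = 0 then \<Sum>s\<in>rowg p. if s = 0 then 1 else 0 else 0)"
 by (intro sum.cong refl) auto
 also have "\<dots> = 1"
 using subgrpD(2,5)[OF subgrp_colg[of p]] subgrpD(2,5)[OF subgrp_rowg[of p]] by simp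
 finally show ?thesis .
qed

lemma cS_nonzero: "cS p ~= (0 :: ('k::field) fna)"
proof
 assume "cS p = (0 :: 'k fna)"
 then have "tau (cS p) = (0 :: 'k)" by simp
 then show False by simp
qed

text \<open>Positivity is used twice: for \<open>cS p\<close>, whose product with its adjoint is a
  multiple of \<open>?b * ?a * ?b\<close>, and then for this self-adjoint element, whose square has
  \<open>cS p * cS p\<close> as a left factor up to a scalar.\<close>

lemma cS_square_nonzero: "cS p * cS p ~= (0 :: ('k::{field, field_char_0}) fna)"
proof -
 let ?d = "sum_list p"
 let ?a = "aS p :: 'k fna" and ?b = "bS p :: 'k fna"
 have za: "zco ?a" by (simp add: aS_def zco_gsum)
 have zb: "zco ?b" by (simp add: bS_def zco_gsum sgnf_def)
 have sqa: "?a * ?a = fscale (of_nat (card (rowg p))) ?a"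
 unfolding aS_def by (rule gsum_square[OF subgrp_rowg chr_1])
 have sqb: "?b * ?b = fscale (of_nat (card (colg p))) ?b"
 unfolding bS_def by (rule gsum_square[OF subgrp_colg chr_sgnf])
 have zc: "zco (?b * ?a)" by (rule zco_mult[OF zb za aS_An])
 have "cS p * ast (cS p) ~= (0 :: 'k fna)"
 by (rule tau_ast_nonzero[OF cS_An _ cS_nonzero]) (simp add: cS_def zc)
 moreover have "cS p * ast (cS p) = ?b * (?a * ?a) * ?b"
 by (simp add: cS_def ast_mult[OF bS_An aS_An] ast_aS ast_bS mult.assoc)
 then have "cS p * ast (cS p) = fscale (of_nat (card (rowg p))) (?b * ?a * ?b)"
 by (simp only: sqa fscale_mult_right fscale_mult_left)
 ultimately have nz: "?b * ?a * ?b ~= 0" by auto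
 let ?y = "?b * ?a * ?b"
 have y: "?y : An ?d" "zco ?y"
 by (intro An_mult bS_An aS_An) (rule zco_mult[OF zc zb bS_An])
 have "ast ?y = ?y"
 by (simp only: ast_mult[OF An_mult[OF bS_An aS_An] bS_An] ast_mult[OF bS_An aS_An] ast_aS ast_bS) (simp only: mult.assoc)
 then have "?y * ?y ~= 0" using tau_ast_nonzero[OF y nz] by simp
 moreover have "?y * ?y = ?b * ?a * (?b * ?b) * ?a * ?b" by (simp add: mult.assoc)
 then have "?y * ?y = fscale (of_nat (card (colg p))) (cS p * cS p * ?b)"
 by (simp only: sqb fscale_mult_right fscale_mult_left cS_def mult.assoc)
 ultimately show ?thesis by auto
qed

lemma cS_square:
 assumes "is_partition p"
 obtains n :: "'k::{field, field_char_0}" where "n ~= 0" "cS p * cS p = fscale n (cS p)"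
proof -
 obtain n :: 'k where n: "cS p * cS p = fscale n (cS p)" using cS_x_cS[OF assms An_1] by auto
 have "n ~= 0" using cS_square_nonzero[of p, where 'k='k] n by auto
 then show ?thesis using n by (rule that)
qed

section \<open>Semistandard tableaux and weight spaces of Schur functors\<close>

definition lin_indep :: "'i set => ('i => ('a \<Rightarrow>\<^sub>0 'k::field)) => bool" where
 "lin_indep I f \<longleftrightarrow> (\<forall>z. (\<Sum>i\<in>I. fscale (z i) (f i)) = 0 --> (\<forall>i\<in>I. z i = 0))"

lemma lin_indepD: "lin_indep I f ==> (\<Sum>i\<in>I. fscale (z i) (f i)) = 0 ==> i : I ==> z i = 0"
 unfolding lin_indep_def by blast

lemma lin_indep_inj:
 assumes "finite I" "lin_indep I f"
 shows "inj_on f I"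
proof (rule inj_onI, rule ccontr)
 fix i j assume ij: "i : I" "j : I" "f i = f j" "i ~= j"
 let ?z = "%k. if k = i then 1 else if k = j then - 1 else 0"
 have "(\<Sum>k\<in>I. fscale (?z k) (f k)) = (\<Sum>k\<in>I. (if k = i then f i else 0) - (if k = j then f j else 0))"
 using ij(4) by (intro sum.cong refl) auto
 also have "\<dots> = 0" using ij assms(1) by (simp add: sum_subtractf)
 finally show False using lin_indepD[OF assms(2) _ ij(1), of ?z] by simp
qed

lemma dim_lin_indep:
 assumes "finite I" "lin_indep I f"
 shows "fs.dim (fs.span (f ` I)) = card I"
proof -
 have inj: "inj_on f I" by (rule lin_indep_inj[OF assms])
 have "fs.independent (f ` I)"
 proof
 assume "fs.dependent (f ` I)"
 then obtain u v where uv: "v : f ` I" "u v ~= 0" "(\<Sum>v\<in>f ` I. fscale (u v) v) = 0"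
 using fs.dependent_finite[of "f ` I"] assms(1) by auto
 then have "(\<Sum>i\<in>I. fscale (u (f i)) (f i)) = 0"
 by (simp add: sum.reindex[OF inj])
 then have "u (f i) = 0" if "i : I" for i
 using lin_indepD[OF assms(2), of "%i. u (f i)"] that by blast
 then show False using uv by auto
 qed
 then show ?thesis
 using fs.dim_span_eq_card_independent card_image[OF inj] by metis
qed

section \<open>Words of a given content\<close>

definition content :: "nat => fn => nat multiset" where
 "content d w = image_mset (app w) (mset_set {..<d})"

definition Wm :: "nat => nat multiset => fn set" where
 "Wm d m = {w : Wd d. content d w = m}"

lemma content_add: "s : Pm d ==> content d (w + s) = content d w"
proof -
 assume s: "s : Pm d"
 have "content d (w + s) = image_mset (app w) (image_mset (app s) (mset_set {..<d}))"
 by (simp add: content_def image_mset.compositionality)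
 also have "image_mset (app s) (mset_set {..<d}) = mset_set (app s ` {..<d})"
 using permutes_inj_on[OF Pm_app[OF s]] by (intro image_mset_mset_set)
 also have "app s ` {..<d} = {..<d}" by (rule permutes_image[OF Pm_app[OF s]])
 finally show ?thesis by (simp add: content_def)
qed

lemma Wm_add: "w : Wm d m ==> s : Pm d ==> w + s : Wm d m"
 by (simp add: Wm_def content_add)

lemma Wm_letters: "w : Wm d m ==> n < d ==> app w n \<in># m"
 by (auto simp: Wm_def content_def)

lemma finite_Wm [simp]: "finite (Wm d m)"
proof -
 have "Wm d m \<subseteq> (%f. Fn (%n. if n < d then f n else n)) ` ({..<d} \<rightarrow>\<^sub>E set_mset m)"
 proof
 fix w assume w: "w : Wm d m"
 let ?f = "\<lambda>n\<in>{..<d}. app w n"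
 have "?f : {..<d} \<rightarrow>\<^sub>E set_mset m" using Wm_letters[OF w] by auto
 moreover have "w = Fn (%n. if n < d then ?f n else n)"
 using w by (intro fn_eqI) (auto simp: Wm_def Wd_def)
 ultimately show "w : (%f. Fn (%n. if n < d then f n else n)) ` ({..<d} \<rightarrow>\<^sub>E set_mset m)"
 by blast
 qed
 then show ?thesis by (rule finite_subset) (intro finite_imageI finite_PiE, auto)
qed

text \<open>The letter at position \<open>n\<close> of a word stands in the cell numbered
  \<open>n\<close>, so a word of the right length is a filling of the diagram.\<close>

definition sstd :: "nat list => fn => bool" where
 "sstd p w \<longleftrightarrow> (\<forall>x<sum_list p. \<forall>y<sum_list p.
 (rw p x = rw p y & cl p x < cl p y --> app w x <= app w y) &
 (cl p x = cl p y & rw p x < rw p y --> app w x < app w y))"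

definition SS :: "nat list => nat multiset => fn set" where
 "SS p m = {w : Wm (sum_list p) m. sstd p w}"

lemma finite_SS [simp]: "finite (SS p m)"
 by (rule finite_subset[of _ "Wm (sum_list p) m"]) (auto simp: SS_def)

lemma sg_colg_cS:
 assumes "t : colg p"
 shows "sg (w + t) * cS p = fscale (sgnf t) (sg w * cS p :: ('k::field) fna)"
proof -
 have "sg (w + t) * cS p = sg w * (sg t * bS p) * (aS p :: 'k fna)"
 by (simp add: cS_def mult.assoc[symmetric] mult_single)
 then show ?thesis by (simp add: bS_left[OF assms] cS_def fscale_mult_left fscale_mult_right mult.assoc)
qed

lemma repeated_column_zero:
 assumes "x < sum_list p" "y < sum_list p" "x ~= y" "cl p x = cl p y" "app w x = app w y"
 shows "sg w * cS p = (0 :: ('k::{field, field_char_0}) fna)"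
proof -
 have "w + tr x y = w" using assms(5) by (intro fn_eqI) (auto simp: transpose_def)
 then have "sg w * cS p = - (sg w * cS p :: 'k fna)"
 using sg_colg_cS[OF tr_colg[OF assms(1,2,4)], of w, where 'k='k] assms(3) by (simp add: sgnf_tr)
 then show ?thesis by (rule eq_neg_imp_zero)
qed

section \<open>Garnir relations\<close>

definition supg :: "nat => nat set => fn set" where
 "supg d X = {s : Pm d. \<forall>n. n \<notin> X --> app s n = n}"

lemma subgrp_supg: "subgrp d (supg d X)"
proof -
 have "app (pinv s) n = n" if "s : Pm d" "app s n = n" for s n
 using pinv_app_app[OF that(1), of n] that(2) by simp
 then show ?thesis by (auto simp: subgrp_def supg_def)
qed

lemma supg_image:
 assumes "s : supg d X"
 shows "app s ` X = X"
proof -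
 have inj: "inj (app s)" and "surj (app s)"
 using assms permutes_inj[OF Pm_app] permutes_surj[OF Pm_app] unfolding supg_def by blast+
 have 1: "app s n : X" if "n : X" for n
 proof (rule ccontr)
 assume "app s n \<notin> X"
 then have "app s (app s n) = app s n" using assms by (simp add: supg_def)
 then have "app s n = n" using inj by (simp add: inj_eq)
 then show False using that \<open>app s n \<notin> X\<close> by simp
 qed
 have 2: "n : app s ` X" if "n : X" for n
 proof -
 obtain k where k: "n = app s k" using \<open>surj (app s)\<close> by blast
 have "k : X" using k that assms by (cases "k : X") (auto simp: supg_def)
 then show ?thesis using k by blast
 qed
 show ?thesis using 1 2 by blast
qed

text \<open>Every column permutation moves two of the cells of \<open>X\<close> into the same row.\<close>

lemma garnir_collision:
 assumes p: "is_partition p" and xy: "x0 < sum_list p" "y0 < sum_list p" "rw p x0 = rw p y0" "cl p x0 < cl p y0"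
 and t: "t : colg p"
 and X: "X = {n. n < sum_list p & cl p n = cl p x0 & rw p x0 <= rw p n} \<union>
 {n. n < sum_list p & cl p n = cl p y0 & rw p n <= rw p x0}"
 shows "\<exists>x\<in>X. \<exists>y\<in>X. x ~= y & rw p (app (pinv t) x) = rw p (app (pinv t) y)"
proof -
 let ?d = "sum_list p"
 let ?A = "{n. n < ?d & cl p n = cl p x0 & rw p x0 <= rw p n}"
 let ?B = "{n. n < ?d & cl p n = cl p y0 & rw p n <= rw p x0}"
 let ?C = "{n. n < ?d & cl p n = cl p x0}"
 let ?C' = "{n. n < ?d & cl p n = cl p x0 & rw p n < rw p x0}"
 have tP: "t : Pm ?d" using t by (simp add: colg_def)
 have "card ?C' = card (rw p ` ?C')"
 by (rule card_image[symmetric], rule inj_onI, rule cell_inj) auto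
 also have "\<dots> <= card {..<rw p x0}" by (rule card_mono) auto
 finally have c': "card ?C' <= rw p x0" by simp
 have "{..rw p x0} \<subseteq> rw p ` ?B"
 proof
 fix j assume "j : {..rw p x0}"
 then have "j <= rw p y0" "j <= rw p x0" using xy(3) by auto
 obtain z where "z < ?d" "rw p z = j" "cl p z = cl p y0" using cell_above[OF p xy(2) \<open>j <= rw p y0\<close>] .
 then show "j : rw p ` ?B" using \<open>j <= rw p x0\<close> by auto
 qed
 then have "card {..rw p x0} <= card (rw p ` ?B)" by (rule card_mono[rotated]) simp
 also have "\<dots> <= card ?B" by (rule card_image_le) simp
 finally have b: "rw p x0 < card ?B" by simp
 have "card (?A \<union> ?C') = card ?A + card ?C'"
 by (rule card_Un_disjoint) auto
 moreover have "?A \<union> ?C' = ?C" by auto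
 moreover have "card X = card ?A + card ?B"
 unfolding X by (rule card_Un_disjoint) (use xy(4) in auto)
 \<comment> \<open>The lower part of the left column and the upper part of the right one overlap in
   the row of \<open>x0\<close>, so together they have more cells than the left column.\<close>
 ultimately have card: "card ?C < card X" using b c' by simp
 \<comment> \<open>A column permutation keeps a cell of \<open>X\<close> in its column, which is
   that of \<open>x0\<close> or one further right; hence its new row still meets the column of
   \<open>x0\<close>. This is the map to which the pigeonhole principle applies.\<close>
 have ex: "\<exists>z. z : ?C & rw p z = rw p (app (pinv t) x)" if "x : X" for x
 proof -
 let ?x = "app (pinv t) x"
 have xd: "x < ?d" using that X by auto
 have lt: "?x < ?d" by (rule Pm_less[OF Pm_pinv[OF tP] xd])
 have "cl p ?x = cl p x" using t lt app_pinv_app[OF tP, of x] by (auto simp: colg_def)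
 then have "cl p x0 <= cl p ?x" using that X xy(4) by auto
 then have "cl p x0 < sh p (rw p ?x)" using cl_less_sh[OF lt] by simp
 then obtain z where "z < ?d" "rw p z = rw p ?x" "cl p z = cl p x0" by (rule cell_exists)
 then show ?thesis by auto
 qed
 define f where "f x = (SOME z. z : ?C & rw p z = rw p (app (pinv t) x))" for x
 have f: "f x : ?C" "rw p (f x) = rw p (app (pinv t) x)" if "x : X" for x
 using someI_ex[OF ex[OF that]] unfolding f_def by blast+
 have "\<not> inj_on f X"
 proof
 assume "inj_on f X"
 then have "card X <= card ?C" by (rule card_inj_on_le) (use f in auto)
 then show False using card by simp
 qed
 then obtain x y where xy': "x : X" "y : X" "x ~= y" "f x = f y" unfolding inj_on_def by blast
 then have "rw p (app (pinv t) x) = rw p (app (pinv t) y)" using f(2)[of x] f(2)[of y] by simp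
 then show ?thesis using xy' by blast
qed

text \<open>For each column permutation \<open>t\<close> a transposition inside \<open>X\<close>
  changes the sign of the alternating sum and, on the other side of \<open>t\<close>, is absorbed by
  the row sum.\<close>

lemma garnir_zero:
 assumes p: "is_partition p" and xy: "x0 < sum_list p" "y0 < sum_list p" "rw p x0 = rw p y0" "cl p x0 < cl p y0"
 and X: "X = {n. n < sum_list p & cl p n = cl p x0 & rw p x0 <= rw p n} \<union>
 {n. n < sum_list p & cl p n = cl p y0 & rw p n <= rw p x0}"
 shows "gsum sgnf (supg (sum_list p) X) * cS p = (0 :: ('k::{field, field_char_0}) fna)"
proof -
 let ?d = "sum_list p"
 let ?G = "gsum sgnf (supg ?d X) :: 'k fna"
 have z: "?G * sg t * aS p = 0" if t: "t : colg p" for t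
 proof -
 have tP: "t : Pm ?d" using t by (simp add: colg_def)
 obtain x y where h: "x : X" "y : X" "x ~= y" "rw p (app (pinv t) x) = rw p (app (pinv t) y)"
 using garnir_collision[OF p xy t X] by blast
 let ?x = "app (pinv t) x" and ?y = "app (pinv t) y"
 have xd: "x < ?d" "y < ?d" using h X by auto
 have s: "tr x y : supg ?d X" using h xd by (auto simp: supg_def transpose_def)
 have r: "tr ?x ?y : rowg p" using h xd Pm_less[OF Pm_pinv[OF tP]] by (intro tr_rowg) auto
 have e: "t + tr ?x ?y = tr x y + t" using conj_tr[OF tP, of ?x ?y] tP by simp
 have "?G * sg t * aS p = ?G * sg t * (sg (tr ?x ?y) * aS p)" by (simp add: aS_left[OF r])
 also have "\<dots> = ?G * (sg t * sg (tr ?x ?y)) * aS p" by (simp add: mult.assoc)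
 also have "sg t * sg (tr ?x ?y) = (sg (tr x y) * sg t :: 'k fna)" by (simp add: mult_single e)
 also have "?G * (sg (tr x y) * sg t) * aS p = (?G * sg (tr x y)) * sg t * aS p" by (simp add: mult.assoc)
 also have "\<dots> = - (?G * sg t * aS p)"
 unfolding gsum_right[OF subgrp_supg chr_sgnf s] using h(3) by (simp add: sgnf_tr)
 finally show ?thesis by (rule eq_neg_imp_zero)
 qed
 have "?G * cS p = (\<Sum>t\<in>colg p. fscale (sgnf t) (?G * sg t * aS p))"
 unfolding cS_def bS_def gsum_def[of _ "colg p"]
 by (simp only: sum_distrib_right sum_distrib_left fscale_mult_right fscale_mult_left mult.assoc)
 also have "\<dots> = 0" by (intro sum.neutral ballI) (simp add: z)
 finally show ?thesis .
qed

text \<open>Passing from \<open>D\<close> to \<open>E\<close> trades elements for equally many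
  others at which \<open>u\<close> is strictly smaller.\<close>

lemma sum_upper_set:
 fixes u :: "nat => nat"
 assumes fin: "finite D" "finite E" and card: "card E = card D"
 and up: "!!a b. a : D - E ==> b : E - D ==> u b < u a"
 shows "sum u E <= sum u D" "sum u E = sum u D ==> E = D"
proof -
 have cd: "card (E - D) = card (D - E)"
 using card fin card_Diff_subset_Int[of E D] card_Diff_subset_Int[of D E] by (simp add: Int_commute)
 have sE: "sum u E = sum u (E \<inter> D) + sum u (E - D)"
 by (rule sum.Int_Diff[OF fin(2)])
 have sD: "sum u D = sum u (E \<inter> D) + sum u (D - E)"
 using sum.Int_Diff[OF fin(1), of u E] by (simp add: Int_commute)
 have *: "E - D ~= {} ==> sum u (E - D) < sum u (D - E)"
 proof -
 assume ne: "E - D ~= {}"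
 then have ne': "D - E ~= {}" using cd fin by (cases "D - E = {}") auto
 define M where "M = Max (u ` (E - D))"
 have M: "u b <= M" if "b : E - D" for b using that fin by (simp add: M_def)
 have "M : u ` (E - D)" unfolding M_def using ne fin by (intro Max_in) auto
 then have M': "M < u a" if "a : D - E" for a using up that by auto
 have "sum u (E - D) <= (\<Sum>b\<in>E - D. M)" by (rule sum_mono) (rule M)
 also have "\<dots> = (\<Sum>a\<in>D - E. M)" by (simp add: cd)
 also have "\<dots> < sum u (D - E)" by (rule sum_strict_mono) (use ne' fin M' in auto)
 finally show ?thesis .
 qed
 show "sum u E <= sum u D" using * sE sD by (cases "E - D = {}") auto
 assume "sum u E = sum u D"
 then have "E - D = {}" using * sE sD by fastforce
 then have "E \<subseteq> D" by blast
 then show "E = D" using card fin by (simp add: card_subset_eq)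
qed

text \<open>\<open>colstat\<close> grows when large letters move to the right and
  \<open>rowstat\<close> when they move down. Both are bounded on words of fixed content, which
  makes straightening terminate; \<open>rowstat\<close> also orders the words for the triangularity
  argument.\<close>

definition colstat :: "nat list => fn => nat" where
 "colstat p w = (\<Sum>n<sum_list p. cl p n * app w n)"

definition rowstat :: "nat list => fn => nat" where
 "rowstat p w = (\<Sum>n<sum_list p. rw p n * app w n)"

lemma letter_le_sum: "w : Wm d m ==> n < d ==> app w n <= sum_mset m"
proof -
 assume "w : Wm d m" "n < d"
 then have "app w n \<in># m" by (rule Wm_letters)
 from sum_mset.remove[OF this] show ?thesis by simp
qed

lemma colstat_bound: "w : Wm (sum_list p) m ==> colstat p w <= (\<Sum>n<sum_list p. cl p n) * sum_mset m"
 unfolding colstat_def sum_distrib_right by (intro sum_mono mult_le_mono2 letter_le_sum) auto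

lemma rowstat_bound: "w : Wm (sum_list p) m ==> rowstat p w <= (\<Sum>n<sum_list p. rw p n) * sum_mset m"
 unfolding rowstat_def sum_distrib_right by (intro sum_mono mult_le_mono2 letter_le_sum) auto

text \<open>Stated additively because subtraction of natural numbers truncates.\<close>

lemma stat_swap:
 fixes f g :: "nat => nat"
 assumes "x < d" "y < d" "x ~= y"
 shows "(\<Sum>n<d. f n * g (transpose x y n)) + f x * g x + f y * g y = (\<Sum>n<d. f n * g n) + f x * g y + f y * g x"
proof -
 have "(\<Sum>n<d. h n) = h x + h y + (\<Sum>n\<in>{..<d} - {x, y}. h n)" for h :: "nat => nat"
 using assms sum.subset_diff[of "{x, y}" "{..<d}" h] by auto
 note 1 = this[of "%n. f n * g (transpose x y n)"] this[of "%n. f n * g n"]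
 have "(\<Sum>n\<in>{..<d} - {x, y}. f n * g (transpose x y n)) = (\<Sum>n\<in>{..<d} - {x, y}. f n * g n)"
 by (rule sum.cong) (auto simp: transpose_def)
 then show ?thesis using 1 assms(3) by simp
qed

lemma colstat_colg: "t : colg p ==> colstat p (w + t) = colstat p w"
proof -
 assume t: "t : colg p"
 have "colstat p (w + t) = (\<Sum>n<sum_list p. cl p (app t n) * app w (app t n))"
 using t by (auto simp: colstat_def colg_def intro!: sum.cong)
 also have "\<dots> = colstat p w"
 unfolding colstat_def using t
 by (intro sum.reindex_bij_betw) (auto simp: colg_def Pm_def intro: permutes_imp_bij)
 finally show ?thesis .
qed

lemma rowstat_rowg: "t : rowg p ==> rowstat p (w + t) = rowstat p w"
proof -
 assume t: "t : rowg p"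
 have "rowstat p (w + t) = (\<Sum>n<sum_list p. rw p (app t n) * app w (app t n))"
 using t by (auto simp: rowstat_def rowg_def intro!: sum.cong)
 also have "\<dots> = rowstat p w"
 unfolding rowstat_def using t
 by (intro sum.reindex_bij_betw) (auto simp: rowg_def Pm_def intro: permutes_imp_bij)
 finally show ?thesis .
qed

text \<open>A Garnir relation expresses a row violation by words with larger \<open>colstat\<close>.\<close>

lemma garnir_straighten:
 assumes p: "is_partition p" and xy: "x0 < sum_list p" "y0 < sum_list p" "rw p x0 = rw p y0" "cl p x0 < cl p y0"
 and viol: "app w y0 < app w x0"
 and strict: "!!x y. x < sum_list p ==> y < sum_list p ==> cl p x = cl p y ==> rw p x < rw p y ==> app w x < app w y"
 and w: "w : Wm (sum_list p) m"
 shows "sg w * cS p : fs.span ((%u. sg u * cS p :: ('k::{field, field_char_0}) fna) ` {u : Wm (sum_list p) m. colstat p w < colstat p u})"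
 (is "_ : fs.span (?f ` ?U)")
proof -
 let ?d = "sum_list p"
 define A where "A = {n. n < ?d & cl p n = cl p x0 & rw p x0 <= rw p n}"
 define B where "B = {n. n < ?d & cl p n = cl p y0 & rw p n <= rw p x0}"
 define X where "X = A \<union> B"
 have z: "gsum sgnf (supg ?d X) * cS p = (0 :: 'k fna)"
 by (rule garnir_zero[OF p xy]) (auto simp: X_def A_def B_def)
 let ?H = "supg ?d X"
 let ?K = "{s : ?H. app s ` B = B}"
 have finH: "finite ?H" by (rule subgrpD(5)[OF subgrp_supg])
 have sP: "s : Pm ?d" if "s : ?H" for s using that by (simp add: supg_def)
 have disj: "A \<inter> B = {}" using xy(4) by (auto simp: A_def B_def)
 have fin: "finite A" "finite B" by (auto simp: A_def B_def)
 \<comment> \<open>Letters of \<open>A\<close> are bounded below by the letter at \<open>x0\<close>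
   and letters of \<open>B\<close> above by the one at \<open>y0\<close>; by the violation every
   letter of \<open>A\<close> exceeds every letter of \<open>B\<close>.\<close>
 have le_A: "app w x0 <= app w n" if "n : A" for n
 proof (cases "rw p n = rw p x0")
 case True
 then have "n = x0" using that xy by - (rule cell_inj, auto simp: A_def)
 then show ?thesis by simp
 next
 case False
 then show ?thesis using that xy strict[of x0 n] by (auto simp: A_def)
 qed
 have le_B: "app w n <= app w y0" if "n : B" for n
 proof (cases "rw p n = rw p y0")
 case True
 then have "n = y0" using that xy by - (rule cell_inj, auto simp: B_def)
 then show ?thesis by simp
 next
 case False
 then show ?thesis using that xy strict[of n y0] by (auto simp: B_def)
 qed
 \<comment> \<open>A permutation of \<open>X\<close> that preserves \<open>B\<close> preserves both
   column pieces, so it is a column permutation and reproduces the word up to sign.\<close>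
 have K: "sg (w + s) * cS p = (fscale (sgnf s) (sg w * cS p) :: 'k fna)" if "s : ?K" for s
 proof (rule sg_colg_cS)
 have im: "app s ` X = X" "app s ` B = B" using that supg_image[of s ?d X] by simp_all
 have inj: "inj (app s)" using that permutes_inj[OF Pm_app[OF sP]] by auto
 have AX: "A = X - B" using disj by (auto simp: X_def)
 then have "app s ` A = A" using image_set_diff[OF inj, of X B] im by simp
 then have "cl p (app s n) = cl p n" if "n : A" for n using that by (auto simp: A_def)
 moreover have "cl p (app s n) = cl p n" if "n : B" for n using that im(2) by (auto simp: B_def)
 moreover have "app s n = n" if "n \<notin> A" "n \<notin> B" for n using that \<open>s : ?K\<close> by (auto simp: supg_def X_def)
 ultimately have "cl p (app s n) = cl p n" for n by (cases "n : A"; cases "n : B") auto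
 then show "s : colg p" using that sP by (auto simp: colg_def)
 qed
 \<comment> \<open>Any other permutation brings larger letters from \<open>A\<close> into
   \<open>B\<close>, whose column lies further right.\<close>
 have U: "w + s : ?U" if "s : ?H - ?K" for s
 proof -
 have im: "app s ` X = X" "app s ` B ~= B" using that supg_image[of s ?d X] by simp_all
 have s: "s : Pm ?d" using that sP by auto
 have inj: "inj (app s)" using permutes_inj[OF Pm_app[OF s]] .
 have sub: "app s ` B \<subseteq> X" using im(1) by (auto simp: X_def)
 have cardB: "card (app s ` B) = card B" by (rule card_image) (rule inj_on_subset[OF inj], simp)
 have up: "app w b < app w a" if "a : app s ` B - B" "b : B - app s ` B" for a b
 proof -
 have "a : A" using that(1) sub by (auto simp: X_def)
 then show ?thesis using le_A[of a] le_B[of b] that(2) viol by simp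
 qed
 note su = sum_upper_set[where u="app w" and D="app s ` B" and E=B, OF finite_imageI[OF fin(2)] fin(2) cardB[symmetric] up]
 have B_less: "sum (app w) B < sum (app w) (app s ` B)"
 using su im(2) by (metis le_neq_implies_less)
 have reX: "(\<Sum>n\<in>X. app w (app s n)) = sum (app w) X"
 using sum.reindex[OF inj_on_subset[OF inj], of X "app w"] im(1) by simp
 have reB: "(\<Sum>n\<in>B. app w (app s n)) = sum (app w) (app s ` B)"
 using sum.reindex[OF inj_on_subset[OF inj], of B "app w"] by simp
 obtain e where e: "cl p y0 = cl p x0 + Suc e" using less_imp_Suc_add[OF xy(4)] by auto
 have part: "(\<Sum>n\<in>X. cl p n * g n) = cl p x0 * sum g X + Suc e * sum g B" for g :: "nat => nat"
 proof -
 have "(\<Sum>n\<in>X. cl p n * g n) = (\<Sum>n\<in>A. cl p n * g n) + (\<Sum>n\<in>B. cl p n * g n)"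
 unfolding X_def by (rule sum.union_disjoint[OF fin disj])
 also have "(\<Sum>n\<in>A. cl p n * g n) = cl p x0 * sum g A"
 by (simp add: sum_distrib_left A_def)
 also have "(\<Sum>n\<in>B. cl p n * g n) = (cl p x0 + Suc e) * sum g B"
 by (simp add: sum_distrib_left B_def e)
 finally show ?thesis unfolding X_def by (simp add: sum.union_disjoint[OF fin disj] algebra_simps)
 qed
 have Xd: "X \<subseteq> {..<?d}" by (auto simp: X_def A_def B_def)
 have split: "(\<Sum>n<?d. h n) = (\<Sum>n\<in>X. h n) + (\<Sum>n\<in>{..<?d} - X. h n)" for h :: "nat => nat"
 using sum.subset_diff[OF Xd, of h] by simp
 have out: "(\<Sum>n\<in>{..<?d} - X. cl p n * app w (app s n)) = (\<Sum>n\<in>{..<?d} - X. cl p n * app w n)"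
 using that by (intro sum.cong) (auto simp: supg_def)
 have "colstat p w < colstat p (w + s)"
 using B_less unfolding colstat_def app_plus comp_def split part reX reB out
 by (simp add: add_less_le_mono[OF B_less mult_le_mono2[OF less_imp_le[OF B_less]]])
 then show ?thesis using Wm_add[OF w s] by simp
 qed
 have K0: "0 : ?K" using subgrpD(2)[OF subgrp_supg] by auto
 have finK: "finite ?K" using finH by simp
 \<comment> \<open>In the vanishing Garnir sum the given word occurs with coefficient
   \<open>card ?K\<close>, which is invertible in characteristic zero.\<close>
 have "sg w * (gsum sgnf ?H * cS p) = (\<Sum>s\<in>?H. fscale (sgnf s) (?f (w + s)))"
 unfolding gsum_def sum_distrib_left sum_distrib_right fscale_mult_left fscale_mult_right
 by (simp add: mult_single mult.assoc[symmetric])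
 also have "\<dots> = (\<Sum>s\<in>?K. fscale (sgnf s) (?f (w + s))) + (\<Sum>s\<in>?H - ?K. fscale (sgnf s) (?f (w + s)))"
 using sum.subset_diff[of ?K ?H] finH by (simp add: add.commute)
 also have "(\<Sum>s\<in>?K. fscale (sgnf s) (?f (w + s))) = (\<Sum>s\<in>?K. fscale 1 (?f w))"
 by (rule sum.cong) (simp_all add: K)
 also have "\<dots> = fscale (of_nat (card ?K)) (?f w)"
 unfolding fs.scale_sum_left[symmetric] by simp
 finally have eq: "fscale (of_nat (card ?K)) (?f w) = - (\<Sum>s\<in>?H - ?K. fscale (sgnf s) (?f (w + s)))"
 using z by (simp add: eq_neg_iff_add_eq_0)
 have "(\<Sum>s\<in>?H - ?K. fscale (sgnf s) (?f (w + s))) : fs.span (?f ` ?U)"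
 by (intro fs.span_sum fs.span_scale fs.span_base imageI U)
 then have in_span: "fscale (of_nat (card ?K)) (?f w) : fs.span (?f ` ?U)"
 unfolding eq by (rule fs.span_neg)
 have "card ?K ~= 0" using K0 finK by auto
 then have inv: "?f w = fscale (inverse (of_nat (card ?K))) (fscale (of_nat (card ?K)) (?f w))"
 by simp
 show ?thesis by (subst inv) (rule fs.span_scale[OF in_span])
qed

text \<open>Induction on \<open>colstat\<close> and then \<open>rowstat\<close>, counted down from
  their bounds. A violation in a column is zero or is removed by a swap that keeps
  \<open>colstat\<close> and raises \<open>rowstat\<close>; a violation in a row is removed by a
  Garnir relation that raises \<open>colstat\<close>.\<close>

lemma ssyt_spans:
 assumes p: "is_partition p" and w: "w : Wm (sum_list p) m"
 shows "sg w * cS p : fs.span ((%u. sg u * cS p :: ('k::{field, field_char_0}) fna) ` SS p m)"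
 (is "_ : fs.span (?f ` _)")
proof -
 let ?d = "sum_list p"
 let ?K1 = "(\<Sum>n<?d. cl p n) * sum_mset m" and ?K2 = "(\<Sum>n<?d. rw p n) * sum_mset m"
 let ?R = "measures [%w. ?K1 - colstat p w, %w. ?K2 - rowstat p w]"
 have bound: "colstat p u <= ?K1" "rowstat p u <= ?K2" if "u : Wm ?d m" for u
 using colstat_bound[OF that] rowstat_bound[OF that] by auto
 from w show ?thesis
 proof (induction w rule: wf_induct_rule[OF wf_measures[of "[%w. ?K1 - colstat p w, %w. ?K2 - rowstat p w]"]])
 case (1 w)
 note w = 1(2)
 have IH: "?f u : fs.span (?f ` SS p m)"
 if "u : Wm ?d m" "colstat p w < colstat p u \<or> colstat p w = colstat p u & rowstat p w < rowstat p u" for u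
 using that bound[OF that(1)] by (intro 1(1)) auto
 show ?case
 proof (cases "\<exists>x<?d. \<exists>y<?d. cl p x = cl p y & rw p x < rw p y & app w y <= app w x")
 case True
 then obtain x y where xy: "x < ?d" "y < ?d" "cl p x = cl p y" "rw p x < rw p y" "app w y <= app w x" by blast
 then have ne: "x ~= y" by auto
 show ?thesis
 proof (cases "app w x = app w y")
 case True
 then show ?thesis
 using repeated_column_zero[OF xy(1,2) ne xy(3), where w=w and 'k='k] by (simp add: fs.span_zero)
 next
 case False
 have t: "tr x y : colg p" using xy by (intro tr_colg) auto
 have tP: "tr x y : Pm ?d" using xy by simp
 obtain a b where ab: "rw p y = rw p x + Suc a" "app w x = app w y + Suc b"
 using xy(4,5) False less_imp_Suc_add by (metis add_Suc_right le_neq_implies_less)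
 have "rowstat p w < rowstat p (w + tr x y)"
 using stat_swap[OF xy(1,2) ne, of "rw p" "app w"] unfolding rowstat_def
 by (simp add: ab comp_def algebra_simps)
 then have "?f (w + tr x y) : fs.span (?f ` SS p m)"
 using colstat_colg[OF t, of w] Wm_add[OF w tP] by (intro IH) auto
 then have "- ?f w : fs.span (?f ` SS p m)"
 using ne by (simp add: sg_colg_cS[OF t] sgnf_tr)
 then show ?thesis using fs.span_neg by fastforce
 qed
 next
 case False
 then have strict: "app w x < app w y" if "x < ?d" "y < ?d" "cl p x = cl p y" "rw p x < rw p y" for x y
 using that by (meson not_le)
 show ?thesis
 proof (cases "sstd p w")
 case True
 then show ?thesis using w by (intro fs.span_base) (auto simp: SS_def)
 next
 case False
 then obtain x y where xy: "x < ?d" "y < ?d" "rw p x = rw p y" "cl p x < cl p y" "app w y < app w x"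
 using strict unfolding sstd_def by (meson not_le)
 have "?f w : fs.span (?f ` {u : Wm ?d m. colstat p w < colstat p u})"
 by (rule garnir_straighten[OF p xy strict w])
 also have "\<dots> \<subseteq> fs.span (?f ` SS p m)"
 by (rule fs.span_minimal[OF _ fs.subspace_span]) (use IH in auto)
 finally show ?thesis .
 qed
 qed
 qed
qed

text \<open>A filling that increases strictly down its columns has its large letters as low as
  possible, so among its column rearrangements it alone attains the maximum of
  \<open>rowstat\<close>.\<close>

lemma rowstat_colg:
 assumes strict: "!!x y. x < sum_list p ==> y < sum_list p ==> cl p x = cl p y ==> rw p x < rw p y ==> app u x < app u y"
 and t: "t : colg p"
 shows "rowstat p (u + t) <= rowstat p u" "rowstat p (u + t) = rowstat p u ==> t = 0"
proof -
 let ?d = "sum_list p"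
 have tP: "t : Pm ?d" using t by (simp add: colg_def)
 have inj: "inj (app t)" using permutes_inj[OF Pm_app[OF tP]] .
 define D where "D i c = {n. n < ?d & cl p n = c & i < rw p n}" for i c
 have fin: "finite (D i c)" for i c by (simp add: D_def)
 \<comment> \<open>A cell in row \<open>k\<close> is counted once for each \<open>i < k\<close>.
   This reduces the comparison to plain sums of the letters below row \<open>i\<close> in one
   column.\<close>
 have stat: "rowstat p v = (\<Sum>i<length p. \<Sum>c<Suc ?d. sum (app v) (D i c))" for v
 proof -
 have "rowstat p v = (\<Sum>n<?d. \<Sum>i<length p. if i < rw p n then app v n else 0)"
 unfolding rowstat_def
 proof (rule sum.cong[OF refl])
 fix n assume "n : {..<?d}"
 then have "rw p n < length p" using tableau_cell_range[of n p] by simp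
 then have "{i. i < length p & i < rw p n} = {..<rw p n}" by auto
 then show "rw p n * app v n = (\<Sum>i<length p. if i < rw p n then app v n else 0)"
 by (simp add: sum.inter_filter[symmetric] lessThan_def)
 qed
 also have "\<dots> = (\<Sum>i<length p. \<Sum>n<?d. if i < rw p n then app v n else 0)" by (rule sum.swap)
 also have "\<dots> = (\<Sum>i<length p. \<Sum>c<Suc ?d. sum (app v) (D i c))"
 proof (rule sum.cong[OF refl])
 fix i
 have "(\<Sum>n<?d. if i < rw p n then app v n else 0) = sum (app v) {n. n < ?d & i < rw p n}"
 by (simp add: sum.inter_filter[symmetric] lessThan_def)
 also have "\<dots> = (\<Sum>c<Suc ?d. sum (app v) {n : {n. n < ?d & i < rw p n}. cl p n = c})"
 by (rule sum.group[symmetric]) (use tableau_cell_range[of _ p] in \<open>force simp: less_Suc_eq_le\<close>)+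
 also have "\<dots> = (\<Sum>c<Suc ?d. sum (app v) (D i c))"
 by (intro sum.cong refl) (auto simp: D_def)
 finally show "(\<Sum>n<?d. if i < rw p n then app v n else 0) = (\<Sum>c<Suc ?d. sum (app v) (D i c))" .
 qed
 finally show ?thesis .
 qed
 have le: "sum (app (u + t)) (D i c) <= sum (app u) (D i c)"
 and eq: "sum (app (u + t)) (D i c) = sum (app u) (D i c) ==> app t ` D i c = D i c" for i c
 proof -
 have re: "sum (app (u + t)) (D i c) = sum (app u) (app t ` D i c)"
 using sum.reindex[OF inj_on_subset[OF inj], of "D i c" "app u"] by simp
 have card: "card (app t ` D i c) = card (D i c)" by (rule card_image) (rule inj_on_subset[OF inj], simp)
 have up: "app u b < app u a" if "a : D i c - app t ` D i c" "b : app t ` D i c - D i c" for a b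
 proof -
 have "b < ?d" "cl p b = c" using that(2) t Pm_less[OF tP] by (auto simp: D_def colg_def)
 then show ?thesis using that by (intro strict) (auto simp: D_def)
 qed
 show "sum (app (u + t)) (D i c) <= sum (app u) (D i c)"
 unfolding re by (rule sum_upper_set(1)[OF fin finite_imageI[OF fin] card up])
 show "app t ` D i c = D i c" if "sum (app (u + t)) (D i c) = sum (app u) (D i c)"
 by (rule sum_upper_set(2)[OF fin finite_imageI[OF fin] card up that[unfolded re]])
 qed
 show "rowstat p (u + t) <= rowstat p u"
 unfolding stat by (intro sum_mono le)
 assume e: "rowstat p (u + t) = rowstat p u"
 have img: "app t ` D i c = D i c" if "i < length p" "c < Suc ?d" for i c
 proof (rule ccontr)
 assume "app t ` D i c ~= D i c"
 then have "sum (app (u + t)) (D i c) < sum (app u) (D i c)"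
 using le[of i c] eq[of i c] by linarith
 then have "(\<Sum>c<Suc ?d. sum (app (u + t)) (D i c)) < (\<Sum>c<Suc ?d. sum (app u) (D i c))"
 using that le by (intro sum_strict_mono_ex1) auto
 moreover have "(\<Sum>c<Suc ?d. sum (app (u + t)) (D i c)) <= (\<Sum>c<Suc ?d. sum (app u) (D i c))" for i
 by (intro sum_mono le)
 ultimately have "rowstat p (u + t) < rowstat p u"
 unfolding stat using that(1) by (intro sum_strict_mono_ex1) (auto simp del: sum.lessThan_Suc app_plus)
 then show False using e by simp
 qed
 have mem: "i < rw p (app t n)" if n: "n < ?d" "i < rw p n" for i n
 proof -
 have "i < length p" "cl p n < Suc ?d" using tableau_cell_range[OF n(1)] n by auto
 then have "app t ` D i (cl p n) = D i (cl p n)" by (rule img)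
 moreover have "n : D i (cl p n)" using n by (simp add: D_def)
 ultimately have "app t n : D i (cl p n)" by blast
 then show ?thesis by (simp add: D_def)
 qed
 have ge: "rw p n <= rw p (app t n)" if "n < ?d" for n
 using mem[OF that] by (meson not_le order_less_irrefl)
 \<comment> \<open>No cell moves up, and the total of the row numbers is invariant, so no cell moves
   at all.\<close>
 have "(\<Sum>n<?d. rw p (app t n)) = (\<Sum>n<?d. rw p n)"
 using permutes_imp_bij[OF Pm_app[OF tP]] by (rule sum.reindex_bij_betw)
 then have same: "rw p (app t n) = rw p n" if "n < ?d" for n
 proof -
 have "\<not> rw p n < rw p (app t n)"
 proof
 assume "rw p n < rw p (app t n)"
 then have "(\<Sum>n<?d. rw p n) < (\<Sum>n<?d. rw p (app t n))"
 using that ge by (intro sum_strict_mono_ex1) auto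
 then show False using \<open>(\<Sum>n<?d. rw p (app t n)) = (\<Sum>n<?d. rw p n)\<close> by simp
 qed
 then show ?thesis using ge[OF that] by simp
 qed
 show "t = 0"
 proof (rule fn_eqI)
 fix n
 show "app t n = app 0 n"
 proof (cases "n < ?d")
 case True
 then have "cl p (app t n) = cl p n" using t by (simp add: colg_def)
 then show ?thesis using cell_inj[OF Pm_less[OF tP True] True same[OF True]] by simp
 next
 case False
 then show ?thesis using permutes_not_in[OF Pm_app[OF tP]] by simp
 qed
 qed
qed

text \<open>In a sorted row the cells with letters below \<open>k\<close> form an initial segment,
  whose size a row permutation cannot change.\<close>

lemma row_sorted_unique:
 assumes u: "sstd p u" and us: "sstd p (u + s)" and s: "s : rowg p"
 shows "u + s = u"
proof -
 let ?d = "sum_list p"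
 have sP: "s : Pm ?d" using s by (simp add: rowg_def)
 define E where "E v r k = {n. n < ?d & rw p n = r & app v n < k}" for v r k
 have fin: "finite (E v r k)" for v r k by (simp add: E_def)
 have down: "y : E v r k" if "sstd p v" "x : E v r k" "y < ?d" "rw p y = r" "cl p y < cl p x" for v r k x y
 proof -
 have "app v y <= app v x" using that unfolding sstd_def E_def by auto
 then show ?thesis using that by (auto simp: E_def)
 qed
 have "app s ` E (u + s) r k = E u r k" for r k
 proof
 show "app s ` E (u + s) r k \<subseteq> E u r k"
 using s Pm_less[OF sP] by (auto simp: E_def rowg_def)
 show "E u r k \<subseteq> app s ` E (u + s) r k"
 proof
 fix n assume n: "n : E u r k"
 let ?n = "app (pinv s) n"
 have "?n < ?d" using Pm_less[OF Pm_pinv[OF sP]] n by (simp add: E_def)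
 moreover have "rw p ?n = rw p n"
 using s calculation app_pinv_app[OF sP, of n] by (auto simp: rowg_def)
 ultimately have "?n : E (u + s) r k" using n app_pinv_app[OF sP, of n] by (simp add: E_def)
 then show "n : app s ` E (u + s) r k" using app_pinv_app[OF sP, of n] by (metis imageI)
 qed
 qed
 moreover have "inj (app s)" using permutes_inj[OF Pm_app[OF sP]] .
 ultimately have card: "card (E (u + s) r k) = card (E u r k)" for r k
 by (metis card_image inj_on_subset subset_UNIV)
 have same: "E (u + s) r k = E u r k" for r k
 proof -
 have "E (u + s) r k \<subseteq> E u r k \<or> E u r k \<subseteq> E (u + s) r k"
 proof (rule ccontr)
 assume "\<not> ?thesis"
 then obtain x y where x: "x : E (u + s) r k" "x \<notin> E u r k" and y: "y : E u r k" "y \<notin> E (u + s) r k" by blast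
 have b: "x < ?d" "y < ?d" "rw p x = r" "rw p y = r" using x y by (auto simp: E_def)
 consider "cl p x < cl p y" | "cl p y < cl p x" | "cl p x = cl p y" by linarith
 then show False
 proof cases
 case 1 then show ?thesis using down[OF u y(1) b(1,3)] x by blast
 next
 case 2 then show ?thesis using down[OF us x(1) b(2,4)] y by blast
 next
 case 3
 then have "x = y" using b cell_inj[OF b(1,2)] by simp
 then show ?thesis using x y by blast
 qed
 qed
 then show ?thesis using card[of r k] fin card_subset_eq by metis
 qed
 show ?thesis
 proof (rule fn_eqI)
 fix n
 show "app (u + s) n = app u n"
 proof (cases "n < ?d")
 case True
 have *: "app (u + s) n < k \<longleftrightarrow> app u n < k" for k
 using same[of "rw p n" k] True unfolding E_def set_eq_iff by auto
 show ?thesis using *[of "app u n"] *[of "app (u + s) n"] by linarith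
 next
 case False
 then show ?thesis using permutes_not_in[OF Pm_app[OF sP]] by simp
 qed
 qed
qed

section \<open>Triangularity of the semistandard words\<close>

lemma lookup_sg_cS:
 "lookup (sg u * cS p) w = (\<Sum>t\<in>colg p. \<Sum>s\<in>rowg p. if u + t + s = w then sgnf t else (0::'k::field))"
proof -
 have "sg u * cS p = (\<Sum>t\<in>colg p. \<Sum>s\<in>rowg p. single (u + t + s) (sgnf t :: 'k))"
 by (simp add: cS_def aS_def bS_def gsum_def sum_distrib_left sum_distrib_right mult_single add.assoc)
 (rule sum.swap)
 then show ?thesis by (simp add: lookup_sum lookup_single when_def)
qed

lemma sstd_strict: "sstd p u ==> x < sum_list p ==> y < sum_list p ==> cl p x = cl p y ==> rw p x < rw p y ==> app u x < app u y"
 unfolding sstd_def by blast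

text \<open>A word in \<open>sg u * cS p\<close> arises by a column permutation, which can only
  lower \<open>rowstat\<close>, and a row permutation, which keeps it. At a word with
  \<open>rowstat\<close> no smaller than that of \<open>u\<close> the column permutation must be
  trivial.\<close>

lemma lookup_sg_cS_triangular:
 assumes u: "sstd p u" and w: "sstd p w" and le: "rowstat p u <= rowstat p w"
 and nz: "lookup (sg u * cS p) w ~= (0::'k::field)"
 shows "u = w"
proof -
 obtain t s where ts: "t : colg p" "s : rowg p" "u + t + s = w"
 proof (rule ccontr)
 assume "\<not> thesis"
 then have "(if u + t + s = w then sgnf t else 0) = (0::'k)" if "t : colg p" "s : rowg p" for t s
 using that \<open>!!t s. t : colg p ==> s : rowg p ==> u + t + s = w ==> thesis\<close> by auto
 then have "lookup (sg u * cS p) w = (0::'k)"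
 unfolding lookup_sg_cS by (intro sum.neutral ballI)
 then show False using nz by simp
 qed
 have "rowstat p w = rowstat p (u + t)" using rowstat_rowg[OF ts(2), of "u + t"] ts(3) by simp
 then have "rowstat p (u + t) = rowstat p u"
 using le rowstat_colg(1)[OF sstd_strict[OF u] ts(1)] by linarith
 then have "t = 0" by (rule rowstat_colg(2)[OF sstd_strict[OF u] ts(1), rotated -1])
 then have "u + s = w" using ts(3) by simp
 then show ?thesis using row_sorted_unique[OF u _ ts(2)] w by simp
qed

text \<open>Only the trivial column permutation contributes, so there are no signs: the coefficient
  counts the row permutations that fix \<open>u\<close>.\<close>

lemma lookup_sg_cS_diagonal:
 assumes u: "sstd p u"
 shows "lookup (sg u * cS p) u ~= (0::'k::{field, field_char_0})"
proof -
 have t0: "t = 0" if "t : colg p" "s : rowg p" "u + t + s = u" for t s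
 proof (rule rowstat_colg(2)[OF sstd_strict[OF u] that(1)])
 show "rowstat p (u + t) = rowstat p u" using rowstat_rowg[OF that(2), of "u + t"] that(3) by simp
 qed
 have "lookup (sg u * cS p) u = (\<Sum>t\<in>colg p. \<Sum>s\<in>rowg p. if t = 0 & u + s = u then (1::'k) else 0)"
 unfolding lookup_sg_cS by (intro sum.cong refl) (use t0 in force)
 also have "\<dots> = (\<Sum>t\<in>colg p. if t = 0 then \<Sum>s\<in>rowg p. if u + s = u then (1::'k) else 0 else 0)"
 by (intro sum.cong refl) auto
 also have "\<dots> = (\<Sum>s\<in>rowg p. if u + s = u then (1::'k) else 0)"
 using subgrpD(2,5)[OF subgrp_colg[of p]] by simp
 also have "\<dots> = of_nat (card {s : rowg p. u + s = u})"
 using subgrpD(5)[OF subgrp_rowg[of p]] by (simp add: sum.inter_filter[symmetric])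
 finally have eq: "lookup (sg u * cS p) u = (of_nat (card {s : rowg p. u + s = u}) :: 'k)" .
 have "0 : {s : rowg p. u + s = u}" using subgrpD(2)[OF subgrp_rowg[of p]] by simp
 then have "card {s : rowg p. u + s = u} ~= 0" using subgrpD(5)[OF subgrp_rowg[of p]] by auto
 then show ?thesis by (simp add: eq)
qed

text \<open>Among the words with nonzero coefficient, evaluation at one of maximal
  \<open>rowstat\<close> isolates it by triangularity.\<close>

lemma ssyt_independent:
 "lin_indep (SS p m) (%u. sg u * cS p :: ('k::{field, field_char_0}) fna)"
 unfolding lin_indep_def
proof (intro allI impI)
 fix z :: "fn => 'k"
 assume 0: "(\<Sum>u\<in>SS p m. fscale (z u) (sg u * cS p)) = 0"
 define N where "N = {u : SS p m. z u ~= 0}"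
 have "N = {}"
 proof (rule ccontr)
 assume ne: "N ~= {}"
 have fin: "finite N" by (simp add: N_def)
 have "Max (rowstat p ` N) : rowstat p ` N" using fin ne by (intro Max_in) auto
 then obtain w where wM: "w : N" "Max (rowstat p ` N) = rowstat p w" by auto
 have "rowstat p u <= rowstat p w" if "u : N" for u
 using that fin wM(2)[symmetric] by simp
 note w = wM(1) this
 have "0 = (\<Sum>u\<in>SS p m. z u * lookup (sg u * cS p) w)"
 using arg_cong[OF 0, of "%x. lookup x w"] by (simp add: lookup_sum)
 also have "\<dots> = (\<Sum>u\<in>SS p m. if u = w then z w * lookup (sg w * cS p) w else 0)"
 proof (rule sum.cong[OF refl])
 fix u assume u: "u : SS p m"
 have "z u * lookup (sg u * cS p) w = 0" if "u ~= w"
 proof (rule ccontr)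
 assume "z u * lookup (sg u * cS p) w ~= 0"
 then have nz: "z u ~= 0" "lookup (sg u * cS p) w ~= (0::'k)" by auto
 then have "u : N" using u by (simp add: N_def)
 then show False
 using lookup_sg_cS_triangular[of p u w, OF _ _ w(2) nz(2)] u w(1) that by (auto simp: SS_def N_def)
 qed
 then show "z u * lookup (sg u * cS p) w = (if u = w then z w * lookup (sg w * cS p) w else 0)"
 by auto
 qed
 also have "\<dots> = z w * lookup (sg w * cS p) w"
 using w(1) by (simp add: N_def)
 finally have "z w * lookup (sg w * cS p) w = 0" by simp
 moreover have "lookup (sg w * cS p) w ~= (0::'k)"
 using w(1) by (intro lookup_sg_cS_diagonal) (auto simp: N_def SS_def)
 ultimately show False using w(1) by (simp add: N_def)
 qed
 then show "\<forall>i\<in>SS p m. z i = 0" by (auto simp: N_def)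
qed

abbreviation rmul :: "('k::field) fna set => 'k fna => 'k fna set" where
 "rmul X c \<equiv> (%x. x * c) ` X"

lemma weight_space_basis:
 assumes "is_partition p"
 shows "rmul (supp_on (Wm (sum_list p) m)) (cS p) =
 fs.span ((%u. sg u * cS p :: ('k::{field, field_char_0}) fna) ` SS p m)"
proof
 show "rmul (supp_on (Wm (sum_list p) m)) (cS p) \<subseteq> fs.span ((%u. sg u * cS p :: 'k fna) ` SS p m)"
 proof
 fix y :: "'k fna" assume "y : rmul (supp_on (Wm (sum_list p) m)) (cS p)"
 then obtain x where x: "x : supp_on (Wm (sum_list p) m)" "y = x * cS p" by blast
 show "y : fs.span ((%u. sg u * cS p) ` SS p m)"
 unfolding x(2) mult_expand_left[of x]
 by (intro fs.span_sum fs.span_scale ssyt_spans[OF assms] supp_onD[OF x(1)])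
 qed
 have sub: "fs.subspace (rmul (supp_on (Wm (sum_list p) m)) (cS p :: 'k fna))"
 by (rule fs2.linear_subspace_image[OF klin_mult_right subspace_supp_on])
 show "fs.span ((%u. sg u * cS p :: 'k fna) ` SS p m) \<subseteq> rmul (supp_on (Wm (sum_list p) m)) (cS p)"
 by (rule fs.span_minimal[OF _ sub]) (auto simp: SS_def)
qed

text \<open>The weight multiplicities of a Schur functor are Kostka numbers. Every multiplicity
  below is computed through this character.\<close>

lemma dim_weight_space:
 assumes "is_partition p"
 shows "fs.dim (rmul (supp_on (Wm (sum_list p) m)) (cS p :: ('k::{field, field_char_0}) fna)) = card (SS p m)"
 unfolding weight_space_basis[OF assms] by (rule dim_lin_indep[OF finite_SS ssyt_independent])

section \<open>Schur functions count semistandard words\<close>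

definition wl :: "nat => nat list => fn" where
 "wl d xs = Fn (%n. if n < d then xs ! n else n)"

lemma wl_Wd [simp]: "wl d xs : Wd d"
 by (simp add: wl_def Wd_def)

lemma concat_nth_block:
 "r < length T ==> c < length (T ! r) ==> concat T ! (sum_list (take r (map length T)) + c) = T ! r ! c"
proof (induction T arbitrary: r)
 case (Cons t T)
 then show ?case by (cases r) (simp_all add: nth_append add.assoc)
qed simp

lemma concat_eqD: "map length T = map length T' ==> concat T = concat T' ==> T = T'"
proof (induction T arbitrary: T')
 case (Cons t T)
 then obtain t' T'' where "T' = t' # T''" by (cases T') auto
 then show ?case using Cons by auto
qed simp

lemma wl_cell:
 assumes "map length T = p" "x < sum_list p"
 shows "app (wl (sum_list p) (concat T)) x = T ! rw p x ! cl p x"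
proof -
 note r = tableau_cell_range[OF assms(2)]
 have len: "length T = length p" using assms(1) by auto
 have "cl p x < length (T ! rw p x)" using r assms(1) len by (metis nth_map)
 then have "concat T ! x = T ! rw p x ! cl p x"
 using concat_nth_block[of "rw p x" T "cl p x"] r assms(1) len by simp
 then show ?thesis using assms(2) by (simp add: wl_def)
qed

lemma sorted_word_content:
 assumes "length xs = d"
 shows "content d (wl d xs) = mset xs"
proof -
 have "content d (wl d xs) = image_mset (%n. xs ! n) (mset_set {..<d})"
 unfolding content_def by (rule image_mset_cong) (simp add: wl_def)
 also have "\<dots> = mset (map (%n. xs ! n) [0..<d])"
 by (simp add: mset_map atLeast0LessThan)
 also have "map (%n. xs ! n) [0..<d] = xs" using assms map_nth by blast
 finally show ?thesis .
qed

text \<open>\<open>semistandard\<close> compares consecutive rows and \<open>sstd\<close> any two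
  rows of a column; a chain connects them because the rows of a partition shrink, so all cells in
  between exist.\<close>

lemma semistandard_iff:
 assumes p: "is_partition p" and T: "map length T = p"
 shows "semistandard p T \<longleftrightarrow> sstd p (wl (sum_list p) (concat T))"
proof
 let ?w = "wl (sum_list p) (concat T)"
 have len: "length T = length p" using T by auto
 have leni: "length (T ! i) = sh p i" if "i < length T" for i
 using that T len by (simp add: sh_def) (metis nth_map)
 {
 assume S: "semistandard p T"
 have rows: "T ! i ! c <= T ! i ! c'" if "i < length T" "c < c'" "c' < length (T ! i)" for i c c'
 using S that unfolding semistandard_def by (meson less_imp_le_nat nth_mem sorted_nth_mono)
 have cols: "i < length T ==> i < j ==> j < length T ==> c < length (T ! j) ==> T ! i ! c < T ! j ! c" for i j c
 proof (induction j)
 case (Suc j)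
 have step: "T ! j ! c < T ! Suc j ! c" using S Suc.prems unfolding semistandard_def by blast
 show ?case
 proof (cases "i = j")
 case False
 have "c < length (T ! j)"
 using Suc.prems leni[of j] leni[of "Suc j"] sh_partition_mono[OF p, of j "Suc j"] by simp
 then have "T ! i ! c < T ! j ! c" using Suc.IH Suc.prems False by simp
 then show ?thesis using step by simp
 qed (use step in simp)
 qed simp
 show "sstd p ?w"
 unfolding sstd_def
 proof (intro allI impI conjI)
 fix x y assume xy: "x < sum_list p" "y < sum_list p"
 note r = tableau_cell_range[OF xy(1)] tableau_cell_range[OF xy(2)]
 have l: "cl p x < length (T ! rw p x)" "cl p y < length (T ! rw p y)"
 using r len leni cl_less_sh xy by auto
 show "app ?w x <= app ?w y" if "rw p x = rw p y & cl p x < cl p y"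
 unfolding wl_cell[OF T xy(1)] wl_cell[OF T xy(2)] using rows that l r len by simp
 show "app ?w x < app ?w y" if "cl p x = cl p y & rw p x < rw p y"
 unfolding wl_cell[OF T xy(1)] wl_cell[OF T xy(2)] using cols that l r len by simp
 qed
 }
 assume S: "sstd p ?w"
 have cell: "\<exists>x<sum_list p. rw p x = i & cl p x = c" if "i < length T" "c < length (T ! i)" for i c
 using cell_exists[of c p i] leni[OF that(1)] that(2) by metis
 show "semistandard p T"
 unfolding semistandard_def
 proof (intro conjI ballI allI impI)
 show "map length T = p" by (rule T)
 fix row assume "row : set T"
 then obtain i where i: "i < length T" "row = T ! i" by (metis in_set_conv_nth)
 show "sorted row"
 unfolding sorted_iff_nth_mono_less i(2)
 proof (intro allI impI)
 fix c c' assume c: "c < c'" "c' < length (T ! i)"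
 obtain x where x: "x < sum_list p" "rw p x = i" "cl p x = c" using cell[OF i(1), of c] c by auto
 obtain y where y: "y < sum_list p" "rw p y = i" "cl p y = c'" using cell[OF i(1) c(2)] by auto
 have "app ?w x <= app ?w y" using S x y c unfolding sstd_def by auto
 then show "T ! i ! c <= T ! i ! c'" using wl_cell[OF T x(1)] wl_cell[OF T y(1)] x y by simp
 qed
 next
 fix i c assume ic: "Suc i < length T & c < length (T ! Suc i)"
 then have "c < length (T ! i)"
 using leni[of i] leni[of "Suc i"] sh_partition_mono[OF p, of i "Suc i"] by simp
 then obtain x where x: "x < sum_list p" "rw p x = i" "cl p x = c" using cell[of i c] ic by auto
 obtain y where y: "y < sum_list p" "rw p y = Suc i" "cl p y = c" using cell[of "Suc i" c] ic by auto
 have "app ?w x < app ?w y" using S x y unfolding sstd_def by auto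
 then show "T ! i ! c < T ! Suc i ! c" using wl_cell[OF T x(1)] wl_cell[OF T y(1)] x y by simp
 qed
qed

lemma schur_function_card:
 assumes p: "is_partition p"
 shows "schur_function p m = card (SS p m)"
proof -
 let ?d = "sum_list p"
 let ?f = "%T. wl ?d (concat T)"
 have len: "length (concat T) = ?d" if "semistandard p T" for T
 using that by (simp add: semistandard_def length_concat)
 have lenm: "map length T = p" if "semistandard p T" for T
 using that by (simp add: semistandard_def)
 have "bij_betw ?f {T. semistandard p T & mset (concat T) = m} (SS p m)"
 unfolding bij_betw_def
 proof
 show "inj_on ?f {T. semistandard p T & mset (concat T) = m}"
 proof (rule inj_onI)
 fix T T' assume h: "T : {T. semistandard p T & mset (concat T) = m}"
 "T' : {T. semistandard p T & mset (concat T) = m}" "?f T = ?f T'"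
 then have l: "length (concat T) = ?d" "length (concat T') = ?d" using len by auto
 have "concat T = concat T'"
 proof (rule nth_equalityI)
 fix n assume "n < length (concat T)"
 then show "concat T ! n = concat T' ! n"
 using arg_cong[OF h(3), of "%w. app w n"] l by (simp add: wl_def)
 qed (use l in simp)
 then show "T = T'" using lenm h by (intro concat_eqD) auto
 qed
 show "?f ` {T. semistandard p T & mset (concat T) = m} = SS p m"
 proof
 show "?f ` {T. semistandard p T & mset (concat T) = m} \<subseteq> SS p m"
 using semistandard_iff[OF p lenm] sorted_word_content[OF len] by (auto simp: SS_def Wm_def)
 show "SS p m \<subseteq> ?f ` {T. semistandard p T & mset (concat T) = m}"
 proof
 fix w assume w: "w : SS p m"
 define T where "T = map (%r. map (%c. app w (sum_list (take r p) + c)) [0..<p ! r]) [0..<length p]"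
 have T: "map length T = p" by (rule nth_equalityI) (simp_all add: T_def)
 have eq: "?f T = w"
 proof (rule fn_eqI)
 fix n
 show "app (?f T) n = app w n"
 proof (cases "n < ?d")
 case True
 note r = tableau_cell_range[OF True]
 show ?thesis unfolding wl_cell[OF T True] using r by (simp add: T_def)
 next
 case False
 then show ?thesis using w by (simp add: wl_def SS_def Wm_def Wd_def)
 qed
 qed
 have "semistandard p T" using semistandard_iff[OF p T] eq w by (simp add: SS_def)
 moreover have "mset (concat T) = m"
 using sorted_word_content[OF len[OF calculation]] eq w by (simp add: SS_def Wm_def)
 ultimately show "w : ?f ` {T. semistandard p T & mset (concat T) = m}" using eq by blast
 qed
 qed
 qed
 then show ?thesis unfolding schur_function_def by (rule bij_betw_same_card)
qed

text \<open>A semistandard filling has distinct letters in each column, so the number of letters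
  below \<open>i\<close> is bounded by \<open>col_distinct_dominance\<close>; for the content at
  hand this number is the partial row sum of \<open>q\<close>.\<close>

lemma SS_dominance:
 assumes p: "is_partition p" and q: "is_partition q" and sz: "sum_list p = sum_list q"
 and ne: "SS p (content (sum_list q) (wl (sum_list q) (map (rw q) [0..<sum_list q]))) ~= {}"
 shows "dom_le q p"
proof -
 let ?d = "sum_list q"
 let ?u = "wl ?d (map (rw q) [0..<?d])"
 obtain w where w: "w : SS p (content ?d ?u)" using ne by blast
 have cd: "col_distinct p (app w)"
 unfolding col_distinct_def
 proof (intro allI impI, rule ccontr)
 fix x y assume h: "x < sum_list p & y < sum_list p & cl p x = cl p y & app w x = app w y" "x ~= y"
 then have "rw p x ~= rw p y" using cell_inj by blast
 then show False using h w sstd_strict[of p w x y] sstd_strict[of p w y x] by (force simp: SS_def)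
 qed
 have cnt: "card {x. x < ?d & app v x < i} = size (filter_mset (%k. k < i) (content ?d v))" for v i
 proof -
 have "filter_mset (%k. k < i) (content ?d v) = image_mset (app v) (filter_mset (%x. app v x < i) (mset_set {..<?d}))"
 by (simp add: content_def filter_mset_image_mset)
 then show ?thesis by (simp add: Collect_conj_eq[symmetric] lessThan_def)
 qed
 have "rc q i <= rc p i" for i
 proof -
 have "rc q i = card {x. x < ?d & app ?u x < i}"
 unfolding rc_def by (rule arg_cong[where f=card]) (auto simp: wl_def)
 also have "\<dots> = card {x. x < ?d & app w x < i}"
 using w sz by (simp add: cnt SS_def Wm_def)
 also have "\<dots> <= rc p i" using col_distinct_dominance[OF p cd, of i] sz by simp
 finally show ?thesis .
 qed
 then show ?thesis by (simp add: dom_le_def)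
qed

text \<open>The content of the filling of \<open>q\<close> whose row \<open>i\<close> consists of
  the letter \<open>i\<close>, that is, the highest weight of shape \<open>q\<close>.\<close>

abbreviation std_content :: "nat list => nat multiset" where
 "std_content q \<equiv> content (sum_list q) (wl (sum_list q) (map (rw q) [0..<sum_list q]))"

lemma SS_diagonal: "SS q (std_content q) ~= {}"
proof -
 have "wl (sum_list q) (map (rw q) [0..<sum_list q]) : SS q (std_content q)"
 by (simp add: SS_def Wm_def Wd_def sstd_def wl_def)
 then show ?thesis by blast
qed

lemma SS_size: "SS p m ~= {} ==> size m = sum_list p"
 by (auto simp: SS_def Wm_def content_def)

text \<open>
 Schur functions are linearly independent: evaluating at the content of a dominance-maximal
 partition isolates its coefficient.
\<close>

lemma schur_unique:
 fixes N M :: "nat list => nat"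
 assumes fin: "finite S" and S: "!!s. s : S ==> is_partition s"
 and eq: "!!m. (\<Sum>s\<in>S. N s * schur_function s m) = (\<Sum>s\<in>S. M s * schur_function s m)"
 and s: "s : S"
 shows "N s = M s"
proof (rule ccontr)
 assume "N s ~= M s"
 define D where "D = {s : S. N s ~= M s}"
 have D: "finite D" "D ~= {}" using fin s \<open>N s ~= M s\<close> by (auto simp: D_def)
 \<comment> \<open>\<open>K\<close> exceeds every length occurring in \<open>D\<close>, so partial
   sums from there on are just the size. The sum \<open>f\<close> of the first \<open>K\<close>
   partial sums is therefore strictly monotone for dominance, and its maximum is a dominance-maximal
   partition.\<close>
 define K where "K = Suc (Max (length ` D))"
 define f where "f q = (\<Sum>i<K. rc q i)" for q
 have "Max (f ` D) : f ` D" using D by (intro Max_in) auto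
 then obtain q where q: "q : D" "Max (f ` D) = f q" by auto
 have max: "f t <= f q" if "t : D" for t using that D q(2)[symmetric] by simp
 have qp: "is_partition q" using q(1) S by (simp add: D_def)
 have rcK: "rc t i = sum_list t" if "t : D" "K <= Suc i" for t i
 proof -
 have "length t <= Max (length ` D)" using that D by simp
 then have "length t <= i" using that(2) by (simp add: K_def)
 then have "{x. x < sum_list t & rw t x < i} = {..<sum_list t}"
 using tableau_cell_range[of _ t] by (auto simp: set_eq_iff) (meson less_le_trans)
 then show ?thesis by (simp add: rc_def)
 qed
 have zero: "schur_function t (std_content q) = 0" if t: "t : D" "t ~= q" for t
 proof (rule ccontr)
 assume "schur_function t (std_content q) ~= 0"
 then have ne: "SS t (std_content q) ~= {}"
 using schur_function_card S t by (auto simp: D_def)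
 have sz: "sum_list t = sum_list q" using SS_size[OF ne] by (simp add: content_def)
 have tp: "is_partition t" using t S by (simp add: D_def)
 have dom: "dom_le q t" by (rule SS_dominance[OF tp qp sz ne])
 have "f q <= f t" unfolding f_def using dom by (intro sum_mono) (simp add: dom_le_def)
 then have "f q = f t" using max[OF t(1)] by simp
 have lt: "rc q i = rc t i" if "i < K" for i
 proof (rule ccontr)
 assume "rc q i ~= rc t i"
 then have "rc q i < rc t i" using dom by (simp add: dom_le_def le_neq_implies_less)
 then have "f q < f t" unfolding f_def using that dom by (intro sum_strict_mono_ex1) (auto simp: dom_le_def)
 then show False using \<open>f q = f t\<close> by simp
 qed
 have "rc q i = rc t i" for i
 using lt[of i] rcK[OF q(1), of i] rcK[OF t(1), of i] sz by (cases "i < K") auto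
 then have "q = t" by (rule rc_eq_imp_eq[OF qp tp])
 then show False using t(2) by simp
 qed
 have split: "(\<Sum>s\<in>S. F s * schur_function s (std_content q)) =
 (\<Sum>s\<in>S - D. F s * schur_function s (std_content q)) + F q * schur_function q (std_content q)" for F
 proof -
 have "(\<Sum>s\<in>S. F s * schur_function s (std_content q)) =
 (\<Sum>s\<in>S - D. F s * schur_function s (std_content q)) + (\<Sum>s\<in>D. F s * schur_function s (std_content q))"
 by (rule sum.subset_diff) (auto simp: D_def fin)
 also have "(\<Sum>s\<in>D. F s * schur_function s (std_content q)) = (\<Sum>s\<in>D. if s = q then F q * schur_function q (std_content q) else 0)"
 by (rule sum.cong) (auto simp: zero)
 finally show ?thesis using D q(1) by simp
 qed
 have "(\<Sum>s\<in>S - D. N s * schur_function s (std_content q)) = (\<Sum>s\<in>S - D. M s * schur_function s (std_content q))"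
 by (rule sum.cong) (auto simp: D_def)
 then have "N q * schur_function q (std_content q) = M q * schur_function q (std_content q)"
 using eq[of "std_content q"] split[of N] split[of M] by simp
 moreover have "schur_function q (std_content q) ~= 0"
 using SS_diagonal[of q] schur_function_card[OF qp] finite_SS by (simp add: card_eq_0_iff)
 ultimately show False using q(1) by (simp add: D_def)
qed

section \<open>Counting standard tableaux\<close>

definition parts :: "nat => nat list set" where
 "parts n = {p. is_partition p & sum_list p = n}"

definition shapes :: "nat => (nat => nat) set" where
 "shapes n = {l. (\<forall>i. l (Suc i) <= l i) & (\<exists>N. (\<forall>i\<ge>N. l i = 0) & (\<Sum>i<N. l i) = n)}"

lemma sum_support_eq:
 fixes l :: "nat => nat"
 assumes "\<forall>i\<ge>N. l i = 0" "N <= M"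
 shows "(\<Sum>i<M. l i) = (\<Sum>i<N. l i)"
 using assms by (intro sum.mono_neutral_right) auto

lemma shapes_mono: "l : shapes n ==> i <= j ==> l j <= l i"
 using lift_Suc_antimono_le[of l i j] by (simp add: shapes_def)

lemma finite_parts [simp]: "finite (parts n)"
proof -
 have "parts n \<subseteq> {xs. set xs \<subseteq> {..n} & length xs <= n}"
 proof
 fix p assume p: "p : parts n"
 have "set p \<subseteq> {..n}" using p member_le_sum_list[of _ p] by (auto simp: parts_def)
 moreover have "length p <= sum_list p" if "0 \<notin> set p" for p :: "nat list"
 using that by (induction p) auto
 ultimately show "p : {xs. set xs \<subseteq> {..n} & length xs <= n}"
 using p by (auto simp: parts_def is_partition_def)
 qed
 then show ?thesis by (rule finite_subset) (simp add: finite_lists_length_le)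
qed

lemma sh_shapes: "p : parts n ==> sh p : shapes n"
 using sh_partition_mono[of p]
 by (auto simp: parts_def shapes_def sh_def sum_list_sum_nth atLeast0LessThan intro!: exI[of _ "length p"])

lemma bij_sh: "bij_betw sh (parts n) (shapes n)"
 unfolding bij_betw_def
proof
 show "inj_on sh (parts n)" by (rule inj_onI) (auto simp: parts_def intro: shape_eqI)
 show "sh ` parts n = shapes n"
 proof
 show "sh ` parts n \<subseteq> shapes n" using sh_shapes by auto
 show "shapes n \<subseteq> sh ` parts n"
 proof
 fix l assume l: "l : shapes n"
 then obtain M where M: "\<forall>i\<ge>M. l i = 0" "(\<Sum>i<M. l i) = n" by (auto simp: shapes_def)
 define N where "N = (LEAST i. l i = 0)"
 have lN: "l N = 0" unfolding N_def by (rule LeastI[of _ M]) (use M in auto)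
 have pos: "l i ~= 0" if "i < N" for i using not_less_Least[of i "%i. l i = 0"] that by (auto simp: N_def)
 have zero: "l i = 0" if "N <= i" for i using shapes_mono[OF l that] lN by simp
 have "N <= M" unfolding N_def by (rule Least_le) (use M in auto)
 have sum: "(\<Sum>i<N. l i) = n" using sum_support_eq[of N l M] zero \<open>N <= M\<close> M(2) by simp
 define p where "p = map l [0..<N]"
 have "0 \<notin> set p"
 proof
 assume "0 : set p"
 then obtain i where "i < N" "l i = 0" by (auto simp: p_def)
 then show False using pos by blast
 qed
 then have "is_partition p"
 using shapes_mono[OF l] by (auto simp: is_partition_def p_def sorted_wrt_iff_nth_less)
 moreover have "sum_list p = n" using sum by (simp add: p_def sum_list_sum_nth atLeast0LessThan)
 moreover have "sh p = l" using zero by (auto simp: sh_def p_def fun_eq_iff)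
 ultimately show "l : sh ` parts n" by (auto simp: parts_def)
 qed
 qed
qed

lemma finite_shapes [simp]: "finite (shapes n)"
 using bij_betw_finite[OF bij_sh] by simp

section \<open>Adding and removing boxes\<close>

definition up :: "(nat => nat) => nat => (nat => nat)" where
 "up l i = l(i := Suc (l i))"

definition dn :: "(nat => nat) => nat => (nat => nat)" where
 "dn l i = l(i := l i - 1)"

definition Addb :: "(nat => nat) => nat set" where
 "Addb l = {i. i = 0 \<or> l i < l (i - 1)}"

definition Remb :: "(nat => nat) => nat set" where
 "Remb l = {i. l (Suc i) < l i}"

lemma finite_Remb: "l : shapes n ==> finite (Remb l)"
proof -
 assume "l : shapes n"
 then obtain N where N: "\<forall>i\<ge>N. l i = 0" by (auto simp: shapes_def)
 have "Remb l \<subseteq> {..<N}"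
 proof
 fix i assume "i : Remb l"
 then have "l i ~= 0" by (auto simp: Remb_def)
 then show "i : {..<N}" using N by (cases "i < N") auto
 qed
 then show ?thesis by (rule finite_subset) simp
qed

text \<open>A box fits below each removable row and, besides, only into the top row. This surplus of
  one is the whole content of the commutation rule.\<close>

lemma Addb_Remb: "Addb l = insert 0 (Suc ` Remb l)"
proof
 show "Addb l \<subseteq> insert 0 (Suc ` Remb l)"
 proof
 fix i assume "i : Addb l"
 then show "i : insert 0 (Suc ` Remb l)" by (cases i) (auto simp: Addb_def Remb_def)
 qed
qed (auto simp: Addb_def Remb_def)

lemma finite_Addb: "l : shapes n ==> finite (Addb l)"
 by (simp add: Addb_Remb finite_Remb)

lemma card_Addb: "l : shapes n ==> card (Addb l) = Suc (card (Remb l))"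
 by (simp add: Addb_Remb finite_Remb card_image)

lemma up_shapes: "l : shapes n ==> i : Addb l ==> up l i : shapes (Suc n)"
proof -
 assume l: "l : shapes n" and i: "i : Addb l"
 obtain N where N: "\<forall>i\<ge>N. l i = 0" "(\<Sum>i<N. l i) = n" using l by (auto simp: shapes_def)
 define M where "M = max N (Suc i)"
 have M: "(\<Sum>i<M. l i) = n" using sum_support_eq[OF N(1), of M] N(2) by (simp add: M_def)
 have "(\<Sum>j<M. h j) = h i + (\<Sum>j\<in>{..<M} - {i}. h j)" for h :: "nat => nat"
 by (rule sum.remove) (auto simp: M_def)
 note 1 = this[of l] this[of "up l i"]
 have "(\<Sum>j\<in>{..<M} - {i}. up l i j) = (\<Sum>j\<in>{..<M} - {i}. l j)" by (rule sum.cong) (auto simp: up_def)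
 then have "(\<Sum>j<M. up l i j) = Suc n" using 1 M by (simp add: up_def)
 moreover have "\<forall>j\<ge>M. up l i j = 0" using N(1) by (auto simp: M_def up_def)
 moreover have "up l i (Suc j) <= up l i j" for j
 using l i shapes_mono[OF l, of j "Suc j"] by (auto simp: up_def Addb_def)
 ultimately show ?thesis by (auto simp: shapes_def)
qed

lemma dn_shapes: "l : shapes (Suc n) ==> i : Remb l ==> dn l i : shapes n"
proof -
 assume l: "l : shapes (Suc n)" and i: "i : Remb l"
 obtain M where M: "\<forall>i\<ge>M. l i = 0" "(\<Sum>i<M. l i) = Suc n" using l by (auto simp: shapes_def)
 have pos: "0 < l i" using i by (auto simp: Remb_def)
 then have iM: "i < M" using M(1) by (cases "i < M") auto
 have "(\<Sum>j<M. h j) = h i + (\<Sum>j\<in>{..<M} - {i}. h j)" for h :: "nat => nat"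
 by (rule sum.remove) (use iM in auto)
 note 1 = this[of l] this[of "dn l i"]
 have "(\<Sum>j\<in>{..<M} - {i}. dn l i j) = (\<Sum>j\<in>{..<M} - {i}. l j)" by (rule sum.cong) (auto simp: dn_def)
 then have "(\<Sum>j<M. dn l i j) = n" using 1 M pos by (simp add: dn_def)
 moreover have "\<forall>j\<ge>M. dn l i j = 0" using M(1) by (auto simp: dn_def)
 moreover have "dn l i (Suc j) <= dn l i j" for j
 using l i shapes_mono[OF l, of j "Suc j"] by (auto simp: dn_def Remb_def)
 ultimately show ?thesis by (auto simp: shapes_def)
qed

lemma up_Remb: "l : shapes n ==> i : Remb (up l i)"
 using shapes_mono[of l n i "Suc i"] by (simp add: Remb_def up_def less_Suc_eq_le)

lemma dn_Addb: "l : shapes n ==> i : Remb l ==> i : Addb (dn l i)"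
 using shapes_mono[of l n "i - 1" i] by (cases i) (auto simp: Remb_def Addb_def dn_def)

lemma dn_up: "dn (up l i) i = l"
 by (auto simp: dn_def up_def)

lemma up_dn: "i : Remb l ==> up (dn l i) i = l"
 by (auto simp: dn_def up_def Remb_def)

lemma up_dn_commute: "i ~= j ==> dn (up l i) j = up (dn l j) i"
 by (auto simp: dn_def up_def fun_eq_iff)

text \<open>An addition and a removal in different rows do not obstruct each other: one order is
  possible exactly when the other is.\<close>

lemma up_dn_exchange:
 "l : shapes n ==> i ~= j ==> i : Addb l & j : Remb (up l i) \<longleftrightarrow> j : Remb l & i : Addb (dn l j)"
 by (cases i) (auto simp: Addb_def Remb_def up_def dn_def split: if_splits)

text \<open>The number of standard tableaux, sorted by the corner that holds the largest
  entry.\<close>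

fun fd :: "nat => (nat => nat) => nat" where
 "fd 0 l = 1"
| "fd (Suc n) l = (\<Sum>i\<in>Remb l. fd n (dn l i))"

lemma shapes_0: "shapes 0 = {%_. 0}"
proof -
 have "l = (%_. 0)" if l: "l : shapes 0" for l
 proof
 fix i
 obtain N where N: "\<forall>i\<ge>N. l i = 0" "(\<Sum>i<N. l i) = 0" using l by (auto simp: shapes_def)
 then show "l i = 0" by (cases "i < N") auto
 qed
 moreover have "(%_. 0) : shapes 0" by (auto simp: shapes_def)
 ultimately show ?thesis by blast
qed

text \<open>The commutation rule of the operators adding and removing a box gives the factor \<open>n + 1\<close>.\<close>

lemma sum_fd_up: "l : shapes n ==> (\<Sum>i\<in>Addb l. fd (Suc n) (up l i)) = Suc n * fd n l"
proof (induction n arbitrary: l)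
 case 0
 then have "l = (%_. 0)" by (simp add: shapes_0)
 then have "Addb l = {0}" "Remb (up l 0) = {0}" by (auto simp: Addb_def Remb_def up_def split: if_splits)
 then show ?case by simp
next
 case (Suc n)
 let ?P = "%i j. fd (Suc n) (dn (up l i) j)"
 have fA: "finite (Addb l)" and fR: "finite (Remb l)" using finite_Addb finite_Remb Suc.prems by auto
 have fRu: "finite (Remb (up l i))" if "i : Addb l" for i
 using finite_Remb[OF up_shapes[OF Suc.prems that]] .
 have fAd: "finite (Addb (dn l j))" if "j : Remb l" for j
 using finite_Addb[OF dn_shapes[OF Suc.prems that]] .
 have "(\<Sum>i\<in>Addb l. fd (Suc (Suc n)) (up l i)) = (\<Sum>i\<in>Addb l. \<Sum>j\<in>Remb (up l i). ?P i j)"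
 by simp
 \<comment> \<open>Removing the box just added gives \<open>l\<close> back, once for each addable
   row; all other removals are exchanged with the addition.\<close>
 also have "\<dots> = (\<Sum>i\<in>Addb l. fd (Suc n) l + (\<Sum>j\<in>Remb (up l i) - {i}. ?P i j))"
 by (rule sum.cong[OF refl], subst sum.remove[OF fRu up_Remb[OF Suc.prems]]) (simp_all add: dn_up del: fd.simps)
 also have "\<dots> = card (Addb l) * fd (Suc n) l + (\<Sum>i\<in>Addb l. \<Sum>j\<in>Remb (up l i) - {i}. ?P i j)"
 by (simp add: sum.distrib del: fd.simps)
 also have "(\<Sum>i\<in>Addb l. \<Sum>j\<in>Remb (up l i) - {i}. ?P i j) =
 (\<Sum>(i, j)\<in>Sigma (Addb l) (%i. Remb (up l i) - {i}). ?P i j)"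
 by (rule sum.Sigma) (use fA fRu in auto)
 also have "\<dots> = (\<Sum>(j, i)\<in>Sigma (Remb l) (%j. Addb (dn l j) - {j}). fd (Suc n) (up (dn l j) i))"
 proof -
 have e: "i : Addb l & j : Remb (up l i) - {i} \<longleftrightarrow> j : Remb l & i : Addb (dn l j) - {j}" for i j
 using up_dn_exchange[OF Suc.prems, of i j] by blast
 have c: "fd (Suc n) (up (dn l j) i) = fd (Suc n) (dn (up l i) j)" if "j : Remb (up l i) - {i}" for i j
 using that up_dn_commute[of i j l] by auto
 show ?thesis
 by (rule sum.reindex_bij_witness[where i="%(a, b). (b, a)" and j="%(a, b). (b, a)"];
 clarsimp simp del: fd.simps Diff_iff; use e c in blast)
 qed
 also have "\<dots> = (\<Sum>j\<in>Remb l. \<Sum>i\<in>Addb (dn l j) - {j}. fd (Suc n) (up (dn l j) i))"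
 by (rule sum.Sigma[symmetric]) (use fR fAd in auto)
 finally have eq: "(\<Sum>i\<in>Addb l. fd (Suc (Suc n)) (up l i)) = card (Addb l) * fd (Suc n) l
 + (\<Sum>j\<in>Remb l. \<Sum>i\<in>Addb (dn l j) - {j}. fd (Suc n) (up (dn l j) i))" .
 have inner: "fd (Suc n) l + (\<Sum>i\<in>Addb (dn l j) - {j}. fd (Suc n) (up (dn l j) i)) = Suc n * fd n (dn l j)"
 if j: "j : Remb l" for j
 using Suc.IH[OF dn_shapes[OF Suc.prems j]] sum.remove[OF fAd[OF j] dn_Addb[OF Suc.prems j], of "%i. fd (Suc n) (up (dn l j) i)"]
 by (simp add: up_dn[OF j] del: fd.simps)
 have "card (Remb l) * fd (Suc n) l + (\<Sum>j\<in>Remb l. \<Sum>i\<in>Addb (dn l j) - {j}. fd (Suc n) (up (dn l j) i)) =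
 (\<Sum>j\<in>Remb l. fd (Suc n) l + (\<Sum>i\<in>Addb (dn l j) - {j}. fd (Suc n) (up (dn l j) i)))"
 by (simp add: sum.distrib del: fd.simps)
 also have "\<dots> = (\<Sum>j\<in>Remb l. Suc n * fd n (dn l j))" by (rule sum.cong[OF refl inner])
 also have "\<dots> = Suc n * fd (Suc n) l" by (simp add: sum_distrib_left del: mult_Suc)
 finally show ?case unfolding eq card_Addb[OF Suc.prems] by (simp add: algebra_simps del: fd.simps)
qed

text \<open>A shape with a removable box is the same as a smaller shape with an addable one. Read in
  this way, one factor of the square is summed by \<open>sum_fd_up\<close>.\<close>

lemma sum_fd_square: "(\<Sum>l\<in>shapes n. fd n l * fd n l) = fact n"
proof (induction n)
 case 0
 then show ?case by (simp add: shapes_0)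
next
 case (Suc n)
 have "(\<Sum>l\<in>shapes (Suc n). fd (Suc n) l * fd (Suc n) l) =
 (\<Sum>l\<in>shapes (Suc n). \<Sum>j\<in>Remb l. fd (Suc n) l * fd n (dn l j))"
 by (rule sum.cong[OF refl]) (simp add: sum_distrib_left)
 also have "\<dots> = (\<Sum>(l, j)\<in>Sigma (shapes (Suc n)) Remb. fd (Suc n) l * fd n (dn l j))"
 by (rule sum.Sigma) (auto simp: finite_Remb)
 also have "\<dots> = (\<Sum>(k, i)\<in>Sigma (shapes n) Addb. fd (Suc n) (up k i) * fd n k)"
 by (rule sum.reindex_bij_witness[where j="%(l, j). (dn l j, j)" and i="%(k, i). (up k i, i)"])
 (auto simp: up_dn dn_up dn_shapes up_shapes up_Remb dn_Addb simp del: fd.simps)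
 also have "\<dots> = (\<Sum>k\<in>shapes n. \<Sum>i\<in>Addb k. fd (Suc n) (up k i) * fd n k)"
 by (rule sum.Sigma[symmetric]) (auto simp: finite_Addb)
 also have "\<dots> = (\<Sum>k\<in>shapes n. Suc n * (fd n k * fd n k))"
 by (rule sum.cong[OF refl]) (simp add: sum_distrib_right[symmetric] sum_fd_up mult.assoc del: fd.simps mult_Suc)
 also have "\<dots> = fact (Suc n)" by (simp add: sum_distrib_left[symmetric] Suc del: mult_Suc)
 finally show ?case .
qed

definition evs :: "nat => (nat => nat) set" where
 "evs r = {l : shapes (2 * r). \<forall>i. even (l i)}"

text \<open>The number of perfect matchings of \<open>2 * r\<close> points.\<close>

fun dfact :: "nat => nat" where
 "dfact 0 = 1"
| "dfact (Suc r) = (2 * r + 1) * dfact r"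

text \<open>Taking two boxes from one row matches even shapes with a removable row and smaller even
  shapes with an addable row. Both describe the same shape in between, and \<open>sum_fd_up\<close>
  contributes the factor \<open>2 * r + 1\<close>.\<close>

lemma sum_fd_even: "(\<Sum>l\<in>evs r. fd (2 * r) l) = dfact r"
proof (induction r)
 case 0
 have "evs 0 = {%_. 0}" by (auto simp: evs_def shapes_0)
 then show ?case by simp
next
 case (Suc r)
 let ?n = "2 * r"
 have fin: "finite (evs r)" for r by (simp add: evs_def)
 have sh: "k : shapes (2 * r)" if "k : evs r" for k r using that by (simp add: evs_def)
 have dd: "dn (dn l j) j : evs r" "j : Addb (dn (dn l j) j)" "up (dn (dn l j) j) j = dn l j" "up (dn l j) j = l"
 if l: "l : evs (Suc r)" and j: "j : Remb l" for l j
 proof -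
 have ls: "l : shapes (Suc (Suc ?n))" using sh[OF l] by simp
 have ev: "even (l i)" for i using l by (simp add: evs_def)
 have lt: "Suc (l (Suc j)) < l j" using j ev[of j] ev[of "Suc j"] by (auto simp: Remb_def elim!: evenE)
 then have j': "j : Remb (dn l j)" by (simp add: Remb_def dn_def)
 have "dn (dn l j) j : shapes ?n" using dn_shapes[OF dn_shapes[OF ls j] j'] .
 moreover have "even (dn (dn l j) j i)" for i
 using ev[of i] lt by (auto simp: dn_def)
 ultimately show "dn (dn l j) j : evs r" by (simp add: evs_def)
 show "j : Addb (dn (dn l j) j)" using dn_Addb[OF dn_shapes[OF ls j] j'] .
 show "up (dn (dn l j) j) j = dn l j" by (rule up_dn[OF j'])
 show "up (dn l j) j = l" by (rule up_dn[OF j])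
 qed
 have uu: "up (up k i) i : evs (Suc r)" "i : Remb (up (up k i) i)"
 if k: "k : evs r" and i: "i : Addb k" for k i
 proof -
 have ev: "even (k i)" for i using k by (simp add: evs_def)
 have us: "up k i : shapes (Suc ?n)" using up_shapes[OF sh[OF k] i] .
 have "i : Addb (up k i)"
 using i ev[of i] ev[of "i - 1"] by (cases i) (auto simp: Addb_def up_def elim!: evenE)
 then have "up (up k i) i : shapes (Suc (Suc ?n))" using up_shapes[OF us] by simp
 then show "up (up k i) i : evs (Suc r)" using ev by (auto simp: evs_def up_def)
 show "i : Remb (up (up k i) i)" by (rule up_Remb[OF us])
 qed
 have "(\<Sum>l\<in>evs (Suc r). fd (2 * Suc r) l) = (\<Sum>l\<in>evs (Suc r). \<Sum>j\<in>Remb l. fd (Suc ?n) (dn l j))"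
 by simp
 also have "\<dots> = (\<Sum>(l, j)\<in>Sigma (evs (Suc r)) Remb. fd (Suc ?n) (dn l j))"
 by (rule sum.Sigma) (use fin finite_Remb[OF sh] in auto)
 also have "\<dots> = (\<Sum>(k, i)\<in>Sigma (evs r) Addb. fd (Suc ?n) (up k i))"
 by (rule sum.reindex_bij_witness[where j="%(l, j). (dn (dn l j) j, j)" and i="%(k, i). (up (up k i) i, i)"])
 (auto simp: dd uu dn_up simp del: fd.simps)
 also have "\<dots> = (\<Sum>k\<in>evs r. \<Sum>i\<in>Addb k. fd (Suc ?n) (up k i))"
 by (rule sum.Sigma[symmetric]) (use fin finite_Addb[OF sh] in auto)
 also have "\<dots> = (\<Sum>k\<in>evs r. Suc ?n * fd ?n k)"
 by (rule sum.cong[OF refl]) (rule sum_fd_up[OF sh])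
 also have "\<dots> = dfact (Suc r)" using Suc by (simp add: sum_distrib_left[symmetric] del: mult_Suc)
 finally show ?case .
qed

text \<open>The default value 0 outside the diagram makes each tableau a single function.\<close>

definition ST :: "nat => (nat => nat) => (nat \<times> nat => nat) set" where
 "ST n l = {t. bij_betw t {(i, c). c < l i} {..<n} & (\<forall>i c. l i <= c --> t (i, c) = 0) &
 (\<forall>i c c'. c < c' & c' < l i --> t (i, c) < t (i, c')) &
 (\<forall>i j c. i < j & c < l j --> t (i, c) < t (j, c))}"

lemma cells_dn: "j : Remb l ==> {(i, c). c < dn l j i} = {(i, c). c < l i} - {(j, l j - 1)}"
 by (auto simp: dn_def Remb_def split: if_splits)

text \<open>The entry \<open>n\<close> is the largest, so erasing or restoring it at a corner
  disturbs no inequality.\<close>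

lemma ST_remove:
 assumes l: "l : shapes (Suc n)" and j: "j : Remb l"
 shows "bij_betw (%t. t((j, l j - 1) := 0)) {t : ST (Suc n) l. t (j, l j - 1) = n} (ST n (dn l j))"
proof (rule bij_betwI[where g="%t. t((j, l j - 1) := n)"])
 let ?x = "(j, l j - 1)"
 have pos: "0 < l j" and lt: "l (Suc j) < l j" using j by (auto simp: Remb_def)
 have below: "l i < l j" if "j < i" for i using shapes_mono[OF l, of "Suc j" i] lt that by simp
 have lu: "{..<Suc n} - {n} = {..<n}" by auto
 have xin: "?x : {(i, c). c < l i}" using pos by auto
 show "(%t. t(?x := 0)) : {t : ST (Suc n) l. t ?x = n} \<rightarrow> ST n (dn l j)"
 proof
 fix t assume t: "t : {t : ST (Suc n) l. t ?x = n}"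
 have "bij_betw t ({(i, c). c < l i} - {?x}) ({..<Suc n} - {n})"
 using t xin by (auto simp: ST_def bij_betw_def inj_on_def)
 then have "bij_betw t {(i, c). c < dn l j i} {..<n}" unfolding cells_dn[OF j] lu .
 then have "bij_betw (t(?x := 0)) {(i, c). c < dn l j i} {..<n}"
 by (rule bij_betw_cong[THEN iffD1, rotated]) (auto simp: cells_dn[OF j])
 then show "t(?x := 0) : ST n (dn l j)"
 using t by (auto simp: ST_def dn_def split: if_splits dest!: below)
 qed
 show "(%t. t(?x := n)) : ST n (dn l j) \<rightarrow> {t : ST (Suc n) l. t ?x = n}"
 proof
 fix t assume t: "t : ST n (dn l j)"
 have tb: "bij_betw t ({(i, c). c < l i} - {?x}) {..<n}" using t unfolding ST_def cells_dn[OF j] by blast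
 then have "bij_betw (t(?x := n)) ({(i, c). c < l i} - {?x}) {..<n}"
 by (rule bij_betw_cong[THEN iffD1, rotated]) auto
 then have "bij_betw (t(?x := n)) (({(i, c). c < l i} - {?x}) \<union> {?x}) ({..<n} \<union> {(t(?x := n)) ?x})"
 by (intro notIn_Un_bij_betw) auto
 moreover have "({(i, c). c < l i} - {?x}) \<union> {?x} = {(i, c). c < l i}" using xin by blast
 moreover have "{..<n} \<union> {(t(?x := n)) ?x} = {..<Suc n}" by auto
 ultimately have b: "bij_betw (t(?x := n)) {(i, c). c < l i} {..<Suc n}" by (simp only:)
 have tl: "t (i, c) < n" if "c < l i" "(i, c) ~= ?x" for i c
 using tb that by (auto simp: bij_betw_def)
 have r: "t (i, c) < t (i, c')" if "c < c'" "c' < l i" "(i, c') ~= ?x" for i c c'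
 proof -
 have "c' < dn l j i" using that by (auto simp: dn_def)
 then show ?thesis using t that(1) by (simp add: ST_def)
 qed
 have cc: "t (i, c) < t (i', c)" if "i < i'" "c < l i'" "(i', c) ~= ?x" for i i' c
 proof -
 have "c < dn l j i'" using that by (auto simp: dn_def)
 then show ?thesis using t that(1) by (simp add: ST_def)
 qed
 have z: "(t(?x := n)) (i, c) = 0" if "l i <= c" for i c
 proof -
 have "dn l j i <= c" "(i, c) ~= ?x" using that pos by (auto simp: dn_def)
 then show ?thesis using t by (auto simp: ST_def)
 qed
 have r': "(t(?x := n)) (i, c) < (t(?x := n)) (i, c')" if "c < c'" "c' < l i" for i c c'
 proof -
 have "(i, c) ~= ?x" using that by auto
 then show ?thesis using r[OF that] tl[of c i] that by (cases "(i, c') = ?x") auto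
 qed
 have c': "(t(?x := n)) (i, c) < (t(?x := n)) (i', c)" if "i < i'" "c < l i'" for i i' c
 proof -
 have "(i, c) ~= ?x" using that below[of i'] by auto
 moreover have "c < l i" using that shapes_mono[OF l, of i i'] by simp
 ultimately show ?thesis using cc[OF that] tl[of c i] by (cases "(i', c) = ?x") auto
 qed
 have "t(?x := n) : ST (Suc n) l"
 unfolding ST_def mem_Collect_eq
 by (intro conjI b allI impI; (rule z | rule r' | rule c'); simp)
 then show "t(?x := n) : {t : ST (Suc n) l. t ?x = n}" by simp
 qed
 show "(t(?x := 0))(?x := n) = t" if "t : {t : ST (Suc n) l. t ?x = n}" for t
 using that by auto
 show "(t(?x := n))(?x := 0) = t" if "t : ST n (dn l j)" for t
 proof -
 have "t ?x = 0" using that by (auto simp: ST_def dn_def)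
 then show ?thesis by auto
 qed
qed

lemma card_ST: "l : shapes n ==> finite (ST n l) & card (ST n l) = fd n l"
proof (induction n arbitrary: l)
 case 0
 then have "ST 0 l = {%_. 0}" by (auto simp: shapes_0 ST_def bij_betw_def)
 then show ?case by simp
next
 case (Suc n)
 let ?S = "%j. {t : ST (Suc n) l. t (j, l j - 1) = n}"
 have "ST (Suc n) l \<subseteq> (\<Union>j\<in>Remb l. ?S j)"
 proof
 fix t assume t: "t : ST (Suc n) l"
 then have "n : t ` {(i, c). c < l i}" by (auto simp: ST_def bij_betw_def)
 then obtain i c where ic: "c < l i" "t (i, c) = n" by auto
 have im: "t ` {(i, c). c < l i} = {..<Suc n}" using t by (simp add: ST_def bij_betw_def)
 have max: "t (i', c') <= n" if "c' < l i'" for i' c'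
 proof -
 have "t (i', c') : t ` {(i, c). c < l i}" using that by blast
 then show ?thesis unfolding im by simp
 qed
 have "c = l i - 1"
 proof (rule ccontr)
 assume "c ~= l i - 1"
 then have "Suc c < l i" using ic by simp
 then have "t (i, c) < t (i, Suc c)" using t by (simp add: ST_def)
 then show False using max[of "Suc c" i] ic \<open>Suc c < l i\<close> by simp
 qed
 moreover have "l (Suc i) <= c"
 proof (rule ccontr)
 assume "\<not> l (Suc i) <= c"
 then have "t (i, c) < t (Suc i, c)" using t by (simp add: ST_def)
 then show False using max[of c "Suc i"] ic \<open>\<not> l (Suc i) <= c\<close> by simp
 qed
 ultimately show "t : (\<Union>j\<in>Remb l. ?S j)" using t ic by (auto simp: Remb_def intro!: exI[of _ i])
 qed
 then have eq: "ST (Suc n) l = (\<Union>j\<in>Remb l. ?S j)" by auto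
 have b: "finite (?S j) & card (?S j) = fd n (dn l j)" if "j : Remb l" for j
 using Suc.IH[OF dn_shapes[OF Suc.prems that]] ST_remove[OF Suc.prems that]
 by (simp add: bij_betw_finite bij_betw_same_card)
 have disj: "?S j \<inter> ?S j' = {}" if "j : Remb l" "j' : Remb l" "j ~= j'" for j j'
 proof -
 have "(j, l j - 1) = (j', l j' - 1)" if "t : ?S j" "t : ?S j'" for t
 proof -
 have "inj_on t {(i, c). c < l i}" "t (j, l j - 1) = t (j', l j' - 1)" using that by (auto simp: ST_def bij_betw_def)
 moreover have "(j, l j - 1) : {(i, c). c < l i}" "(j', l j' - 1) : {(i, c). c < l i}"
 using \<open>j : Remb l\<close> \<open>j' : Remb l\<close> by (auto simp: Remb_def)
 ultimately show ?thesis by (metis inj_onD)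
 qed
 then show ?thesis using that(3) by blast
 qed
 have "card (ST (Suc n) l) = (\<Sum>j\<in>Remb l. card (?S j))"
 by (subst eq, rule card_UN_disjoint[OF finite_Remb[OF Suc.prems]]) (use b in blast, use disj in blast)
 also have "\<dots> = fd (Suc n) l" using b by simp
 finally have "card (ST (Suc n) l) = fd (Suc n) l" .
 moreover have "finite (ST (Suc n) l)" by (subst eq) (use b finite_Remb[OF Suc.prems] in simp)
 ultimately show ?case by blast
qed

text \<open>When each letter is used once, weak and strict increase coincide, and semistandard words
  become standard tableaux.\<close>

lemma card_SS_standard:
 assumes p: "is_partition p"
 shows "card (SS p (mset_set {..<sum_list p})) = fd (sum_list p) (sh p)"
proof -
 let ?d = "sum_list p"
 let ?C = "{(i, c). c < sh p i}"
 let ?num = "%(i, c). sum_list (take i p) + c"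
 have cellC: "tableau_cell p x : ?C" if "x < ?d" for x
 using cl_less_sh[OF that] by (simp add: case_prod_unfold)
 have numc: "?num (tableau_cell p x) = x" if "x < ?d" for x
 using tableau_cell_range[OF that] by (simp add: case_prod_unfold)
 have cnum: "tableau_cell p (?num x) = x" "?num x < ?d" if "x : ?C" for x
 using that tableau_cell_number[of "fst x" p "snd x"] by (auto simp: sh_def split: if_splits)
 have bt: "bij_betw (tableau_cell p) {..<?d} ?C"
 by (rule bij_betwI[where g="?num"]) (use cellC numc cnum in auto)
 have std: "content ?d w = mset_set {..<?d} \<longleftrightarrow> bij_betw (app w) {..<?d} {..<?d}" for w
 proof
 assume h: "content ?d w = mset_set {..<?d}"
 then have im: "app w ` {..<?d} = {..<?d}"
 using set_image_mset[of "app w" "mset_set {..<?d}"] unfolding h[unfolded content_def] by simp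
 then have "inj_on (app w) {..<?d}" by (intro eq_card_imp_inj_on) auto
 then show "bij_betw (app w) {..<?d} {..<?d}" using im by (simp add: bij_betw_def)
 next
 assume "bij_betw (app w) {..<?d} {..<?d}"
 then show "content ?d w = mset_set {..<?d}"
 unfolding content_def by (subst image_mset_mset_set) (auto simp: bij_betw_def)
 qed
 let ?f = "%w x. if x : ?C then app w (?num x) else 0"
 let ?g = "%t. Fn (%n. if n < ?d then t (tableau_cell p n) else n)"
 have "bij_betw ?f (SS p (mset_set {..<?d})) (ST ?d (sh p))"
 proof (rule bij_betwI[where g="?g"])
 show "?f : SS p (mset_set {..<?d}) \<rightarrow> ST ?d (sh p)"
 proof
 fix w assume w: "w : SS p (mset_set {..<?d})"
 have wb: "bij_betw (app w) {..<?d} {..<?d}" using w std by (simp add: SS_def Wm_def)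
 have s: "sstd p w" using w by (simp add: SS_def)
 have "bij_betw ?num ?C {..<?d}"
 by (rule bij_betwI[where g="tableau_cell p"]) (use cellC numc cnum in auto)
 from bij_betw_trans[OF this wb] have "bij_betw (?f w) ?C {..<?d}"
 by (rule bij_betw_cong[THEN iffD1, rotated]) auto
 moreover have "?f w (i, c) < ?f w (i, c')" if "c < c'" "c' < sh p i" for i c c'
 proof -
 have C: "(i, c) : ?C" "(i, c') : ?C" using that by auto
 note n = cnum[OF C(1)] cnum[OF C(2)]
 have "app w (?num (i, c)) <= app w (?num (i, c'))"
 using s n that unfolding sstd_def by auto
 moreover have "?num (i, c) ~= ?num (i, c')" using that by simp
 then have "app w (?num (i, c)) ~= app w (?num (i, c'))"
 using inj_on_eq_iff[of "app w" "{..<?d}" "?num (i, c)" "?num (i, c')"] wb n by (simp add: bij_betw_def)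
 ultimately show ?thesis using C by simp
 qed
 moreover have "?f w (i, c) < ?f w (j, c)" if "i < j" "c < sh p j" for i j c
 proof -
 have C: "(i, c) : ?C" "(j, c) : ?C" using that sh_partition_mono[OF p, of i j] by auto
 note n = cnum[OF C(1)] cnum[OF C(2)]
 have "app w (?num (i, c)) < app w (?num (j, c))"
 using s n that unfolding sstd_def by auto
 then show ?thesis using C by simp
 qed
 ultimately show "?f w : ST ?d (sh p)" unfolding ST_def by auto
 qed
 show "?g : ST ?d (sh p) \<rightarrow> SS p (mset_set {..<?d})"
 proof
 fix t assume t: "t : ST ?d (sh p)"
 have tb: "bij_betw t ?C {..<?d}" using t by (simp add: ST_def)
 have "bij_betw (app (?g t)) {..<?d} {..<?d}"
 using bij_betw_trans[OF bt tb] by (rule bij_betw_cong[THEN iffD1, rotated]) auto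
 then have "content ?d (?g t) = mset_set {..<?d}" using std by blast
 moreover have "sstd p (?g t)"
 unfolding sstd_def
 proof (intro allI impI conjI)
 fix x y assume xy: "x < ?d" "y < ?d"
 have tc: "tableau_cell p z = (rw p z, cl p z)" for z by simp
 show "app (?g t) x <= app (?g t) y" if "rw p x = rw p y & cl p x < cl p y"
 using t that cl_less_sh[OF xy(2)] xy tc[of x] tc[of y] unfolding ST_def
 by (simp del: prod.collapse) (metis less_imp_le)
 show "app (?g t) x < app (?g t) y" if "cl p x = cl p y & rw p x < rw p y"
 using t that cl_less_sh[OF xy(2)] xy tc[of x] tc[of y] unfolding ST_def
 by (simp del: prod.collapse) metis
 qed
 ultimately show "?g t : SS p (mset_set {..<?d})" by (simp add: SS_def Wm_def Wd_def)
 qed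
 show "?g (?f w) = w" if "w : SS p (mset_set {..<?d})" for w
 proof (rule fn_eqI)
 fix n show "app (?g (?f w)) n = app w n"
 using that cellC[of n] numc[of n] by (auto simp: SS_def Wm_def Wd_def)
 qed
 show "?f (?g t) = t" if "t : ST ?d (sh p)" for t
 proof
 fix x show "?f (?g t) x = t x"
 using that cnum[of x] by (cases x) (auto simp: ST_def)
 qed
 qed
 then have "card (SS p (mset_set {..<?d})) = card (ST ?d (sh p))" by (rule bij_betw_same_card)
 also have "\<dots> = fd ?d (sh p)" using card_ST[of "sh p" ?d] sh_shapes[of p ?d] p by (simp add: parts_def)
 finally show ?thesis .
qed

section \<open>Matrix units and multiplicities\<close>

text \<open>Elimination by induction: a vector that detects \<open>y a\<close> modulo the other
  \<open>y j\<close> is made orthogonal to these, and the earlier dual vectors are corrected by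
  it.\<close>

lemma dual_basis:
 fixes y :: "'i => ('k::field) fna"
 assumes fin: "finite I" and X: "fs.subspace X"
 and nd: "!!z. (\<Sum>i\<in>I. fscale (z i) (y i)) ~= 0 ==> \<exists>x\<in>X. tau (x * (\<Sum>i\<in>I. fscale (z i) (y i))) ~= 0"
 and ind: "lin_indep I y"
 shows "\<exists>x. (\<forall>i\<in>I. x i : X) & (\<forall>i\<in>I. \<forall>j\<in>I. tau (x i * y j) = (if i = j then 1 else 0))"
 using fin nd ind
proof (induction I)
 case empty
 then show ?case by simp
next
 case (insert a J)
 have ext: "(\<Sum>i\<in>insert a J. fscale ((z(a := c)) i) (y i)) = fscale c (y a) + (\<Sum>i\<in>J. fscale (z i) (y i))" for z c
 proof -
 have "(\<Sum>i\<in>J. fscale ((z(a := c)) i) (y i)) = (\<Sum>i\<in>J. fscale (z i) (y i))"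
 using insert.hyps by (intro sum.cong) auto
 then show ?thesis using insert.hyps by simp
 qed
 have "\<exists>x. (\<forall>i\<in>J. x i : X) & (\<forall>i\<in>J. \<forall>j\<in>J. tau (x i * y j) = (if i = j then 1 else 0))"
 proof (rule insert.IH)
 fix z assume "(\<Sum>i\<in>J. fscale (z i) (y i)) ~= 0"
 then show "\<exists>x\<in>X. tau (x * (\<Sum>i\<in>J. fscale (z i) (y i))) ~= 0"
 using insert.prems(1)[of "z(a := 0)"] unfolding ext by simp
 next
 show "lin_indep J y"
 unfolding lin_indep_def
 proof (intro allI impI ballI)
 fix z i assume h: "(\<Sum>i\<in>J. fscale (z i) (y i)) = 0" "i : J"
 have "(z(a := 0)) i = 0"
 by (rule lin_indepD[OF insert.prems(2)]) (use h in \<open>simp_all add: ext del: fun_upd_apply\<close>)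
 then show "z i = 0" using h insert.hyps by (cases "i = a") auto
 qed
 qed
 then obtain x where x: "!!i. i : J ==> x i : X" "!!i j. i : J ==> j : J ==> tau (x i * y j) = (if i = j then 1 else 0)"
 by blast
 \<comment> \<open>The coefficients make \<open>v\<close> orthogonal to all \<open>x j\<close>.
   Removing from \<open>x0\<close> its part along the \<open>x j\<close> then kills the pairings
   with \<open>y j\<close> and leaves \<open>tau (x0 * v)\<close> as the pairing with
   \<open>y a\<close>.\<close>
 define z where "z j = - tau (x j * y a)" for j
 define v where "v = fscale 1 (y a) + (\<Sum>i\<in>J. fscale (z i) (y i))"
 have "v ~= 0"
 proof
 assume "v = 0"
 then have "(z(a := 1)) a = 0"
 by (intro lin_indepD[OF insert.prems(2)]) (simp_all add: v_def ext del: fun_upd_apply)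
 then show False by simp
 qed
 then obtain x0 where x0: "x0 : X" "tau (x0 * v) ~= 0"
 using insert.prems(1)[of "z(a := 1)"] unfolding ext v_def by blast
 define x1 where "x1 = x0 - (\<Sum>j\<in>J. fscale (tau (x0 * y j)) (x j))"
 have x1X: "x1 : X" unfolding x1_def using x0 x X
 by (intro fs.subspace_diff fs.subspace_sum fs.subspace_scale) auto
 have x1J: "tau (x1 * y j) = 0" if "j : J" for j
 using that insert.hyps by (simp add: x1_def left_diff_distrib sum_distrib_right fscale_mult_left x(2) if_distrib cong: if_cong)
 have x1a: "tau (x1 * y a) = tau (x0 * v)"
 by (simp add: x1_def v_def z_def left_diff_distrib right_diff_distrib distrib_left sum_distrib_right sum_distrib_left fscale_mult_left fscale_mult_right sum_negf mult.commute)
 define xa where "xa = fscale (inverse (tau (x1 * y a))) x1"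
 have xa: "xa : X" "tau (xa * y a) = 1" "j : J ==> tau (xa * y j) = 0" for j
 using x1X X x0(2) x1J x1a by (auto simp: xa_def fscale_mult_left intro: fs.subspace_scale)
 define x' where "x' i = (if i = a then xa else x i - fscale (tau (x i * y a)) xa)" for i
 have "x' i : X" if "i : insert a J" for i
 using that xa x X by (auto simp: x'_def intro!: fs.subspace_diff fs.subspace_scale)
 moreover have "tau (x' i * y j) = (if i = j then 1 else 0)" if "i : insert a J" "j : insert a J" for i j
 using that xa x(2) insert.hyps by (auto simp: x'_def left_diff_distrib fscale_mult_left)
 ultimately show ?case by blast
qed

section \<open>Finite-dimensional subspaces\<close>

definition fin_dim :: "('a \<Rightarrow>\<^sub>0 'k::field) set => bool" where
 "fin_dim V \<longleftrightarrow> fs.subspace V & (\<exists>W. finite W & V \<subseteq> fs.span W)"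

lemma fin_dim_basis:
 assumes "fin_dim V"
 obtains y where "lin_indep {..<fs.dim V} y" "fs.span (y ` {..<fs.dim V}) = V"
 "!!i. i < fs.dim V ==> y i : V"
proof -
 obtain W where W: "finite W" "V \<subseteq> fs.span W" and sub: "fs.subspace V" using assms by (auto simp: fin_dim_def)
 obtain B where B: "B \<subseteq> V" "fs.independent B" "V \<subseteq> fs.span B" "card B = fs.dim V" by (rule fs.basis_exists)
 have finB: "finite B"
 using fs.independent_span_bound[OF W(1) B(2)] B(1) W(2) by auto
 then obtain y where y: "bij_betw y {..<fs.dim V} B"
 using ex_bij_betw_nat_finite[OF finB] B(4) by (auto simp: atLeast0LessThan)
 then have inj: "inj_on y {..<fs.dim V}" and im: "y ` {..<fs.dim V} = B" by (auto simp: bij_betw_def)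
 have "lin_indep {..<fs.dim V} y"
 unfolding lin_indep_def
 proof (intro allI impI ballI)
 fix z i assume h: "(\<Sum>i\<in>{..<fs.dim V}. fscale (z i) (y i)) = 0" "i : {..<fs.dim V}"
 let ?u = "%b. z (inv_into {..<fs.dim V} y b)"
 have "(\<Sum>b\<in>B. fscale (?u b) b) = (\<Sum>i\<in>{..<fs.dim V}. fscale (?u (y i)) (y i))"
 unfolding im[symmetric] by (rule sum.reindex_cong[OF inj]) auto
 also have "\<dots> = (\<Sum>i\<in>{..<fs.dim V}. fscale (z i) (y i))"
 by (rule sum.cong[OF refl]) (simp only: inv_into_f_f[OF inj])
 also have "\<dots> = 0" by (rule h(1))
 finally have 0: "(\<Sum>b\<in>B. fscale (?u b) b) = 0" .
 have "?u (y i) = 0"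
 by (rule fs.independentD[OF B(2) finB subset_refl 0]) (use im h(2) in blast)
 then show "z i = 0" using inj h(2) by (simp add: inv_into_f_f)
 qed
 moreover have "fs.span B = V" using B(1,3) fs.span_minimal[OF B(1) sub] by blast
 ultimately show ?thesis using B(1) im by (intro that[of y]) auto
qed

lemma fin_dim_image: "fin_dim V ==> klin F ==> fin_dim (F ` V)"
proof -
 assume V: "fin_dim V" and F: "klin F"
 obtain W where W: "finite W" "V \<subseteq> fs.span W" using V by (auto simp: fin_dim_def)
 have "F ` V \<subseteq> fs.span (F ` W)" using fs2.linear_span_image[OF F, of W] W(2) by auto
 moreover have "fs.subspace (F ` V)"
 using V fs2.linear_subspace_image[OF F] by (auto simp: fin_dim_def)
 ultimately show ?thesis using W(1) by (auto simp: fin_dim_def)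
qed

lemma fin_dim_supp_on: "finite S ==> fin_dim (supp_on S)"
 by (auto simp: fin_dim_def subspace_supp_on supp_on_span)

lemma lin_indep_card_le:
 assumes "finite I" "lin_indep I f" "fin_dim V" "!!i. i : I ==> f i : V"
 shows "card I <= fs.dim V"
proof -
 obtain y where y: "fs.span (y ` {..<fs.dim V}) = V" by (rule fin_dim_basis[OF assms(3)])
 have "fs.independent (f ` I)"
 proof
 assume "fs.dependent (f ` I)"
 then obtain u v where uv: "v : f ` I" "u v ~= 0" "(\<Sum>v\<in>f ` I. fscale (u v) v) = 0"
 using fs.dependent_finite[of "f ` I"] assms(1) by auto
 then have "(\<Sum>i\<in>I. fscale (u (f i)) (f i)) = 0"
 by (simp add: sum.reindex[OF lin_indep_inj[OF assms(1,2)]])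
 then have "u (f i) = 0" if "i : I" for i
 using lin_indepD[OF assms(2), of "%i. u (f i)"] that by blast
 then show False using uv by auto
 qed
 moreover have "f ` I \<subseteq> fs.span (y ` {..<fs.dim V})" unfolding y using assms(4) by blast
 ultimately have "card (f ` I) <= card (y ` {..<fs.dim V})"
 using fs.independent_span_bound[of "y ` {..<fs.dim V}" "f ` I"] by simp
 also have "\<dots> <= fs.dim V" using card_image_le[of "{..<fs.dim V}" y] by simp
 finally show ?thesis by (simp add: card_image[OF lin_indep_inj[OF assms(1,2)]])
qed

lemma lin_indep_spans:
 assumes "finite I" "lin_indep I f" "fin_dim V" "!!i. i : I ==> f i : V" "fs.dim V <= card I"
 shows "fs.span (f ` I) = V"
proof
 have sub: "fs.subspace V" using assms(3) by (simp add: fin_dim_def)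
 show "fs.span (f ` I) \<subseteq> V" by (rule fs.span_minimal[OF _ sub]) (use assms(4) in auto)
 show "V \<subseteq> fs.span (f ` I)"
 proof (rule ccontr)
 assume "\<not> V \<subseteq> fs.span (f ` I)"
 then obtain v where v: "v : V" "v \<notin> fs.span (f ` I)" by blast
 define g where "g o' = (case o' of None => v | Some i => f i)" for o'
 let ?J = "insert None (Some ` I)"
 have "lin_indep ?J g"
 unfolding lin_indep_def
 proof (intro allI impI)
 fix z assume "(\<Sum>o'\<in>?J. fscale (z o') (g o')) = 0"
 then have 0: "fscale (z None) v + (\<Sum>i\<in>I. fscale (z (Some i)) (f i)) = 0"
 using assms(1) by (simp add: sum.reindex g_def)
 have "z None = 0"
 proof (rule ccontr)
 assume nz: "z None ~= 0"
 have "fscale (z None) v = - (\<Sum>i\<in>I. fscale (z (Some i)) (f i))"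
 using 0 by (simp add: eq_neg_iff_add_eq_0)
 also have "\<dots> : fs.span (f ` I)" by (intro fs.span_neg fs.span_sum fs.span_scale fs.span_base) auto
 finally have "fscale (inverse (z None)) (fscale (z None) v) : fs.span (f ` I)" by (rule fs.span_scale)
 then show False using v nz by simp
 qed
 moreover have "z (Some i) = 0" if "i : I" for i
 using lin_indepD[OF assms(2), of "%i. z (Some i)"] 0 calculation that by simp
 ultimately show "\<forall>i\<in>?J. z i = 0" by auto
 qed
 moreover have "g i : V" if "i : ?J" for i using that v assms(4) by (auto simp: g_def)
 ultimately have "card ?J <= fs.dim V"
 using assms(1) by (intro lin_indep_card_le[OF _ _ assms(3)]) auto
 moreover have "card ?J = Suc (card I)" using assms(1) by (simp add: card_image)
 ultimately show False using assms(5) by simp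
 qed
qed

lemma fin_dim_An: "fin_dim (An d)"
 by (rule fin_dim_supp_on) simp

lemma klin_sandwich: "klin (%x. u * x * v)" for u v :: "('k::field) fna"
 by (rule klin_comp[OF klin_mult_right klin_mult_left])

text \<open>For \<open>ep\<close> idempotent up to a factor, the dimension of this corner is the
  multiplicity of the irreducible module of shape \<open>p\<close> in the left ideal generated by
  \<open>ep\<close>.\<close>

abbreviation cAe :: "nat => nat list => ('k::field) fna => 'k fna set" where
 "cAe d p ep \<equiv> (%a. cS p * a * ep) ` An d"

lemma fin_dim_cAe: "fin_dim (cAe d p ep)"
 by (rule fin_dim_image[OF fin_dim_An klin_sandwich])

lemma parts_iff: "p : parts d \<longleftrightarrow> is_partition p & sum_list p = d"
 by (simp add: parts_def)

lemma cS_parts: "p : parts d ==> cS p : An d"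
 by (metis cS_An parts_iff)

text \<open>
 As \<open>tau (cS p) = 1\<close>, a pairing of \<open>cS p * A\<close> with \<open>A * cS p\<close> that is dual with respect to
 \<open>tau\<close> is dual as a product with values in the multiples of \<open>cS p\<close>.
\<close>

lemma corner_value:
 fixes a b :: "('k::{field, field_char_0}) fna"
 assumes "p : parts d" "a : An d"
 shows "cS p * a * cS p = fscale (tau (cS p * a * cS p)) (cS p)"
proof -
 obtain ka where "cS p * a * cS p = fscale ka (cS p)"
 using cS_x_cS[of p a] assms by (auto simp: parts_iff)
 then show ?thesis by simp
qed

text \<open>Inserting \<open>cS p\<close> into \<open>tau (y * ?v)\<close> only multiplies it by
  \<open>n\<close>, so \<open>tau\<close> detects elements of the corner already by multiples of
  \<open>cS p\<close>; \<open>corner_value\<close> then turns duality for \<open>tau\<close> into an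
  identity of products. The trailing factor 1 is the unit of the algebra.\<close>

lemma dual_corner:
 fixes ep :: "('k::{field, field_char_0}) fna"
 assumes p: "p : parts d" and e: "ep : An d"
 and I: "finite I" "lin_indep I alp" "!!i. i : I ==> alp i : cAe d p ep"
 shows "\<exists>be. (\<forall>i\<in>I. be i : rmul (rmul (An d) (cS p)) 1) &
 (\<forall>i\<in>I. \<forall>j\<in>I. alp i * be j = (if i = j then cS p else 0))"
proof -
 have pp: "is_partition p" using p by (simp add: parts_iff)
 have cA: "(cS p :: 'k fna) : An d" using p by (rule cS_parts)
 obtain n :: 'k where n: "n ~= 0" "cS p * cS p = fscale n (cS p)" using cS_square[OF pp] by blast
 have al: "\<exists>a. a : An d & alp i = cS p * a" if "i : I" for i
 proof -
 obtain a where "a : An d" "alp i = cS p * a * ep" using I(3)[OF \<open>i : I\<close>] by blast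
 then show ?thesis using e by (intro exI[of _ "a * ep"]) (simp add: mult.assoc)
 qed
 have "\<exists>x. (\<forall>i\<in>I. x i : rmul (An d) (cS p)) & (\<forall>i\<in>I. \<forall>j\<in>I. tau (x i * alp j) = (if i = j then 1 else 0))"
 proof (rule dual_basis[OF I(1) _ _ I(2)])
 show "fs.subspace (rmul (An d) (cS p))"
 by (rule fs2.linear_subspace_image[OF klin_mult_right subspace_supp_on])
 fix z assume nz: "(\<Sum>i\<in>I. fscale (z i) (alp i)) ~= 0" (is "?v ~= 0")
 have "alp i : An d" if "i : I" for i using al[OF that] cA by auto
 then have vA: "?v : An d" by (intro supp_on_closed(4) supp_on_closed(3))
 have cv: "cS p * ?v = fscale n ?v"
 unfolding sum_distrib_left fs.scale_sum_right
 proof (rule sum.cong[OF refl])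
 fix i assume "i : I"
 then obtain a where "alp i = cS p * a" using al by blast
 then show "cS p * fscale (z i) (alp i) = fscale n (fscale (z i) (alp i))"
 by (simp add: fscale_mult_right mult.assoc[symmetric] n(2) fscale_mult_left mult.commute)
 qed
 obtain y where y: "y : An d" "tau (?v * y) ~= 0" using tau_nondegenerate[OF vA nz] by blast
 have "tau (y * cS p * ?v) = n * tau (y * ?v)" by (simp only: mult.assoc cv fscale_mult_right tau_linear)
 also have "tau (y * ?v) = tau (?v * y)" by (rule tau_commute[OF y(1) vA])
 finally have "tau (y * cS p * ?v) ~= 0" using n(1) y(2) by simp
 then show "\<exists>x\<in>rmul (An d) (cS p). tau (x * ?v) ~= 0" using y(1) by blast
 qed
 then obtain x where x: "!!i. i : I ==> x i : rmul (An d) (cS p)"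
 "!!i j. i : I ==> j : I ==> tau (x i * alp j) = (if i = j then 1 else 0)" by blast
 have "alp i * x j = (if i = j then cS p else 0)" if ij: "i : I" "j : I" for i j
 proof -
 obtain a where a: "a : An d" "alp i = cS p * a" using al ij by blast
 obtain b where b: "b : An d" "x j = b * cS p" using x(1)[OF ij(2)] by blast
 have eq: "alp i * x j = cS p * (a * b) * cS p" using a b by (simp add: mult.assoc)
 then have "alp i * x j = fscale (tau (alp i * x j)) (cS p)"
 using corner_value[OF p An_mult[OF a(1) b(1)]] by simp
 moreover have "tau (alp i * x j) = tau (x j * alp i)"
 using a b cA by (intro tau_commute[of _ d]) auto
 ultimately show ?thesis using x(2)[OF ij(2,1)] by auto
 qed
 then show ?thesis using x(1) by (intro exI[of _ x]) auto
qed

text \<open>Multiplying a relation on the right by \<open>be q l\<close> removes the other blocks by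
  orthogonality of the symmetrizers and the other columns by duality; a multiple of a relation among
  the \<open>t q j\<close> is left.\<close>

lemma units_lin_indep:
 fixes t alp be :: "nat list => nat => ('k::{field, field_char_0}) fna"
 assumes t: "!!p. p : parts d ==> lin_indep {..<J p} (t p)"
 and tc: "!!p j. p : parts d ==> j < J p ==> \<exists>x. t p j = x * cS p"
 and ab: "!!p k l. p : parts d ==> k < K p ==> l < K p ==> alp p k * be p l = (if k = l then cS p else 0)"
 and a: "!!p k. p : parts d ==> k < K p ==> \<exists>x\<in>An d. alp p k = cS p * x"
 and b: "!!p k. p : parts d ==> k < K p ==> \<exists>x\<in>An d. be p k = x * cS p"
 shows "lin_indep (SIGMA p:parts d. {..<J p} \<times> {..<K p}) (%(p, j, k). t p j * alp p k)"
 unfolding lin_indep_def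
proof (intro allI impI)
 fix z assume "(\<Sum>i\<in>(SIGMA p:parts d. {..<J p} \<times> {..<K p}). fscale (z i) (case i of (p, j, k) => t p j * alp p k)) = 0"
 then have 0: "(\<Sum>p\<in>parts d. \<Sum>(j, k)\<in>{..<J p} \<times> {..<K p}. fscale (z (p, j, k)) (t p j * alp p k)) = 0"
 by (simp add: sum.Sigma split_def)
 have "z (q, j, l) = 0" if q: "q : parts d" and j: "j < J q" and l: "l < K q" for q j l
 proof -
 obtain n :: 'k where n: "n ~= 0" "cS q * cS q = fscale n (cS q)"
 using cS_square[of q] q by (auto simp: parts_iff)
 have cross: "alp p k * be q l = (if p = q & k = l then cS q else 0)" if p: "p : parts d" and k: "k < K p" for p k
 proof (cases "p = q")
 case True
 then show ?thesis using ab q k l by simp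
 next
 case False
 obtain x where x: "x : An d" "alp p k = cS p * x" using a[OF p k] by blast
 obtain y where y: "y : An d" "be q l = y * cS q" using b[OF q l] by blast
 have "alp p k * be q l = cS p * (x * y) * cS q" using x y by (simp add: mult.assoc)
 then show ?thesis using cS_orthogonal[of p q d "x * y"] False p q x y by (simp add: parts_iff)
 qed
 have tq: "t q i * cS q = fscale n (t q i)" if i: "i < J q" for i
 proof -
 obtain x where "t q i = x * cS q" using tc[OF q i] by blast
 then show ?thesis using n(2) by (simp add: mult.assoc fscale_mult_right)
 qed
 have "0 = (\<Sum>p\<in>parts d. \<Sum>(j, k)\<in>{..<J p} \<times> {..<K p}. fscale (z (p, j, k)) (t p j * alp p k)) * be q l"
 unfolding 0 by simp
 also have "\<dots> = (\<Sum>p\<in>parts d. \<Sum>(j, k)\<in>{..<J p} \<times> {..<K p}. fscale (z (p, j, k)) (t p j * (alp p k * be q l)))"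
 by (simp add: sum_distrib_right fscale_mult_left mult.assoc split_def)
 also have "\<dots> = (\<Sum>p\<in>parts d. if p = q then (\<Sum>j<J q. fscale (n * z (q, j, l)) (t q j)) else 0)"
 proof (rule sum.cong[OF refl])
 fix p assume p: "p : parts d"
 show "(\<Sum>(j, k)\<in>{..<J p} \<times> {..<K p}. fscale (z (p, j, k)) (t p j * (alp p k * be q l))) =
 (if p = q then (\<Sum>j<J q. fscale (n * z (q, j, l)) (t q j)) else 0)"
 proof (cases "p = q")
 case False
 then show ?thesis using p cross by (auto intro!: sum.neutral)
 next
 case True
 have "(\<Sum>(j, k)\<in>{..<J q} \<times> {..<K q}. fscale (z (q, j, k)) (t q j * (alp q k * be q l))) =
 (\<Sum>j<J q. \<Sum>k<K q. fscale (z (q, j, k)) (t q j * (alp q k * be q l)))"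
 by (rule sum.cartesian_product[symmetric])
 also have "\<dots> = (\<Sum>j<J q. \<Sum>k<K q. if k = l then fscale (n * z (q, j, l)) (t q j) else 0)"
 using q by (intro sum.cong refl) (simp add: cross tq mult.commute)
 also have "\<dots> = (\<Sum>j<J q. fscale (n * z (q, j, l)) (t q j))"
 using l by simp
 finally show ?thesis using True by simp
 qed
 qed
 also have "\<dots> = (\<Sum>j<J q. fscale (n * z (q, j, l)) (t q j))" using q by simp
 finally have "n * z (q, j, l) = 0"
 using lin_indepD[OF t[OF q], of "%j. n * z (q, j, l)" j] j by simp
 then show ?thesis using n(1) by simp
 qed
 then show "\<forall>i\<in>(SIGMA p:parts d. {..<J p} \<times> {..<K p}). z i = 0" by auto
qed

text \<open>A permutation is a word that uses each letter once. The group algebra is thus itself a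
  weight space, and its left ideals inherit the semistandard basis.\<close>

lemma Pm_eq_Wm: "Pm d = Wm d (mset_set {..<d})"
proof
 show "Pm d \<subseteq> Wm d (mset_set {..<d})"
 using content_add[of _ d 0] by (auto simp: Wm_def Pm_Wd content_def)
 show "Wm d (mset_set {..<d}) \<subseteq> Pm d"
 proof
 fix w assume w: "w : Wm d (mset_set {..<d})"
 have im: "app w ` {..<d} = {..<d}"
 using w set_image_mset[of "app w" "mset_set {..<d}"] by (simp add: Wm_def content_def)
 then have "bij_betw (app w) {..<d} {..<d}"
 by (auto simp: bij_betw_def intro!: eq_card_imp_inj_on)
 then have "app w permutes {..<d}"
 by (rule bij_imp_permutes) (use w in \<open>auto simp: Wm_def Wd_def\<close>)
 then show "w : Pm d" by (simp add: Pm_def)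
 qed
qed

lemma dim_left_ideal:
 assumes "p : parts d"
 shows "fs.dim (rmul (An d) (cS p :: ('k::{field, field_char_0}) fna)) = fd d (sh p)"
 using dim_weight_space[of p "mset_set {..<d}", where 'k='k] card_SS_standard[of p] assms
 by (simp add: parts_iff Pm_eq_Wm)

lemma sum_fd_square_parts: "(\<Sum>p\<in>parts d. fd d (sh p) * fd d (sh p)) = fact d"
 using sum.reindex_bij_betw[OF bij_sh, of "%l. fd d l * fd d l" d] by (simp add: sum_fd_square)

lemma dim_An: "fs.dim (An d :: ('k::field) fna set) = fact d"
proof -
 have "lin_indep (Pm d) (%s. sg s :: 'k fna)"
 unfolding lin_indep_def
 proof (intro allI impI ballI)
 fix z :: "fn => 'k" and s
 assume h: "(\<Sum>s\<in>Pm d. fscale (z s) (sg s)) = 0" "s : Pm d"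
 have "lookup (\<Sum>s\<in>Pm d. fscale (z s) (sg s)) s = z s"
 using h(2) by (simp add: lookup_sum lookup_single when_def)
 then show "z s = 0" using h(1) by simp
 qed
 then have "fs.dim (fs.span ((%s. sg s :: 'k fna) ` Pm d)) = card (Pm d)"
 by (intro dim_lin_indep) simp_all
 then show ?thesis by (simp add: supp_on_span card_Pm)
qed

text \<open>Products of dual bases of \<open>A * cS p\<close> and \<open>cS p * A\<close> are
  independent like matrix units, and by \<open>sum_fd_square_parts\<close> there are as many of them
  as permutations; so they span the algebra and in particular its unit.\<close>

lemma completeness:
 "(1 :: ('k::{field, field_char_0}) fna) \<in>
 fs.span {a * cS p * b |p a b. p : parts d & a : An d & b : An d}" (is "_ : fs.span ?S")
proof -
 let ?f = "%p. fd d (sh p)"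
 have ex: "\<exists>y x. lin_indep {..<?f p} y & (\<forall>i<?f p. y i : rmul (An d) (cS p)) &
 (\<forall>i<?f p. x i : (%a. cS p * a) ` An d) &
 (\<forall>i<?f p. \<forall>j<?f p. x i * y j = (if i = j then cS p else (0 :: 'k fna)))" if p: "p : parts d" for p
 proof -
 have pp: "is_partition p" using p by (simp add: parts_iff)
 have cA: "(cS p :: 'k fna) : An d" using p by (rule cS_parts)
 obtain n :: 'k where n: "n ~= 0" "cS p * cS p = fscale n (cS p)" using cS_square[OF pp] by blast
 have fdL: "fin_dim (rmul (An d) (cS p :: 'k fna))" by (rule fin_dim_image[OF fin_dim_An klin_mult_right])
 obtain y :: "nat => 'k fna" where y: "lin_indep {..<?f p} y" "!!i. i < ?f p ==> y i : rmul (An d) (cS p)"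
 using fin_dim_basis[OF fdL] unfolding dim_left_ideal[OF p] by metis
 have "\<exists>x. (\<forall>i\<in>{..<?f p}. x i : (%a. cS p * a) ` An d) &
 (\<forall>i\<in>{..<?f p}. \<forall>j\<in>{..<?f p}. tau (x i * y j) = (if i = j then 1 else 0))"
 proof (rule dual_basis[OF _ _ _ y(1)])
 show "fs.subspace ((%a. cS p * a) ` An d)"
 by (rule fs2.linear_subspace_image[OF klin_mult_left subspace_supp_on])
 fix z assume nz: "(\<Sum>i\<in>{..<?f p}. fscale (z i) (y i)) ~= 0" (is "?v ~= 0")
 have yi: "y i : An d & y i * cS p = fscale n (y i)" if i: "i < ?f p" for i
 proof -
 obtain a where a: "a : An d" "y i = a * cS p" using y(2)[OF i] by blast
 then show ?thesis using cA n(2) by (simp add: mult.assoc fscale_mult_right)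
 qed
 have vA: "?v : An d" using yi by (intro supp_on_closed(4) supp_on_closed(3)) auto
 have vc: "?v * cS p = fscale n ?v"
 unfolding sum_distrib_right fs.scale_sum_right
 by (rule sum.cong[OF refl]) (use yi in \<open>simp add: fscale_mult_left mult.commute\<close>)
 obtain w where w: "w : An d" "tau (?v * w) ~= 0" using tau_nondegenerate[OF vA nz] by blast
 have "tau (cS p * w * ?v) = tau (w * ?v * cS p)"
 using cA w vA by (simp add: mult.assoc tau_commute[of "cS p" d])
 also have "\<dots> = n * tau (w * ?v)" by (simp only: mult.assoc vc fscale_mult_right tau_linear)
 also have "tau (w * ?v) = tau (?v * w)" by (rule tau_commute[OF w(1) vA])
 finally have "tau (cS p * w * ?v) ~= 0" using n(1) w(2) by simp
 then show "\<exists>x\<in>(%a. cS p * a) ` An d. tau (x * ?v) ~= 0" using w(1) by blast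
 qed simp
 then obtain x where x: "!!i. i < ?f p ==> x i : (%a. cS p * a) ` An d"
 "!!i j. i < ?f p ==> j < ?f p ==> tau (x i * y j) = (if i = j then 1 else 0)" by auto
 have "x i * y j = (if i = j then cS p else 0)" if ij: "i < ?f p" "j < ?f p" for i j
 proof -
 obtain a where a: "a : An d" "x i = cS p * a" using x(1)[OF ij(1)] by blast
 obtain b where b: "b : An d" "y j = b * cS p" using y(2)[OF ij(2)] by blast
 have "x i * y j = cS p * (a * b) * cS p" using a b by (simp add: mult.assoc)
 then have "x i * y j = fscale (tau (x i * y j)) (cS p)"
 using corner_value[OF p An_mult[OF a(1) b(1)]] by simp
 then show ?thesis using x(2)[OF ij] by auto
 qed
 then show ?thesis using x(1) y by blast
 qed
 define R where "R p yx \<longleftrightarrow> lin_indep {..<?f p} (fst yx) & (\<forall>i<?f p. fst yx i : rmul (An d) (cS p)) &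
 (\<forall>i<?f p. snd yx i : (%a. cS p * a) ` An d) &
 (\<forall>i<?f p. \<forall>j<?f p. snd yx i * fst yx j = (if i = j then cS p else (0 :: 'k fna)))"
 for p and yx :: "(nat => 'k fna) \<times> (nat => 'k fna)"
 have "\<forall>p\<in>parts d. \<exists>yx. R p yx"
 proof
 fix p assume "p : parts d"
 from ex[OF this] obtain y x where "R p (y, x)" unfolding R_def by auto
 then show "\<exists>yx. R p yx" by blast
 qed
 then obtain F where F: "!!p. p : parts d ==> R p (F p)" using bchoice[of "parts d" R] by blast
 define y where "y p = fst (F p)" for p
 define x where "x p = snd (F p)" for p
 have yx: "!!p. p : parts d ==> lin_indep {..<?f p} (y p)"
 "!!p i. p : parts d ==> i < ?f p ==> y p i : rmul (An d) (cS p)"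
 "!!p i. p : parts d ==> i < ?f p ==> x p i : (%a. cS p * a) ` An d"
 "!!p i j. p : parts d ==> i < ?f p ==> j < ?f p ==> x p i * y p j = (if i = j then cS p else (0 :: 'k fna))"
 using F unfolding R_def y_def x_def by blast+
 let ?I = "SIGMA p:parts d. {..<?f p} \<times> {..<?f p}"
 let ?g = "%(p, j, k). y p j * x p k"
 have ind: "lin_indep ?I ?g"
 by (rule units_lin_indep[where be=y]) (use yx in \<open>blast+\<close>)
 have fin: "finite ?I" by simp
 have mem: "?g i : fs.span ?S & ?g i : An d" if i: "i : ?I" for i
 proof -
 obtain p j k where ijk: "i = (p, j, k)" "p : parts d" "j < ?f p" "k < ?f p" using i by auto
 obtain a where a: "a : An d" "x p k = cS p * a" using yx(3)[OF ijk(2,4)] by blast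
 obtain b where b: "b : An d" "y p j = b * cS p" using yx(2)[OF ijk(2,3)] by blast
 have cA: "(cS p :: 'k fna) : An d" using ijk(2) by (rule cS_parts)
 have "?g i = b * cS p * (cS p * a)" using ijk a b by simp
 then show ?thesis using a b cA ijk(2) by (auto intro!: fs.span_base An_mult)
 qed
 have "card ?I = (\<Sum>p\<in>parts d. ?f p * ?f p)" by (simp add: card_cartesian_product)
 then have "fs.span (?g ` ?I) = An d"
 using mem by (intro lin_indep_spans[OF fin ind fin_dim_An]) (auto simp: dim_An sum_fd_square_parts)
 then have "1 : fs.span (?g ` ?I)" by simp
 also have "\<dots> \<subseteq> fs.span ?S" by (rule fs.span_minimal[OF _ fs.subspace_span]) (use mem in blast)
 finally show ?thesis .
qed

lemma span_mult:
 fixes u v :: "'a::monoid_add \<Rightarrow>\<^sub>0 'k::field"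
 assumes "u : fs.span U" "v : fs.span V" "!!a b. a : U ==> b : V ==> a * b : Z" "fs.subspace Z"
 shows "u * v : Z"
proof -
 have 1: "a * v : Z" if a: "a : U" for a
 proof -
 have "fs.subspace {v. a * v : Z}"
 using assms(4) by (auto simp: fs.subspace_def distrib_left fscale_mult_right)
 then have "fs.span V \<subseteq> {v. a * v : Z}" by (intro fs.span_minimal) (use assms(3) a in auto)
 then show ?thesis using assms(2) by blast
 qed
 have "fs.subspace {u. u * v : Z}"
 using assms(4) by (auto simp: fs.subspace_def distrib_right fscale_mult_left)
 then have "fs.span U \<subseteq> {u. u * v : Z}" by (intro fs.span_minimal) (use 1 in auto)
 then show ?thesis using assms(1) by blast
qed

text \<open>Resolving the unit between \<open>x\<close> and \<open>ep\<close> expresses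
  \<open>X * ep\<close> through products of \<open>X * cS p\<close> with the corners, and products
  of bases are independent. Each irreducible contributes its multiplicity in the ideal of
  \<open>ep\<close> times the dimension of its part of \<open>X\<close>.\<close>

lemma dim_formula:
 fixes ep :: "('k::{field, field_char_0}) fna"
 assumes e: "ep : An d" and X: "fin_dim X" and XA: "!!x a. x : X ==> a : An d ==> x * a : X"
 shows "fs.dim (rmul X ep) = (\<Sum>p\<in>parts d. fs.dim (cAe d p ep) * fs.dim (rmul X (cS p)))"
proof -
 let ?J = "%p. fs.dim (rmul X (cS p))" and ?K = "%p. fs.dim (cAe d p ep)"
 have sX: "fs.subspace X" using X by (simp add: fin_dim_def)
 have ex1: "\<exists>t. lin_indep {..<?J p} t & fs.span (t ` {..<?J p}) = rmul X (cS p)" for p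
 by (rule fin_dim_basis[OF fin_dim_image[OF X klin_mult_right]]) blast
 define t where "t p = (SOME t. lin_indep {..<?J p} t & fs.span (t ` {..<?J p}) = rmul X (cS p))" for p
 have t: "lin_indep {..<?J p} (t p)" "fs.span (t p ` {..<?J p}) = rmul X (cS p)" for p
 using someI_ex[OF ex1[of p], folded t_def] by auto
 have ex2: "\<exists>a. lin_indep {..<?K p} a & fs.span (a ` {..<?K p}) = cAe d p ep" for p
 by (rule fin_dim_basis[OF fin_dim_cAe]) blast
 define alp where "alp p = (SOME a. lin_indep {..<?K p} a & fs.span (a ` {..<?K p}) = cAe d p ep)" for p
 have alp: "lin_indep {..<?K p} (alp p)" "fs.span (alp p ` {..<?K p}) = cAe d p ep" for p
 using someI_ex[OF ex2[of p], folded alp_def] by auto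
 have tm: "t p j : rmul X (cS p)" if "j < ?J p" for p j
 proof -
 have "t p j : fs.span (t p ` {..<?J p})" by (rule fs.span_base) (use that in blast)
 then show ?thesis by (simp only: t(2))
 qed
 have am: "alp p k : cAe d p ep" if "k < ?K p" for p k
 proof -
 have "alp p k : fs.span (alp p ` {..<?K p})" by (rule fs.span_base) (use that in blast)
 then show ?thesis by (simp only: alp(2))
 qed
 let ?B = "%p be. (\<forall>i\<in>{..<?K p}. be i : rmul (rmul (An d) (cS p)) 1) &
 (\<forall>i\<in>{..<?K p}. \<forall>j\<in>{..<?K p}. alp p i * be j = (if i = j then cS p else 0))"
 have ex3: "\<exists>be. ?B p be" if "p : parts d" for p
 using that by (intro dual_corner[OF _ e _ alp(1)]) (use am in auto)
 define be where "be p = (SOME be. ?B p be)" for p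
 have b: "?B p (be p)" if "p : parts d" for p
 unfolding be_def by (rule someI_ex[OF ex3[OF that]])
 have be: "be p i : rmul (rmul (An d) (cS p)) 1" if "p : parts d" "i < ?K p" for p i
 using b[OF that(1)] that(2) by blast
 have be2: "alp p i * be p j = (if i = j then cS p else 0)" if "p : parts d" "i < ?K p" "j < ?K p" for p i j
 using b[OF that(1)] that(2,3) by blast
 let ?I = "SIGMA p:parts d. {..<?J p} \<times> {..<?K p}"
 let ?g = "%(p, j, k). t p j * alp p k"
 have ind: "lin_indep ?I ?g"
 proof (rule units_lin_indep[where be=be])
 fix p j assume "p : parts d" "j < ?J p"
 then show "\<exists>x. t p j = x * cS p" using tm by blast
 next
 fix p k assume h: "p : parts d" "k < ?K p"
 obtain a where "a : An d" "alp p k = cS p * a * ep" using am[OF h(2)] by blast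
 then show "\<exists>x\<in>An d. alp p k = cS p * x" using e by (intro bexI[of _ "a * ep"]) (auto simp: mult.assoc)
 show "\<exists>x\<in>An d. be p k = x * cS p" using be[OF h] by auto
 qed (use t be2 in auto)
 have gm: "?g i : rmul X ep" if i: "i : ?I" for i
 proof -
 obtain p j k where ijk: "i = (p, j, k)" "p : parts d" "j < ?J p" "k < ?K p" using i by auto
 obtain x where x: "x : X" "t p j = x * cS p" using tm[OF ijk(3)] by blast
 obtain a where a: "a : An d" "alp p k = cS p * a * ep" using am[OF ijk(4)] by blast
 have "?g i = (x * (cS p * (cS p * a))) * ep" using ijk x a by (simp add: mult.assoc)
 then show ?thesis using x a cS_parts[OF ijk(2)] by (auto intro!: XA An_mult)
 qed
 have sub: "fs.subspace (rmul X ep)" by (rule fs2.linear_subspace_image[OF klin_mult_right sX])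
 have "rmul X ep \<subseteq> fs.span (?g ` ?I)"
 proof
 fix y assume "y : rmul X ep"
 then obtain x where x: "x : X" "y = x * ep" by blast
 \<comment> \<open>The factor 1 is there to be replaced by its expansion through the
   symmetrizers.\<close>
 have "x * 1 : {v. v * ep : fs.span (?g ` ?I)}"
 proof (rule span_mult[OF fs.span_base[of x "{x}"] completeness[of d]])
 show "fs.subspace {v. v * ep : fs.span (?g ` ?I)}"
 by (auto simp: fs.subspace_def distrib_right fscale_mult_left fs.span_add fs.span_scale fs.span_zero)
 fix x' w :: "'k fna" assume "x' : {x}" "w : {a * cS p * b |p a b. p : parts d & a : An d & b : An d}"
 then obtain p a b where w: "x' = x" "w = a * cS p * b" "p : parts d" "a : An d" "b : An d" by blast
 obtain n :: 'k where n: "n ~= 0" "cS p * cS p = fscale n (cS p)"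
 using cS_square[of p] w(3) by (auto simp: parts_iff)
 have "(x * a * cS p) * (cS p * b * ep) : fs.span (?g ` ?I)"
 proof (rule span_mult[OF _ _ _ fs.subspace_span])
 show "x * a * cS p : fs.span (t p ` {..<?J p})" unfolding t(2) using x w XA by blast
 show "cS p * b * ep : fs.span (alp p ` {..<?K p})" unfolding alp(2) using w by blast
 fix u v assume "u : t p ` {..<?J p}" "v : alp p ` {..<?K p}"
 then obtain j k where "u = t p j" "v = alp p k" "j < ?J p" "k < ?K p" by blast
 then show "u * v : fs.span (?g ` ?I)" using w(3) by (intro fs.span_base image_eqI[of _ _ "(p, j, k)"]) auto
 qed
 moreover have "(x * a * cS p) * (cS p * b * ep) = x * a * (cS p * cS p) * b * ep" by (simp add: mult.assoc)
 ultimately have "fscale n (x' * w * ep) : fs.span (?g ` ?I)"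
 by (simp add: n(2) w(1,2) fscale_mult_left fscale_mult_right mult.assoc)
 then have "fscale (inverse n) (fscale n (x' * w * ep)) : fs.span (?g ` ?I)" by (rule fs.span_scale)
 then show "x' * w : {v. v * ep : fs.span (?g ` ?I)}" using n(1) by simp
 qed simp
 then show "y : fs.span (?g ` ?I)" using x(2) by simp
 qed
 then have "rmul X ep = fs.span (?g ` ?I)"
 using fs.span_minimal[OF _ sub, of "?g ` ?I"] gm by blast
 then have "fs.dim (rmul X ep) = card ?I" using dim_lin_indep[OF _ ind] by simp
 also have "\<dots> = (\<Sum>p\<in>parts d. ?J p * ?K p)" by (simp add: card_cartesian_product)
 finally show ?thesis by (simp add: mult.commute)
qed

section \<open>Littlewood--Richardson coefficients as multiplicities\<close>

definition bil :: "('a => 'b => 'c) => ('a \<Rightarrow>\<^sub>0 'k::field) => ('b \<Rightarrow>\<^sub>0 'k) => ('c \<Rightarrow>\<^sub>0 'k)" where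
 "bil m x y = lin_ext (%a. lin_ext (%b. single (m a b) 1) y) x"

lemma klin_bil_left: "klin (%x. bil m x y)"
 unfolding bil_def by (rule klin_lin_ext)

lemma klin_bil_right: "klin (%y. bil m x y)"
 unfolding bil_def lin_ext_def[of _ x]
 by (intro klin_sum klin_scale klin_lin_ext)

lemma bil_single [simp]: "bil m (single a c) (single b c') = single (m a b) (c * c')"
 by (simp add: bil_def)

text \<open>An interchange law between basis elements passes to the bilinear extensions, one
  argument at a time.\<close>

lemma bil_mult:
 fixes x y a b :: "('k::field) fna" and m1 m2 m3 :: "fn => fn => fn"
 assumes "!!u v s t. u : keys x ==> v : keys y ==> s : keys a ==>
 t : keys b ==> m1 u v + m2 s t = m3 (u + s) (v + t)"
 shows "bil m1 x y * bil m2 a b = bil m3 (x * a) (y * b)"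
proof (rule klin_eqI[of "%x. bil m1 x y * bil m2 a b" "%x. bil m3 (x * a) (y * b)"])
 show "klin (%x. bil m1 x y * bil m2 a b)" by (rule klin_comp[OF klin_mult_right klin_bil_left])
 show "klin (%x. bil m3 (x * a) (y * b))" by (rule klin_comp[OF klin_bil_left klin_mult_right])
 fix u assume u: "u : keys x"
 show "bil m1 (sg u) y * bil m2 a b = bil m3 (sg u * a) (y * b)"
 proof (rule klin_eqI[of "%y. bil m1 (sg u) y * bil m2 a b" "%y. bil m3 (sg u * a) (y * b)"])
 show "klin (%y. bil m1 (sg u) y * bil m2 a b)" by (rule klin_comp[OF klin_mult_right klin_bil_right])
 show "klin (%y. bil m3 (sg u * a) (y * b))" by (rule klin_comp[OF klin_bil_right klin_mult_right])
 fix v assume v: "v : keys y"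
 show "bil m1 (sg u) (sg v) * bil m2 a b = bil m3 (sg u * a) (sg v * b)"
 proof (rule klin_eqI[of "%a. bil m1 (sg u) (sg v) * bil m2 a b" "%a. bil m3 (sg u * a) (sg v * b)"])
 show "klin (%a. bil m1 (sg u) (sg v) * bil m2 a b)" by (rule klin_comp[OF klin_mult_left klin_bil_left])
 show "klin (%a. bil m3 (sg u * a) (sg v * b))" by (rule klin_comp[OF klin_bil_left klin_mult_left])
 fix s assume s: "s : keys a"
 show "bil m1 (sg u) (sg v) * bil m2 (sg s) b = bil m3 (sg u * sg s) (sg v * b)"
 proof (rule klin_eqI[of "%b. bil m1 (sg u) (sg v) * bil m2 (sg s) b" "%b. bil m3 (sg u * sg s) (sg v * b)"])
 show "klin (%b. bil m1 (sg u) (sg v) * bil m2 (sg s) b)" by (rule klin_comp[OF klin_mult_left klin_bil_right])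
 show "klin (%b. bil m3 (sg u * sg s) (sg v * b))" by (rule klin_comp[OF klin_bil_right klin_mult_left])
 fix t assume t: "t : keys b"
 show "bil m1 (sg u) (sg v) * bil m2 (sg s) (sg t) = bil m3 (sg u * sg s) (sg v * sg t :: 'k fna)"
 by (simp add: mult_single assms[OF u v s t])
 qed
 qed
 qed
qed

lemma bil_sum:
 "bil m x y = (\<Sum>a\<in>keys x. \<Sum>b\<in>keys y. single (m a b) (lookup x a * lookup y b))"
 by (simp add: bil_def lin_ext_def fs.scale_sum_right)

lemma lookup_bil:
 assumes "!!a b. a : keys x ==> b : keys y ==> m a b = m u v \<longleftrightarrow> a = u & b = v"
 shows "lookup (bil m x y) (m u v) = lookup x u * lookup y v"
proof -
 have "lookup (bil m x y) (m u v) =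
 (\<Sum>a\<in>keys x. \<Sum>b\<in>keys y. if b = v then if a = u then lookup x a * lookup y b else 0 else 0)"
 unfolding bil_sum lookup_sum
 by (intro sum.cong refl) (simp add: lookup_single when_def assms)
 also have "\<dots> = (\<Sum>a\<in>keys x. if a = u then lookup x a * lookup y v else 0)"
 by (intro sum.cong refl) (simp add: in_keys_iff)
 also have "\<dots> = lookup x u * lookup y v" by (simp add: in_keys_iff)
 finally show ?thesis .
qed

lemma bil_supp_on:
 assumes "x : supp_on S" "y : supp_on S'" "!!a b. a : S ==> b : S' ==> m a b : U"
 shows "bil m x y : supp_on U"
 unfolding bil_sum using assms by (intro supp_on_closed(4) single_supp_on) (auto dest: supp_onD)

definition catw :: "nat => nat => fn => fn => fn" where
 "catw e f u v = Fn (%j. if j < e then app u j else if j < e + f then app v (j - e) else j)"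

text \<open>The length of the second block is not a parameter: \<open>t\<close> fixes all positions
  past its own length.\<close>

definition bxw :: "nat => fn => fn => fn" where
 "bxw e s t = Fn (%j. if j < e then app s j else e + app t (j - e))"

lemma catw_bxw:
 assumes "s : Pm e" "t : Pm f"
 shows "catw e f u v + bxw e s t = catw e f (u + s) (v + t)"
proof (rule fn_eqI)
 fix j
 have "app t (j - e) = j - e" if "\<not> j < e + f"
 using permutes_not_in[OF Pm_app[OF assms(2)], of "j - e"] that by simp
 then show "app (catw e f u v + bxw e s t) j = app (catw e f (u + s) (v + t)) j"
 using Pm_less[OF assms(1), of j] Pm_less[OF assms(2), of "j - e"]
 by (auto simp: catw_def bxw_def)
qed

lemma bxw_bxw: "s' : Pm e ==> bxw e s t + bxw e s' t' = bxw e (s + s') (t + t')"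
 by (rule fn_eqI) (auto simp: bxw_def dest: Pm_less)

lemma bxw_0 [simp]: "bxw e 0 0 = 0"
 by (rule fn_eqI) (auto simp: bxw_def)

lemma bxw_Pm:
 assumes "s : Pm e" "t : Pm f"
 shows "bxw e s t : Pm (e + f)"
proof -
 have inv: "bxw e s' t' + bxw e s t = 0" "bxw e s t + bxw e s' t' = 0" if "s' = pinv s" "t' = pinv t" for s' t'
 using that assms bxw_bxw[OF assms(1)] bxw_bxw[OF Pm_pinv[OF assms(1)]]
 by (simp_all add: pinv_left[OF assms(1)] pinv_left[OF assms(2)] pinv_right[OF assms(1)] pinv_right[OF assms(2)])
 have i: "app (bxw e (pinv s) (pinv t)) (app (bxw e s t) j) = j" "app (bxw e s t) (app (bxw e (pinv s) (pinv t)) j) = j" for j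
 using arg_cong[OF inv(1)[OF refl refl], of "%w. app w j"] arg_cong[OF inv(2)[OF refl refl], of "%w. app w j"] by simp_all
 have l: "app (bxw e s t) j < e + f" if "s : Pm e" "t : Pm f" "j < e + f" for s t j
 using Pm_less[OF that(1), of j] Pm_less[OF that(2), of "j - e"] that(3) by (auto simp: bxw_def)
 have "bij_betw (app (bxw e s t)) {..<e + f} {..<e + f}"
 by (rule bij_betw_byWitness[where f'="app (bxw e (pinv s) (pinv t))"])
 (use i l[OF assms] l[OF Pm_pinv[OF assms(1)] Pm_pinv[OF assms(2)]] in auto)
 moreover have "app (bxw e s t) j = j" if "j \<notin> {..<e + f}" for j
 using permutes_not_in[OF Pm_app[OF assms(2)], of "j - e"] that by (simp add: bxw_def)
 ultimately have "app (bxw e s t) permutes {..<e + f}" by (rule bij_imp_permutes)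
 then show ?thesis by (simp add: Pm_def)
qed

abbreviation Bx :: "nat => ('k::field) fna => 'k fna => 'k fna" where
 "Bx e \<equiv> bil (bxw e)"

abbreviation Cat :: "nat => nat => ('k::field) fna => 'k fna => 'k fna" where
 "Cat e f \<equiv> bil (catw e f)"

lemma Cat_Bx: "a : An e ==> b : An f ==> Cat e f x y * Bx e a b = Cat e f (x * a) (y * b)"
 by (rule bil_mult) (simp add: catw_bxw supp_onD)

lemma Bx_Bx: "a' : An e ==> Bx e a b * Bx e a' b' = Bx e (a * a') (b * b')"
 by (rule bil_mult) (simp add: bxw_bxw supp_onD)

lemma Bx_An: "a : An e ==> b : An f ==> Bx e a b : An (e + f)"
 by (rule bil_supp_on) (auto simp: bxw_Pm)

lemma catw_inj:
 assumes "a : Wd e" "u : Wd e" "b : Wd f" "v : Wd f"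
 shows "catw e f a b = catw e f u v \<longleftrightarrow> a = u & b = v"
proof
 assume h: "catw e f a b = catw e f u v"
 have *: "app (catw e f a b) j = app (catw e f u v) j" for j using h by simp
 have "app a j = app u j" for j using *[of j] assms(1,2) by (cases "j < e") (auto simp: catw_def Wd_def)
 moreover have "app b j = app v j" for j using *[of "e + j"] assms(3,4) by (cases "j < f") (auto simp: catw_def Wd_def)
 ultimately show "a = u & b = v" by (auto intro: fn_eqI)
qed simp

lemma lookup_Cat:
 assumes "x : Tn e" "y : Tn f" "u : Wd e" "v : Wd f"
 shows "lookup (Cat e f x y) (catw e f u v) = lookup x u * lookup y v"
 by (rule lookup_bil, rule catw_inj) (use assms in \<open>auto dest: supp_onD\<close>)

lemma content_catw: "content (e + f) (catw e f u v) = content e u + content f v"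
proof -
 have "{..<e + f} = {..<e} \<union> (%j. e + j) ` {..<f}"
 proof
 show "{..<e + f} \<subseteq> {..<e} \<union> (%j. e + j) ` {..<f}"
 proof
 fix x assume "x : {..<e + f}"
 then show "x : {..<e} \<union> (%j. e + j) ` {..<f}"
 by (cases "x < e") (auto intro!: image_eqI[of x _ "x - e"])
 qed
 qed auto
 then have "mset_set {..<e + f} = mset_set {..<e} + mset_set ((%j. e + j) ` {..<f})"
 by (simp only:) (rule mset_set_Union, auto)
 also have "mset_set ((%j. e + j) ` {..<f}) = image_mset (%j. e + j) (mset_set {..<f})"
 by (rule image_mset_mset_set[symmetric]) simp
 finally have "content (e + f) (catw e f u v) = image_mset (app (catw e f u v)) (mset_set {..<e}) +
 image_mset (%j. app (catw e f u v) (e + j)) (mset_set {..<f})"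
 by (simp add: content_def image_mset.compositionality comp_def)
 also have "image_mset (app (catw e f u v)) (mset_set {..<e}) = content e u"
 unfolding content_def by (rule image_mset_cong) (simp add: catw_def)
 also have "image_mset (%j. app (catw e f u v) (e + j)) (mset_set {..<f}) = content f v"
 unfolding content_def by (rule image_mset_cong) (simp add: catw_def)
 finally show ?thesis .
qed

lemma catw_Wd [simp]: "catw e f u v : Wd (e + f)"
 by (simp add: Wd_def catw_def)

lemma catw_Wm: "u : Wm e m ==> v : Wm f m' ==> catw e f u v : Wm (e + f) (m + m')"
 by (simp add: Wm_def content_catw)

lemma catw_split:
 assumes "w : Wd (e + f)"
 obtains u v where "u : Wd e" "v : Wd f" "w = catw e f u v"
proof (rule that)
 let ?u = "Fn (%j. if j < e then app w j else j)" and ?v = "Fn (%j. if j < f then app w (e + j) else j)"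
 show "?u : Wd e" "?v : Wd f" by (simp_all add: Wd_def)
 show "w = catw e f ?u ?v" by (rule fn_eqI) (use assms in \<open>auto simp: catw_def Wd_def\<close>)
qed

lemma finite_submsets: "finite {a. a \<subseteq># (m :: 'a multiset)}"
proof (induction m)
 case (add x m)
 have "{a. a \<subseteq># add_mset x m} \<subseteq> {a. a \<subseteq># m} \<union> add_mset x ` {a. a \<subseteq># m}"
 proof
 fix a assume a: "a : {a. a \<subseteq># add_mset x m}"
 show "a : {a. a \<subseteq># m} \<union> add_mset x ` {a. a \<subseteq># m}"
 proof (cases "x \<in># a")
 case True
 then obtain b where b: "a = add_mset x b" by (metis mset_add)
 then show ?thesis using a by auto
 next
 case False
 have "a \<subseteq># m"
 proof (rule mset_subset_eqI)
 fix y show "count a y <= count m y"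
 using mset_subset_eq_count[of a "add_mset x m" y] a False by (cases "y = x") (auto simp: not_in_iff)
 qed
 then show ?thesis by simp
 qed
 qed
 then show ?case by (rule finite_subset) (use add in auto)
qed simp

lemma Wm_subset_Wd: "supp_on (Wm d m) \<subseteq> Tn d"
 by (auto simp: supp_on_def Wm_def)

lemma supp_on_Wm_mult: "x : supp_on (Wm d m) ==> a : An d ==> x * a : supp_on (Wm d m)"
 by (rule supp_on_mult) (auto simp: Wm_add)

lemma fin_dim_Wm: "fin_dim (supp_on (Wm d m))"
 by (rule fin_dim_supp_on) simp

text \<open>A word splits uniquely into two words whose contents add up, and the block product acts
  on the two parts separately. This is the multiplicativity of characters.\<close>

lemma dim_split:
 fixes a b :: "('k::field) fna"
 assumes a: "a : An e" and b: "b : An f"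
 shows "fs.dim (rmul (supp_on (Wm (e + f) m)) (Bx e a b)) =
 (\<Sum>m1\<in>{m1. m1 \<subseteq># m}. fs.dim (rmul (supp_on (Wm e m1)) a) * fs.dim (rmul (supp_on (Wm f (m - m1))) b))"
proof -
 let ?U = "%m1. rmul (supp_on (Wm e m1)) a" and ?V = "%m2. rmul (supp_on (Wm f m2)) b"
 have ex1: "\<exists>y. lin_indep {..<fs.dim (?U m1)} y & fs.span (y ` {..<fs.dim (?U m1)}) = ?U m1" for m1
 by (rule fin_dim_basis[OF fin_dim_image[OF fin_dim_Wm klin_mult_right]]) blast
 have ex2: "\<exists>y. lin_indep {..<fs.dim (?V m2)} y & fs.span (y ` {..<fs.dim (?V m2)}) = ?V m2" for m2
 by (rule fin_dim_basis[OF fin_dim_image[OF fin_dim_Wm klin_mult_right]]) blast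
 define u where "u m1 = (SOME y. lin_indep {..<fs.dim (?U m1)} y & fs.span (y ` {..<fs.dim (?U m1)}) = ?U m1)" for m1
 define v where "v m2 = (SOME y. lin_indep {..<fs.dim (?V m2)} y & fs.span (y ` {..<fs.dim (?V m2)}) = ?V m2)" for m2
 define D where "D m1 = fs.dim (?U m1)" for m1
 define D' where "D' m2 = fs.dim (?V m2)" for m2
 have u: "lin_indep {..<D m1} (u m1)" "fs.span (u m1 ` {..<D m1}) = ?U m1" for m1
 using someI_ex[OF ex1[of m1], folded u_def D_def] by auto
 have v: "lin_indep {..<D' m2} (v m2)" "fs.span (v m2 ` {..<D' m2}) = ?V m2" for m2
 using someI_ex[OF ex2[of m2], folded v_def D'_def] by auto
 have um: "u m1 i : ?U m1" if "i < D m1" for m1 i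
 proof -
 have "u m1 i : fs.span (u m1 ` {..<D m1})" by (rule fs.span_base) (use that in blast)
 then show ?thesis by (simp only: u(2))
 qed
 have vm: "v m2 i : ?V m2" if "i < D' m2" for m2 i
 proof -
 have "v m2 i : fs.span (v m2 ` {..<D' m2})" by (rule fs.span_base) (use that in blast)
 then show ?thesis by (simp only: v(2))
 qed
 have us: "u m1 i : supp_on (Wm e m1)" if "i < D m1" for m1 i
 using um[OF that] supp_on_Wm_mult[OF _ a] by auto
 have vs: "v m2 i : supp_on (Wm f m2)" if "i < D' m2" for m2 i
 using vm[OF that] supp_on_Wm_mult[OF _ b] by auto
 let ?M = "{m1. m1 \<subseteq># m}"
 let ?I = "SIGMA m1:?M. {..<D m1} \<times> {..<D' (m - m1)}"
 let ?g = "%(m1, i, j). Cat e f (u m1 i) (v (m - m1) j)"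
 have finI: "finite ?I" using finite_submsets by auto
 have ind: "lin_indep ?I ?g"
 unfolding lin_indep_def
 proof (intro allI impI)
 fix z assume "(\<Sum>i\<in>?I. fscale (z i) (?g i)) = 0"
 then have 0: "(\<Sum>m1\<in>?M. \<Sum>(i, j)\<in>{..<D m1} \<times> {..<D' (m - m1)}. fscale (z (m1, i, j)) (Cat e f (u m1 i) (v (m - m1) j))) = 0"
 by (simp add: sum.Sigma split_def finite_submsets)
 \<comment> \<open>At a concatenated word the content of the first part selects \<open>m1\<close>;
   the two parts then evaluate the two basis expansions independently, which allows independence to
   be used first for \<open>u\<close> and then for \<open>v\<close>.\<close>
 have key: "(\<Sum>i<D m1. \<Sum>j<D' (m - m1). z (m1, i, j) * (lookup (u m1 i) w1 * lookup (v (m - m1) j) w2)) = 0"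
 if m1: "m1 \<subseteq># m" and w1: "w1 : Wm e m1" and w2: "w2 : Wd f" for m1 w1 w2
 proof -
 have w1d: "w1 : Wd e" using w1 by (simp add: Wm_def)
 have lk: "lookup (Cat e f (u m' i) (v (m - m') j)) (catw e f w1 w2) =
 lookup (u m' i) w1 * lookup (v (m - m') j) w2"
 if "i < D m'" "j < D' (m - m')" for m' i j
 using us[OF that(1)] vs[OF that(2)] Wm_subset_Wd by (intro lookup_Cat w1d w2) blast+
 have "0 = lookup (\<Sum>m1\<in>?M. \<Sum>(i, j)\<in>{..<D m1} \<times> {..<D' (m - m1)}. fscale (z (m1, i, j)) (Cat e f (u m1 i) (v (m - m1) j))) (catw e f w1 w2)"
 unfolding 0 by simp
 also have "\<dots> = (\<Sum>m'\<in>?M. \<Sum>(i, j)\<in>{..<D m'} \<times> {..<D' (m - m')}. z (m', i, j) * (lookup (u m' i) w1 * lookup (v (m - m') j) w2))"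
 unfolding lookup_sum split_def lookup_fscale
 by (intro sum.cong refl) (auto simp: lk)
 also have "\<dots> = (\<Sum>m'\<in>?M. if m' = m1 then \<Sum>(i, j)\<in>{..<D m1} \<times> {..<D' (m - m1)}. z (m1, i, j) * (lookup (u m1 i) w1 * lookup (v (m - m1) j) w2) else 0)"
 proof (rule sum.cong[OF refl])
 fix m' assume "m' : ?M"
 have "lookup (u m' i) w1 = 0" if "m' ~= m1" "i < D m'" for i
 using lookup_supp_on[OF us[OF that(2)], of w1] w1 that(1) by (auto simp: Wm_def)
 then show "(\<Sum>(i, j)\<in>{..<D m'} \<times> {..<D' (m - m')}. z (m', i, j) * (lookup (u m' i) w1 * lookup (v (m - m') j) w2)) =
 (if m' = m1 then \<Sum>(i, j)\<in>{..<D m1} \<times> {..<D' (m - m1)}. z (m1, i, j) * (lookup (u m1 i) w1 * lookup (v (m - m1) j) w2) else 0)"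
 by (cases "m' = m1") (auto intro!: sum.neutral)
 qed
 also have "\<dots> = (\<Sum>(i, j)\<in>{..<D m1} \<times> {..<D' (m - m1)}. z (m1, i, j) * (lookup (u m1 i) w1 * lookup (v (m - m1) j) w2))"
 using m1 finite_submsets[of m] by simp
 finally show ?thesis by (simp add: sum.cartesian_product)
 qed
 have "z (m1, i, j) = 0" if m1: "m1 \<subseteq># m" and i: "i < D m1" and j: "j < D' (m - m1)" for m1 i j
 proof -
 have c: "(\<Sum>j<D' (m - m1). z (m1, i, j) * lookup (v (m - m1) j) w2) = 0" if w2: "w2 : Wd f" for w2
 proof -
 have "(\<Sum>i<D m1. fscale (\<Sum>j<D' (m - m1). z (m1, i, j) * lookup (v (m - m1) j) w2) (u m1 i)) = 0"
 proof (rule poly_mapping_eqI)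
 fix w1
 show "lookup (\<Sum>i<D m1. fscale (\<Sum>j<D' (m - m1). z (m1, i, j) * lookup (v (m - m1) j) w2) (u m1 i)) w1 = lookup 0 w1"
 proof (cases "w1 : Wm e m1")
 case True
 show ?thesis using key[OF m1 True w2]
 by (simp add: lookup_sum sum_distrib_left sum_distrib_right ac_simps)
 next
 case False
 have "lookup (u m1 i) w1 = 0" if "i < D m1" for i using lookup_supp_on[OF us[OF that] False] .
 then show ?thesis by (simp add: lookup_sum)
 qed
 qed
 then show ?thesis using lin_indepD[OF u(1), where z="%i. \<Sum>j<D' (m - m1). z (m1, i, j) * lookup (v (m - m1) j) w2" and i=i] i by simp
 qed
 have "(\<Sum>j<D' (m - m1). fscale (z (m1, i, j)) (v (m - m1) j)) = 0"
 proof (rule poly_mapping_eqI)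
 fix w2
 show "lookup (\<Sum>j<D' (m - m1). fscale (z (m1, i, j)) (v (m - m1) j)) w2 = lookup 0 w2"
 proof (cases "w2 : Wd f")
 case True
 then show ?thesis using c by (simp add: lookup_sum)
 next
 case False
 have "lookup (v (m - m1) j) w2 = 0" if "j < D' (m - m1)" for j
 using lookup_supp_on[OF vs[OF that], of w2] False by (auto simp: Wm_def)
 then show ?thesis by (simp add: lookup_sum)
 qed
 qed
 then show ?thesis using lin_indepD[OF v(1), where z="%j. z (m1, i, j)" and i=j] j by simp
 qed
 then show "\<forall>i\<in>?I. z i = 0" by auto
 qed
 have span: "rmul (supp_on (Wm (e + f) m)) (Bx e a b) = fs.span (?g ` ?I)"
 proof
 have sub: "fs.subspace (rmul (supp_on (Wm (e + f) m)) (Bx e a b))"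
 by (rule fs2.linear_subspace_image[OF klin_mult_right subspace_supp_on])
 show "fs.span (?g ` ?I) \<subseteq> rmul (supp_on (Wm (e + f) m)) (Bx e a b)"
 proof (rule fs.span_minimal[OF _ sub], rule image_subsetI)
 fix i assume "i : ?I"
 then obtain m1 k j where i: "i = (m1, k, j)" "m1 \<subseteq># m" "k < D m1" "j < D' (m - m1)" by auto
 obtain x where x: "x : supp_on (Wm e m1)" "u m1 k = x * a" using um[OF i(3)] by blast
 obtain y where y: "y : supp_on (Wm f (m - m1))" "v (m - m1) j = y * b" using vm[OF i(4)] by blast
 have "Cat e f x y : supp_on (Wm (e + f) m)"
 using bil_supp_on[OF x(1) y(1), of "catw e f" "Wm (e + f) m"] catw_Wm[of _ e m1 _ f "m - m1"] i(2) by simp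
 moreover have "?g i = Cat e f x y * Bx e a b" using i x y Cat_Bx[OF a b] by simp
 ultimately show "?g i : rmul (supp_on (Wm (e + f) m)) (Bx e a b)" by blast
 qed
 show "rmul (supp_on (Wm (e + f) m)) (Bx e a b) \<subseteq> fs.span (?g ` ?I)"
 proof
 fix y assume "y : rmul (supp_on (Wm (e + f) m)) (Bx e a b)"
 then obtain x where x: "x : supp_on (Wm (e + f) m)" "y = x * Bx e a b" by blast
 have "sg w * Bx e a b : fs.span (?g ` ?I)" if w: "w : Wm (e + f) m" for w
 proof -
 have wd: "w : Wd (e + f)" using w by (simp add: Wm_def)
 obtain w1 w2 where w12: "w1 : Wd e" "w2 : Wd f" "w = catw e f w1 w2" by (rule catw_split[OF wd])
 define m1 where "m1 = content e w1"
 have m: "m = m1 + content f w2" using w by (simp add: Wm_def w12(3) content_catw m1_def)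
 have m2: "m - m1 = content f w2" by (simp add: m)
 have "sg w = (Cat e f (sg w1) (sg w2) :: 'k fna)" by (simp add: w12(3))
 then have eq: "sg w * Bx e a b = Cat e f (sg w1 * a) (sg w2 * b)"
 using Cat_Bx[OF a b, of "sg w1" "sg w2"] by (simp only:)
 have 1: "sg w1 * a : fs.span (u m1 ` {..<D m1})"
 unfolding u(2) by (rule imageI) (simp add: Wm_def w12 m1_def)
 have 2: "sg w2 * b : fs.span (v (m - m1) ` {..<D' (m - m1)})"
 unfolding v(2) by (rule imageI) (simp add: Wm_def w12 m2)
 have 3: "Cat e f (u m1 i) y : fs.span (?g ` ?I)" if i: "i < D m1" and y: "y : fs.span (v (m - m1) ` {..<D' (m - m1)})" for i y
 proof -
 have "Cat e f (u m1 i) ` fs.span (v (m - m1) ` {..<D' (m - m1)}) = fs.span (Cat e f (u m1 i) ` (v (m - m1) ` {..<D' (m - m1)}))"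
 by (rule fs2.linear_span_image[OF klin_bil_right, symmetric])
 moreover have "Cat e f (u m1 i) ` (v (m - m1) ` {..<D' (m - m1)}) \<subseteq> ?g ` ?I"
 using i m by (auto intro!: image_eqI[of _ _ "(m1, i, _)"])
 ultimately show ?thesis using y fs.span_mono by blast
 qed
 have "(%x. Cat e f x (sg w2 * b)) ` fs.span (u m1 ` {..<D m1}) = fs.span ((%x. Cat e f x (sg w2 * b)) ` (u m1 ` {..<D m1}))"
 by (rule fs2.linear_span_image[OF klin_bil_left, symmetric])
 moreover have "fs.span ((%x. Cat e f x (sg w2 * b)) ` (u m1 ` {..<D m1})) \<subseteq> fs.span (?g ` ?I)"
 by (rule fs.span_minimal[OF _ fs.subspace_span]) (use 3[OF _ 2] in auto)
 ultimately show ?thesis unfolding eq using 1 by blast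
 qed
 then show "y : fs.span (?g ` ?I)"
 unfolding x(2) mult_expand_left[of x] by (intro fs.span_sum fs.span_scale) (use supp_onD[OF x(1)] in blast)
 qed
 qed
 have "fs.dim (rmul (supp_on (Wm (e + f) m)) (Bx e a b)) = card ?I"
 unfolding span by (rule dim_lin_indep[OF finI ind])
 also have "\<dots> = (\<Sum>m1\<in>?M. D m1 * D' (m - m1))"
 using finite_submsets[of m] by (subst card_SigmaI) (auto simp: card_cartesian_product)
 finally show ?thesis by (simp add: D_def D'_def)
qed

lemma dim_weight_expand:
 fixes ep :: "('k::{field, field_char_0}) fna"
 assumes "ep : An d"
 shows "fs.dim (rmul (supp_on (Wm d m)) ep) = (\<Sum>p\<in>parts d. fs.dim (cAe d p ep) * schur_function p m)"
proof -
 have "fs.dim (rmul (supp_on (Wm d m)) (cS p :: 'k fna)) = schur_function p m" if "p : parts d" for p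
 using that dim_weight_space[of p m, where 'k='k] schur_function_card[of p m] by (auto simp: parts_iff)
 then show ?thesis
 using dim_formula[OF assms fin_dim_Wm[of d m] supp_on_Wm_mult] by simp
qed

text \<open>Computed from weight spaces, the corner dimensions expand the product of the two Schur
  functions. By \<open>schur_unique\<close> this expansion is the only one, as the definite
  description in \<open>lr_coeff\<close> requires.\<close>

lemma lr_coeff_dim:
 assumes q: "is_partition q" and t: "is_partition t"
 shows "lr_coeff q t p = (if p : parts (sum_list q + sum_list t)
 then fs.dim (cAe (sum_list q + sum_list t) p (Bx (sum_list q) (cS q) (cS t) :: ('k::{field, field_char_0}) fna)) else 0)"
proof -
 let ?d = "sum_list q + sum_list t"
 let ?e = "Bx (sum_list q) (cS q) (cS t) :: 'k fna"
 define N where "N p = (if p : parts ?d then fs.dim (cAe ?d p ?e) else 0)" for p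
 have eA: "?e : An ?d" by (rule Bx_An[OF cS_An cS_An])
 have Nsub: "{s. N s ~= 0} \<subseteq> parts ?d" by (auto simp: N_def)
 then have fin: "finite {s. N s ~= 0}" by (rule finite_subset) simp
 have schurq: "schur_function q m = fs.dim (rmul (supp_on (Wm (sum_list q) m)) (cS q :: 'k fna))" for m
 by (simp add: schur_function_card[OF q] dim_weight_space[OF q])
 have schurt: "schur_function t m = fs.dim (rmul (supp_on (Wm (sum_list t) m)) (cS t :: 'k fna))" for m
 by (simp add: schur_function_card[OF t] dim_weight_space[OF t])
 have prod: "symfun_mult (schur_function q) (schur_function t) = (%m. \<Sum>s\<in>{s. N s ~= 0}. N s * schur_function s m)"
 proof
 fix m
 have "symfun_mult (schur_function q) (schur_function t) m = fs.dim (rmul (supp_on (Wm ?d m)) ?e)"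
 unfolding dim_split[OF cS_An cS_An] symfun_mult_def schurq schurt ..
 also have "\<dots> = (\<Sum>s\<in>parts ?d. N s * schur_function s m)"
 unfolding dim_weight_expand[OF eA] by (simp add: N_def)
 also have "\<dots> = (\<Sum>s\<in>{s. N s ~= 0}. N s * schur_function s m)"
 by (rule sum.mono_neutral_right) (use Nsub in auto)
 finally show "symfun_mult (schur_function q) (schur_function t) m = (\<Sum>s\<in>{s. N s ~= 0}. N s * schur_function s m)" .
 qed
 have "lr_coeff q t = N"
 unfolding lr_coeff_def
 proof (rule the_equality)
 show "finite {s. N s ~= 0} & (\<forall>s. N s ~= 0 --> is_partition s) &
 symfun_mult (schur_function q) (schur_function t) = (%m. \<Sum>s\<in>{s. N s ~= 0}. N s * schur_function s m)"
 using fin prod Nsub by (auto simp: parts_def)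
 fix M assume M: "finite {s. M s ~= 0} & (\<forall>s. M s ~= 0 --> is_partition s) &
 symfun_mult (schur_function q) (schur_function t) = (%m. \<Sum>s\<in>{s. M s ~= 0}. M s * schur_function s m)"
 let ?S = "{s. M s ~= 0} \<union> {s. N s ~= 0}"
 have finS: "finite ?S" using M fin by simp
 have S: "is_partition s" if "s : ?S" for s using that M Nsub by (auto simp: parts_def)
 have ext: "(\<Sum>s\<in>?S. F s * schur_function s m) = (\<Sum>s\<in>{s. F s ~= 0}. F s * schur_function s m)"
 if "F = M \<or> F = N" for F m
 by (rule sum.mono_neutral_right[OF finS]) (use that in auto)
 have eq: "(\<Sum>s\<in>?S. M s * schur_function s m) = (\<Sum>s\<in>?S. N s * schur_function s m)" for m
 unfolding ext[OF disjI1[OF refl]] ext[OF disjI2[OF refl]]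
 using M fun_cong[OF prod, of m] by simp
 show "M = N"
 proof
 fix s show "M s = N s"
 using schur_unique[OF finS S eq] by (cases "s : ?S") auto
 qed
 qed
 then show ?thesis by (simp add: N_def)
qed

section \<open>The hyperoctahedral symmetrizer\<close>

text \<open>It plays two roles: on letters it is the duality of the hyperbolic basis, on positions
  the pairing along which tensors are contracted.\<close>

definition star :: "nat => nat" where
 "star n = (if even n then n + 1 else n - 1)"

lemma star_star [simp]: "star (star n) = n"
 by (simp add: star_def)

lemma star_neq [simp]: "star n ~= n"
 by (cases "even n") (auto simp: star_def elim: oddE)

lemma star_eq_iff: "star a = star b \<longleftrightarrow> a = b"
 by (metis star_star)

lemma star_less: "even m ==> star n < m \<longleftrightarrow> n < m"
 by (auto simp: star_def elim!: evenE oddE)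

lemma even_star: "even (star n) \<longleftrightarrow> odd n"
 by (auto simp: star_def)

lemma star_add_even: "even m ==> star (m + n) = m + star n"
 by (auto simp: star_def elim!: oddE)

text \<open>The hyperoctahedral group as the centralizer of \<open>star\<close>.\<close>

definition Hs :: "nat => fn set" where
 "Hs r = {s : Pm (2 * r). \<forall>j. app s (star j) = star (app s j)}"

lemma subgrp_Hs [simp]: "subgrp (2 * r) (Hs r)"
proof -
 have "app (pinv s) (star j) = star (app (pinv s) j)" if s: "s : Hs r" for s j
 proof -
 have sP: "s : Pm (2 * r)" using s by (simp add: Hs_def)
 have "app s (star (app (pinv s) j)) = star j" using s app_pinv_app[OF sP, of j] by (simp add: Hs_def)
 then have "app (pinv s) (star j) = app (pinv s) (app s (star (app (pinv s) j)))" by simp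
 then show ?thesis by (simp only: pinv_app_app[OF sP])
 qed
 then show ?thesis by (auto simp: subgrp_def Hs_def)
qed

definition hS :: "nat => ('k::field) fna" where
 "hS r = gsum (%s. 1) (Hs r)"

lemma hS_An [simp]: "hS r : An (2 * r)"
 by (simp add: hS_def)

lemma hS_left: "s : Hs r ==> sg s * hS r = hS r"
 unfolding hS_def by (subst gsum_left[OF subgrp_Hs chr_1]) auto

lemma hS_right: "s : Hs r ==> hS r * sg s = hS r"
 unfolding hS_def by (subst gsum_right[OF subgrp_Hs chr_1]) auto

lemma hS_square: "hS r * hS r = fscale (of_nat (card (Hs r))) (hS r)"
 unfolding hS_def by (rule gsum_square[OF subgrp_Hs chr_1])

definition fpf :: "nat set => (nat => nat) set" where
 "fpf S = {f. (\<forall>x\<in>S. f x : S & f x ~= x & f (f x) = x) & (\<forall>x. x \<notin> S --> f x = x)}"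

text \<open>The partner of a fixed point \<open>s\<close> of the set can be any other point, and
  removing the pair leaves a matching of the rest.\<close>

lemma card_fpf: "finite S ==> card S = 2 * r ==> finite (fpf S) & card (fpf S) <= dfact r"
proof (induction r arbitrary: S)
 case 0
 then have "fpf S = {id}" by (auto simp: fpf_def)
 then show ?case by simp
next
 case (Suc r)
 then obtain s where s: "s : S" by fastforce
 let ?F = "%t. {f : fpf S. f s = t}"
 have b: "finite (?F t) & card (?F t) <= dfact r" if t: "t : S - {s}" for t
 proof -
 let ?S = "S - {s, t}"
 have "card ?S = 2 * r" using Suc.prems s t by (simp add: card_Diff_subset)
 then have IH: "finite (fpf ?S)" "card (fpf ?S) <= dfact r" using Suc.IH[of ?S] Suc.prems by auto
 let ?g = "%f. f(s := s, t := t)"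
 have img: "?g ` ?F t \<subseteq> fpf ?S"
 proof (rule image_subsetI)
 fix f assume f: "f : ?F t"
 then have fs: "f s = t" "f t = s" using s by (auto simp: fpf_def)
 have ff: "f (f x) = x" "f x : S" "f x ~= x" if "x : S" for x using f that by (auto simp: fpf_def)
 have "f x ~= s" "f x ~= t" if "x : ?S" for x
 using ff(1)[of x] fs that by auto
 then show "?g f : fpf ?S" using f ff by (auto simp: fpf_def)
 qed
 have inj: "inj_on ?g (?F t)"
 proof (rule inj_onI)
 fix f f' assume h: "f : ?F t" "f' : ?F t" "?g f = ?g f'"
 have "f s = f' s" "f t = f' t" using h(1,2) s by (auto simp: fpf_def)
 then show "f = f'" using h(3) by (metis fun_upd_triv fun_upd_twist fun_upd_upd)
 qed
 have "finite (?F t)" using finite_imageD[OF finite_subset[OF img IH(1)] inj] .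
 moreover have "card (?F t) <= card (fpf ?S)" by (rule card_inj_on_le[OF inj img IH(1)])
 ultimately show ?thesis using IH(2) by simp
 qed
 have sub: "fpf S = (\<Union>t\<in>S - {s}. ?F t)" using s by (auto simp: fpf_def)
 have fin: "finite (fpf S)" by (subst sub) (use b Suc.prems in auto)
 have "card (fpf S) = card (\<Union>t\<in>S - {s}. ?F t)" by (subst sub) simp
 also have "\<dots> <= (\<Sum>t\<in>S - {s}. card (?F t))" by (rule card_UN_le) (use Suc.prems in auto)
 also have "\<dots> <= (\<Sum>t\<in>S - {s}. dfact r)" by (rule sum_mono) (use b in auto)
 also have "\<dots> = dfact (Suc r)" using Suc.prems s by simp
 finally show ?case using fin by simp
qed

lemma dim_span_card_le:
 fixes B :: "('a \<Rightarrow>\<^sub>0 'k::field) set"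
 assumes "finite B"
 shows "fs.dim (fs.span B) <= card B"
 using fs.dim_le_card[OF order_refl assms] .

text \<open>All elements of a left coset of the hyperoctahedral group have the same product with
  \<open>hS r\<close>, and a coset is determined by the matching onto which it carries the standard
  one.\<close>

lemma dim_An_hS: "fs.dim (rmul (An (2 * r)) (hS r :: ('k::field) fna)) <= dfact r"
proof -
 let ?B = "(%g. sg g * hS r :: 'k fna) ` Pm (2 * r)"
 have eq: "rmul (An (2 * r)) (hS r :: 'k fna) = fs.span ?B"
 proof -
 have "fs.span ((%x. x * hS r) ` ((%a. sg a :: 'k fna) ` Pm (2 * r))) = (%x. x * hS r) ` fs.span ((%a. sg a) ` Pm (2 * r))"
 by (rule fs2.linear_span_image[OF klin_mult_right])
 then show ?thesis unfolding supp_on_span by (simp add: image_image)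
 qed
 \<comment> \<open>The conjugate of \<open>star\<close> by \<open>g\<close>, restricted to the
   \<open>2 * r\<close> positions.\<close>
 define m where "m g = (%j. if j < 2 * r then app g (star (app (pinv g) j)) else j)" for g
 have mf: "m g : fpf {..<2 * r}" if g: "g : Pm (2 * r)" for g
 proof -
 have lt: "app (pinv g) j < 2 * r" "app g j < 2 * r" if "j < 2 * r" for j
 using Pm_less[OF g that] Pm_less[OF Pm_pinv[OF g] that] by auto
 have 1: "m g j < 2 * r" if "j < 2 * r" for j using that lt by (simp add: m_def star_less)
 have "m g j ~= j" if "j < 2 * r" for j
 proof
 assume "m g j = j"
 then have "app (pinv g) (app g (star (app (pinv g) j))) = app (pinv g) j" using that by (simp add: m_def)
 then show False by (simp only: pinv_app_app[OF g]) simp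
 qed
 moreover have "m g (m g j) = j" if "j < 2 * r" for j
 using that 1[OF that] by (simp add: m_def pinv_app_app[OF g] app_pinv_app[OF g])
 ultimately show ?thesis using 1 by (auto simp: fpf_def m_def)
 qed
 have same: "sg g * hS r = (sg g' * hS r :: 'k fna)" if g: "g : Pm (2 * r)" and g': "g' : Pm (2 * r)" and eq: "m g = m g'" for g g'
 proof -
 let ?s = "pinv g + g'"
 have sP: "?s : Pm (2 * r)" using g g' by simp
 have "app ?s (star j) = star (app ?s j)" for j
 proof (cases "j < 2 * r")
 case True
 let ?i = "app g' j"
 have i: "?i < 2 * r" by (rule Pm_less[OF g' True])
 have "app g' (star j) = m g' ?i" using i by (simp add: m_def pinv_app_app[OF g'])
 also have "m g' ?i = m g ?i" by (simp only: eq)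
 also have "\<dots> = app g (star (app (pinv g) ?i))" using i by (simp add: m_def)
 finally show ?thesis by (simp add: pinv_app_app[OF g])
 next
 case False
 then have "\<not> star j < 2 * r" by (simp add: star_less)
 then show ?thesis using False permutes_not_in[OF Pm_app[OF sP]] by (simp del: app_plus)
 qed
 then have "?s : Hs r" using sP by (simp add: Hs_def)
 have "sg g' = (sg g * sg ?s :: 'k fna)"
 by (simp add: mult_single add.assoc[symmetric] pinv_right[OF g])
 then show ?thesis using hS_left[OF \<open>?s : Hs r\<close>, where 'a='k] by (simp add: mult.assoc)
 qed
 have fpf: "finite (fpf {..<2 * r})" "card (fpf {..<2 * r}) <= dfact r" using card_fpf[of "{..<2 * r}" r] by auto
 define G where "G f = (SOME g. g : Pm (2 * r) & m g = f)" for f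
 have "?B \<subseteq> (%f. sg (G f) * hS r) ` fpf {..<2 * r}"
 proof (rule image_subsetI)
 fix g assume g: "g : Pm (2 * r)"
 have "G (m g) : Pm (2 * r) & m (G (m g)) = m g" unfolding G_def by (rule someI[of _ g]) (use g in simp)
 then have "sg g * hS r = (sg (G (m g)) * hS r :: 'k fna)" using same[OF g] by simp
 then show "sg g * hS r : (%f. sg (G f) * hS r :: 'k fna) ` fpf {..<2 * r}" using mf[OF g] by blast
 qed
 then have "card ?B <= card ((%f. sg (G f) * hS r :: 'k fna) ` fpf {..<2 * r})" by (rule card_mono[rotated]) (simp add: fpf)
 also have "\<dots> <= card (fpf {..<2 * r})" by (rule card_image_le[OF fpf(1)])
 finally have "card ?B <= dfact r" using fpf(2) by simp
 moreover have "fs.dim (fs.span ?B) <= card ?B" by (rule dim_span_card_le) simp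
 ultimately show ?thesis unfolding eq by simp
qed

definition evp :: "nat => nat list set" where
 "evp r = {p : parts (2 * r). \<forall>x\<in>set p. even x}"

text \<open>Rows of even length begin at even numbers, so partners are neighbours in one
  row.\<close>

lemma cell_star:
 assumes p: "p : evp r" and x: "x < 2 * r"
 shows "rw p (star x) = rw p x" "cl p (star x) = star (cl p x)"
proof -
 have sz: "sum_list p = 2 * r" using p by (simp add: evp_def parts_def)
 have ev: "even y" if "y : set p" for y using p that by (simp add: evp_def)
 note r = tableau_cell_range[of x p, unfolded sz, OF x]
 have pe: "even (p ! rw p x)" using r ev by simp
 have se: "even (sum_list (take (rw p x) p))"
 proof -
 have "even (sum_list ys)" if "set ys \<subseteq> set p" for ys using that ev by (induction ys) auto
 then show ?thesis using set_take_subset by metis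
 qed
 have "star (cl p x) < p ! rw p x" using r pe by (simp add: star_less)
 then have "tableau_cell p (sum_list (take (rw p x) p) + star (cl p x)) = (rw p x, star (cl p x))"
 using tableau_cell_number[of "rw p x" p "star (cl p x)"] r by simp
 moreover have "sum_list (take (rw p x) p) + star (cl p x) = star x"
 using star_add_even[OF se, of "cl p x"] r by simp
 ultimately show "rw p (star x) = rw p x" "cl p (star x) = star (cl p x)" by simp_all
qed

text \<open>A permutation commuting with \<open>star\<close> and preserving parity acts twice by the same permutation.\<close>

lemma sgnf_star_commuting:
 assumes t: "t : Pm (2 * r)" and comm: "!!x. x < 2 * r ==> app t (star x) = star (app t x)"
 and par: "!!x. x < 2 * r ==> even (app t x) \<longleftrightarrow> even x"
 shows "sgnf t = (1::'k::field)"
proof -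
 have lt: "app t x < 2 * r" if "x < 2 * r" for x by (rule Pm_less[OF t that])
 have out: "app t x = x" if "\<not> x < 2 * r" for x using permutes_not_in[OF Pm_app[OF t]] that by simp
 have par': "even (app t x) \<longleftrightarrow> even x" for x using par[of x] out[of x] by (cases "x < 2 * r") auto
 have injt: "app t x = app t y \<longleftrightarrow> x = y" for x y using permutes_inj[OF Pm_app[OF t]] by (simp add: inj_eq)
 \<comment> \<open>\<open>t1\<close> and \<open>t2\<close> are the actions on even and on odd
   positions. The involution \<open>io\<close> exchanges the two classes and conjugates one action
   into the other, so the sign of \<open>t\<close> is a square.\<close>
 define t1 where "t1 = Fn (%j. if even j then app t j else j)"
 define t2 where "t2 = Fn (%j. if odd j then app t j else j)"
 define io where "io = Fn (%j. if j < 2 * r then star j else j)"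
 have perm: "s : Pm (2 * r)" if "inj (app s)" "!!j. j < 2 * r ==> app s j < 2 * r" "!!j. \<not> j < 2 * r ==> app s j = j" for s
 proof -
 have "app s ` {..<2 * r} = {..<2 * r}"
 by (rule endo_inj_surj) (use that inj_on_subset[OF that(1)] in auto)
 then have "bij_betw (app s) {..<2 * r} {..<2 * r}" using inj_on_subset[OF that(1)] by (auto simp: bij_betw_def)
 then have "app s permutes {..<2 * r}" by (rule bij_imp_permutes) (use that(3) in simp)
 then show ?thesis by (simp add: Pm_def)
 qed
 have P1: "t1 : Pm (2 * r)"
 proof (rule perm)
 show "inj (app t1)"
 proof (rule injI)
 fix x y assume "app t1 x = app t1 y"
 then show "x = y" using par'[of x] par'[of y] injt[of x y] by (cases "even x"; cases "even y") (auto simp: t1_def)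
 qed
 qed (use lt out in \<open>auto simp: t1_def\<close>)
 have Pio: "io : Pm (2 * r)"
 proof (rule perm)
 show "inj (app io)"
 proof (rule injI)
 fix x y assume "app io x = app io y"
 then show "x = y"
 using star_less[of "2 * r" x] star_less[of "2 * r" y] star_eq_iff[of x y]
 by (cases "x < 2 * r"; cases "y < 2 * r") (auto simp: io_def)
 qed
 qed (auto simp: io_def star_less)
 have "t1 + t2 = t" by (rule fn_eqI) (use par' in \<open>auto simp: t1_def t2_def\<close>)
 moreover have e2: "io + t1 + io = t2"
 proof (rule fn_eqI)
 fix j
 show "app (io + t1 + io) j = app t2 j"
 using comm[of j] lt[of j] out[of j] star_less[of "2 * r" j] star_less[of "2 * r" "app t j"]
 by (cases "j < 2 * r"; cases "even j") (auto simp: io_def t1_def t2_def even_star)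
 qed
 moreover have "sgnf (io + t1 + io) = (sgnf t1 :: 'k)"
 by (simp add: sgnf_add[OF Pm_add[OF Pio P1] Pio] sgnf_add[OF Pio P1] mult.commute mult.left_commute)
 moreover have "t2 : Pm (2 * r)" using Pm_add[OF Pm_add[OF Pio P1] Pio] e2 by simp
 ultimately show ?thesis using sgnf_add[OF P1, of t2, where 'a='k] by simp
qed

text \<open>The trace of the product is a signed count of the factorizations of the identity into a
  column, a row and a hyperoctahedral permutation. For even rows the column factor always has sign
  one, and the trivial factorization makes the count positive.\<close>

lemma cS_hS_nonzero:
 assumes p: "p : evp r"
 shows "cS p * hS r ~= (0 :: ('k::{field, field_char_0}) fna)"
proof -
 have sz: "sum_list p = 2 * r" and pp: "is_partition p" using p by (auto simp: evp_def parts_def)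
 have sign1: "sgnf t = (1::'k)" if t: "t : colg p" and s: "s : rowg p" and h: "h : Hs r" and z: "t + s + h = 0" for t s h
 proof -
 have tP: "t : Pm (2 * r)" and sP: "s : Pm (2 * r)" and hP: "h : Pm (2 * r)"
 using t s h sz by (auto simp: colg_def rowg_def Hs_def)
 define g where "g = pinv h"
 have g: "g : Hs r" using subgrpD(4)[OF subgrp_Hs h] by (simp add: g_def)
 then have gP: "g : Pm (2 * r)" by (simp add: Hs_def)
 have "t + s = t + s + h + pinv h" by (simp add: add.assoc pinv_right[OF hP])
 then have ts: "t + s = g" unfolding z by (simp add: g_def)
 have inv: "app (pinv t) (app g y) = app s y" for y
 unfolding ts[symmetric] by (simp add: pinv_app_app[OF tP])
 let ?q = "pinv t"
 have qP: "?q : Pm (2 * r)" using tP by simp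
 have q: "?q : colg p" using subgrpD(4)[OF subgrp_colg t] .
 \<comment> \<open>The row of the image is controlled by the row factor and its column by the column
   factor. Both respect \<open>star\<close>, so the images of two partners lie in the cells of two
   partners.\<close>
 have comm: "app ?q (star z) = star (app ?q z)" if z: "z < 2 * r" for z
 proof -
 let ?y = "app (pinv g) z"
 have y: "?y < 2 * r" by (rule Pm_less[OF Pm_pinv[OF gP] z])
 have gy: "app g ?y = z" by (rule app_pinv_app[OF gP])
 have gy': "app g (star ?y) = star z" using g gy by (simp add: Hs_def)
 have lt: "app ?q z < 2 * r" "app ?q (star z) < 2 * r" "star ?y < 2 * r" "star z < 2 * r"
 using Pm_less[OF qP] z y by (auto simp: star_less)
 have r1: "rw p (app ?q z) = rw p ?y" using inv[of ?y] s y sz by (simp add: gy rowg_def)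
 have r2: "rw p (app ?q (star z)) = rw p (star ?y)" using inv[of "star ?y"] s lt(3) sz by (simp add: gy' rowg_def)
 have r3: "rw p (star ?y) = rw p ?y" by (rule cell_star(1)[OF p y])
 have c1: "cl p (app ?q (star z)) = cl p (star z)" using q lt(4) sz by (simp add: colg_def)
 have c2: "cl p (star z) = star (cl p z)" by (rule cell_star(2)[OF p z])
 have c3: "cl p (app ?q z) = cl p z" using q z sz by (simp add: colg_def)
 have "rw p (app ?q (star z)) = rw p (star (app ?q z))"
 using r1 r2 r3 cell_star(1)[OF p lt(1)] by simp
 moreover have "cl p (app ?q (star z)) = cl p (star (app ?q z))"
 using c1 c2 c3 cell_star(2)[OF p lt(1)] by simp
 ultimately show ?thesis
 by - (rule cell_inj, use lt sz in \<open>simp_all add: star_less\<close>)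
 qed
 have ecl: "even (cl p x) \<longleftrightarrow> even x" if x: "x < 2 * r" for x
 proof -
 have "even (sum_list ys)" if "set ys \<subseteq> set p" for ys using that p by (induction ys) (auto simp: evp_def)
 then have "even (sum_list (take (rw p x) p))" by (simp add: set_take_subset)
 moreover have "x = sum_list (take (rw p x) p) + cl p x" using tableau_cell_range[of x p] x sz by simp
 ultimately show ?thesis by (metis even_add)
 qed
 have par: "even (app ?q z) \<longleftrightarrow> even z" if z: "z < 2 * r" for z
 proof -
 have "cl p (app ?q z) = cl p z" using q z sz by (simp add: colg_def)
 then show ?thesis using ecl[OF z] ecl[OF Pm_less[OF qP z]] by simp
 qed
 have "sgnf ?q = (1::'k)" by (rule sgnf_star_commuting[OF qP comm par])
 then show ?thesis using sgnf_pinv[OF tP, where 'a='k] by simp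
 qed
 have "tau (cS p * hS r) = (\<Sum>t\<in>colg p. \<Sum>s\<in>rowg p. \<Sum>h\<in>Hs r. if t + s + h = 0 then sgnf t else (0::'k))"
 proof -
 have "cS p * hS r = (\<Sum>t\<in>colg p. \<Sum>s\<in>rowg p. \<Sum>h\<in>Hs r. single (t + s + h) (sgnf t :: 'k))"
 unfolding cS_def aS_def bS_def hS_def gsum_def sum_distrib_left sum_distrib_right
 by (subst sum.swap[of _ "Hs r"], subst sum.swap[of _ "Hs r" "colg p"])
 (simp add: mult_single sum.swap[of _ "rowg p" "colg p"] sum.swap[of _ "Hs r"])
 then show ?thesis by (simp add: tau_def lookup_sum lookup_single when_def)
 qed
 also have "\<dots> = (\<Sum>t\<in>colg p. \<Sum>s\<in>rowg p. \<Sum>h\<in>Hs r. of_nat (if t + s + h = 0 then 1 else 0))"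
 by (intro sum.cong refl) (simp add: sign1)
 also have "\<dots> = of_nat (\<Sum>t\<in>colg p. \<Sum>s\<in>rowg p. \<Sum>h\<in>Hs r. if t + s + h = 0 then 1 else 0)"
 by (simp only: of_nat_sum)
 finally have eq: "tau (cS p * hS r) = (of_nat (\<Sum>t\<in>colg p. \<Sum>s\<in>rowg p. \<Sum>h\<in>Hs r. if t + s + h = 0 then 1 else 0) :: 'k)" .
 have fin: "finite (colg p)" "finite (rowg p)" "finite (Hs r)"
 using subgrpD(5)[OF subgrp_colg] subgrpD(5)[OF subgrp_rowg] subgrpD(5)[OF subgrp_Hs] by auto
 have z: "0 : colg p" "0 : rowg p" "0 : Hs r"
 using subgrpD(2)[OF subgrp_colg] subgrpD(2)[OF subgrp_rowg] subgrpD(2)[OF subgrp_Hs] by auto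
 have "(1::nat) <= (if 0 + 0 + (0::fn) = 0 then 1 else 0)" by simp
 also have "\<dots> <= (\<Sum>h\<in>Hs r. if 0 + 0 + h = 0 then 1 else 0)"
 by (rule member_le_sum[OF z(3) _ fin(3), of "%h. if 0 + 0 + h = 0 then 1 else (0::nat)"]) simp
 also have "\<dots> <= (\<Sum>s\<in>rowg p. \<Sum>h\<in>Hs r. if 0 + s + h = 0 then 1 else 0)"
 by (rule member_le_sum[OF z(2) _ fin(2), of "%s. \<Sum>h\<in>Hs r. if 0 + s + h = 0 then 1 else (0::nat)"]) simp
 also have "\<dots> <= (\<Sum>t\<in>colg p. \<Sum>s\<in>rowg p. \<Sum>h\<in>Hs r. if t + s + h = 0 then 1 else 0)"
 by (rule member_le_sum[OF z(1) _ fin(1), of "%t. \<Sum>s\<in>rowg p. \<Sum>h\<in>Hs r. if t + s + h = 0 then 1 else (0::nat)"]) simp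
 finally have "(\<Sum>t\<in>colg p. \<Sum>s\<in>rowg p. \<Sum>h\<in>Hs r. if t + s + h = 0 then 1 else 0) ~= (0::nat)" by simp
 then have "tau (cS p * hS r) ~= (0::'k)" unfolding eq by (simp del: of_nat_sum)
 then show ?thesis by auto
qed

lemma dim_pos:
 assumes "fin_dim V" "v : V" "v ~= 0"
 shows "1 <= fs.dim V"
proof -
 have "lin_indep {()} (%_. v)" using assms(3) by (auto simp: lin_indep_def)
 then have "card {()} <= fs.dim V" using assms by (intro lin_indep_card_le) auto
 then show ?thesis by simp
qed

text \<open>A squeeze: even partitions have nonzero corners, their tableaux number
  \<open>dfact r\<close>, and the left ideal of \<open>hS r\<close> has dimension at most
  \<open>dfact r\<close>. So every corner is as small as it can be.\<close>

lemma dim_cS_hS: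
 assumes p: "p : parts (2 * r)"
 shows "fs.dim (cAe (2 * r) p (hS r :: ('k::{field, field_char_0}) fna)) = (if p : evp r then 1 else 0)"
proof -
 let ?D = "%p. fs.dim (cAe (2 * r) p (hS r :: 'k fna))" and ?f = "%p. fd (2 * r) (sh p)"
 have evsub: "evp r \<subseteq> parts (2 * r)" by (auto simp: evp_def)
 have sumD: "(\<Sum>p\<in>parts (2 * r). ?D p * ?f p) <= dfact r"
 proof -
 have "fs.dim (rmul (An (2 * r)) (hS r :: 'k fna)) = (\<Sum>p\<in>parts (2 * r). ?D p * fs.dim (rmul (An (2 * r)) (cS p :: 'k fna)))"
 by (rule dim_formula[OF hS_An fin_dim_An An_mult])
 also have "\<dots> = (\<Sum>p\<in>parts (2 * r). ?D p * ?f p)"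
 by (rule sum.cong[OF refl]) (simp add: dim_left_ideal)
 finally show ?thesis using dim_An_hS[of r, where 'k='k] by simp
 qed
 have bij: "bij_betw sh (evp r) (evs r)"
 proof -
 have "sh ` evp r = evs r"
 proof
 show "sh ` evp r \<subseteq> evs r" using sh_shapes by (auto simp: evp_def evs_def sh_def)
 show "evs r \<subseteq> sh ` evp r"
 proof
 fix l assume l: "l : evs r"
 then obtain q where q: "q : parts (2 * r)" "l = sh q" using bij_sh[of "2 * r"] by (auto simp: evs_def bij_betw_def)
 have "even x" if "x : set q" for x
 proof -
 obtain i where "i < length q" "x = q ! i" using \<open>x : set q\<close> by (metis in_set_conv_nth)
 then have "x = sh q i" by (simp add: sh_def)
 then show ?thesis using l q(2) by (simp add: evs_def)
 qed
 then show "l : sh ` evp r" using q by (auto simp: evp_def)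
 qed
 qed
 moreover have "inj_on sh (evp r)" using bij_sh[of "2 * r"] evsub inj_on_subset by (auto simp: bij_betw_def)
 ultimately show ?thesis by (simp add: bij_betw_def)
 qed
 have sumE: "(\<Sum>p\<in>evp r. ?f p) = dfact r"
 using sum.reindex_bij_betw[OF bij, of "fd (2 * r)"] sum_fd_even by simp
 have D1: "1 <= ?D p" if "p : evp r" for p
 proof (rule dim_pos[OF fin_dim_cAe])
 show "cS p * 1 * hS r : cAe (2 * r) p (hS r :: 'k fna)" by (rule imageI) simp
 show "cS p * 1 * hS r ~= (0 :: 'k fna)" using cS_hS_nonzero[OF that, where 'k='k] by simp
 qed
 have f1: "1 <= ?f p" if "p : parts (2 * r)" for p
 proof -
 have "1 <= fs.dim (rmul (An (2 * r)) (cS p :: 'k fna))"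
 proof (rule dim_pos[OF fin_dim_image[OF fin_dim_An klin_mult_right] _ cS_nonzero])
 show "cS p : rmul (An (2 * r)) (cS p :: 'k fna)" by (rule image_eqI[of _ _ 1]) simp_all
 qed
 then show ?thesis using dim_left_ideal[OF that, where 'k='k] by simp
 qed
 define E where "E p = (if p : evp r then 1 else 0 :: nat)" for p
 have le: "E p * ?f p <= ?D p * ?f p" for p using D1[of p] by (auto simp: E_def)
 have "(\<Sum>p\<in>parts (2 * r). E p * ?f p) = (\<Sum>p\<in>evp r. E p * ?f p)"
 by (rule sum.mono_neutral_right) (use evsub in \<open>auto simp: E_def\<close>)
 also have "\<dots> = dfact r" using sumE by (simp add: E_def)
 finally have sumEE: "(\<Sum>p\<in>parts (2 * r). E p * ?f p) = dfact r" .
 have "E p * ?f p = ?D p * ?f p"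
 proof (rule ccontr)
 assume "E p * ?f p ~= ?D p * ?f p"
 then have "E p * ?f p < ?D p * ?f p" using le[of p] by simp
 then have "(\<Sum>p\<in>parts (2 * r). E p * ?f p) < (\<Sum>p\<in>parts (2 * r). ?D p * ?f p)"
 by (intro sum_strict_mono_ex1) (use le p in auto)
 then show False using sumD sumEE by simp
 qed
 then show ?thesis using f1[OF p] by (simp add: E_def)
qed

text \<open>\<open>fq q r\<close> is the idempotent, up to a factor, of the induced module of layer \<open>r\<close>.\<close>

definition fq :: "nat list => nat => ('k::field) fna" where
 "fq q r = Bx (sum_list q) (cS q) (hS r)"

lemma fq_An [simp]: "fq q r : An (sum_list q + 2 * r)"
 unfolding fq_def by (rule Bx_An[OF cS_An hS_An])

text \<open>The character of \<open>fq q r\<close> is computed twice: by its corners, and as the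
  Schur function of \<open>q\<close> times the sum of the Schur functions of even partitions.
  Independence of Schur functions compares the coefficients.\<close>

lemma dim_fq:
 assumes q: "is_partition q" and p: "p : parts (sum_list q + 2 * r)"
 shows "fs.dim (cAe (sum_list q + 2 * r) p (fq q r :: ('k::{field, field_char_0}) fna)) =
 (\<Sum>t\<in>evp r. lr_coeff q t p)"
proof -
 let ?e = "sum_list q" and ?f = "2 * r"
 let ?P = "parts (?e + ?f)"
 have evsub: "evp r \<subseteq> parts ?f" by (auto simp: evp_def)
 have finE: "finite (evp r)" using evsub by (rule finite_subset) simp
 have schurq: "fs.dim (rmul (supp_on (Wm ?e m)) (cS q :: 'k fna)) = schur_function q m" for m
 by (simp add: schur_function_card[OF q] dim_weight_space[OF q])
 have schurh: "fs.dim (rmul (supp_on (Wm ?f m)) (hS r :: 'k fna)) = (\<Sum>t\<in>evp r. schur_function t m)" for m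
 proof -
 have "fs.dim (rmul (supp_on (Wm ?f m)) (hS r :: 'k fna)) = (\<Sum>t\<in>parts ?f. (if t : evp r then 1 else 0) * schur_function t m)"
 unfolding dim_weight_expand[OF hS_An] by (rule sum.cong[OF refl]) (simp add: dim_cS_hS)
 also have "\<dots> = (\<Sum>t\<in>evp r. (if t : evp r then 1 else 0) * schur_function t m)"
 by (rule sum.mono_neutral_right) (use evsub in auto)
 finally show ?thesis by simp
 qed
 have schurt: "fs.dim (rmul (supp_on (Wm ?f m)) (cS t :: 'k fna)) = schur_function t m" if "t : evp r" for t m
 using that dim_weight_space[of t m, where 'k='k] by (auto simp: schur_function_card evp_def parts_def)
 have eq: "(\<Sum>s\<in>?P. fs.dim (cAe (?e + ?f) s (fq q r :: 'k fna)) * schur_function s m) =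
 (\<Sum>s\<in>?P. (\<Sum>t\<in>evp r. lr_coeff q t s) * schur_function s m)" for m
 proof -
 have "(\<Sum>s\<in>?P. fs.dim (cAe (?e + ?f) s (fq q r :: 'k fna)) * schur_function s m) =
 fs.dim (rmul (supp_on (Wm (?e + ?f) m)) (fq q r :: 'k fna))"
 by (rule dim_weight_expand[OF fq_An, symmetric])
 also have "\<dots> = (\<Sum>m1\<in>{m1. m1 \<subseteq># m}. schur_function q m1 * (\<Sum>t\<in>evp r. schur_function t (m - m1)))"
 unfolding fq_def dim_split[OF cS_An hS_An] schurq schurh ..
 also have "\<dots> = (\<Sum>t\<in>evp r. \<Sum>m1\<in>{m1. m1 \<subseteq># m}. schur_function q m1 * schur_function t (m - m1))"
 by (simp add: sum_distrib_left sum.swap[of _ "evp r"])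
 also have "\<dots> = (\<Sum>t\<in>evp r. \<Sum>s\<in>?P. lr_coeff q t s * schur_function s m)"
 proof (rule sum.cong[OF refl])
 fix t assume t: "t : evp r"
 have tp: "is_partition t" "sum_list t = ?f" using t by (auto simp: evp_def parts_def)
 have tA: "(cS t :: 'k fna) : An ?f" using cS_An[of t] tp(2) by simp
 have "(\<Sum>m1\<in>{m1. m1 \<subseteq># m}. schur_function q m1 * schur_function t (m - m1)) =
 fs.dim (rmul (supp_on (Wm (?e + ?f) m)) (Bx ?e (cS q) (cS t) :: 'k fna))"
 unfolding dim_split[OF cS_An tA] schurq schurt[OF t] ..
 also have "\<dots> = (\<Sum>s\<in>?P. lr_coeff q t s * schur_function s m)"
 unfolding dim_weight_expand[OF Bx_An[OF cS_An tA]]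
 by (rule sum.cong[OF refl]) (simp add: lr_coeff_dim[OF q tp(1), where 'k='k] tp(2))
 finally show "(\<Sum>m1\<in>{m1. m1 \<subseteq># m}. schur_function q m1 * schur_function t (m - m1)) =
 (\<Sum>s\<in>?P. lr_coeff q t s * schur_function s m)" .
 qed
 also have "\<dots> = (\<Sum>s\<in>?P. (\<Sum>t\<in>evp r. lr_coeff q t s) * schur_function s m)"
 by (subst sum.swap) (simp add: sum_distrib_right)
 finally show ?thesis .
 qed
 show ?thesis by (rule schur_unique[OF finite_parts _ eq p]) (simp add: parts_def)
qed

lemma evp_double: "evp r = map ((*) 2) ` parts r"
proof
 show "map ((*) 2) ` parts r \<subseteq> evp r"
 by (auto simp: evp_def parts_def is_partition_def sorted_wrt_map sum_list_const_mult image_iff)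
 show "evp r \<subseteq> map ((*) 2) ` parts r"
 proof
 fix p assume p: "p : evp r"
 define s where "s = map (%x. x div 2) p"
 have ps: "p = map ((*) 2) s"
 using p by (auto simp: s_def evp_def comp_def intro!: map_idI[symmetric])
 have "2 * sum_list s = 2 * r" using p unfolding ps by (simp add: evp_def parts_def sum_list_const_mult)
 moreover have "is_partition s"
 using p unfolding ps by (auto simp: evp_def parts_def is_partition_def sorted_wrt_map image_iff)
 ultimately show "p : map ((*) 2) ` parts r" using ps by (auto simp: parts_def)
 qed
qed

lemma multiplicity:
 assumes q: "is_partition q"
 shows "(\<Sum>s\<in>{s. is_partition s & sum_list s = r}. lr_coeff q (map ((*) 2) s) p) =
 (if p : parts (sum_list q + 2 * r)
 then fs.dim (cAe (sum_list q + 2 * r) p (fq q r :: ('k::{field, field_char_0}) fna)) else 0)"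
proof -
 have inj: "inj_on (map ((*) (2::nat))) (parts r)" by (rule inj_onI) (auto dest: map_inj_on simp: inj_on_def)
 have "(\<Sum>s\<in>{s. is_partition s & sum_list s = r}. lr_coeff q (map ((*) 2) s) p) = (\<Sum>t\<in>evp r. lr_coeff q t p)"
 unfolding evp_double sum.reindex[OF inj] by (simp add: parts_def)
 moreover have "lr_coeff q t p = 0" if "t : evp r" "p \<notin> parts (sum_list q + 2 * r)" for t
 using that lr_coeff_dim[OF q, of t p] by (auto simp: evp_def parts_def)
 ultimately show ?thesis using dim_fq[OF q, of p r, where 'k='k] by auto
qed

section \<open>Socles of filtered modules\<close>

text \<open>The record of a module carries no axioms. These are the identities of an abelian group
  with additive operators; the scalar -1 provides negatives.\<close>

locale lrep =
 fixes g :: "'g set" and M :: "('k::field, 'g, 'm) rep"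
 assumes zero_carr: "rzero M : rcarr M"
 and add_carr: "x : rcarr M ==> y : rcarr M ==> radd M x y : rcarr M"
 and scale_carr: "x : rcarr M ==> rscale M c x : rcarr M"
 and act_carr: "X : g ==> x : rcarr M ==> ract M X x : rcarr M"
 and add_assoc: "x : rcarr M ==> y : rcarr M ==> z : rcarr M ==> radd M (radd M x y) z = radd M x (radd M y z)"
 and add_comm: "x : rcarr M ==> y : rcarr M ==> radd M x y = radd M y x"
 and add_zero: "x : rcarr M ==> radd M x (rzero M) = x"
 and add_neg: "x : rcarr M ==> radd M x (rscale M (-1) x) = rzero M"
 and scale_add: "x : rcarr M ==> y : rcarr M ==> rscale M c (radd M x y) = radd M (rscale M c x) (rscale M c y)"
 and act_add: "X : g ==> x : rcarr M ==> y : rcarr M ==> ract M X (radd M x y) = radd M (ract M X x) (ract M X y)"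

lemma submodD:
 assumes "submod g M S"
 shows "x : S ==> x : rcarr M" "rzero M : S" "x : S ==> y : S ==> radd M x y : S"
 "x : S ==> rscale M c x : S" "X : g ==> x : S ==> ract M X x : S"
 using assms unfolding submod_def by blast+

context lrep
begin

lemma lrep_sub: "submod g M S ==> lrep g (sub_rep M S)"
 by unfold_locales
 (auto simp: submodD submodD(1)[THEN add_assoc] add_neg scale_add act_add add_zero intro: add_comm)

abbreviation neg :: "'m => 'm" where
 "neg x \<equiv> rscale M (-1) x"

lemma add_left_cancel:
 assumes "x : rcarr M" "y : rcarr M" "z : rcarr M" "radd M x y = radd M x z"
 shows "y = z"
proof -
 have e: "radd M (neg x) (radd M x w) = w" if "w : rcarr M" for w
 proof -
 have "radd M (neg x) (radd M x w) = radd M (radd M (neg x) x) w"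
 using assms(1) that by (simp add: add_assoc scale_carr)
 also have "radd M (neg x) x = rzero M"
 using add_neg[OF assms(1)] add_comm[OF assms(1) scale_carr[OF assms(1)], of "-1"] by simp
 also have "radd M (rzero M) w = w"
 using add_comm[OF zero_carr that] add_zero[OF that] by simp
 finally show ?thesis .
 qed
 have "y = radd M (neg x) (radd M x y)" by (rule e[OF assms(2), symmetric])
 also have "\<dots> = radd M (neg x) (radd M x z)" by (simp only: assms(4))
 also have "\<dots> = z" by (rule e[OF assms(3)])
 finally show ?thesis .
qed

lemma add_zero_left: "x : rcarr M ==> radd M (rzero M) x = x"
 using add_comm[of "rzero M" x] add_zero zero_carr by simp

lemma diff_add: "x : rcarr M ==> y : rcarr M ==> radd M y (radd M x (neg y)) = x"
proof -
 assume x: "x : rcarr M" and y: "y : rcarr M"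
 have "radd M y (radd M x (neg y)) = radd M y (radd M (neg y) x)"
 using x y by (simp add: add_comm[of x "neg y"] scale_carr)
 also have "\<dots> = radd M (radd M y (neg y)) x" using x y by (simp add: add_assoc scale_carr)
 also have "\<dots> = x" using x y by (simp add: add_neg add_zero_left)
 finally show ?thesis .
qed

lemma scale_zero: "rscale M c (rzero M) = rzero M"
proof -
 let ?z = "rscale M c (rzero M)"
 have z: "?z : rcarr M" by (rule scale_carr[OF zero_carr])
 have "radd M ?z ?z = radd M ?z (rzero M)"
 using scale_add[OF zero_carr zero_carr, of c] by (simp add: add_zero[OF zero_carr] add_zero[OF z])
 then show ?thesis by (rule add_left_cancel[OF z z zero_carr])
qed

lemma act_zero: "X : g ==> ract M X (rzero M) = rzero M"
proof -
 assume X: "X : g"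
 let ?z = "ract M X (rzero M)"
 have z: "?z : rcarr M" by (rule act_carr[OF X zero_carr])
 have "radd M ?z ?z = radd M ?z (rzero M)"
 using act_add[OF X zero_carr zero_carr] by (simp add: add_zero[OF zero_carr] add_zero[OF z])
 then show ?thesis by (rule add_left_cancel[OF z z zero_carr])
qed

end

text \<open>The operations on cosets are unions over representatives; invariance under adding
  elements of \<open>N\<close> shows that each union is a single coset.\<close>

locale lrep_quot = lrep +
 fixes N
 assumes N: "submod g M N"
begin

abbreviation q where "q \<equiv> rcoset M N"

lemma NC: "n : N ==> n : rcarr M" by (rule submodD(1)[OF N])

lemma q_add_N:
 assumes x: "x : rcarr M" and n: "n : N"
 shows "q (radd M x n) = q x"
proof
 show "q (radd M x n) \<subseteq> q x"
 using x n by (auto simp: rcoset_def add_assoc NC submodD(3)[OF N] intro!: imageI)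
 show "q x \<subseteq> q (radd M x n)"
 proof
 fix z assume "z : q x"
 then obtain m where m: "m : N" "z = radd M x m" by (auto simp: rcoset_def)
 have nn: "neg n : N" using n by (rule submodD(4)[OF N])
 have "radd M (radd M x n) (radd M m (neg n)) = radd M x (radd M n (radd M m (neg n)))"
 using x n m nn by (simp add: add_assoc NC add_carr)
 also have "radd M n (radd M m (neg n)) = m" using n m by (simp add: diff_add NC)
 finally show "z : q (radd M x n)"
 using m(2) submodD(3)[OF N m(1) nn] unfolding rcoset_def
 by (intro image_eqI[of _ _ "radd M m (neg n)"]) simp_all
 qed
qed

lemma q_self: "x : rcarr M ==> x : q x"
 unfolding rcoset_def by (rule image_eqI[of _ _ "rzero M"]) (simp_all add: add_zero submodD(2)[OF N])

lemma q_eq_iff: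
 assumes "x : rcarr M" "y : rcarr M"
 shows "q x = q y \<longleftrightarrow> radd M x (neg y) : N"
proof
 assume "q x = q y"
 then have "x : q y" using q_self assms by blast
 then obtain n where n: "n : N" "x = radd M y n" by (auto simp: rcoset_def)
 have "radd M y (radd M x (neg y)) = radd M y n" using n diff_add assms by simp
 then have "radd M x (neg y) = n" using assms n by - (rule add_left_cancel[of y], simp_all add: add_carr scale_carr NC)
 then show "radd M x (neg y) : N" using n by simp
next
 assume "radd M x (neg y) : N"
 then show "q x = q y" using q_add_N[OF assms(2), of "radd M x (neg y)"] diff_add assms by simp
qed

lemma q_zero: "q (rzero M) = N"
 by (auto simp: rcoset_def add_zero_left NC image_iff)

lemma q_eq_N: "x : rcarr M ==> q x = N \<longleftrightarrow> x : N"
proof -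
 assume x: "x : rcarr M"
 show ?thesis
 proof
 assume "q x = N" then show "x : N" using q_self[OF x] by simp
 next
 assume n: "x : N"
 have "q (radd M (rzero M) x) = q (rzero M)" by (rule q_add_N[OF zero_carr n])
 then show "q x = N" by (simp add: add_zero_left[OF x] q_zero)
 qed
qed

abbreviation QM where "QM \<equiv> quot_rep M N"

lemma quot_simps [simp]: "rcarr QM = q ` rcarr M" "rzero QM = N"
 by (simp_all add: quot_rep_def)

lemma UN_const: "A ~= {} ==> (!!a. a : A ==> f a = c) ==> (\<Union>a\<in>A. f a) = c"
 by auto

lemma quot_add: "x : rcarr M ==> y : rcarr M ==> radd QM (q x) (q y) = q (radd M x y)"
proof -
 assume x: "x : rcarr M" and y: "y : rcarr M"
 have e: "q (radd M a b) = q (radd M x y)" if ab: "a : q x" "b : q y" for a b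
 proof -
 obtain n m where nm: "n : N" "m : N" "a = radd M x n" "b = radd M y m" using ab by (auto simp: rcoset_def)
 have "radd M a b = radd M (radd M (radd M x y) n) m"
 proof -
 have "radd M a b = radd M x (radd M n (radd M y m))" using x y nm by (simp add: add_assoc add_carr NC)
 also have "radd M n (radd M y m) = radd M (radd M n y) m" using x y nm by (simp add: add_assoc NC)
 also have "radd M n y = radd M y n" using y nm by (simp add: add_comm NC)
 finally show ?thesis using x y nm by (simp add: add_assoc add_carr NC)
 qed
 then show ?thesis using x y nm by (simp add: q_add_N add_carr NC)
 qed
 have ne: "q x ~= {}" "q y ~= {}" using q_self x y by auto
 have "radd QM (q x) (q y) = (\<Union>a\<in>q x. \<Union>b\<in>q y. q (radd M a b))" by (simp add: quot_rep_def)
 also have "\<dots> = q (radd M x y)" by (intro UN_const ne e)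
 finally show ?thesis .
qed

lemma quot_scale: "x : rcarr M ==> rscale QM c (q x) = q (rscale M c x)"
proof -
 assume x: "x : rcarr M"
 have e: "q (rscale M c a) = q (rscale M c x)" if a: "a : q x" for a
 proof -
 obtain n where n: "n : N" "a = radd M x n" using a by (auto simp: rcoset_def)
 then show ?thesis using x by (simp add: scale_add NC q_add_N scale_carr submodD(4)[OF N])
 qed
 have "rscale QM c (q x) = (\<Union>a\<in>q x. q (rscale M c a))" by (simp add: quot_rep_def)
 also have "\<dots> = q (rscale M c x)" by (intro UN_const e) (use q_self x in auto)
 finally show ?thesis .
qed

lemma quot_act: "X : g ==> x : rcarr M ==> ract QM X (q x) = q (ract M X x)"
proof -
 assume X: "X : g" and x: "x : rcarr M"
 have e: "q (ract M X a) = q (ract M X x)" if a: "a : q x" for a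
 proof -
 obtain n where n: "n : N" "a = radd M x n" using a by (auto simp: rcoset_def)
 then show ?thesis using x X by (simp add: act_add NC q_add_N act_carr submodD(5)[OF N])
 qed
 have "ract QM X (q x) = (\<Union>a\<in>q x. q (ract M X a))" by (simp add: quot_rep_def)
 also have "\<dots> = q (ract M X x)" by (intro UN_const e) (use q_self x in auto)
 finally show ?thesis .
qed

lemma quot_submod_image:
 assumes S: "submod g M S"
 shows "submod g QM (q ` S)"
 unfolding submod_def
proof (intro conjI ballI allI)
 show "q ` S \<subseteq> rcarr QM" using submodD(1)[OF S] by auto
 show "rzero QM : q ` S" using submodD(2)[OF S] q_zero by (auto intro!: image_eqI[of _ _ "rzero M"])
 show "radd QM x y : q ` S" if "x : q ` S" "y : q ` S" for x y
 using that submodD(1,3)[OF S] by (auto simp: quot_add intro!: imageI)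
 show "rscale QM c x : q ` S" if "x : q ` S" for c x
 using that submodD(1,4)[OF S] by (auto simp: quot_scale intro!: imageI)
 show "ract QM X x : q ` S" if "X : g" "x : q ` S" for X x
 using that submodD(1,5)[OF S] by (auto simp: quot_act intro!: imageI)
qed

lemma quot_submod_preimage:
 assumes U: "submod g QM U"
 shows "submod g M {x : rcarr M. q x : U}"
 unfolding submod_def
proof (intro conjI ballI allI)
 show "rzero M : {x : rcarr M. q x : U}" using submodD(2)[OF U] q_zero zero_carr by simp
 show "radd M x y : {x : rcarr M. q x : U}" if "x : {x : rcarr M. q x : U}" "y : {x : rcarr M. q x : U}" for x y
 using that submodD(3)[OF U, of "q x" "q y"] by (simp add: quot_add add_carr)
 show "rscale M c x : {x : rcarr M. q x : U}" if "x : {x : rcarr M. q x : U}" for c x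
 using that submodD(4)[OF U, of "q x" c] by (simp add: quot_scale scale_carr)
 show "ract M X x : {x : rcarr M. q x : U}" if "X : g" "x : {x : rcarr M. q x : U}" for X x
 using that submodD(5)[OF U, of X "q x"] by (simp add: quot_act act_carr)
qed auto

end

lemma submod_sub_rep: "submod g M S ==> submod g (sub_rep M S) U \<longleftrightarrow> submod g M U & U \<subseteq> S"
 using submodD(1)[of g M S] by (auto simp: submod_def)

text \<open>The data of one socle step: the maps \<open>P i\<close> identify \<open>F'\<close>
  modulo \<open>N\<close> with a finite sum of simple modules, and a submodule properly above
  \<open>N\<close> has elements of \<open>F'\<close> outside \<open>N\<close>. The second condition
  keeps further simple submodules out of the quotient.\<close>

locale layer = lrep_quot g M N
 for g :: "'g set" and M :: "('k::field, 'g, 'm) rep" and N :: "'m set" +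
 fixes F' :: "'m set" and I :: "'i set" and Di :: "'i => ('k, 'g, 'n) rep" and P :: "'i => 'm => 'n"
 assumes F': "submod g M F'" and NF': "N \<subseteq> F'" and finI: "finite I"
 and Di: "i : I ==> lrep g (Di i)" and simple: "i : I ==> simple_rep g (Di i)"
 and P_carr: "i : I ==> x : F' ==> P i x : rcarr (Di i)"
 and P_add: "i : I ==> x : F' ==> y : F' ==> P i (radd M x y) = radd (Di i) (P i x) (P i y)"
 and P_scale: "i : I ==> x : F' ==> P i (rscale M c x) = rscale (Di i) c (P i x)"
 and P_act: "i : I ==> X : g ==> x : F' ==> P i (ract M X x) = ract (Di i) X (P i x)"
 and P_surj: "(!!i. i : I ==> f i : rcarr (Di i)) ==> \<exists>x\<in>F'. \<forall>i\<in>I. P i x = f i"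
 and P_kernel: "x : F' ==> (\<forall>i\<in>I. P i x = rzero (Di i)) \<longleftrightarrow> x : N"
 and essential: "submod g M S ==> N \<subseteq> S ==> S ~= N ==> \<exists>y\<in>S. y : F' & y \<notin> N"
begin

lemma F'C: "x : F' ==> x : rcarr M" by (rule submodD(1)[OF F'])

lemma q_eq_P:
 assumes "x : F'" "y : F'" "!!i. i : I ==> P i x = P i y"
 shows "q x = q y"
proof -
 have "P i (radd M x (neg y)) = rzero (Di i)" if i: "i : I" for i
 using assms lrep.add_neg[OF Di[OF i] P_carr[OF i assms(2)]] i by (simp add: P_add P_scale submodD(4)[OF F'])
 then have "radd M x (neg y) : N"
 using P_kernel[OF submodD(3)[OF F' assms(1) submodD(4)[OF F' assms(2)]]] by blast
 then show ?thesis using q_eq_iff assms F'C by simp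
qed

lemma P_zero: "i : I ==> P i (rzero M) = rzero (Di i)"
 using P_kernel[OF submodD(2)[OF F']] submodD(2)[OF N] by blast

text \<open>The preimage in \<open>F'\<close> of the summand with index \<open>i\<close>; it
  contains \<open>N\<close>, and its image modulo \<open>N\<close> is a copy of
  \<open>Di i\<close>.\<close>

definition Fi :: "'i => 'm set" where
 "Fi i = {z : F'. \<forall>j\<in>I. j ~= i --> P j z = rzero (Di j)}"

lemma Fi_submod: "submod g M (Fi i)"
 unfolding submod_def
proof (intro conjI ballI allI)
 show "Fi i \<subseteq> rcarr M" using F'C by (auto simp: Fi_def)
 show "rzero M : Fi i" by (simp add: Fi_def submodD(2)[OF F'] P_zero)
 show "radd M x y : Fi i" if "x : Fi i" "y : Fi i" for x y
 using that lrep.add_zero[OF Di lrep.zero_carr[OF Di]] by (auto simp: Fi_def P_add submodD(3)[OF F'])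
 show "rscale M c x : Fi i" if "x : Fi i" for c x
 using that lrep.scale_zero[OF Di] by (auto simp: Fi_def P_scale submodD(4)[OF F'])
 show "ract M X x : Fi i" if "X : g" "x : Fi i" for X x
 using that lrep.act_zero[OF Di] by (auto simp: Fi_def P_act submodD(5)[OF F'])
qed

lemma Fi_lift:
 assumes i: "i : I" and t: "t : rcarr (Di i)"
 obtains z where "z : Fi i" "P i z = t"
proof -
 have "\<exists>x\<in>F'. \<forall>j\<in>I. P j x = (if j = i then t else rzero (Di j))"
 by (rule P_surj) (use t lrep.zero_carr[OF Di] in auto)
 then obtain z where "z : F'" "\<forall>j\<in>I. P j z = (if j = i then t else rzero (Di j))" by blast
 then show ?thesis using i by (intro that[of z]) (simp_all add: Fi_def)
qed

text \<open>A submodule of the image is pulled back to \<open>Fi i\<close> and pushed forward to the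
  simple module \<open>Di i\<close>, where only two possibilities are left.\<close>

lemma Fi_simple:
 assumes i: "i : I"
 shows "simple_rep g (sub_rep QM (q ` Fi i))"
proof -
 interpret D: lrep g "Di i" by (rule Di[OF i])
 have S: "submod g QM (q ` Fi i)" by (rule quot_submod_image[OF Fi_submod])
 have FiC: "x : rcarr M" "x : F'" if "x : Fi i" for x using that F'C by (auto simp: Fi_def)
 have inN: "x : N" if "x : Fi i" "P i x = rzero (Di i)" for x
 using that P_kernel[OF FiC(2)[OF that(1)]] by (auto simp: Fi_def)
 have same: "q x = q y" if "x : Fi i" "y : Fi i" "P i x = P i y" for x y
 proof (rule q_eq_P)
 fix j assume "j : I"
 then show "P j x = P j y" using that by (cases "j = i") (auto simp: Fi_def)
 qed (use that FiC in auto)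
 have ne: "q ` Fi i ~= {N}"
 proof
 assume h: "q ` Fi i = {N}"
 obtain t where t: "t : rcarr (Di i)" "t ~= rzero (Di i)"
 using simple[OF i] D.zero_carr unfolding simple_rep_def by blast
 obtain z where z: "z : Fi i" "P i z = t" by (rule Fi_lift[OF i t(1)])
 have "q z = N" using h z(1) by blast
 then have "z : N" using q_eq_N[OF FiC(1)[OF z(1)]] by simp
 then have "P i z = rzero (Di i)" using P_kernel[OF FiC(2)[OF z(1)]] i by blast
 then show False using z t by simp
 qed
 have "U = {N} \<or> U = q ` Fi i" if U: "submod g (sub_rep QM (q ` Fi i)) U" for U
 proof -
 have U1: "submod g QM U" and U2: "U \<subseteq> q ` Fi i" using U submod_sub_rep[OF S] by auto
 let ?W = "{z : Fi i. q z : U}"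
 have W: "submod g M ?W"
 proof -
 have "?W = Fi i \<inter> {x : rcarr M. q x : U}" using FiC by auto
 then show ?thesis using Fi_submod[of i] quot_submod_preimage[OF U1] by (auto simp: submod_def)
 qed
 have "submod g (Di i) (P i ` ?W)"
 unfolding submod_def
 proof (intro conjI ballI allI)
 show "P i ` ?W \<subseteq> rcarr (Di i)" using P_carr[OF i] FiC by auto
 show "rzero (Di i) : P i ` ?W" by (rule image_eqI[where f="P i", OF P_zero[OF i, symmetric] submodD(2)[OF W]])
 show "radd (Di i) x y : P i ` ?W" if xy: "x : P i ` ?W" "y : P i ` ?W" for x y
 proof -
 obtain a b where ab: "a : ?W" "b : ?W" "x = P i a" "y = P i b" using xy by blast
 then have "radd (Di i) x y = P i (radd M a b)" using P_add[OF i] FiC(2) by simp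
 then show ?thesis using submodD(3)[OF W ab(1,2)] by blast
 qed
 show "rscale (Di i) c x : P i ` ?W" if x: "x : P i ` ?W" for c x
 proof -
 obtain a where a: "a : ?W" "x = P i a" using x by blast
 then have "rscale (Di i) c x = P i (rscale M c a)" using P_scale[OF i] FiC(2) by simp
 then show ?thesis using submodD(4)[OF W a(1), of c] by blast
 qed
 show "ract (Di i) X x : P i ` ?W" if X: "X : g" and x: "x : P i ` ?W" for X x
 proof -
 obtain a where a: "a : ?W" "x = P i a" using x by blast
 then have "ract (Di i) X x = P i (ract M X a)" using P_act[OF i X] FiC(2) by simp
 then show ?thesis using submodD(5)[OF W X a(1)] by blast
 qed
 qed
 then consider "P i ` ?W = {rzero (Di i)}" | "P i ` ?W = rcarr (Di i)"
 using simple[OF i] unfolding simple_rep_def by blast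
 then show ?thesis
 proof cases
 case 1
 have "u = N" if u: "u : U" for u
 proof -
 obtain z where z: "z : Fi i" "u = q z" using U2 u by blast
 then have "P i z = rzero (Di i)" using 1 u by blast
 then have "z : N" using inN z by simp
 then show ?thesis using q_eq_N[OF FiC(1)[OF z(1)]] z(2) by simp
 qed
 moreover have "N : U" using submodD(2)[OF U1] by simp
 ultimately show ?thesis by blast
 next
 case 2
 have "q z : U" if z: "z : Fi i" for z
 proof -
 have "P i z : P i ` ?W" unfolding 2 using P_carr[OF i] FiC(2)[OF z] by simp
 then obtain w where "w : ?W" "P i z = P i w" by blast
 then show ?thesis using same[OF z, of w] by simp
 qed
 then show ?thesis using U2 by blast
 qed
 qed
 then show ?thesis using ne by (simp add: simple_rep_def)
qed

lemma foldr_q: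
 assumes "!!i. i : set is ==> f i : F'"
 shows "foldr (radd M) (map f is) (rzero M) : F' &
 foldr (radd QM) (map (%i. q (f i)) is) N = q (foldr (radd M) (map f is) (rzero M))"
 using assms
proof (induction "is")
 case Nil
 then show ?case by (simp add: submodD(2)[OF F'] q_zero)
next
 case (Cons i "is")
 then show ?case using F'C by (simp add: submodD(3)[OF F'] quot_add)
qed

text \<open>By \<open>essential\<close> a simple submodule of the quotient meets the image of
  \<open>F'\<close> and hence lies in it. Conversely an element of \<open>F'\<close> is, modulo
  \<open>N\<close>, the sum of lifts of its components.\<close>

lemma soc_quot: "{x : rcarr M. q x : soc g QM} = F'"
proof
 let ?SS = "\<Union> {S. submod g QM S & simple_rep g (sub_rep QM S)}"
 have sub: "?SS \<subseteq> q ` F'"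
 proof
 fix u assume "u : ?SS"
 then obtain S where S: "submod g QM S" "simple_rep g (sub_rep QM S)" "u : S" by blast
 let ?S = "{x : rcarr M. q x : S}"
 have pre: "submod g M ?S" by (rule quot_submod_preimage[OF S(1)])
 have NS: "N : S" using submodD(2)[OF S(1)] by simp
 have "N \<subseteq> ?S"
 proof
 fix x assume x: "x : N"
 then have "q x = N" using q_eq_N[OF NC[OF x]] by simp
 then show "x : ?S" using NS NC[OF x] by simp
 qed
 moreover have "?S ~= N"
 proof
 assume h: "?S = N"
 have "s = N" if s: "s : S" for s
 proof -
 obtain x where x: "x : rcarr M" "s = q x" using submodD(1)[OF S(1) s] by auto
 then have "x : N" using h s by blast
 then show ?thesis using q_eq_N[OF x(1)] x(2) by simp
 qed
 then have "S = {N}" using NS by blast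
 then show False using S(2) by (simp add: simple_rep_def)
 qed
 ultimately obtain y where y: "y : ?S" "y : F'" "y \<notin> N" using essential[OF pre] by blast
 let ?T = "q ` (?S \<inter> F')"
 have "submod g M (?S \<inter> F')" using pre F' by (auto simp: submod_def)
 then have T: "submod g QM ?T" by (rule quot_submod_image)
 have "?T \<subseteq> S" by auto
 then have "submod g (sub_rep QM S) ?T" using submod_sub_rep[OF S(1)] T by blast
 then have "?T = {N} \<or> ?T = S" using S(2) by (auto simp: simple_rep_def)
 moreover have "?T ~= {N}"
 proof
 assume "?T = {N}"
 then have "q y = N" using y by blast
 then show False using q_eq_N[OF F'C[OF y(2)]] y(3) by simp
 qed
 ultimately have "u : ?T" using S(3) by blast
 then show "u : q ` F'" by blast
 qed
 have fold: "foldr (radd QM) zs N : q ` F'" if "set zs \<subseteq> ?SS" for zs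
 using that
 proof (induction zs)
 case Nil
 show ?case using submodD(2)[OF F'] q_zero by (auto intro!: image_eqI[of _ _ "rzero M"])
 next
 case (Cons z zs)
 then have "z : q ` F'" "foldr (radd QM) zs N : q ` F'" using sub by auto
 then show ?case using F'C submodD(3)[OF F'] by (auto simp: quot_add intro!: imageI)
 qed
 show "{x : rcarr M. q x : soc g QM} \<subseteq> F'"
 proof
 fix x assume "x : {x : rcarr M. q x : soc g QM}"
 then obtain zs where x: "x : rcarr M" "q x = foldr (radd QM) zs N" "set zs \<subseteq> ?SS" by (auto simp: soc_def)
 then obtain y where y: "y : F'" "q x = q y" using fold[OF x(3)] by auto
 then have d: "radd M x (neg y) : F'" using q_eq_iff[OF x(1) F'C[OF y(1)]] NF' by blast
 have "radd M y (radd M x (neg y)) = x" by (rule diff_add[OF x(1) F'C[OF y(1)]])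
 then show "x : F'" using submodD(3)[OF F' y(1) d] by simp
 qed
 show "F' \<subseteq> {x : rcarr M. q x : soc g QM}"
 proof
 fix y assume y: "y : F'"
 obtain "is" where is': "distinct is" "set is = I" using finite_distinct_list[OF finI] by blast
 define f where "f i = (SOME z. z : Fi i & P i z = P i y)" for i
 have f: "f i : Fi i" "P i (f i) = P i y" if i: "i : I" for i
 proof -
 have "\<exists>z. z : Fi i & P i z = P i y" using Fi_lift[OF i P_carr[OF i y]] by metis
 from someI_ex[OF this] show "f i : Fi i" "P i (f i) = P i y" by (auto simp: f_def)
 qed
 have fF: "f i : F'" if "i : I" for i using f(1)[OF that] by (simp add: Fi_def)
 have Pf: "P j (f i) = rzero (Di j)" if "i : I" "j : I" "j ~= i" for i j
 using f(1)[OF that(1)] that by (simp add: Fi_def)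
 \<comment> \<open>The list has no repetitions, so each component of a partial sum is either final
   or still zero.\<close>
 have *: "P j (foldr (radd M) (map f js) (rzero M)) = (if j : set js then P j y else rzero (Di j))"
 if j: "j : I" and js: "set js \<subseteq> I" "distinct js" for j js
 using js
 proof (induction js)
 case Nil
 then show ?case by (simp add: P_zero[OF j])
 next
 case (Cons i js)
 have rest: "foldr (radd M) (map f js) (rzero M) : F'" using foldr_q[of js f] fF Cons.prems by auto
 have "P j (foldr (radd M) (map f (i # js)) (rzero M)) = radd (Di j) (P j (f i)) (if j : set js then P j y else rzero (Di j))"
 using Cons rest fF by (simp add: P_add[OF j])
 moreover have "P j (f i) = (if j = i then P j y else rzero (Di j))"
 using Cons.prems f(2)[OF j] Pf[of i j] j by auto
 moreover have "i \<notin> set js" using Cons.prems by simp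
 ultimately show ?case
 using lrep.add_zero[OF Di[OF j] P_carr[OF j y]] lrep.add_zero_left[OF Di[OF j] P_carr[OF j y]]
 lrep.add_zero[OF Di[OF j] lrep.zero_carr[OF Di[OF j]]]
 by (cases "j = i") simp_all
 qed
 let ?s = "foldr (radd M) (map f is) (rzero M)"
 have s: "?s : F'" "foldr (radd QM) (map (%i. q (f i)) is) N = q ?s" using foldr_q[of "is" f] fF is' by auto
 have "q y = q ?s" by (rule q_eq_P[OF y s(1)]) (use * is' in simp)
 then have "q y = foldr (radd QM) (map (%i. q (f i)) is) (rzero QM)" using s(2) by simp
 moreover have "set (map (%i. q (f i)) is) \<subseteq> ?SS"
 proof
 fix u assume "u : set (map (%i. q (f i)) is)"
 then obtain i where i: "i : I" "u = q (f i)" using is' by auto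
 then have "u : q ` Fi i" using f(1) by blast
 then show "u : ?SS" using quot_submod_image[OF Fi_submod] Fi_simple[OF i(1)] by blast
 qed
 ultimately have "q y : soc g QM" unfolding soc_def by blast
 then show "y : {x : rcarr M. q x : soc g QM}" using F'C[OF y] by simp
 qed
qed

lemma layer_iso: "rep_iso g (quot_rep (sub_rep M F') N) (direct_sum_rep I Di)"
proof -
 let ?D = "direct_sum_rep I Di"
 let ?L = "quot_rep (sub_rep M F') N"
 interpret S: lrep g "sub_rep M F'" by (rule lrep_sub[OF F'])
 interpret L: lrep_quot g "sub_rep M F'" N
 by unfold_locales (use submod_sub_rep[OF F'] N NF' in blast)
 have qq: "rcoset (sub_rep M F') N = q" by (auto simp: rcoset_def fun_eq_iff)
 define \<Psi> where "\<Psi> x = (\<lambda>i\<in>I. P i x)" for x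
 \<comment> \<open>The chosen representative is immaterial, since representatives differ by elements
   of \<open>N\<close>, the common kernel of the \<open>P i\<close>.\<close>
 define G where "G A = \<Psi> (SOME x. x : F' & A = q x)" for A
 have GQ: "G (q x) = \<Psi> x" if x: "x : F'" for x
 proof -
 let ?y = "SOME y. y : F' & q x = q y"
 have y: "?y : F' & q x = q ?y" by (rule someI[of _ x]) (use x in simp)
 have "P i x = P i ?y" if i: "i : I" for i
 proof -
 have "radd M x (neg ?y) : N" using q_eq_iff[of x ?y] x y F'C by simp
 then have "P i (radd M x (neg ?y)) = rzero (Di i)" using P_kernel[of "radd M x (neg ?y)"] NF' i by blast
 then have "radd (Di i) (P i x) (rscale (Di i) (-1) (P i ?y)) = rzero (Di i)"
 using x y i by (simp add: P_add P_scale submodD(4)[OF F'])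
 then show ?thesis
 using lrep.diff_add[OF Di[OF i] P_carr[OF i x] P_carr[OF i, of ?y]] lrep.add_zero[OF Di[OF i] P_carr[OF i, of ?y]] y by simp
 qed
 then show ?thesis unfolding G_def \<Psi>_def by (intro restrict_ext) simp
 qed
 have carrD: "rcarr ?D = (\<Pi>\<^sub>E i\<in>I. rcarr (Di i))"
 using finI by (auto simp: direct_sum_rep_def)
 have "bij_betw G (rcarr ?L) (rcarr ?D)"
 unfolding bij_betw_def
 proof
 show "inj_on G (rcarr ?L)"
 proof (rule inj_onI)
 fix A B assume "A : rcarr ?L" "B : rcarr ?L" and eq: "G A = G B"
 then obtain x y where xy: "x : F'" "A = q x" "y : F'" "B = q y" using qq by auto
 have "\<Psi> x = \<Psi> y" using eq by (simp only: xy GQ[OF xy(1)] GQ[OF xy(3)])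
 have "P i x = P i y" if "i : I" for i
 using fun_cong[OF \<open>\<Psi> x = \<Psi> y\<close>, of i] that unfolding \<Psi>_def by simp
 then show "A = B" unfolding xy(2,4) by (intro q_eq_P[OF xy(1,3)])
 qed
 show "G ` rcarr ?L = rcarr ?D"
 proof
 show "G ` rcarr ?L \<subseteq> rcarr ?D"
 unfolding carrD using qq GQ P_carr by (auto simp: \<Psi>_def)
 show "rcarr ?D \<subseteq> G ` rcarr ?L"
 proof
 fix f assume f: "f : rcarr ?D"
 then obtain x where x: "x : F'" "\<forall>i\<in>I. P i x = f i" using P_surj[of f] unfolding carrD by auto
 have "\<Psi> x = f" unfolding \<Psi>_def using x f carrD by (auto simp: PiE_def extensional_def)
 then show "f : G ` rcarr ?L" using GQ[OF x(1)] x(1) qq by (auto intro!: image_eqI[of _ _ "q x"])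
 qed
 qed
 qed
 moreover have "\<forall>A\<in>rcarr ?L. \<forall>B\<in>rcarr ?L. G (radd ?L A B) = radd ?D (G A) (G B)"
 using L.quot_add qq GQ submodD(3)[OF F'] P_add by (auto simp: \<Psi>_def direct_sum_rep_def)
 moreover have "\<forall>c. \<forall>A\<in>rcarr ?L. G (rscale ?L c A) = rscale ?D c (G A)"
 using L.quot_scale qq GQ submodD(4)[OF F'] P_scale by (auto simp: \<Psi>_def direct_sum_rep_def)
 moreover have "\<forall>X\<in>g. \<forall>A\<in>rcarr ?L. G (ract ?L X A) = ract ?D X (G A)"
 using L.quot_act qq GQ submodD(5)[OF F'] P_act by (auto simp: \<Psi>_def direct_sum_rep_def)
 ultimately show ?thesis unfolding rep_iso_def by blast
qed

end

text \<open>An injective map compatible with the operations carries the identities over from its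
  target; for tensors this avoids computing with cosets of cosets.\<close>

lemma lrep_realized:
 fixes \<psi> :: "'m => 'w::ab_group_add" and M :: "('k::field, 'g, 'm) rep"
 assumes inj: "inj_on \<psi> (rcarr M)"
 and z: "rzero M : rcarr M" "\<psi> (rzero M) = 0"
 and add: "!!x y. x : rcarr M ==> y : rcarr M ==> radd M x y : rcarr M & \<psi> (radd M x y) = \<psi> x + \<psi> y"
 and scale: "!!c x. x : rcarr M ==> rscale M c x : rcarr M & \<psi> (rscale M c x) = s c (\<psi> x)"
 and act: "!!X x. X : g ==> x : rcarr M ==> ract M X x : rcarr M & \<psi> (ract M X x) = \<rho> X (\<psi> x)"
 and s: "!!c x y. s c (x + y) = s c x + s c y" "!!x. s (-1) x = - x"
 and \<rho>: "!!X x y. X : g ==> \<rho> X (x + y) = \<rho> X x + \<rho> X y"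
 shows "lrep g M"
proof unfold_locales
 fix x y z assume "x : rcarr M" "y : rcarr M" "z : rcarr M"
 then show "radd M (radd M x y) z = radd M x (radd M y z)"
 using add by (intro inj_onD[OF inj]) (simp_all add: add.assoc)
next
 fix x y assume xy: "x : rcarr M" "y : rcarr M"
 then show "radd M x y = radd M y x"
 using add by (intro inj_onD[OF inj]) (simp_all add: add.commute)
 show "rscale M c (radd M x y) = radd M (rscale M c x) (rscale M c y)" for c
 using xy add scale by (intro inj_onD[OF inj]) (simp_all add: s)
 show "ract M X (radd M x y) = radd M (ract M X x) (ract M X y)" if "X : g" for X
 using xy add act that by (intro inj_onD[OF inj]) (simp_all add: \<rho>)
next
 fix x assume "x : rcarr M"
 then show "radd M x (rzero M) = x" "radd M x (rscale M (-1) x) = rzero M"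
 using add scale z by (auto intro!: inj_onD[OF inj] simp: s)
qed (use z add scale act in auto)

section \<open>Hyperbolic bases\<close>

context countable_orthogonal_space
begin

lemma Q_add_left: "Q (x + y) w = Q x w + Q y w"
 and Q_scale_left: "Q (scale c x) w = c * Q x w"
 using Q_linear_left[of w] by (simp_all add: Vector_Spaces.linear_iff)

lemma Q_add_right: "Q w (x + y) = Q w x + Q w y"
 and Q_scale_right: "Q w (scale c x) = c * Q w x"
 using Q_linear_right[of w] by (simp_all add: Vector_Spaces.linear_iff)

lemma Q_zero [simp]: "Q 0 w = 0" "Q w 0 = 0"
 using Q_scale_left[of 0 0 w] Q_scale_right[of w 0 0] by simp_all

lemma Q_neg: "Q (- x) w = - Q x w" "Q w (- x) = - Q w x"
 using Q_scale_left[of "-1" x w] Q_scale_right[of w "-1" x] by simp_all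

lemma Q_diff_left: "Q (x - y) w = Q x w - Q y w"
 using Q_add_left[of x "- y" w] by (simp add: Q_neg)

lemma Q_diff_right: "Q w (x - y) = Q w x - Q w y"
 using Q_add_right[of w x "- y"] by (simp add: Q_neg)

lemma Q_sum_left: "Q (sum f A) w = (\<Sum>a\<in>A. Q (f a) w)"
 by (induction A rule: infinite_finite_induct) (simp_all add: Q_add_left)

lemma Q_sum_right: "Q w (sum f A) = (\<Sum>a\<in>A. Q w (f a))"
 by (induction A rule: infinite_finite_induct) (simp_all add: Q_add_right)

lemmas Q_simps = Q_add_left Q_add_right Q_scale_left Q_scale_right Q_diff_left Q_diff_right Q_sum_left Q_sum_right Q_neg

definition hyp :: "(nat => 'v) => nat => bool" where
 "hyp h n \<longleftrightarrow> (\<forall>a<2 * n. \<forall>b<2 * n. Q (h a) (h b) = (if b = star a then 1 else 0))"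

text \<open>The vector dual to \<open>h a\<close> is \<open>h (star a)\<close>, hence the
  coefficients of this orthogonal projection.\<close>

definition perp :: "(nat => 'v) => nat => 'v => 'v" where
 "perp h n v = v - (\<Sum>a<2 * n. scale (Q v (h (star a))) (h a))"

lemma perp_orth:
 assumes h: "hyp h n" and b: "b < 2 * n"
 shows "Q (perp h n v) (h b) = 0"
proof -
 have sb: "star b < 2 * n" using b by (simp add: star_less)
 have "(\<Sum>a<2 * n. Q v (h (star a)) * Q (h a) (h b)) = (\<Sum>a<2 * n. if a = star b then Q v (h b) else 0)"
 using h b by (intro sum.cong refl) (auto simp: hyp_def)
 also have "\<dots> = Q v (h b)" using sb by simp
 finally show ?thesis by (simp add: perp_def Q_simps)
qed

lemma Q_perp_right:
 assumes "!!b. b < 2 * n ==> Q w (h b) = 0"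
 shows "Q w (perp h n v) = Q w v"
 using assms by (simp add: perp_def Q_simps)

lemma perp_span: "v - perp h n v : span (h ` {..<2 * n})"
 unfolding perp_def by (simp, intro span_sum span_scale span_base imageI)

lemma not_finite_span:
 assumes "finite T"
 shows "span T ~= UNIV"
proof
 assume T: "span T = UNIV"
 obtain B where "infinite B" "\<not> dependent B" using countable_basis by blast
 then show False using independent_span_bound[OF assms, of B] T by auto
qed

lemma hyp_extend_pair:
 assumes h: "hyp h n" and x: "!!b. b < 2 * n ==> Q x (h b) = 0" and y: "!!b. b < 2 * n ==> Q y (h b) = 0"
 and xy: "Q x x = 0" "Q y y = 0" "Q x y = 1"
 shows "hyp (h(2 * n := x, Suc (2 * n) := y)) (Suc n)"
proof -
 let ?h = "h(2 * n := x, Suc (2 * n) := y)"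
 have yx: "Q y x = 1" using xy(3) Q_symmetric[of x y] by simp
 have x': "Q (h b) x = 0" and y': "Q (h b) y = 0" if "b < 2 * n" for b
 using x[OF that] y[OF that] Q_symmetric by metis+
 have s1: "star (2 * n) = Suc (2 * n)" "star (Suc (2 * n)) = 2 * n" by (auto simp: star_def)
 have s2: "star a ~= 2 * n" "star a ~= Suc (2 * n)" if "a < 2 * n" for a
 using star_less[of "2 * n" a] that by auto
 show ?thesis
 unfolding hyp_def
 proof (intro allI impI)
 fix a b assume ab: "a < 2 * Suc n" "b < 2 * Suc n"
 have that1: "a < 2 * n \<or> a = 2 * n \<or> a = Suc (2 * n)" and that2: "b < 2 * n \<or> b = 2 * n \<or> b = Suc (2 * n)"
 using ab by auto
 show "Q (?h a) (?h b) = (if b = star a then 1 else 0)"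
 using that1 that2
 by (elim disjE; simp add: x y x' y' xy yx s1 s2 s2[symmetric] h[unfolded hyp_def, rule_format])
 qed
qed

text \<open>A new hyperbolic pair is found in the orthogonal complement of the old ones, chosen so
  that its span contains the component of \<open>v\<close> there.\<close>

lemma hyp_extend:
 assumes h: "hyp h n"
 shows "\<exists>h'. hyp h' (Suc n) & (\<forall>a<2 * n. h' a = h a) & v : span (h' ` {..<2 * Suc n})"
proof -
 let ?U = "span (h ` {..<2 * n})"
 \<comment> \<open>Every step adds a pair, so when \<open>v\<close> is already covered some vector
   outside the span takes its place.\<close>
 obtain b where b: "b \<notin> ?U" "v : ?U \<or> v = b"
 proof (cases "v : ?U")
 case True
 obtain b where "b \<notin> ?U" using not_finite_span[of "h ` {..<2 * n}"] by auto
 then show ?thesis using that True by blast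
 qed (use that in blast)
 define b' where "b' = perp h n b"
 have b'o: "Q b' (h a) = 0" if "a < 2 * n" for a unfolding b'_def by (rule perp_orth[OF h that])
 have bb': "b - b' : ?U" unfolding b'_def by (rule perp_span)
 then have b'0: "b' ~= 0" using b(1) by auto
 have "\<exists>x y. (\<forall>a<2 * n. Q x (h a) = 0) & (\<forall>a<2 * n. Q y (h a) = 0) &
 Q x x = 0 & Q y y = 0 & Q x y = 1 & b' : span {x, y}"
 proof (cases "Q b' b' = 0")
 \<comment> \<open>For isotropic \<open>b'\<close> a vector pairing to one with it becomes isotropic
   after subtracting half its norm times \<open>b'\<close>.\<close>
 case True
 obtain w where w: "Q b' w ~= 0" using Q_nondegenerate[of b'] b'0 by blast
 define w1 where "w1 = scale (inverse (Q b' w)) (perp h n w)"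
 have w1o: "Q w1 (h a) = 0" if "a < 2 * n" for a
 using perp_orth[OF h that, of w] by (simp add: w1_def Q_simps)
 have bw: "Q b' w1 = 1" using w Q_perp_right[of n b' h w, OF b'o] by (simp add: w1_def Q_simps)
 then have wb: "Q w1 b' = 1" using Q_symmetric[of w1 b'] by simp
 define y where "y = w1 - scale (Q w1 w1 / 2) b'"
 have "Q y (h a) = 0" if "a < 2 * n" for a using w1o[OF that] b'o[OF that] by (simp add: y_def Q_simps)
 moreover have "Q b' y = 1" using bw True by (simp add: y_def Q_simps)
 moreover have "Q y y = 0" using bw wb True by (simp add: y_def Q_simps)
 ultimately show ?thesis using b'o True by (intro exI[of _ b'] exI[of _ y]) (auto simp: span_base)
 next
 \<comment> \<open>Otherwise a vector \<open>w\<close> orthogonal to \<open>b'\<close> and of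
   opposite norm makes both \<open>b' + w\<close> and \<open>b' - w\<close> isotropic.\<close>
 case False
 define c where "c = Q b' b'"
 have c: "c ~= 0" using False by (simp add: c_def)
 define pr where "pr v = perp h n v - scale (Q (perp h n v) b' / c) b'" for v
 have pro: "Q (pr v) (h a) = 0" if "a < 2 * n" for a v
 using perp_orth[OF h that, of v] b'o[OF that] by (simp add: pr_def Q_simps)
 have prb: "Q (pr v) b' = 0" for v using c by (simp add: pr_def Q_simps c_def[symmetric])
 have Qpr: "Q u (pr v) = Q u v" if "!!a. a < 2 * n ==> Q u (h a) = 0" "Q u b' = 0" for u v
 using Q_perp_right[of n u h v, OF that(1)] that(2) by (simp add: pr_def Q_simps)
 \<comment> \<open>If all of these vectors were isotropic, polarization would make the form vanish
   between them, non-degeneracy would make them zero, and the space would be spanned by finitely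
   many vectors.\<close>
 have "\<exists>u. Q (pr u) (pr u) ~= 0"
 proof (rule ccontr)
 assume "\<nexists>u. Q (pr u) (pr u) ~= 0"
 then have iso: "Q (pr u) (pr u) = 0" for u by blast
 have pradd: "pr (u + v) = pr u + pr v" for u v
 proof -
 have "perp h n (u + v) = perp h n u + perp h n v"
 by (simp add: perp_def Q_add_left scale_left_distrib sum.distrib add_diff_add)
 then show ?thesis
 by (simp add: pr_def Q_add_left add_divide_distrib scale_left_distrib add_diff_add)
 qed
 have "Q (pr u) (pr v) = 0" for u v
 proof -
 have "0 = Q (pr (u + v)) (pr (u + v))" by (rule iso[symmetric])
 also have "\<dots> = Q (pr u) (pr v) + Q (pr v) (pr u)"
 unfolding pradd by (simp add: Q_simps iso)
 also have "Q (pr v) (pr u) = Q (pr u) (pr v)" by (rule Q_symmetric)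
 also have "Q (pr u) (pr v) + Q (pr u) (pr v) = 2 * Q (pr u) (pr v)" by (rule mult_2[symmetric])
 finally show ?thesis by simp
 qed
 then have "Q (pr u) v = 0" for u v using Qpr[of "pr u" v] pro prb by simp
 then have pr0: "pr u = 0" for u using Q_nondegenerate by blast
 have "u : span (insert b' (h ` {..<2 * n}))" for u
 proof -
 have "u = (u - perp h n u) + scale (Q (perp h n u) b' / c) b'" using pr0[of u] by (simp add: pr_def)
 also have "\<dots> : span (insert b' (h ` {..<2 * n}))"
 using perp_span[of u h n] span_mono[of "h ` {..<2 * n}" "insert b' (h ` {..<2 * n})"]
 by (intro span_add span_scale) (auto intro: span_base)
 finally show ?thesis .
 qed
 then show False using not_finite_span[of "insert b' (h ` {..<2 * n})"] by auto
 qed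
 then obtain u where u: "Q (pr u) (pr u) ~= 0" by blast
 \<comment> \<open>The square root exists because the field is algebraically closed.\<close>
 obtain s where s: "s ^ 2 = - c / Q (pr u) (pr u)" using nth_root_exists[of 2] by auto
 define w where "w = scale s (pr u)"
 have wo: "Q w (h a) = 0" if "a < 2 * n" for a using pro[OF that, of u] by (simp add: w_def Q_simps)
 have wb: "Q w b' = 0" "Q b' w = 0" using prb[of u] Q_symmetric[of b' w] by (auto simp: w_def Q_simps)
 have ww: "Q w w = - c"
 proof -
 have "Q w w = s ^ 2 * Q (pr u) (pr u)" by (simp add: w_def Q_simps power2_eq_square)
 then show ?thesis using s u by simp
 qed
 define x where "x = b' + w"
 define y where "y = scale (1 / (2 * c)) (b' - w)"
 have "Q x (h a) = 0" "Q y (h a) = 0" if "a < 2 * n" for a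
 using wo[OF that] b'o[OF that] by (simp_all add: x_def y_def Q_simps)
 moreover have "Q x x = 0" "Q y y = 0" using wb ww by (simp_all add: x_def y_def Q_simps c_def[symmetric])
 moreover have "Q x y = 1" using wb ww c by (simp add: x_def y_def Q_simps c_def[symmetric] field_simps)
 moreover have "b' : span {x, y}"
 proof -
 have "scale c y = scale (1 / 2) (b' - w)" using c by (simp add: y_def)
 then have "scale (1 / 2) x + scale c y = scale (1 / 2) (b' + b')" by (simp add: x_def scale_right_distrib[symmetric])
 also have "\<dots> = scale (1 / 2 + 1 / 2) b'" by (simp only: scale_left_distrib scale_right_distrib)
 also have "\<dots> = b'" by simp
 finally have "b' = scale (1 / 2) x + scale c y" by simp
 also have "\<dots> : span {x, y}" by (intro span_add span_scale span_base) auto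
 finally show ?thesis .
 qed
 ultimately show ?thesis by blast
 qed
 then obtain x y where xy: "!!a. a < 2 * n ==> Q x (h a) = 0" "!!a. a < 2 * n ==> Q y (h a) = 0"
 "Q x x = 0" "Q y y = 0" "Q x y = 1" "b' : span {x, y}" by blast
 let ?h = "h(2 * n := x, Suc (2 * n) := y)"
 have img: "h ` {..<2 * n} \<subseteq> ?h ` {..<2 * Suc n}" "{x, y} \<subseteq> ?h ` {..<2 * Suc n}"
 proof -
 show "h ` {..<2 * n} \<subseteq> ?h ` {..<2 * Suc n}"
 proof (rule image_subsetI)
 fix a assume "a : {..<2 * n}"
 then show "h a : ?h ` {..<2 * Suc n}" by (intro image_eqI[of _ _ a]) auto
 qed
 have "x : ?h ` {..<2 * Suc n}" by (rule image_eqI[of _ _ "2 * n"]) auto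
 moreover have "y : ?h ` {..<2 * Suc n}" by (rule image_eqI[of _ _ "Suc (2 * n)"]) auto
 ultimately show "{x, y} \<subseteq> ?h ` {..<2 * Suc n}" by blast
 qed
 have U: "?U \<subseteq> span (?h ` {..<2 * Suc n})" by (rule span_mono[OF img(1)])
 have "b' : span (?h ` {..<2 * Suc n})" using xy(6) span_mono[OF img(2)] by blast
 moreover have "b = (b - b') + b'" by simp
 ultimately have "b : span (?h ` {..<2 * Suc n})" using bb' U by (metis span_add subsetD)
 then have "v : span (?h ` {..<2 * Suc n})" using b(2) U by blast
 moreover have "hyp ?h (Suc n)" by (rule hyp_extend_pair[OF h xy(1,2,3,4,5)])
 ultimately show ?thesis by (intro exI[of _ ?h]) auto
qed

text \<open>The vectors of a countable basis are absorbed one by one. Earlier pairs are never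
  changed, so the pairs of all stages fit together.\<close>

lemma hyperbolic_basis:
 "\<exists>h. (\<forall>a b. Q (h a) (h b) = (if b = star a then 1 else 0)) & span (range h) = UNIV"
proof -
 obtain B where B: "countable B" "infinite B" "span B = UNIV" using countable_basis by blast
 define e where "e = from_nat_into B"
 have e: "range e = B" unfolding e_def by (rule range_from_nat_into[OF _ B(1)]) (use B(2) in auto)
 have "\<exists>f. \<forall>n. hyp (f n) n & ((\<forall>a<2 * n. f (Suc n) a = f n a) & e n : span (f (Suc n) ` {..<2 * Suc n}))"
 proof (rule dependent_nat_choice)
 show "\<exists>x. hyp x 0" by (simp add: hyp_def)
 fix x n assume "hyp x n"
 from hyp_extend[OF this, of "e n"]
 show "\<exists>y. hyp y (Suc n) & (\<forall>a<2 * n. y a = x a) & e n : span (y ` {..<2 * Suc n})" by simp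
 qed
 then obtain f where f: "!!n. hyp (f n) n" "!!n a. a < 2 * n ==> f (Suc n) a = f n a"
 "!!n. e n : span (f (Suc n) ` {..<2 * Suc n})" by blast
 have stable': "f m a = f n a" if "a < 2 * n" "n <= m" for a n m
 using that(2) by (induction rule: dec_induct) (use that(1) f(2) in auto)
 \<comment> \<open>Since \<open>a < 2 * Suc a\<close>, the vector with index \<open>a\<close> is
   settled by stage \<open>Suc a\<close>.\<close>
 define h where "h a = f (Suc a) a" for a
 have hf: "h a = f n a" if "a < 2 * n" for a n
 proof (cases "n <= Suc a")
 case True
 then show ?thesis using stable'[OF that True] by (simp add: h_def)
 next
 case False
 then show ?thesis using stable'[of a "Suc a" n] by (simp add: h_def)
 qed
 have "Q (h a) (h b) = (if b = star a then 1 else 0)" for a b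
 proof -
 let ?n = "Suc (max a b)"
 have "h a = f ?n a" "h b = f ?n b" by (auto intro: hf)
 then show ?thesis using f(1)[of ?n] by (simp add: hyp_def)
 qed
 moreover have "span (range h) = UNIV"
 proof -
 have "e n : span (range h)" for n
 proof -
 have "f (Suc n) ` {..<2 * Suc n} \<subseteq> range h" using hf[of _ "Suc n"] by (metis image_subsetI lessThan_iff rangeI)
 then show ?thesis using f(3)[of n] span_mono by blast
 qed
 then have "B \<subseteq> span (range h)" using e by auto
 then have "span B \<subseteq> span (range h)" by (rule span_minimal) simp
 then show ?thesis using B(3) by auto
 qed
 ultimately show ?thesis by blast
qed

end

section \<open>Tensor powers in coordinates\<close>

definition upd :: "fn => nat => nat => fn" where
 "upd w i b = Fn ((app w)(i := b))"

definition trc :: "nat => fn => fn" where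
 "trc e w = Fn (%i. if i < e then app w i else i)"

lemma app_upd [simp]: "app (upd w i b) j = (if j = i then b else app w j)"
 by (simp add: upd_def)

lemma app_trc [simp]: "app (trc e w) j = (if j < e then app w j else j)"
 by (simp add: trc_def)

lemma Wd_upd [simp]: "w : Wd d ==> i < d ==> upd w i b : Wd d"
 by (simp add: Wd_def)

lemma Wd_trc [simp]: "trc e w : Wd e"
 by (simp add: Wd_def)

lemma Wd_eqI: "w : Wd d ==> w' : Wd d ==> (!!i. i < d ==> app w i = app w' i) ==> w = w'"
 by (rule fn_eqI) (metis (mono_tags, lifting) Wd_def linorder_not_le mem_Collect_eq)

text \<open>The contraction of the positions \<open>e\<close> and \<open>Suc e\<close> at the end of
  a word: basis letters pair to one with their partner and to zero with all others.\<close>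

definition Ph1 :: "nat => ('k::field) fna => 'k fna" where
 "Ph1 e = lin_ext (%w. if app w (Suc e) = star (app w e) then sg (trc e w) else 0)"

lemma klin_Ph1: "klin (Ph1 e)"
 unfolding Ph1_def by (rule klin_lin_ext)

lemma Ph1_sg: "Ph1 e (sg w) = (if app w (Suc e) = star (app w e) then sg (trc e w) else 0)"
 by (simp add: Ph1_def)

locale hyperbolic_space = countable_orthogonal_space scale Q
 for scale :: "'k::{alg_closed_field, field_char_0} => 'v::ab_group_add => 'v" and Q +
 fixes h :: "nat => 'v"
 assumes Q_h: "Q (h a) (h b) = (if b = star a then 1 else 0)"
 and span_h: "span (range h) = UNIV"
begin

text \<open>The coordinate at \<open>h a\<close>, because pairing with \<open>h (star a)\<close> is
  the dual functional.\<close>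

definition cf :: "'v => nat => 'k" where
 "cf v a = Q v (h (star a))"

lemma cf_simps: "cf (x + y) a = cf x a + cf y a" "cf (scale c x) a = c * cf x a" "cf 0 a = 0"
 "cf (h b) a = (if a = b then 1 else 0)"
 by (auto simp: cf_def Q_simps Q_h star_eq_iff)

lemma finite_cf: "finite {a. cf v a ~= 0}"
proof -
 have "v : span (range h)" by (simp add: span_h)
 then show ?thesis
 proof (induction rule: span_induct_alt)
 case base
 show ?case by (simp add: cf_simps)
 next
 case (step c x y)
 then obtain b where "x = h b" by blast
 then have "{a. cf (scale c x + y) a ~= 0} \<subseteq> insert b {a. cf y a ~= 0}" by (auto simp: cf_simps)
 then show ?case using step.IH by (meson finite_insert finite_subset)
 qed
qed

definition kap :: "nat => 'v list => 'k fna" where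
 "kap d vs = Abs_poly_mapping (%w. if w : Wd d then \<Prod>i<d. cf (vs ! i) (app w i) else 0)"

lemma lookup_kap: "lookup (kap d vs) w = (if w : Wd d then \<Prod>i<d. cf (vs ! i) (app w i) else 0)"
proof -
 let ?B = "(%f. Fn (%i. if i < d then f i else i)) ` (PiE {..<d} (%i. {a. cf (vs ! i) a ~= 0}))"
 have "{w. (if w : Wd d then \<Prod>i<d. cf (vs ! i) (app w i) else 0) ~= 0} \<subseteq> ?B"
 proof
 fix w assume "w : {w. (if w : Wd d then \<Prod>i<d. cf (vs ! i) (app w i) else 0) ~= 0}"
 then have w: "w : Wd d" "!!i. i < d ==> cf (vs ! i) (app w i) ~= 0" by (auto split: if_splits)
 show "w : ?B"
 proof (rule image_eqI)
 show "w = Fn (%i. if i < d then restrict (app w) {..<d} i else i)"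
 by (rule fn_eqI) (use w(1) in \<open>simp add: Wd_def\<close>)
 show "restrict (app w) {..<d} : (\<Pi>\<^sub>E i\<in>{..<d}. {a. cf (vs ! i) a ~= 0})"
 using w(2) by (intro PiE_I) simp_all
 qed
 qed
 moreover have "finite ?B" by (intro finite_imageI finite_PiE) (simp_all add: finite_cf)
 ultimately have "finite {w. (if w : Wd d then \<Prod>i<d. cf (vs ! i) (app w i) else 0) ~= 0}" by (rule finite_subset)
 then show ?thesis unfolding kap_def by (simp add: lookup_Abs_poly_mapping)
qed

lemma kap_Tn [simp]: "kap d vs : Tn d"
 by (rule supp_onI) (simp add: lookup_kap)

lemma lookup_kap_update:
 assumes "length vs = d" "i < d" "w : Wd d"
 shows "lookup (kap d (vs[i := u])) w = cf u (app w i) * (\<Prod>j\<in>{..<d} - {i}. cf (vs ! j) (app w j))"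
proof -
 have "(\<Prod>j\<in>{..<d} - {i}. cf (vs[i := u] ! j) (app w j)) = (\<Prod>j\<in>{..<d} - {i}. cf (vs ! j) (app w j))"
 by (rule prod.cong) auto
 then show ?thesis using assms by (simp add: lookup_kap prod.remove[of "{..<d}" i])
qed

definition mlin :: "nat => ('v list => 'k fna) => bool" where
 "mlin d G \<longleftrightarrow> (\<forall>vs i. length vs = d --> i < d -->
 (\<forall>u w. G (vs[i := u + w]) = G (vs[i := u]) + G (vs[i := w])) &
 (\<forall>c u. G (vs[i := scale c u]) = fscale c (G (vs[i := u]))))"

lemma mlinI:
 assumes "!!vs i u w. length vs = d ==> i < d ==> G (vs[i := u + w]) = G (vs[i := u]) + G (vs[i := w])"
 "!!vs i c u. length vs = d ==> i < d ==> G (vs[i := scale c u]) = fscale c (G (vs[i := u]))"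
 shows "mlin d G"
 using assms by (simp add: mlin_def)

lemma mlinD:
 assumes "mlin d G" "length vs = d" "i < d"
 shows "G (vs[i := u + w]) = G (vs[i := u]) + G (vs[i := w])" "G (vs[i := scale c u]) = fscale c (G (vs[i := u]))"
 using assms by (simp_all add: mlin_def)

lemma mlin_kap: "mlin d (kap d)"
proof (rule mlinI)
 fix vs :: "'v list" and i u w c assume a: "length vs = d" "i < d"
 show "kap d (vs[i := u + w]) = kap d (vs[i := u]) + kap d (vs[i := w])"
 proof (rule poly_mapping_eqI)
 fix x
 show "lookup (kap d (vs[i := u + w])) x = lookup (kap d (vs[i := u]) + kap d (vs[i := w])) x"
 by (cases "x : Wd d") (simp_all add: lookup_add lookup_kap_update a cf_simps distrib_right, simp add: lookup_kap)
 qed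
 show "kap d (vs[i := scale c u]) = fscale c (kap d (vs[i := u]))"
 proof (rule poly_mapping_eqI)
 fix x
 show "lookup (kap d (vs[i := scale c u])) x = lookup (fscale c (kap d (vs[i := u]))) x"
 by (cases "x : Wd d") (simp_all add: lookup_kap_update a cf_simps, simp add: lookup_kap)
 qed
qed

lemma mlin_klin: "klin F ==> mlin d G ==> mlin d (%vs. F (G vs))"
 by (rule mlinI) (simp_all add: mlinD klinD)

lemma mlin_sum: "(!!j. j : J ==> mlin d (G j)) ==> mlin d (%vs. \<Sum>j\<in>J. G j vs)"
 unfolding mlin_def by (simp add: sum.distrib[symmetric] fs.scale_sum_right)

lemma mlin_rels:
 assumes G: "mlin d G" and t: "t : tensor_rels scale d"
 shows "lin_ext G t = 0"
proof -
 have k: "klin (lin_ext G)" by (rule klin_lin_ext)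
 have "fs.subspace {t. lin_ext G t = 0}"
 by (auto simp: fs.subspace_def klinD[OF k])
 moreover have "{single (vs[i := u + w]) 1 - single (vs[i := u]) 1 - single (vs[i := w]) 1
 |vs i u w. length vs = d & i < d} \<union>
 {single (vs[i := scale c u]) 1 - single (vs[i := u]) c
 |vs i c u. length vs = d & i < d} \<subseteq> {t. lin_ext G t = 0}"
 by (auto simp: klinD[OF k] mlinD[OF G])
 ultimately have "tensor_rels scale d \<subseteq> {t. lin_ext G t = 0}"
 unfolding tensor_rels_def by (intro fs.span_minimal)
 then show ?thesis using t by auto
qed

definition wrd :: "nat => fn => 'v list" where
 "wrd d w = map (%i. h (app w i)) [0..<d]"

lemma wrd_simps [simp]: "length (wrd d w) = d" "i < d ==> wrd d w ! i = h (app w i)"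
 by (simp_all add: wrd_def)

lemma wrd_upd: "i < d ==> (wrd d w)[i := h b] = wrd d (upd w i b)"
 by (rule nth_equalityI) (simp_all add: nth_list_update)

lemma kap_wrd [simp]:
 assumes "w : Wd d"
 shows "kap d (wrd d w) = sg w"
proof (rule poly_mapping_eqI)
 fix x
 show "lookup (kap d (wrd d w)) x = lookup (sg w) x"
 proof (cases "x = w")
 case True
 then show ?thesis using assms by (simp add: lookup_kap cf_simps)
 next
 case False
 have "lookup (kap d (wrd d w)) x = 0"
 proof (cases "x : Wd d")
 case True
 then obtain i where i: "i < d" "app x i ~= app w i" using False Wd_eqI[OF True assms] by blast
 have "(\<Prod>i<d. cf (wrd d w ! i) (app x i)) = 0"
 by (rule prod_zero) (use i in \<open>auto simp: cf_simps\<close>)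
 then show ?thesis by (simp add: lookup_kap)
 qed (simp add: lookup_kap)
 then show ?thesis using False by (simp add: lookup_single)
 qed
qed

abbreviation wl :: "nat => 'k fna => ('v list \<Rightarrow>\<^sub>0 'k)" where
 "wl d \<equiv> lin_ext (%w. single (wrd d w) 1)"

lemma subspace_rels: "fs.subspace (tensor_rels scale d)"
 by (simp add: tensor_rels_def fs.subspace_span)

text \<open>Entries are expanded in basis vectors one position at a time. In the induction
  \<open>k\<close> is the number of leading positions whose entries may still be arbitrary.\<close>

lemma rels_diff:
 assumes "length vs = d"
 shows "single vs 1 - wl d (kap d vs) : tensor_rels scale d"
proof -
 have k: "klin (wl d)" by (rule klin_lin_ext)
 have "k <= d ==> (!!i. k <= i ==> i < d ==> vs ! i : range h) ==> length vs = d ==>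
 single vs 1 - wl d (kap d vs) : tensor_rels scale d" for k vs
 proof (induction k arbitrary: vs)
 case 0
 define w where "w = Fn (%i. if i < d then (SOME a. h a = vs ! i) else i)"
 have w: "w : Wd d" by (simp add: w_def Wd_def)
 have "vs = wrd d w"
 proof (rule nth_equalityI)
 fix i assume "i < length vs"
 then have i: "i < d" using 0 by simp
 then have "\<exists>a. h a = vs ! i" using 0(2)[of i] by auto
 from someI_ex[OF this] show "vs ! i = wrd d w ! i" using i by (simp add: w_def)
 qed (simp add: 0)
 then show ?case using w by (simp add: fs.subspace_0[OF subspace_rels])
 next
 case (Suc k)
 define D where "D u = single (vs[k := u]) 1 - wl d (kap d (vs[k := u]))" for u
 have kd: "k < d" using Suc.prems by simp
 note len = \<open>length vs = d\<close>
 have base: "D (h a) : tensor_rels scale d" for a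
 unfolding D_def
 proof (rule Suc.IH)
 fix i assume "k <= i" "i < d"
 then show "vs[k := h a] ! i : range h" using Suc.prems(2)[of i] len by (cases "i = k") simp_all
 qed (use kd len in auto)
 have step: "D (scale c x + y) : tensor_rels scale d" if "D x : tensor_rels scale d" "D y : tensor_rels scale d" for c x y
 proof -
 let ?g1 = "single (vs[k := scale c x + y]) 1 - single (vs[k := scale c x]) 1 - single (vs[k := y]) (1::'k)"
 let ?g2 = "single (vs[k := scale c x]) 1 - single (vs[k := x]) c"
 have g: "?g1 : tensor_rels scale d" "?g2 : tensor_rels scale d"
 unfolding tensor_rels_def by (rule fs.span_base, use kd len in blast)+
 have "D (scale c x + y) = ?g1 + ?g2 + fscale c (D x) + D y"
 by (simp add: D_def mlinD[OF mlin_kap len kd] klinD[OF k] fs.scale_right_diff_distrib)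
 also have "\<dots> : tensor_rels scale d"
 by (intro fs.subspace_add[OF subspace_rels] fs.subspace_scale[OF subspace_rels] g that)
 finally show ?thesis .
 qed
 have zero: "D 0 : tensor_rels scale d"
 proof -
 let ?g2 = "single (vs[k := scale 0 0]) 1 - single (vs[k := 0]) (0::'k)"
 have "?g2 : tensor_rels scale d"
 unfolding tensor_rels_def by (rule fs.span_base) (use kd len in blast)
 moreover have "kap d (vs[k := 0]) = 0" using mlinD(2)[OF mlin_kap len kd, of 0 0] by simp
 ultimately show ?thesis by (simp add: D_def klinD[OF k])
 qed
 have "vs ! k : span (range h)" by (simp add: span_h)
 then have "D (vs ! k) : tensor_rels scale d"
 proof (induction rule: span_induct_alt)
 case (step c x y)
 then show ?case using base \<open>!!c x y. D x : _ ==> D y : _ ==> D (scale c x + y) : _\<close> by blast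
 qed (rule zero)
 then show ?case by (simp add: D_def)
 qed
 from this[of d vs] show ?thesis using assms by simp
qed

text \<open>A multilinear map kills the tensor relations, and modulo these a list equals its
  expansion in basis words.\<close>

lemma mlin_eq:
 assumes "mlin d G" "length vs = d"
 shows "G vs = lin_ext (%w. G (wrd d w)) (kap d vs)"
proof -
 have k: "klin (lin_ext G)" by (rule klin_lin_ext)
 have "lin_ext G (single vs 1 - wl d (kap d vs)) = 0"
 by (rule mlin_rels[OF assms(1) rels_diff[OF assms(2)]])
 then have "G vs = lin_ext G (wl d (kap d vs))" by (simp add: klinD[OF k])
 also have "\<dots> = lin_ext (%w. G (wrd d w)) (kap d vs)"
 by (rule klin_eqI[OF klin_comp[OF k klin_lin_ext] klin_lin_ext]) simp
 finally show ?thesis .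
qed

lemma mlin_eqI:
 assumes "mlin d G" "mlin d H" "!!w. w : Wd d ==> G (wrd d w) = H (wrd d w)" "length vs = d"
 shows "G vs = H vs"
proof -
 have "lin_ext (%w. G (wrd d w)) (kap d vs) = lin_ext (%w. H (wrd d w)) (kap d vs)"
 by (rule klin_eqI[OF klin_lin_ext klin_lin_ext]) (simp add: assms(3) supp_onD[OF kap_Tn])
 then show ?thesis using mlin_eq[OF assms(1,4)] mlin_eq[OF assms(2,4)] by simp
qed

section \<open>The tensor power as a space with coordinates\<close>

abbreviation Free :: "nat => ('v list \<Rightarrow>\<^sub>0 'k) set" where
 "Free d \<equiv> supp_on {vs. length vs = d}"

lemma free_carr: "rcarr (free_rep d :: ('k, 'v => 'v, 'v list \<Rightarrow>\<^sub>0 'k) rep) = Free d"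
 by (auto simp: free_rep_def supp_on_def)

definition coord :: "nat => ('v list \<Rightarrow>\<^sub>0 'k) => 'k fna" where
 "coord d = lin_ext (kap d)"

lemma klin_coord: "klin (coord d)"
 unfolding coord_def by (rule klin_lin_ext)

lemma coord_single [simp]: "coord d (single vs c) = fscale c (kap d vs)"
 by (simp add: coord_def)

lemma coord_Tn [simp]: "coord d t : Tn d"
 by (simp add: coord_def lin_ext_def)

lemma coord_wl: "x : Tn d ==> coord d (wl d x) = x"
 by (rule klin_eqI[OF klin_comp[OF klin_coord klin_lin_ext] klin_id]) (simp add: supp_onD)

lemma wl_Free [simp]: "wl d x : Free d"
 by (simp add: lin_ext_def)

text \<open>An element of the free space differs from the lift of its coordinates by relations
  only.\<close>

lemma rels_iff:
 assumes "t : Free d"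
 shows "t : tensor_rels scale d \<longleftrightarrow> coord d t = 0"
proof
 assume "t : tensor_rels scale d"
 then show "coord d t = 0" unfolding coord_def by (rule mlin_rels[OF mlin_kap])
next
 assume z: "coord d t = 0"
 define F where "F t = t - wl d (coord d t)" for t
 have F: "klin F" unfolding F_def
 by (rule klinI) (simp_all add: klinD[OF klin_coord] klinD[OF klin_lin_ext] fs.scale_right_diff_distrib)
 have "F t = (\<Sum>a\<in>keys t. fscale (lookup t a) (F (single a 1)))"
 by (rule klin_expand[OF F])
 also have "\<dots> : tensor_rels scale d"
 by (intro fs.subspace_sum[OF subspace_rels] fs.subspace_scale[OF subspace_rels])
 (use supp_onD[OF assms] rels_diff in \<open>auto simp: F_def\<close>)
 finally show "t : tensor_rels scale d" using z by (simp add: F_def klinD[OF klin_lin_ext])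
qed

abbreviation cst :: "nat => ('v list \<Rightarrow>\<^sub>0 'k) => ('k, 'v) tensor" where
 "cst d \<equiv> rcoset (free_rep d) (tensor_rels scale d)"

lemma cst_def: "cst d t = (+) t ` tensor_rels scale d"
 by (simp add: rcoset_def free_rep_def)

lemma cst_self: "t : cst d t"
 unfolding cst_def by (rule image_eqI[of _ _ 0]) (simp_all add: fs.subspace_0[OF subspace_rels])

lemma coord_cst: "s : cst d t ==> coord d s = coord d t"
 unfolding cst_def coord_def by (auto simp: klinD[OF klin_lin_ext] mlin_rels[OF mlin_kap])

lemma rels_Free: "t : tensor_rels scale d ==> t : Free d"
proof -
 have "tensor_rels scale d \<subseteq> Free d"
 unfolding tensor_rels_def by (rule fs.span_minimal[OF _ subspace_supp_on]) auto
 then show "t : tensor_rels scale d ==> t : Free d" by auto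
qed

lemma cst_Free: "t : Free d ==> s : cst d t ==> s : Free d"
 unfolding cst_def using rels_Free by auto

lemma cst_eqI:
 assumes "s : Free d" "t : Free d" "coord d s = coord d t"
 shows "cst d s = cst d t"
proof -
 have *: "cst d s \<subseteq> cst d t" if "s : Free d" "t : Free d" "coord d s = coord d t" for s t
 proof
 fix z assume "z : cst d s"
 then have z: "coord d z = coord d t" "z : Free d" using coord_cst cst_Free that by auto
 then have "z - t : tensor_rels scale d" using that by (subst rels_iff) (simp_all add: klinD[OF klin_coord])
 then show "z : cst d t" unfolding cst_def by (rule image_eqI[rotated]) simp
 qed
 show ?thesis using *[OF assms] *[OF assms(2,1)] assms(3) by simp
qed

lemma tpow_simps: "rcarr (tpow scale d) = cst d ` Free d"
 "rzero (tpow scale d) = tensor_rels scale d"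
 "radd (tpow scale d) A B = (\<Union>a\<in>A. \<Union>b\<in>B. cst d (a + b))"
 "rscale (tpow scale d) c A = (\<Union>a\<in>A. cst d (fscale c a))"
 "ract (tpow scale d) X A = tmap scale d (leibniz X) A"
proof -
 have f: "radd (free_rep d) = (+)" "rscale (free_rep d) = fscale" "ract (free_rep d) X = lin_ext (leibniz X)"
 by (simp_all add: free_rep_def)
 show "rcarr (tpow scale d) = cst d ` Free d"
 unfolding free_carr[symmetric] by (simp add: tpow_def quot_rep_def)
 show "rzero (tpow scale d) = tensor_rels scale d"
 "radd (tpow scale d) A B = (\<Union>a\<in>A. \<Union>b\<in>B. cst d (a + b))"
 "rscale (tpow scale d) c A = (\<Union>a\<in>A. cst d (fscale c a))"
 "ract (tpow scale d) X A = tmap scale d (leibniz X) A"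
 by (simp_all add: tpow_def quot_rep_def f tmap_def)
qed

text \<open>All representatives of a class have the same coordinates, so any of them will do. The
  map identifies the tensor power with \<open>Tn d\<close>.\<close>

definition psi :: "nat => ('k, 'v) tensor => 'k fna" where
 "psi d A = coord d (SOME t. t : A)"

lemma psi_cst: "psi d (cst d t) = coord d t"
 unfolding psi_def by (rule coord_cst, rule someI, rule cst_self)

lemma psi_coord: "A : rcarr (tpow scale d) ==> t : A ==> coord d t = psi d A & t : Free d"
 unfolding tpow_simps using psi_cst coord_cst cst_Free by fastforce

lemma tpow_nonempty: "A : rcarr (tpow scale d) ==> A ~= {}"
 unfolding tpow_simps using cst_self by blast

lemma psi_inj: "inj_on (psi d) (rcarr (tpow scale d))"
proof (rule inj_onI)
 fix A B assume "A : rcarr (tpow scale d)" "B : rcarr (tpow scale d)" and e: "psi d A = psi d B"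
 then obtain s t where st: "s : Free d" "t : Free d" "A = cst d s" "B = cst d t"
 unfolding tpow_simps by blast
 then have "coord d s = coord d t" using e by (simp only: psi_cst)
 then show "A = B" unfolding st(3,4) by (rule cst_eqI[OF st(1,2)])
qed

lemma psi_Tn [simp]: "psi d A : Tn d"
 by (simp add: psi_def)

lemma psi_surj: "x : Tn d ==> \<exists>A\<in>rcarr (tpow scale d). psi d A = x"
 unfolding tpow_simps by (intro bexI[of _ "cst d (wl d x)"]) (simp_all add: psi_cst coord_wl)

lemma psi_zero: "rzero (tpow scale d) : rcarr (tpow scale d)" "psi d (rzero (tpow scale d)) = 0"
proof -
 have "rzero (tpow scale d) = cst d 0" by (simp add: tpow_simps cst_def)
 then show "rzero (tpow scale d) : rcarr (tpow scale d)" "psi d (rzero (tpow scale d)) = 0"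
 by (simp_all add: tpow_simps(1) psi_cst klinD[OF klin_coord] del: cst_def)
qed

lemma UN_cst:
 assumes "A ~= {}" "!!a. a : A ==> f a : Free d & coord d (f a) = y"
 shows "(\<Union>a\<in>A. cst d (f a)) : rcarr (tpow scale d) & psi d (\<Union>a\<in>A. cst d (f a)) = y"
proof -
 obtain b where b: "b : A" using assms(1) by blast
 have "cst d (f a) = cst d (f b)" if "a : A" for a
 using assms(2)[OF that] assms(2)[OF b] by (intro cst_eqI) auto
 then have "(\<Union>a\<in>A. cst d (f a)) = cst d (f b)" using b by blast
 then show ?thesis using assms(2)[OF b] by (simp add: tpow_simps psi_cst)
qed

lemma psi_add:
 assumes "A : rcarr (tpow scale d)" "B : rcarr (tpow scale d)"
 shows "radd (tpow scale d) A B : rcarr (tpow scale d) & psi d (radd (tpow scale d) A B) = psi d A + psi d B"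
proof -
 have "(\<Union>a\<in>A. \<Union>b\<in>B. cst d (a + b)) = (\<Union>z\<in>A\<times>B. cst d (fst z + snd z))" by fastforce
 moreover have "(\<Union>z\<in>A\<times>B. cst d (fst z + snd z)) : rcarr (tpow scale d) & psi d (\<Union>z\<in>A\<times>B. cst d (fst z + snd z)) = psi d A + psi d B"
 by (rule UN_cst) (use tpow_nonempty assms psi_coord in \<open>auto simp: klinD[OF klin_coord]\<close>)
 ultimately show ?thesis by (simp add: tpow_simps(3))
qed

lemma psi_scale:
 assumes "A : rcarr (tpow scale d)"
 shows "rscale (tpow scale d) c A : rcarr (tpow scale d) & psi d (rscale (tpow scale d) c A) = fscale c (psi d A)"
 unfolding tpow_simps(4)
 by (rule UN_cst) (use tpow_nonempty assms psi_coord in \<open>auto simp: klinD[OF klin_coord]\<close>)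

text \<open>The transfer principle behind the Lie algebra action, the contractions and the
  symmetrizers: it is enough to find a linear map of coordinates that is correct on pure
  tensors.\<close>

lemma psi_tmap:
 assumes f: "!!vs. length vs = d ==> f vs : Free e"
 and F: "!!vs. length vs = d ==> coord e (f vs) = F (kap d vs)" "klin F"
 and A: "A : rcarr (tpow scale d)"
 shows "tmap scale e f A : rcarr (tpow scale e) & psi e (tmap scale e f A) = F (psi d A)"
 unfolding tmap_def
proof (rule UN_cst)
 fix a assume "a : A"
 then have a: "coord d a = psi d A" "a : Free d" using psi_coord[OF A] by auto
 have "coord e (lin_ext f a) = F (coord d a)"
 by (rule klin_eqI[OF klin_comp[OF klin_coord klin_lin_ext] klin_comp[OF F(2) klin_coord]])
 (use supp_onD[OF a(2)] F(1) in auto)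
 moreover have "lin_ext f a : Free e"
 unfolding lin_ext_def by (intro supp_on_closed f) (use supp_onD[OF a(2)] in auto)
 ultimately show "lin_ext f a : Free e & coord e (lin_ext f a) = F (psi d A)" using a by simp
qed (rule tpow_nonempty[OF A])

section \<open>The Leibniz action in coordinates\<close>

definition lb :: "nat => ('v => 'v) => 'v list => 'k fna" where
 "lb d X vs = (\<Sum>i<d. kap d (vs[i := X (vs ! i)]))"

definition dact :: "nat => ('v => 'v) => 'k fna => 'k fna" where
 "dact d X = lin_ext (%w. lb d X (wrd d w))"

lemma klin_dact: "klin (dact d X)"
 unfolding dact_def by (rule klin_lin_ext)

lemma dact_Tn [simp]: "dact d X x : Tn d"
 by (simp add: dact_def lin_ext_def lb_def)

lemma mlin_lb:
 assumes X: "Vector_Spaces.linear scale scale X"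
 shows "mlin d (lb d X)"
proof -
 have X': "X (u + w) = X u + X w" "X (scale c u) = scale c (X u)" for u w c
 using X by (simp_all add: Vector_Spaces.linear_iff)
 have "mlin d (%vs. kap d (vs[j := X (vs ! j)]))" if j: "j < d" for j
 proof (rule mlinI)
 fix vs :: "'v list" and i u w c assume a: "length vs = d" "i < d"
 show "kap d (vs[i := u + w, j := X (vs[i := u + w] ! j)]) =
 kap d (vs[i := u, j := X (vs[i := u] ! j)]) + kap d (vs[i := w, j := X (vs[i := w] ! j)])"
 using a j by (cases "i = j") (simp_all add: X' mlinD[OF mlin_kap] list_update_swap[of i j])
 show "kap d (vs[i := scale c u, j := X (vs[i := scale c u] ! j)]) =
 fscale c (kap d (vs[i := u, j := X (vs[i := u] ! j)]))"
 using a j by (cases "i = j") (simp_all add: X' mlinD[OF mlin_kap] list_update_swap[of i j])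
 qed
 then show ?thesis unfolding lb_def by (intro mlin_sum) simp
qed

lemma dact_kap:
 assumes "Vector_Spaces.linear scale scale X" "length vs = d"
 shows "dact d X (kap d vs) = lb d X vs"
 unfolding dact_def by (rule mlin_eq[OF mlin_lb[OF assms(1)] assms(2), symmetric])

lemma psi_act:
 assumes X: "Vector_Spaces.linear scale scale X" and A: "A : rcarr (tpow scale d)"
 shows "ract (tpow scale d) X A : rcarr (tpow scale d) & psi d (ract (tpow scale d) X A) = dact d X (psi d A)"
 unfolding tpow_simps(5)
proof (rule psi_tmap[OF _ _ klin_dact A])
 fix vs :: "'v list" assume vs: "length vs = d"
 show "leibniz X vs : Free d" by (simp add: leibniz_def vs)
 show "coord d (leibniz X vs) = dact d X (kap d vs)"
 by (simp add: dact_kap[OF X vs] leibniz_def lb_def vs klinD[OF klin_coord])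
qed

text \<open>Reindexing the product of coordinates by \<open>s\<close>; here moving tensor positions
  becomes right multiplication.\<close>

lemma kap_permute:
 assumes s: "s : Pm d"
 shows "kap d (map (%j. vs ! app s j) [0..<d]) = kap d vs * sg s"
proof (rule poly_mapping_eqI)
 fix w
 have W: "w + pinv s : Wd d \<longleftrightarrow> w : Wd d"
 using Wd_add[of w d "pinv s"] Wd_add[of "w + pinv s" d s] s by (auto simp: add.assoc)
 have p: "app s permutes {..<d}" by (rule Pm_app[OF s])
 have "(\<Prod>i<d. cf (vs ! app s i) (app w i)) = (\<Prod>i<d. cf (vs ! i) (app w (inv (app s) i)))"
 using prod.permute[OF p, of "%i. cf (vs ! i) (app w (inv (app s) i))"]
 by (simp add: o_def permutes_inverses[OF p])
 then show "lookup (kap d (map (%j. vs ! app s j) [0..<d])) w = lookup (kap d vs * sg s) w"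
 by (simp add: lookup_mult_sg[OF s] lookup_kap W app_pinv)
qed

lemma kap_take:
 assumes "length vs = Suc (Suc e)"
 shows "Ph1 e (kap (Suc (Suc e)) vs) = fscale (Q (vs ! e) (vs ! Suc e)) (kap e (take e vs))"
proof (rule mlin_eqI[OF mlin_klin[OF klin_Ph1 mlin_kap] _ _ assms])
 show "mlin (Suc (Suc e)) (%vs. fscale (Q (vs ! e) (vs ! Suc e)) (kap e (take e vs)))"
 proof (rule mlinI)
 fix vs :: "'v list" and i u w c assume a: "length vs = Suc (Suc e)" "i < Suc (Suc e)"
 then consider "i < e" | "i = e" | "i = Suc e" by linarith
 note c3 = this
 have l: "length (take e vs) = e" using a by simp
 show "fscale (Q (vs[i := u + w] ! e) (vs[i := u + w] ! Suc e)) (kap e (take e (vs[i := u + w]))) =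
 fscale (Q (vs[i := u] ! e) (vs[i := u] ! Suc e)) (kap e (take e (vs[i := u]))) +
 fscale (Q (vs[i := w] ! e) (vs[i := w] ! Suc e)) (kap e (take e (vs[i := w])))"
 using c3 by cases (use a l in \<open>simp_all add: take_update_swap mlinD[OF mlin_kap l] fs.scale_right_distrib Q_simps fs.scale_left_distrib list_update_beyond\<close>)
 show "fscale (Q (vs[i := scale c u] ! e) (vs[i := scale c u] ! Suc e)) (kap e (take e (vs[i := scale c u]))) =
 fscale c (fscale (Q (vs[i := u] ! e) (vs[i := u] ! Suc e)) (kap e (take e (vs[i := u]))))"
 using c3 by cases (use a l in \<open>simp_all add: take_update_swap mlinD[OF mlin_kap l] Q_simps mult.commute list_update_beyond\<close>)
 qed
 fix w assume w: "w : Wd (Suc (Suc e))"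
 have "take e (wrd (Suc (Suc e)) w) = wrd e (trc e w)"
 by (rule nth_equalityI) simp_all
 then show "Ph1 e (kap (Suc (Suc e)) (wrd (Suc (Suc e)) w)) =
 fscale (Q (wrd (Suc (Suc e)) w ! e) (wrd (Suc (Suc e)) w ! Suc e)) (kap e (take e (wrd (Suc (Suc e)) w)))"
 using w by (simp add: Ph1_sg Q_h del: wrd_def)
qed

text \<open>Operators change letters while permutations move positions, so the two actions
  commute.\<close>

lemma dact_mult:
 assumes X: "Vector_Spaces.linear scale scale X" and x: "x : Tn d" and y: "y : An d"
 shows "dact d X (x * y) = dact d X x * y"
proof -
 have *: "dact d X (sg w * sg s) = dact d X (sg w) * sg s" if w: "w : Wd d" and s: "s : Pm d" for w s
 proof -
 let ?p = "%vs. map (%j. vs ! app s j) [0..<d] :: 'v list"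
 have p: "app s permutes {..<d}" by (rule Pm_app[OF s])
 have sd: "app s j < d" if "j < d" for j using permutes_in_image[OF p, of j] that by simp
 have "sg w * sg s = kap d (?p (wrd d w))" using w s by (simp add: kap_permute)
 then have "dact d X (sg w * sg s) = lb d X (?p (wrd d w))" by (simp add: dact_kap[OF X])
 also have "\<dots> = (\<Sum>i<d. kap d (?p ((wrd d w)[app s i := X (wrd d w ! app s i)])))"
 unfolding lb_def
 proof (rule sum.cong[OF refl])
 fix i assume i: "i : {..<d}"
 have "(?p (wrd d w))[i := X (?p (wrd d w) ! i)] = ?p ((wrd d w)[app s i := X (wrd d w ! app s i)])"
 by (rule nth_equalityI) (use i sd in \<open>auto simp: nth_list_update inj_eq[OF permutes_inj[OF p]]\<close>)
 then show "kap d ((?p (wrd d w))[i := X (?p (wrd d w) ! i)]) = kap d (?p ((wrd d w)[app s i := X (wrd d w ! app s i)]))"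
 by simp
 qed
 also have "\<dots> = (\<Sum>i<d. kap d ((wrd d w)[app s i := X (wrd d w ! app s i)])) * sg s"
 by (simp add: kap_permute[OF s] sum_distrib_right)
 also have "(\<Sum>i<d. kap d ((wrd d w)[app s i := X (wrd d w ! app s i)])) = lb d X (wrd d w)"
 unfolding lb_def using sum.permute[OF p, of "%i. kap d ((wrd d w)[i := X (wrd d w ! i)])"] by (simp add: o_def)
 also have "lb d X (wrd d w) = dact d X (sg w)" by (simp add: dact_def)
 finally show ?thesis .
 qed
 have "dact d X (x * y) = dact d X x * y" if "y = sg s" "s : Pm d" for y s
 by (rule klin_eqI[OF klin_comp[OF klin_dact klin_mult_right] klin_comp[OF klin_mult_right klin_dact]])
 (use that supp_onD[OF x] * in auto)
 then show ?thesis
 by (rule_tac klin_eqI[OF klin_comp[OF klin_dact klin_mult_left] klin_mult_left]) (use supp_onD[OF y] in auto)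
qed

text \<open>The two terms in which \<open>X\<close> acts on a contracted position cancel because
  \<open>X\<close> is skew.\<close>

lemma dact_Ph1:
 assumes X: "Vector_Spaces.linear scale scale X" and skew: "!!u v. Q (X u) v + Q u (X v) = 0"
 and x: "x : Tn (Suc (Suc e))"
 shows "Ph1 e (dact (Suc (Suc e)) X x) = dact e X (Ph1 e x)"
proof -
 let ?d = "Suc (Suc e)"
 have "Ph1 e (dact ?d X (sg w)) = dact e X (Ph1 e (sg w))" if w: "w : Wd ?d" for w
 proof -
 let ?v = "wrd ?d w"
 let ?c = "Q (?v ! e) (?v ! Suc e)"
 have l: "length (take e ?v) = e" by simp
 have "Ph1 e (dact ?d X (sg w)) = Ph1 e (lb ?d X ?v)" by (simp add: dact_def)
 also have "\<dots> = (\<Sum>i<?d. Ph1 e (kap ?d (?v[i := X (?v ! i)])))"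
 unfolding lb_def by (simp add: klinD[OF klin_Ph1])
 also have "\<dots> = (\<Sum>i<?d. fscale (Q (?v[i := X (?v ! i)] ! e) (?v[i := X (?v ! i)] ! Suc e)) (kap e (take e (?v[i := X (?v ! i)]))))"
 by (intro sum.cong refl kap_take) simp
 also have "\<dots> = (\<Sum>i<e. fscale ?c (kap e ((take e ?v)[i := X (?v ! i)]))) +
 (fscale (Q (X (?v ! e)) (?v ! Suc e)) (kap e (take e ?v)) + fscale (Q (?v ! e) (X (?v ! Suc e))) (kap e (take e ?v)))"
 proof -
 have "(\<Sum>i<e. fscale (Q (?v[i := X (?v ! i)] ! e) (?v[i := X (?v ! i)] ! Suc e)) (kap e (take e (?v[i := X (?v ! i)])))) =
 (\<Sum>i<e. fscale ?c (kap e ((take e ?v)[i := X (?v ! i)])))"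
 by (rule sum.cong) (simp_all add: take_update_swap)
 then show ?thesis by (simp add: take_update_swap list_update_beyond add.assoc)
 qed
 also have "fscale (Q (X (?v ! e)) (?v ! Suc e)) (kap e (take e ?v)) + fscale (Q (?v ! e) (X (?v ! Suc e))) (kap e (take e ?v)) = 0"
 by (simp only: fs.scale_left_distrib[symmetric] skew fs.scale_zero_left)
 also have "(\<Sum>i<e. fscale ?c (kap e ((take e ?v)[i := X (?v ! i)]))) = fscale ?c (lb e X (take e ?v))"
 by (simp add: lb_def fs.scale_sum_right)
 also have "lb e X (take e ?v) = dact e X (kap e (take e ?v))" by (rule dact_kap[OF X l, symmetric])
 also have "fscale ?c (dact e X (kap e (take e ?v))) = dact e X (Ph1 e (kap ?d ?v))"
 by (simp add: kap_take klinD[OF klin_dact] del: kap_wrd)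
 finally show ?thesis using w by simp
 qed
 then show ?thesis
 by (rule_tac klin_eqI[OF klin_comp[OF klin_Ph1 klin_dact] klin_comp[OF klin_dact klin_Ph1]]) (use supp_onD[OF x] in auto)
qed

end

section \<open>Contractions and the trace filtration\<close>

text \<open>A contraction that keeps the length of the word by writing the letter 0 at both
  positions, so that the other positions keep their numbers.\<close>

definition Con :: "nat => nat => ('k::field) fna => 'k fna" where
 "Con i j = lin_ext (%w. if app w j = star (app w i) then sg (upd (upd w i 0) j 0) else 0)"

definition Tl :: "nat => ('k::field) fna set" where
 "Tl d = {x : Tn d. \<forall>i<d. \<forall>j<d. i ~= j --> Con i j x = 0}"

text \<open>The last \<open>2 * r\<close> positions are contracted in neighbouring pairs, beginning
  at the end.\<close>

primrec Phi :: "nat => nat => ('k::field) fna => 'k fna" where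
 "Phi e 0 = (%x. x)"
| "Phi e (Suc r) = (%x. Ph1 e (Phi (Suc (Suc e)) r x))"

text \<open>Together with all permutations of the positions the one contraction \<open>Phi\<close>
  represents every \<open>r\<close>-fold contraction. If \<open>2 * r\<close> exceeds
  \<open>d\<close> there is none, and the whole tensor power qualifies.\<close>

definition Fl :: "nat => nat => ('k::field) fna set" where
 "Fl d r = {x : Tn d. 2 * r <= d --> (\<forall>s\<in>Pm d. Phi (d - 2 * r) r (x * sg s) = 0)}"

lemma klin_Con: "klin (Con i j)"
 unfolding Con_def by (rule klin_lin_ext)

lemma Con_sg: "Con i j (sg w) = (if app w j = star (app w i) then sg (upd (upd w i 0) j 0) else 0)"
 by (simp add: Con_def)

lemma star_swap: "a = star b \<longleftrightarrow> b = star a"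
 by (metis star_star)

lemma Con_sym: "i ~= j ==> Con i j x = Con j i x"
proof (rule klin_eqI[OF klin_Con klin_Con])
 fix w assume "i ~= j"
 then have "upd (upd w i 0) j 0 = upd (upd w j 0) i 0" by (intro fn_eqI) simp
 then show "Con i j (sg w) = Con j i (sg w)" using star_swap[of "app w j" "app w i"] by (simp add: Con_sg)
qed

text \<open>Each contraction is recovered from the other by a linear map that merely rearranges and
  relabels positions, so they vanish together.\<close>

lemma Con_Ph1:
 assumes s: "s : Pm (Suc (Suc e))" and x: "x : Tn (Suc (Suc e))"
 shows "Con (app s e) (app s (Suc e)) x = 0 \<longleftrightarrow> Ph1 e (x * sg s) = 0"
proof -
 let ?i = "app s e" and ?j = "app s (Suc e)"
 let ?F = "lin_ext (%v. sg (trc e (v + s)))" and ?G = "lin_ext (%u. sg (upd (upd (u + pinv s) ?i 0) ?j 0))"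
 have inj: "app s a = app s b \<longleftrightarrow> a = b" for a b
 using permutes_inj[OF Pm_app[OF s]] by (simp add: inj_eq)
 have F: "Ph1 e (x * sg s) = ?F (Con ?i ?j x)"
 proof (rule klin_eqI[OF klin_comp[OF klin_Ph1 klin_mult_right] klin_comp[OF klin_lin_ext klin_Con]])
 fix w
 have "trc e (upd (upd w ?i 0) ?j 0 + s) = trc e (w + s)"
 by (rule fn_eqI) (simp add: inj)
 then show "Ph1 e (sg w * sg s) = ?F (Con ?i ?j (sg w))"
 by (simp add: sg_mult Ph1_sg Con_sg klinD[OF klin_lin_ext])
 qed
 have G: "Con ?i ?j x = ?G (Ph1 e (x * sg s))"
 proof (rule klin_eqI[OF klin_Con klin_comp[OF klin_lin_ext klin_comp[OF klin_Ph1 klin_mult_right]]])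
 fix w assume "w : keys x"
 then have w: "w : Wd (Suc (Suc e))" by (rule supp_onD[OF x])
 have "upd (upd w ?i 0) ?j 0 = upd (upd (trc e (w + s) + pinv s) ?i 0) ?j 0"
 proof (rule fn_eqI)
 fix l
 have e: "app s (app (pinv s) l) = l" by (rule app_pinv_app[OF s])
 consider "l = ?i" | "l = ?j" | "app (pinv s) l < e" | "l ~= ?i" "l ~= ?j" "\<not> app (pinv s) l < e" by blast
 then show "app (upd (upd w ?i 0) ?j 0) l = app (upd (upd (trc e (w + s) + pinv s) ?i 0) ?j 0) l"
 proof cases
 case 4
 then have "app (pinv s) l ~= e" "app (pinv s) l ~= Suc e" using e by auto
 then have "\<not> app (pinv s) l < Suc (Suc e)" using 4 by linarith
 then have "\<not> l < Suc (Suc e)" using Pm_less[OF Pm_pinv[OF s]] by blast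
 then have "app w l = l" "app (pinv s) l = l"
 using w permutes_not_in[OF Pm_app[OF Pm_pinv[OF s]], of l] by (simp_all add: Wd_def)
 then show ?thesis using 4 by simp
 qed (use e in simp_all)
 qed
 then show "Con ?i ?j (sg w) = ?G (Ph1 e (sg w * sg s))"
 by (simp add: sg_mult Ph1_sg Con_sg klinD[OF klin_lin_ext])
 qed
 show ?thesis using F G by (metis klinD(3)[OF klin_lin_ext])
qed

lemma klin_Phi: "klin (Phi e r)"
proof (induction r arbitrary: e)
 case 0
 then show ?case by (simp add: klin_id)
next
 case (Suc r)
 then show ?case by (simp add: klin_comp[OF klin_Ph1 Suc])
qed


lemma Phi_sg:
 assumes "w : Wd (e + 2 * r)"
 shows "Phi e r (sg w :: ('k::field) fna) = (if \<forall>j<2 * r. app w (e + star j) = star (app w (e + j)) then sg (trc e w) else 0)"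
 using assms
proof (induction r arbitrary: e)
 case 0
 have "trc e w = w" by (rule Wd_eqI[of _ e]) (use 0 in simp_all)
 then show ?case by simp
next
 case (Suc r)
 have w: "w : Wd (Suc (Suc e) + 2 * r)" using Suc.prems by simp
 have t: "trc e (trc (Suc (Suc e)) w) = trc e w" by (rule fn_eqI) simp
 have "(\<forall>j<2 * Suc r. app w (e + star j) = star (app w (e + j))) \<longleftrightarrow>
 app w (Suc e) = star (app w e) & (\<forall>j<2 * r. app w (Suc (Suc e) + star j) = star (app w (Suc (Suc e) + j)))"
 (is "?L \<longleftrightarrow> ?R")
 proof
 assume L: ?L
 have "app w (Suc (Suc e) + star j) = star (app w (Suc (Suc e) + j))" if "j < 2 * r" for j
 using L[rule_format, of "2 + j"] that star_add_even[of 2 j] by simp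
 moreover have "app w (Suc e) = star (app w e)" using L[rule_format, of 0] by (simp add: star_def)
 ultimately show ?R by blast
 next
 assume R: ?R
 show ?L
 proof (intro allI impI)
 fix j assume j: "j < 2 * Suc r"
 consider "j = 0" | "j = 1" | "2 <= j" by linarith
 then show "app w (e + star j) = star (app w (e + j))"
 proof cases
 case 3
 then obtain i where "j = 2 + i" by (metis le_Suc_ex)
 then show ?thesis using R[THEN conjunct2, rule_format, of i] j star_add_even[of 2 i] by simp
 qed (use R in \<open>simp_all add: star_def[of 0] star_def[of "Suc 0"]\<close>)
 qed
 qed
 note eq = this
 define C where "C \<longleftrightarrow> (\<forall>j<2 * r. app w (Suc (Suc e) + star j) = star (app w (Suc (Suc e) + j)))"
 have "Phi e (Suc r) (sg w :: 'k fna) = Ph1 e (if C then sg (trc (Suc (Suc e)) w) else 0)"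
 by (simp only: Phi.simps Suc.IH[OF w] C_def)
 also have "\<dots> = (if app w (Suc e) = star (app w e) & C then sg (trc e w) else 0)"
 by (simp add: Ph1_sg klinD[OF klin_Ph1] t)
 finally show ?case by (simp only: eq C_def)
qed

lemma Ph1_Tn [simp]: "Ph1 e x : Tn e"
 unfolding Ph1_def lin_ext_def by (intro supp_on_closed) auto

lemma Phi_Tn: "x : Tn (e + 2 * r) ==> Phi e r x : Tn e"
 by (cases r) simp_all

text \<open>Exchanging contracted pairs, or the members of one, changes nothing since being partners
  is a symmetric relation; the permutation of the first block passes through.\<close>

lemma Phi_Bx_sg:
 assumes x: "x : Tn (e + 2 * r)" and s: "s : Pm e" and t: "t : Hs r"
 shows "Phi e r (x * sg (bxw e s t)) = Phi e r x * sg s"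
proof (rule klin_eqI[OF klin_comp[OF klin_Phi klin_mult_right] klin_comp[OF klin_mult_right klin_Phi]])
 fix w assume "w : keys x"
 then have w: "w : Wd (e + 2 * r)" by (rule supp_onD[OF x])
 have tP: "t : Pm (2 * r)" and ts: "!!j. app t (star j) = star (app t j)" using t by (auto simp: Hs_def)
 have w': "w + bxw e s t : Wd (e + 2 * r)" by (intro Wd_add w bxw_Pm s tP)
 have tr: "trc e (w + bxw e s t) = trc e w + s"
 by (rule fn_eqI) (use Pm_less[OF s] permutes_not_in[OF Pm_app[OF s]] in \<open>auto simp: bxw_def\<close>)
 define C where "C \<longleftrightarrow> (\<forall>j<2 * r. app w (e + star j) = star (app w (e + j)))"
 have "(\<forall>j<2 * r. app w (e + star (app t j)) = star (app w (e + app t j))) \<longleftrightarrow>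
 (\<forall>j<2 * r. app w (e + star j) = star (app w (e + j)))"
 using Pm_less[OF tP] Pm_less[OF Pm_pinv[OF tP]] app_pinv_app[OF tP] by metis
 then have eq: "(\<forall>j<2 * r. app (w + bxw e s t) (e + star j) = star (app (w + bxw e s t) (e + j))) \<longleftrightarrow>
 (\<forall>j<2 * r. app w (e + star j) = star (app w (e + j)))" by (simp add: bxw_def ts)
 show "Phi e r (sg w * sg (bxw e s t)) = Phi e r (sg w) * sg s"
 unfolding sg_mult Phi_sg[OF w] Phi_sg[OF w'] eq tr C_def[symmetric] by (simp add: sg_mult)
qed

lemma Phi_Bx:
 assumes x: "x : Tn (e + 2 * r)" and a: "a : An e" and t: "t : Hs r"
 shows "Phi e r (x * Bx e a (sg t)) = Phi e r x * a"
 by (rule klin_eqI[OF klin_comp[OF klin_Phi klin_comp[OF klin_mult_left klin_bil_left]] klin_mult_left])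
 (use supp_onD[OF a] in \<open>simp add: Phi_Bx_sg x t\<close>)

lemma Phi_Bx_hS:
 assumes x: "x : Tn (e + 2 * r)" and a: "a : An e"
 shows "Phi e r (x * Bx e a (hS r)) = fscale (of_nat (card (Hs r))) (Phi e r x * a)"
proof -
 have "x * Bx e a (hS r) = (\<Sum>t\<in>Hs r. x * Bx e a (sg t))"
 by (simp add: hS_def gsum_def klinD[OF klin_bil_right] sum_distrib_left)
 then have "Phi e r (x * Bx e a (hS r)) = (\<Sum>t\<in>Hs r. Phi e r x * a)"
 by (simp add: klinD[OF klin_Phi] Phi_Bx x a)
 also have "\<dots> = fscale (of_nat (card (Hs r))) (Phi e r x * a)"
 using fs.scale_sum_left[of "%_. 1" "Hs r" "Phi e r x * a"] unfolding fs.scale_one by simp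
 finally show ?thesis .
qed

lemma Fl_Tn: "x : Fl d r ==> x : Tn d"
 by (simp add: Fl_def)

lemma Fl_0: "x : Fl d 0 \<longleftrightarrow> x = 0"
proof
 assume "x : Fl d 0"
 then have "\<forall>s\<in>Pm d. x * sg s = 0" by (simp add: Fl_def)
 from bspec[OF this Pm_0] show "x = 0" by simp
qed (simp add: Fl_def)

lemma Fl_An:
 assumes x: "x : Fl (e + 2 * r) r" and a: "a : An (e + 2 * r)"
 shows "Phi e r (x * a) = 0"
proof -
 have "Phi e r (x * a) = (%_. 0) a"
 by (rule klin_eqI[OF klin_comp[OF klin_Phi klin_mult_left] klin_zero])
 (use supp_onD[OF a] x in \<open>simp add: Fl_def\<close>)
 then show ?thesis .
qed

lemma FlI:
 assumes "x : Tn d" "!!e s. d = e + 2 * r ==> s : Pm d ==> Phi e r (x * sg s) = 0"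
 shows "x : Fl d r"
 using assms by (auto simp: Fl_def)

lemma Fl_mult: "x : Fl d r ==> a : An d ==> x * a : Fl d r"
 by (rule FlI) (simp_all add: Fl_Tn mult.assoc Fl_An)

lemma subspace_Fl: "fs.subspace (Fl d r)"
proof -
 have "x + y : Fl d r" if "x : Fl d r" "y : Fl d r" for x y :: "('k::field) fna"
 using that by (auto simp: Fl_def distrib_right klinD[OF klin_Phi])
 moreover have "fscale c x : Fl d r" if "x : Fl d r" for c and x :: "('k::field) fna"
 using that by (auto simp: Fl_def fscale_mult_left klinD[OF klin_Phi])
 moreover have "0 : Fl d r" by (simp add: Fl_def klinD[OF klin_Phi])
 ultimately show ?thesis unfolding fs.subspace_def by blast
qed

lemma Fl_mono:
 assumes "x : Fl d r"
 shows "x : Fl d (Suc r)"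
proof (rule FlI)
 show "x : Tn d" by (rule Fl_Tn[OF assms])
 fix e s assume d: "d = e + 2 * Suc r" and s: "s : Pm d"
 have "Phi (Suc (Suc e)) r (x * sg s) = 0"
 by (rule Fl_An) (use assms d s in simp_all)
 then show "Phi e (Suc r) (x * sg s) = 0" by (simp add: klinD[OF klin_Ph1])
qed

text \<open>The positions \<open>i\<close> and \<open>j\<close> come last and all others keep their
  order, in agreement with the deletion by \<open>nths\<close> in
  \<open>contraction\<close>.\<close>

definition s0 :: "nat => nat => nat => fn" where
 "s0 e i j = Fn (%m. if m < e then (if m < i then m else if Suc m < j then Suc m else Suc (Suc m))
 else if m = e then i else if m = Suc e then j else m)"

lemma s0_Pm:
 assumes "i < j" "j < Suc (Suc e)"
 shows "s0 e i j : Pm (Suc (Suc e))"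
proof -
 have inj: "inj_on (app (s0 e i j)) {..<Suc (Suc e)}"
 by (rule inj_onI) (use assms in \<open>auto simp: s0_def split: if_splits\<close>)
 have "app (s0 e i j) ` {..<Suc (Suc e)} \<subseteq> {..<Suc (Suc e)}"
 using assms by (auto simp: s0_def)
 then have "app (s0 e i j) ` {..<Suc (Suc e)} = {..<Suc (Suc e)}"
 by (rule endo_inj_surj[OF finite_lessThan _ inj])
 then have "bij_betw (app (s0 e i j)) {..<Suc (Suc e)} {..<Suc (Suc e)}"
 using inj by (simp add: bij_betw_def)
 then show ?thesis unfolding Pm_def by (simp, intro bij_imp_permutes) (auto simp: s0_def)
qed

lemma s0_simps [simp]: "app (s0 e i j) e = i" "app (s0 e i j) (Suc e) = j"
 by (simp_all add: s0_def)

lemma Tl_iff_s0: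
 assumes "x : Tn (Suc (Suc e))"
 shows "x : Tl (Suc (Suc e)) \<longleftrightarrow> (\<forall>i j. i < j & j < Suc (Suc e) --> Ph1 e (x * sg (s0 e i j)) = 0)" (is "_ \<longleftrightarrow> ?R")
proof
 assume t: "x : Tl (Suc (Suc e))"
 show ?R
 proof (intro allI impI)
 fix i j assume "i < j & j < Suc (Suc e)"
 then show "Ph1 e (x * sg (s0 e i j)) = 0"
 using t by (subst Con_Ph1[OF s0_Pm assms, symmetric]) (auto simp: Tl_def)
 qed
next
 assume R: ?R
 have *: "Con i j x = 0" if "i < j" "j < Suc (Suc e)" for i j
 using Con_Ph1[OF s0_Pm[OF that] assms] R that by simp
 have "Con i j x = 0" if "i < Suc (Suc e)" "j < Suc (Suc e)" "i ~= j" for i j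
 using that *[of i j] *[of j i] Con_sym[of i j x] by (cases "i < j") auto
 then show "x : Tl (Suc (Suc e))" using assms by (simp add: Tl_def)
qed

lemma Tl_Fl: "Tl d = Fl d 1"
proof (cases "2 <= d")
 case False
 then show ?thesis by (auto simp: Tl_def Fl_def)
next
 case True
 then obtain e where d: "d = Suc (Suc e)" by (metis add_2_eq_Suc le_Suc_ex)
 have "x : Tl d \<longleftrightarrow> x : Fl d 1" if x: "x : Tn d" for x :: "('k::field) fna"
 proof
 assume t: "x : Tl d"
 have "Ph1 e (x * sg s) = 0" if s: "s : Pm d" for s
 proof -
 have "app s e ~= app s (Suc e)" using permutes_inj[OF Pm_app[OF s]] by (simp add: inj_eq)
 then have "Con (app s e) (app s (Suc e)) x = 0" using t Pm_less[OF s] by (auto simp: Tl_def d)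
 then show ?thesis using Con_Ph1 s x d by blast
 qed
 then show "x : Fl d 1" using x by (simp add: Fl_def d)
 next
 assume "x : Fl d 1"
 then have "Ph1 e (x * sg s) = 0" if "s : Pm d" for s using that by (simp add: Fl_def d)
 then show "x : Tl d" unfolding d using s0_Pm by (subst Tl_iff_s0[OF x[unfolded d]]) (auto simp: d)
 qed
 then show ?thesis by (auto simp: Tl_def Fl_def)
qed

text \<open>A further contraction of the result is a contraction of \<open>x\<close> in
  \<open>r + 1\<close> pairs and vanishes.\<close>

lemma Phi_Tl:
 assumes x: "x : Fl (e + 2 * r) (Suc r)" and a: "a : An (e + 2 * r)"
 shows "Phi e r (x * a) : Tl e"
 unfolding Tl_Fl
proof (rule FlI)
 have xa: "x * a : Tn (e + 2 * r)" by (rule Tn_mult[OF Fl_Tn[OF x] a])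
 then show "Phi e r (x * a) : Tn e" by (rule Phi_Tn)
 fix f s assume e: "e = f + 2 * 1" and s: "s : Pm e"
 have b: "sg (bxw e s 0) : An (e + 2 * r)" by (intro single_supp_on bxw_Pm s Pm_0)
 have "Phi f 1 (Phi e r (x * a) * sg s) = Phi f 1 (Phi e r (x * a * sg (bxw e s 0)))"
 by (subst Phi_Bx_sg[OF xa s]) (simp_all add: Hs_def)
 also have "\<dots> = Phi f (Suc r) (x * (a * sg (bxw e s 0)))" by (simp add: e mult.assoc)
 also have "\<dots> = 0" by (rule Fl_An) (use x An_mult[OF a b] in \<open>simp_all add: e\<close>)
 finally show "Phi f 1 (Phi e r (x * a) * sg s) = 0" .
qed

section \<open>The orthogonal Lie algebra and the contractions\<close>

context hyperbolic_space
begin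

lemma so_linear:
 assumes "X : so_inf scale Q"
 shows "Vector_Spaces.linear scale scale X" "Q (X u) v + Q u (X v) = 0"
proof -
 interpret F: vector_space "%c (X :: 'v => 'v) v. scale c (X v)"
 by unfold_locales (auto simp: scale_right_distrib scale_left_distrib fun_eq_iff)
 have "X : gl_inf scale Q" using assms by (simp add: so_inf_def)
 then have "X : F.span {(%v. scale (Q v w) u) |u w. True}" by (simp add: gl_inf_def)
 then have "X (x + y) = X x + X y & X (scale c x) = scale c (X x)" for x y c
 proof (induction rule: F.span_induct_alt)
 case base
 show ?case by simp
 next
 case (step b Y Z)
 then show ?case by (auto simp: Q_simps scale_right_distrib scale_left_distrib ac_simps)
 qed
 then show "Vector_Spaces.linear scale scale X"
 by (simp add: Vector_Spaces.linear_iff vector_space_axioms)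
 show "Q (X u) v + Q u (X v) = 0" using assms by (simp add: so_inf_def)
qed

text \<open>The elementary replacement of the letter \<open>a\<close> by \<open>b\<close>. Skewness
  forces a second one, of \<open>star b\<close> by \<open>star a\<close> with a minus sign.\<close>

definition elem :: "nat => nat => 'v => 'v" where
 "elem a b = (%v. scale (Q v (h (star a))) (h b) - scale (Q v (h b)) (h (star a)))"

lemma elem_so: "elem a b : so_inf scale Q"
proof -
 interpret F: vector_space "%c (X :: 'v => 'v) v. scale c (X v)"
 by unfold_locales (auto simp: scale_right_distrib scale_left_distrib fun_eq_iff)
 have "elem a b = (%v. scale (Q v (h (star a))) (h b)) - (%v. scale (Q v (h b)) (h (star a)))"
 by (simp add: elem_def fun_eq_iff)
 also have "\<dots> : gl_inf scale Q"
 unfolding gl_inf_def by (intro F.span_diff F.span_base) blast+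
 finally have "elem a b : gl_inf scale Q" .
 then show ?thesis by (simp add: so_inf_def elem_def Q_simps) (simp add: Q_symmetric algebra_simps)
qed

lemma dact_Phi:
 assumes X: "X : so_inf scale Q" and x: "x : Tn (e + 2 * r)"
 shows "Phi e r (dact (e + 2 * r) X x) = dact e X (Phi e r x)"
 using x
proof (induction r arbitrary: e)
 case 0
 then show ?case by simp
next
 case (Suc r)
 have "Phi (Suc (Suc e)) r (dact (Suc (Suc e) + 2 * r) X x) = dact (Suc (Suc e)) X (Phi (Suc (Suc e)) r x)"
 by (rule Suc.IH) (use Suc.prems in simp)
 moreover have "Phi (Suc (Suc e)) r x : Tn (Suc (Suc e))" by (rule Phi_Tn) (use Suc.prems in simp)
 ultimately show ?case using dact_Ph1[OF so_linear[OF X]] by simp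
qed

lemma dact_Fl:
 assumes X: "X : so_inf scale Q" and x: "x : Fl d r"
 shows "dact d X x : Fl d r"
proof (rule FlI)
 fix e s assume d: "d = e + 2 * r" and s: "s : Pm d"
 have xT: "x * sg s : Tn (e + 2 * r)" using Fl_Tn[OF x] s d by simp
 have "dact d X x * sg s = dact d X (x * sg s)" by (rule dact_mult[OF so_linear(1)[OF X] Fl_Tn[OF x], symmetric]) (simp add: s)
 then have "Phi e r (dact d X x * sg s) = dact e X (Phi e r (x * sg s))" using dact_Phi[OF X xT] d by simp
 also have "Phi e r (x * sg s) = 0" by (rule Fl_An) (use x s d in simp_all)
 finally show "Phi e r (dact d X x * sg s) = 0" by (simp add: klinD[OF klin_dact])
qed simp

section \<open>Contractions and Young symmetrizers translated to coordinates\<close>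

lemma nths_nth: "nths xs A = map ((!) xs) (filter (%i. i : A) [0..<length xs])"
proof (induction xs rule: rev_induct)
 case (snoc x xs)
 have "map ((!) (xs @ [x])) (filter (%i. i : A) [0..<length xs]) = map ((!) xs) (filter (%i. i : A) [0..<length xs])"
 by (rule map_cong) (auto simp: nth_append)
 then show ?case using snoc by (simp add: nths_append)
qed simp

lemma nths_s0:
 assumes "length vs = Suc (Suc e)" "i < j" "j < Suc (Suc e)"
 shows "nths vs (- {i, j}) = map (%m. vs ! app (s0 e i j) m) [0..<e]"
proof -
 have "[0..<Suc (Suc e)] = [0..<i] @ [i..<j] @ [j..<Suc (Suc e)]"
 using assms upt_add_eq_append[of 0 i "j - i"] upt_add_eq_append[of 0 j "Suc (Suc e) - j"] by simp
 also have "\<dots> = [0..<i] @ [i] @ [Suc i..<j] @ [j] @ [Suc j..<Suc (Suc e)]"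
 using assms by (simp add: upt_conv_Cons)
 finally have "filter (%m. m : - {i, j}) [0..<Suc (Suc e)] = [0..<i] @ [Suc i..<j] @ [Suc j..<Suc (Suc e)]"
 using assms by (auto simp: filter_id_conv)
 moreover have "[0..<i] @ [Suc i..<j] @ [Suc j..<Suc (Suc e)] = map (app (s0 e i j)) [0..<e]"
 proof -
 obtain l where j: "j = Suc l" using assms by (cases j) simp_all
 have "[0..<e] = [0..<i] @ [i..<l] @ [l..<e]"
 using assms j upt_add_eq_append[of 0 i "l - i"] upt_add_eq_append[of 0 l "e - l"] by simp
 moreover have "map (app (s0 e i j)) [0..<i] = map id [0..<i]" "map (app (s0 e i j)) [i..<l] = map Suc [i..<l]"
 "map (app (s0 e i j)) [l..<e] = map Suc (map Suc [l..<e])"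
 unfolding map_map by (rule map_cong; use assms j in \<open>simp add: s0_def\<close>)+
 ultimately show ?thesis by (simp add: map_Suc_upt j del: map_map)
 qed
 ultimately show ?thesis by (simp add: nths_nth assms(1) comp_def)
qed

lemma contraction_psi:
 assumes A: "A : rcarr (tpow scale (Suc (Suc e)))" and ij: "i < j" "j < Suc (Suc e)"
 shows "contraction scale Q (Suc (Suc e)) i j A : rcarr (tpow scale e) &
 psi e (contraction scale Q (Suc (Suc e)) i j A) = Ph1 e (psi (Suc (Suc e)) A * sg (s0 e i j))"
proof -
 let ?d = "Suc (Suc e)" and ?s = "s0 e i j"
 have "tmap scale e (%vs. single (nths vs (- {i, j})) (Q (vs ! i) (vs ! j))) A : rcarr (tpow scale e) &
 psi e (tmap scale e (%vs. single (nths vs (- {i, j})) (Q (vs ! i) (vs ! j))) A) = Ph1 e (psi ?d A * sg ?s)"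
 proof (rule psi_tmap[OF _ _ klin_comp[OF klin_Ph1 klin_mult_right] A])
 fix vs :: "'v list" assume vs: "length vs = ?d"
 note n = nths_s0[OF vs ij]
 show "single (nths vs (- {i, j})) (Q (vs ! i) (vs ! j)) : Free e"
 by (rule single_supp_on) (simp add: n)
 have l: "length (map (%m. vs ! app ?s m) [0..<?d]) = ?d" by simp
 have t: "take e (map (%m. vs ! app ?s m) [0..<?d]) = map (%m. vs ! app ?s m) [0..<e]"
 by (simp add: take_map)
 have "Ph1 e (kap ?d vs * sg ?s) = Ph1 e (kap ?d (map (%m. vs ! app ?s m) [0..<?d]))"
 by (simp only: kap_permute[OF s0_Pm[OF ij]])
 also have "\<dots> = fscale (Q (vs ! i) (vs ! j)) (kap e (map (%m. vs ! app ?s m) [0..<e]))"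
 unfolding kap_take[OF l] t by (simp add: nth_append del: upt_Suc)
 finally show "coord e (single (nths vs (- {i, j})) (Q (vs ! i) (vs ! j))) = Ph1 e (kap ?d vs * sg ?s)"
 by (simp add: n)
 qed
 then show ?thesis by (simp add: contraction_def)
qed

lemma psi_eq_0: "A : rcarr (tpow scale d) ==> A = rzero (tpow scale d) \<longleftrightarrow> psi d A = 0"
 using psi_zero[of d] inj_onD[OF psi_inj, of d A "rzero (tpow scale d)"] by auto

lemma traceless_psi:
 assumes A: "A : rcarr (tpow scale d)"
 shows "A : traceless scale Q d \<longleftrightarrow> psi d A : Tl d"
proof (cases "2 <= d")
 case False
 then have "\<not> (i < j & j < d)" "\<not> (i < d & j < d & i ~= j)" for i j by auto
 then show ?thesis using A by (auto simp: traceless_def Tl_def)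
next
 case True
 then obtain e where d: "d = Suc (Suc e)" by (metis add_2_eq_Suc le_Suc_ex)
 show ?thesis
 unfolding d Tl_iff_s0[OF psi_Tn] traceless_def
 using A contraction_psi[of A e] psi_eq_0[of _ e] by (auto simp: d)
qed

text \<open>\<open>permute_tensor\<close> reads a list through \<open>inv \<sigma>\<close>, which in
  coordinates is right multiplication by the inverse. Inversion preserves both stabilizers and signs
  and reverses each product.\<close>

lemma young_cS:
 "lin_ext (%\<sigma>. sg (pinv (Fn \<sigma>))) (young_symmetrizer p) = (cS p :: 'k fna)"
proof -
 have R: "(\<Sum>\<sigma>\<in>row_stabilizer p. f (pinv (Fn \<sigma>))) = (\<Sum>s\<in>rowg p. f s)" for f :: "fn => 'k fna"
 by (rule sum.reindex_bij_witness[where i="%s. app (pinv s)" and j="%\<sigma>. pinv (Fn \<sigma>)"])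
 (use subgrpD[OF subgrp_rowg[of p]] in \<open>auto simp: row_stabilizer_def rowg_def Pm_def\<close>)
 have C: "(\<Sum>\<sigma>\<in>col_stabilizer p. f (pinv (Fn \<sigma>))) = (\<Sum>s\<in>colg p. f s)" for f :: "fn => 'k fna"
 by (rule sum.reindex_bij_witness[where i="%s. app (pinv s)" and j="%\<sigma>. pinv (Fn \<sigma>)"])
 (use subgrpD[OF subgrp_colg[of p]] in \<open>auto simp: col_stabilizer_def colg_def Pm_def\<close>)
 have "lin_ext (%\<sigma>. sg (pinv (Fn \<sigma>))) (young_symmetrizer p) =
 (\<Sum>\<sigma>\<in>row_stabilizer p. \<Sum>\<tau>\<in>col_stabilizer p. fscale (of_int (sign \<tau>)) (sg (pinv (Fn (\<sigma> \<circ> \<tau>))) :: 'k fna))"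
 by (simp add: young_symmetrizer_def klinD[OF klin_lin_ext] del: fscale_single)
 also have "\<dots> = (\<Sum>\<sigma>\<in>row_stabilizer p. \<Sum>\<tau>\<in>col_stabilizer p.
 fscale (sgnf (pinv (Fn \<tau>))) (sg (pinv (Fn \<tau>) + pinv (Fn \<sigma>))))"
 proof (intro sum.cong refl)
 fix \<sigma> \<tau> assume "\<sigma> : row_stabilizer p" "\<tau> : col_stabilizer p"
 then have P: "Fn \<sigma> : Pm (sum_list p)" "Fn \<tau> : Pm (sum_list p)"
 by (auto simp: row_stabilizer_def col_stabilizer_def Pm_def)
 have "Fn (\<sigma> \<circ> \<tau>) = Fn \<sigma> + Fn \<tau>" by (rule fn_eqI) simp
 then show "fscale (of_int (sign \<tau>)) (sg (pinv (Fn (\<sigma> \<circ> \<tau>)))) =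
 fscale (sgnf (pinv (Fn \<tau>))) (sg (pinv (Fn \<tau>) + pinv (Fn \<sigma>)) :: 'k fna)"
 by (simp add: pinv_add[OF P] sgnf_pinv[OF P(2)]) (simp add: sgnf_def)
 qed
 also have "\<dots> = (\<Sum>\<sigma>\<in>row_stabilizer p. \<Sum>t\<in>colg p. fscale (sgnf t) (sg (t + pinv (Fn \<sigma>))))"
 by (intro sum.cong refl C)
 also have "\<dots> = (\<Sum>s\<in>rowg p. \<Sum>t\<in>colg p. fscale (sgnf t) (sg (t + s)))"
 by (rule R)
 also have "\<dots> = cS p"
 by (simp add: cS_def aS_def bS_def gsum_def sum_distrib_left sum_distrib_right mult_single)
 finally show ?thesis .
qed

lemma psi_schur:
 "schur_functor scale p \<subseteq> rcarr (tpow scale (sum_list p)) &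
 psi (sum_list p) ` schur_functor scale p = (%x :: 'k fna. x * cS p) ` Tn (sum_list p)"
proof -
 let ?d = "sum_list p" and ?c = "young_symmetrizer p :: (nat => nat) \<Rightarrow>\<^sub>0 'k"
 let ?t = "tmap scale ?d (permute_tensor ?c)"
 have keys: "\<sigma> permutes {..<?d}" if "\<sigma> : keys ?c" for \<sigma>
 proof -
 have "?c : supp_on {\<sigma>. \<sigma> permutes {..<?d}}"
 unfolding young_symmetrizer_def
 by (intro supp_on_closed single_supp_on) (auto simp: row_stabilizer_def col_stabilizer_def intro: permutes_compose)
 from supp_onD[OF this that] show ?thesis by simp
 qed
 have *: "?t A : rcarr (tpow scale ?d) & psi ?d (?t A) = psi ?d A * cS p" if A: "A : rcarr (tpow scale ?d)" for A
 proof (rule psi_tmap[OF _ _ klin_mult_right A])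
 fix vs :: "'v list" assume vs: "length vs = ?d"
 show "permute_tensor ?c vs : Free ?d" by (simp add: permute_tensor_def vs)
 have "coord ?d (permute_tensor ?c vs) =
 (\<Sum>\<sigma>\<in>keys ?c. fscale (lookup ?c \<sigma>) (kap ?d (map (%j. vs ! inv \<sigma> j) [0..<?d])))"
 by (simp add: permute_tensor_def klinD[OF klin_coord] vs)
 also have "\<dots> = (\<Sum>\<sigma>\<in>keys ?c. fscale (lookup ?c \<sigma>) (kap ?d vs * sg (pinv (Fn \<sigma>))))"
 proof (intro sum.cong refl)
 fix \<sigma> assume "\<sigma> : keys ?c"
 then have "pinv (Fn \<sigma>) : Pm ?d" using keys by (intro Pm_pinv) (simp add: Pm_def)
 from kap_permute[OF this, of vs]
 show "fscale (lookup ?c \<sigma>) (kap ?d (map (%j. vs ! inv \<sigma> j) [0..<?d])) =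
 fscale (lookup ?c \<sigma>) (kap ?d vs * sg (pinv (Fn \<sigma>)))" by (simp add: app_pinv)
 qed
 also have "\<dots> = kap ?d vs * lin_ext (%\<sigma>. sg (pinv (Fn \<sigma>))) ?c"
 by (simp add: lin_ext_def sum_distrib_left fscale_mult_right del: fscale_single)
 finally show "coord ?d (permute_tensor ?c vs) = kap ?d vs * cS p" by (simp only: young_cS)
 qed
 have "psi ?d ` ?t ` rcarr (tpow scale ?d) = (%x :: 'k fna. x * cS p) ` Tn ?d"
 proof
 show "psi ?d ` ?t ` rcarr (tpow scale ?d) \<subseteq> (%x :: 'k fna. x * cS p) ` Tn ?d" using * by auto
 show "(%x :: 'k fna. x * cS p) ` Tn ?d \<subseteq> psi ?d ` ?t ` rcarr (tpow scale ?d)"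
 proof
 fix y assume "y : (%x :: 'k fna. x * cS p) ` Tn ?d"
 then obtain x where x: "x : Tn ?d" "y = x * cS p" by blast
 obtain A where "A : rcarr (tpow scale ?d)" "psi ?d A = x" using psi_surj[OF x(1)] by blast
 then show "y : psi ?d ` ?t ` rcarr (tpow scale ?d)" using * x(2) by (metis imageI)
 qed
 qed
 then show ?thesis using * by (auto simp: schur_functor_def)
qed

end

section \<open>Submodules of tensor powers\<close>

text \<open>The words that can arise when \<open>k\<close> letters have been replaced: the new
  letters \<open>n\<close>, \<open>n + 2\<close> and so on occur once each, and the rest are old.
  With \<open>n\<close> even, steps of two keep new letters from being partners.\<close>

definition gd :: "nat => nat => nat => fn => bool" where
 "gd n d k w \<longleftrightarrow> w : Wd d & (\<forall>i<d. app w i < n \<or> (\<exists>j<k. app w i = n + 2 * j)) &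
 (\<forall>j<k. \<exists>!i. i < d & app w i = n + 2 * j)"

text \<open>Undoes the replacement: the new letter \<open>n + 2 * j\<close> becomes
  \<open>a j\<close> again.\<close>

definition red :: "nat => nat => (nat => nat) => fn => fn" where
 "red n d a w = Fn (%i. if i < d & n <= app w i then a ((app w i - n) div 2) else app w i)"

definition bw :: "nat => nat => fn" where
 "bw n d = Fn (%i. if i < d then n + 2 * i else i)"

definition Wl :: "nat => nat => fn set" where
 "Wl n d = {w : Wd d. \<forall>i<d. app w i < n}"

lemma bw_Wd [simp]: "bw n d : Wd d"
 by (simp add: bw_def Wd_def)

text \<open>The letters of \<open>bw n d\<close> are distinct, so its rearrangements are distinct
  basis elements.\<close>

lemma lookup_bw:
 assumes y: "y : An d" and s: "s : Pm d"
 shows "lookup (sg (bw n d) * y) (bw n d + s) = lookup y s"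
proof -
 have inj: "bw n d + t = bw n d + s \<longleftrightarrow> t = s" if t: "t : Pm d" for t
 proof
 assume e: "bw n d + t = bw n d + s"
 have "app t i = app s i" if i: "i < d" for i
 using arg_cong[OF e, of "%w. app w i"] Pm_less[OF t i] Pm_less[OF s i] by (simp add: bw_def)
 then show "t = s" by (rule Wd_eqI[OF Pm_Wd[OF t] Pm_Wd[OF s]])
 qed simp
 have "lookup (sg (bw n d) * y) (bw n d + s) =
 (\<Sum>t\<in>keys y. if t = s then lookup y t else 0)"
 unfolding mult_expand_right[of "sg (bw n d)" y] lookup_sum
 by (rule sum.cong) (use supp_onD[OF y] inj in \<open>auto simp: sg_mult lookup_single when_def\<close>)
 then show ?thesis by (simp add: in_keys_iff)
qed

lemma letters_bound:
 assumes "x : Tn d"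
 obtains n where "even n" "m <= n" "x : supp_on (Wl n d)"
proof -
 let ?A = "(\<Union>w\<in>keys x. app w ` {..<d})"
 have f: "finite ?A" by simp
 define M where "M = Max (insert 0 ?A)"
 let ?n = "2 * (m + Suc M)"
 have "app w i < ?n" if "w : keys x" "i < d" for w i
 proof -
 have "app w i <= M" unfolding M_def by (rule Max_ge) (use f that in auto)
 also have "M < ?n" by simp
 finally show ?thesis .
 qed
 then have "x : supp_on (Wl ?n d)" using supp_onD[OF assms] by (auto simp: supp_on_def Wl_def)
 then show ?thesis by (intro that[of ?n]) simp_all
qed

context hyperbolic_space
begin

lemma elem_h: "elem a b (h c) = (if c = a then h b else 0) - (if c = star b then h (star a) else 0)"
 using star_swap[of b c] by (auto simp: elem_def Q_h star_eq_iff)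

lemma kap_update_zero: "length vs = d ==> i < d ==> kap d (vs[i := 0]) = 0"
 using mlinD(2)[OF mlin_kap, of vs d i 0 0] by simp

lemma kap_update_diff: "length vs = d ==> i < d ==> kap d (vs[i := u - w]) = kap d (vs[i := u]) - kap d (vs[i := w])"
 using mlinD(1)[OF mlin_kap, of vs d i "u - w" w] by (simp add: algebra_simps)

lemma dact_elem:
 assumes w: "w : Wd d"
 shows "dact d (elem a b) (sg w) = (\<Sum>i<d. (if app w i = a then sg (upd w i b) else 0)) -
 (\<Sum>i<d. (if app w i = star b then sg (upd w i (star a)) else 0))"
proof -
 have "kap d ((wrd d w)[i := elem a b (h (app w i))]) =
 (if app w i = a then sg (upd w i b) else 0) - (if app w i = star b then sg (upd w i (star a)) else 0)"
 if i: "i < d" for i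
 using i w by (simp add: elem_h kap_update_diff kap_update_zero wrd_upd)
 then show ?thesis by (simp add: dact_def lb_def sum_subtractf)
qed

text \<open>As the partner of \<open>b\<close> does not occur, the second term of
  \<open>elem a b\<close> contributes nothing.\<close>

lemma lookup_dact_elem:
 assumes y: "y : Tn d" "!!v i. v : keys y ==> i < d ==> app v i ~= star b" and w: "w : Wd d"
 shows "lookup (dact d (elem a b) y) w = (\<Sum>i\<in>{i. i < d & app w i = b}. lookup y (upd w i a))"
proof -
 have "dact d (elem a b) y = (\<Sum>i<d. lin_ext (%v. if app v i = a then sg (upd v i b) else 0) y)"
 by (rule klin_eqI[OF klin_dact klin_sum[OF klin_lin_ext]])
 (use y supp_onD[OF y(1)] in \<open>simp add: dact_elem\<close>)
 also have "lookup \<dots> w = (\<Sum>i<d. if app w i = b then lookup y (upd w i a) else 0)"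
 unfolding lookup_sum
 proof (rule sum.cong[OF refl])
 fix i assume i: "i : {..<d}"
 have eq: "app v i = a & upd v i b = w \<longleftrightarrow> app w i = b & v = upd w i a" for v
 proof
 assume v: "app v i = a & upd v i b = w"
 then have w: "w = upd v i b" by simp
 have "v = upd w i a" unfolding w by (rule fn_eqI) (use conjunct1[OF v] in simp)
 moreover have "app w i = b" unfolding w by simp
 ultimately show "app w i = b & v = upd w i a" by simp
 next
 assume v: "app w i = b & v = upd w i a"
 have "upd v i b = w" by (rule fn_eqI) (use v in auto)
 then show "app v i = a & upd v i b = w" using v by auto
 qed
 have "lookup (lin_ext (%v. if app v i = a then sg (upd v i b) else 0) y) w =
 (\<Sum>v\<in>keys y. if app v i = a & upd v i b = w then lookup y v else 0)"
 by (auto simp: lin_ext_def lookup_sum lookup_single when_def intro!: sum.cong)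
 also have "\<dots> = (\<Sum>v\<in>keys y. if v = upd w i a then if app w i = b then lookup y v else 0 else 0)"
 unfolding eq by (intro sum.cong refl) auto
 also have "\<dots> = (if app w i = b then lookup y (upd w i a) else 0)"
 by (simp add: in_keys_iff)
 finally show "lookup (lin_ext (%v. if app v i = a then sg (upd v i b) else 0) y) w =
 (if app w i = b then lookup y (upd w i a) else 0)" .
 qed
 also have "\<dots> = (\<Sum>i\<in>{i. i < d & app w i = b}. lookup y (upd w i a))"
 by (simp add: sum.inter_filter[symmetric])
 finally show ?thesis .
qed

text \<open>Step \<open>j\<close> replaces one occurrence of the letter \<open>a j\<close> by the
  new letter \<open>n + 2 * j\<close>, summed over all occurrences.\<close>

primrec Pk :: "nat => nat => (nat => nat) => nat => 'k fna => 'k fna" where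
 "Pk d n a 0 = (%x. x)"
| "Pk d n a (Suc k) = (%x. dact d (elem (a k) (n + 2 * k)) (Pk d n a k x))"

lemma Pk_Tn: "x : Tn d ==> Pk d n a k x : Tn d"
 by (cases k) simp_all

lemma Pk_mult: "x : Tn d ==> y : An d ==> Pk d n a k (x * y) = Pk d n a k x * y"
 by (induction k) (simp_all add: dact_mult[OF so_linear(1)[OF elem_so]] Pk_Tn)

lemma Pk_Phi: "x : Tn (e + 2 * r) ==> Phi e r (Pk (e + 2 * r) n a k x) = Pk e n a k (Phi e r x)"
 by (induction k) (simp_all add: dact_Phi[OF elem_so] Pk_Tn)

lemma lookup_Pk:
 assumes n: "even n" and x: "x : supp_on (Wl n d)" and a: "!!j. j < k ==> a j < n"
 shows "lookup (Pk d n a k x) w = (if gd n d k w then lookup x (red n d a w) else 0)"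
 using a
proof (induction k arbitrary: w)
 case 0
 show ?case
 proof (cases "gd n d 0 w")
 case True
 then have "red n d a w = w" by (intro fn_eqI) (auto simp: red_def gd_def)
 then show ?thesis using True by simp
 next
 case False
 then have "w \<notin> Wl n d" by (auto simp: gd_def Wl_def)
 then show ?thesis using False lookup_supp_on[OF x] by simp
 qed
next
 case (Suc k)
 let ?y = "Pk d n a k x" and ?b = "n + 2 * k"
 have IH: "lookup ?y w = (if gd n d k w then lookup x (red n d a w) else 0)" for w
 by (rule Suc.IH) (use Suc.prems in auto)
 have ak: "a k < n" using Suc.prems by simp
 have yT: "?y : Tn d"
 by (rule supp_onI) (simp add: IH gd_def)
 show ?case
 proof (cases "w : Wd d")
 case False
 then have "lookup (Pk d n a (Suc k) x) w = 0" by (simp add: lookup_supp_on[OF dact_Tn])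
 then show ?thesis using False by (simp add: gd_def)
 next
 case w: True
 \<comment> \<open>The partners of new letters have the form \<open>n + 2 * j + 1\<close>; they are
   neither old nor introduced by any step.\<close>
 have "app v i ~= star ?b" if v: "v : keys ?y" and i: "i < d" for v i
 proof
 assume e: "app v i = star ?b"
 have "gd n d k v" using v IH[of v] by (auto simp: in_keys_iff split: if_splits)
 then have "app v i < n \<or> (\<exists>j<k. app v i = n + 2 * j)" using i by (simp add: gd_def)
 moreover have "star ?b = n + 2 * k + 1" using n by (simp add: star_def)
 ultimately show False using e n by presburger
 qed
 then have look: "lookup (Pk d n a (Suc k) x) w =
 (\<Sum>i\<in>{i. i < d & app w i = ?b}. lookup ?y (upd w i (a k)))"
 using lookup_dact_elem[OF yT _ w, of ?b "a k"] by simp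
 have up: "gd n d (Suc k) w" if i: "i < d" "app w i = ?b" and g: "gd n d k (upd w i (a k))" for i
 unfolding gd_def
 proof (intro conjI allI impI)
 show "w : Wd d" by (rule w)
 fix l assume l: "l < d"
 show "app w l < n \<or> (\<exists>j<Suc k. app w l = n + 2 * j)"
 proof (cases "l = i")
 case False
 then have "app w l < n \<or> (\<exists>j<k. app w l = n + 2 * j)" using g l unfolding gd_def by fastforce
 then show ?thesis using less_SucI by blast
 qed (use i in auto)
 next
 fix j assume j: "j < Suc k"
 show "\<exists>!l. l < d & app w l = n + 2 * j"
 proof (cases "j = k")
 case True
 show ?thesis
 proof (rule ex1I)
 show "i < d & app w i = n + 2 * j" using i True by simp
 fix l assume l: "l < d & app w l = n + 2 * j"
 show "l = i"
 proof (rule ccontr)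
 assume "l ~= i"
 then have "app w l < n \<or> (\<exists>j<k. app w l = n + 2 * j)" using g l unfolding gd_def by fastforce
 then show False using l True by auto
 qed
 qed
 next
 case False
 then have jk: "j < k" using j by simp
 have eq: "l < d & app (upd w i (a k)) l = n + 2 * j \<longleftrightarrow> l < d & app w l = n + 2 * j" for l
 using i ak False by auto
 have "\<exists>!l. l < d & app (upd w i (a k)) l = n + 2 * j" using g jk unfolding gd_def by blast
 then show ?thesis unfolding eq .
 qed
 qed
 show ?thesis
 proof (cases "gd n d (Suc k) w")
 case False
 then have "lookup ?y (upd w i (a k)) = 0" if "i < d" "app w i = ?b" for i
 using up[OF that] IH by auto
 then show ?thesis unfolding look using False by (simp add: sum.neutral)
 next
 case True
 then have "\<exists>!i. i < d & app w i = ?b" unfolding gd_def by blast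
 then obtain i where i': "i < d & app w i = ?b" and u': "\<forall>l. l < d & app w l = ?b --> l = i" by (rule ex1E)
 note i = conjunct1[OF i'] conjunct2[OF i'] and u = u'[rule_format, OF conjI]
 have "{i. i < d & app w i = ?b} \<subseteq> {i}"
 proof
 fix l assume "l : {i. i < d & app w i = ?b}"
 then show "l : {i}" using u[of l] by simp
 qed
 then have set: "{i. i < d & app w i = ?b} = {i}" using i by blast
 have "gd n d k (upd w i (a k))"
 unfolding gd_def
 proof (intro conjI allI impI)
 show "upd w i (a k) : Wd d" using w i by simp
 fix l assume l: "l < d"
 show "app (upd w i (a k)) l < n \<or> (\<exists>j<k. app (upd w i (a k)) l = n + 2 * j)"
 proof (cases "l = i")
 case False
 then have ne: "app w l ~= ?b" using u l by blast
 have "app w l < n \<or> (\<exists>j<Suc k. app w l = n + 2 * j)" using True l unfolding gd_def by blast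
 then show ?thesis using False ne less_Suc_eq by auto
 qed (use ak in simp)
 next
 fix j assume j: "j < k"
 have eq: "l < d & app (upd w i (a k)) l = n + 2 * j \<longleftrightarrow> l < d & app w l = n + 2 * j" for l
 using i ak j by auto
 have "\<exists>!l. l < d & app w l = n + 2 * j" using True j less_SucI unfolding gd_def by blast
 then show "\<exists>!l. l < d & app (upd w i (a k)) l = n + 2 * j" unfolding eq .
 qed
 moreover have "red n d a (upd w i (a k)) = red n d a w"
 by (rule fn_eqI) (use i ak in \<open>auto simp: red_def\<close>)
 ultimately show ?thesis unfolding look set using True IH by simp
 qed
 qed
qed

text \<open>The new letters occupy \<open>k\<close> distinct positions; when they fill the word,
  only their order is free.\<close>

lemma gd_card:
 assumes "gd n d k w"
 shows "k <= d" and "k = d ==> \<exists>s\<in>Pm d. w = bw n d + s"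
proof -
 define f where "f j = (THE i. i < d & app w i = n + 2 * j)" for j
 have f: "f j < d & app w (f j) = n + 2 * j" if "j < k" for j
 unfolding f_def by (rule theI') (use assms that in \<open>simp add: gd_def\<close>)
 have inj: "inj_on f {..<k}"
 proof (rule inj_onI)
 fix i j assume ij: "i : {..<k}" "j : {..<k}" and e: "f i = f j"
 have "n + 2 * i = app w (f i)" using f[of i] ij(1) by simp
 also have "\<dots> = n + 2 * j" unfolding e using f[of j] ij(2) by simp
 finally show "i = j" by simp
 qed
 have im: "f ` {..<k} \<subseteq> {..<d}"
 proof
 fix l assume "l : f ` {..<k}"
 then obtain j where "j < k" "l = f j" by blast
 then show "l : {..<d}" using f[of j] by simp
 qed
 show "k <= d" using card_inj_on_le[OF inj im] by simp
 assume k: "k = d"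
 have surj: "f ` {..<d} = {..<d}"
 using endo_inj_surj[of "{..<d}" f] inj im k by simp
 define s where "s = Fn (%i. if i < d then (app w i - n) div 2 else i)"
 have fs: "app s (f j) = j" if "j < d" for j using f[of j] that k by (simp add: s_def)
 have wf: "app w i = n + 2 * app s i & app s i < d" if i: "i < d" for i
 proof -
 obtain j where "j < d" "i = f j" using surj i by auto
 then show ?thesis using f[of j] fs[of j] k by simp
 qed
 have "app s ` {..<d} = {..<d}"
 proof
 show "app s ` {..<d} \<subseteq> {..<d}" using wf by blast
 show "{..<d} \<subseteq> app s ` {..<d}"
 proof
 fix j assume "j : {..<d}"
 then show "j : app s ` {..<d}" using fs[of j] f[of j] k by (intro image_eqI[of _ _ "f j"]) simp_all
 qed
 qed
 then have "bij_betw (app s) {..<d} {..<d}"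
 by (simp add: bij_betw_def eq_card_imp_inj_on)
 then have "s : Pm d" unfolding Pm_def by (simp, intro bij_imp_permutes) (simp_all add: s_def)
 moreover have "w = bw n d + s"
 proof (rule Wd_eqI[of _ d])
 show "w : Wd d" using assms by (simp add: gd_def)
 show "bw n d + s : Wd d" using \<open>s : Pm d\<close> by simp
 show "app w i = app (bw n d + s) i" if "i < d" for i using wf[OF that] by (simp add: bw_def)
 qed
 ultimately show "\<exists>s\<in>Pm d. w = bw n d + s" by blast
qed

lemma gd_bw:
 assumes s: "s : Pm d"
 shows "gd n d d (bw n d + s)"
 unfolding gd_def
proof (intro conjI allI impI)
 show "bw n d + s : Wd d" using s by simp
 show "app (bw n d + s) i < n \<or> (\<exists>j<d. app (bw n d + s) i = n + 2 * j)" if "i < d" for i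
 using Pm_less[OF s that] by (auto simp: bw_def)
 fix j assume j: "j < d"
 show "\<exists>!i. i < d & app (bw n d + s) i = n + 2 * j"
 proof (rule ex1I)
 show "app (pinv s) j < d & app (bw n d + s) (app (pinv s) j) = n + 2 * j"
 using Pm_less[OF Pm_pinv[OF s] j] app_pinv_app[OF s, of j] j by (simp add: bw_def)
 fix i assume "i < d & app (bw n d + s) i = n + 2 * j"
 then have "app s i = j" using Pm_less[OF s, of i] by (simp add: bw_def)
 then show "i = app (pinv s) j" using pinv_app_app[OF s, of i] by simp
 qed
qed

text \<open>Once all \<open>d\<close> letters are replaced, only rearrangements of
  \<open>bw n d\<close> remain. The group algebra factor records the coefficients of
  \<open>x\<close> along the orbit of \<open>a\<close>.\<close>

lemma Pk_full:
 assumes n: "even n" and x: "x : supp_on (Wl n d)" and a: "a : Wl n d"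
 shows "Pk d n (app a) d x = sg (bw n d) * (\<Sum>s\<in>Pm d. single s (lookup x (a + s)))" (is "_ = _ * ?alp")
proof (rule poly_mapping_eqI)
 fix w
 have aW: "a : Wd d" and an: "!!j. j < d ==> app a j < n" using a by (auto simp: Wl_def)
 have alp: "?alp : An d" by (intro supp_on_closed single_supp_on)
 have lookalp: "lookup ?alp s = lookup x (a + s)" if "s : Pm d" for s
 using that by (simp add: lookup_sum lookup_single when_def)
 note L = lookup_Pk[OF n x, of d "app a", OF an]
 show "lookup (Pk d n (app a) d x) w = lookup (sg (bw n d) * ?alp) w"
 proof (cases "\<exists>s\<in>Pm d. w = bw n d + s")
 case True
 then obtain s where s: "s : Pm d" "w = bw n d + s" by blast
 have "red n d (app a) w = a + s"
 proof (rule Wd_eqI[of _ d])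
 show "red n d (app a) w : Wd d" using s by (auto simp: red_def Wd_def bw_def permutes_not_in[OF Pm_app])
 show "a + s : Wd d" using aW s by simp
 show "app (red n d (app a) w) i = app (a + s) i" if "i < d" for i
 using Pm_less[OF s(1) that] that by (simp add: red_def s(2) bw_def)
 qed
 then show ?thesis using gd_bw[OF s(1), of n] by (simp add: L s lookalp lookup_bw[OF alp])
 next
 case False
 have "sg (bw n d) * ?alp : supp_on {bw n d + s |s. s : Pm d}"
 by (rule supp_on_mult[OF _ alp, of _ "{bw n d}"]) auto
 then have "lookup (sg (bw n d) * ?alp) w = 0" using False by (intro lookup_supp_on) auto
 moreover have "\<not> gd n d d w" using gd_card(2)[of n d d w] False by blast
 ultimately show ?thesis by (simp add: L)
 qed
qed

lemma Pk_kill: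
 assumes n: "even n" and x: "x : supp_on (Wl n d)" and a: "!!j. j < k ==> a j < n" and k: "d < k"
 shows "Pk d n a k x = 0"
proof (rule poly_mapping_eqI)
 fix w
 have "\<not> gd n d k w" using gd_card(1)[of n d k w] k by auto
 then show "lookup (Pk d n a k x) w = lookup 0 w"
 using lookup_Pk[where d=d and k=k and a=a, OF n x a] by simp
qed

section \<open>Submodules as subspaces of the word space\<close>

definition stable :: "nat => 'k fna set => bool" where
 "stable d S \<longleftrightarrow> fs.subspace S & S \<subseteq> Tn d & (\<forall>X\<in>so_inf scale Q. \<forall>x\<in>S. dact d X x : S)"

lemma stableD:
 assumes "stable d S"
 shows "fs.subspace S" "x : S ==> x : Tn d" "X : so_inf scale Q ==> x : S ==> dact d X x : S"
 using assms by (auto simp: stable_def)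

lemma stable_Pk: "stable d S ==> x : S ==> Pk d n a k x : S"
 by (induction k) (simp_all add: stableD elem_so)

definition mix :: "nat => nat => nat => fn => fn" where
 "mix n d k w = Fn (%i. if i < k then app w i else if i < d then n + 2 * i else i)"

definition agr :: "nat => nat => fn => fn => bool" where
 "agr d k w p \<longleftrightarrow> (\<forall>i. k <= i --> i < d --> app w i = app p i)"

text \<open>An interpolation between \<open>bw n d\<close> and \<open>x\<close>: the first
  \<open>k\<close> positions show the letters of \<open>x\<close>, the others new ones. Admitting
  only words that agree with \<open>p\<close> from \<open>k\<close> on remembers the hidden letters,
  so that they can be restored one at a time.\<close>

definition Yk :: "nat => nat => nat => fn => 'k fna => 'k fna" where
 "Yk n d k p = lin_ext (%w. if agr d k w p then sg (mix n d k w) else 0)"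

lemma klin_Yk: "klin (Yk n d k p)"
 unfolding Yk_def by (rule klin_lin_ext)

text \<open>Restoring the letter at position \<open>k\<close> also produces a term for each earlier
  position that holds its partner. For a fixed earlier position these terms factor through the
  contraction with position \<open>k\<close>, which vanishes on traceless \<open>x\<close>.\<close>

lemma Yk_step:
 assumes n: "even n" and x: "x : supp_on (Wl n d)" "x : Tl d" and k: "k < d"
 shows "(\<Sum>a<n. dact d (elem (n + 2 * k) a) (Yk n d k (upd p k a) x)) = Yk n d (Suc k) p x"
proof -
 let ?b = "n + 2 * k"
 let ?L = "%i. lin_ext (%u. if agr d (Suc k) u p then sg (upd (mix n d k u) i (star ?b)) else 0) :: 'k fna => 'k fna"
 have kL: "klin (?L i)" for i by (rule klin_lin_ext)
 have "(\<Sum>a<n. dact d (elem ?b a) (Yk n d k (upd p k a) x)) = Yk n d (Suc k) p x + (\<Sum>i<k. fscale (-1) (?L i (Con k i x)))"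
 proof (rule klin_eqI[where F="%x. \<Sum>a<n. dact d (elem ?b a) (Yk n d k (upd p k a) x)"
 and G="%x. Yk n d (Suc k) p x + (\<Sum>i<k. fscale (-1) (?L i (Con k i x)))"])
 show "klin (%x. \<Sum>a<n. dact d (elem ?b a) (Yk n d k (upd p k a) x))"
 by (rule klin_sum) (rule klin_comp[OF klin_dact klin_Yk])
 show "klin (%x. Yk n d (Suc k) p x + (\<Sum>i<k. fscale (-1) (?L i (Con k i x))))"
 by (rule klin_add[OF klin_Yk]) (rule klin_sum, rule klin_scale, rule klin_comp[OF kL klin_Con])
 fix w assume "w : keys x"
 then have "w : Wl n d" by (rule supp_onD[OF x(1)])
 then have w: "w : Wd d" and wn: "!!i. i < d ==> app w i < n" by (auto simp: Wl_def)
 have mW: "mix n d k w : Wd d" using k by (simp add: mix_def Wd_def)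
 have agr: "agr d k w (upd p k a) \<longleftrightarrow> app w k = a & agr d (Suc k) w p" for a
 proof -
 have "k <= i \<longleftrightarrow> i = k \<or> Suc k <= i" for i by auto
 then show ?thesis unfolding agr_def using k by force
 qed
 have "(\<Sum>a<n. dact d (elem ?b a) (Yk n d k (upd p k a) (sg w))) =
 (\<Sum>a<n. if a = app w k then if agr d (Suc k) w p then dact d (elem ?b a) (sg (mix n d k w)) else 0 else 0)"
 by (intro sum.cong refl) (auto simp: Yk_def agr klinD[OF klin_dact])
 also have "\<dots> = (if agr d (Suc k) w p then dact d (elem ?b (app w k)) (sg (mix n d k w)) else 0)"
 using wn[OF k] by simp
 also have "dact d (elem ?b (app w k)) (sg (mix n d k w)) =
 sg (mix n d (Suc k) w) - (\<Sum>i<k. if app w i = star (app w k) then sg (upd (mix n d k w) i (star ?b)) else 0)"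
 proof -
 have "(\<Sum>i<d. if app (mix n d k w) i = ?b then sg (upd (mix n d k w) i (app w k)) else (0 :: 'k fna)) =
 (\<Sum>i<d. if i = k then sg (upd (mix n d k w) k (app w k)) else 0)"
 proof (intro sum.cong refl)
 fix i assume i: "i : {..<d}"
 have "app (mix n d k w) i = ?b \<longleftrightarrow> i = k" using i wn[of i] by (auto simp: mix_def)
 then show "(if app (mix n d k w) i = ?b then sg (upd (mix n d k w) i (app w k)) else (0 :: 'k fna)) =
 (if i = k then sg (upd (mix n d k w) k (app w k)) else 0)" by simp
 qed
 also have "\<dots> = sg (upd (mix n d k w) k (app w k))" using k by simp
 also have "upd (mix n d k w) k (app w k) = mix n d (Suc k) w"
 by (rule fn_eqI) (use k in \<open>auto simp: mix_def\<close>)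
 finally have 1: "(\<Sum>i<d. if app (mix n d k w) i = ?b then sg (upd (mix n d k w) i (app w k)) else (0 :: 'k fna)) =
 sg (mix n d (Suc k) w)" .
 \<comment> \<open>The partner of an old letter is old, whereas the letters from position
   \<open>k\<close> on are new; so only earlier positions contribute.\<close>
 have 2: "(\<Sum>i<d. if app (mix n d k w) i = star (app w k) then sg (upd (mix n d k w) i (star ?b)) else (0 :: 'k fna)) =
 (\<Sum>i<k. if app w i = star (app w k) then sg (upd (mix n d k w) i (star ?b)) else 0)"
 proof (rule sum.mono_neutral_cong_right)
 show "\<forall>i\<in>{..<d} - {..<k}. (if app (mix n d k w) i = star (app w k) then sg (upd (mix n d k w) i (star ?b)) else (0 :: 'k fna)) = 0"
 using star_less[OF n, of "app w k"] wn[OF k] by (auto simp: mix_def)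
 qed (use k in \<open>auto simp: mix_def\<close>)
 show ?thesis unfolding dact_elem[OF mW] 1 2 ..
 qed
 also have "(if agr d (Suc k) w p then sg (mix n d (Suc k) w) -
 (\<Sum>i<k. if app w i = star (app w k) then sg (upd (mix n d k w) i (star ?b)) else 0) else 0) =
 Yk n d (Suc k) p (sg w) + (\<Sum>i<k. fscale (-1) (?L i (Con k i (sg w))))"
 proof -
 have "fscale (-1) (?L i (Con k i (sg w))) =
 (if agr d (Suc k) w p then - (if app w i = star (app w k) then sg (upd (mix n d k w) i (star ?b)) else 0) else 0)"
 if i: "i < k" for i
 proof -
 have "agr d (Suc k) (upd (upd w k 0) i 0) p \<longleftrightarrow> agr d (Suc k) w p" using i by (auto simp: agr_def)
 moreover have "upd (mix n d k (upd (upd w k 0) i 0)) i (star ?b) = upd (mix n d k w) i (star ?b)"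
 by (rule fn_eqI) (auto simp: mix_def)
 ultimately show ?thesis by (simp add: Con_sg klinD[OF klin_lin_ext] single_uminus[symmetric])
 qed
 then show ?thesis by (simp add: Yk_def sum_negf)
 qed
 finally show "(\<Sum>a<n. dact d (elem ?b a) (Yk n d k (upd p k a) (sg w))) =
 Yk n d (Suc k) p (sg w) + (\<Sum>i<k. fscale (-1) (?L i (Con k i (sg w))))" .
 qed
 also have "(\<Sum>i<k. fscale (-1) (?L i (Con k i x))) = 0"
 by (rule sum.neutral) (use x(2) k in \<open>auto simp: Tl_def klinD[OF kL]\<close>)
 finally show ?thesis by simp
qed

text \<open>\<open>Yk\<close> leads from a multiple of \<open>bw n d\<close> at \<open>k = 0\<close>
  to \<open>x\<close> at \<open>k = d\<close> without leaving \<open>S\<close>.\<close>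

lemma stable_Tl:
 assumes n: "even n" and S: "stable d S" and b: "sg (bw n d) : S" and x: "x : supp_on (Wl n d)" "x : Tl d"
 shows "x : S"
proof -
 have "k <= d ==> Yk n d k p x : S" for k p
 proof (induction k arbitrary: p)
 case 0
 have m0: "mix n d 0 w = bw n d" for w by (simp add: mix_def bw_def)
 have "Yk n d 0 p x = (\<Sum>w\<in>keys x. fscale (lookup x w) (if agr d 0 w p then sg (bw n d) else 0))"
 unfolding Yk_def lin_ext_def m0 ..
 also have "\<dots> : S"
 by (intro fs.subspace_sum[OF stableD(1)[OF S]] fs.subspace_scale[OF stableD(1)[OF S]])
 (simp add: b fs.subspace_0[OF stableD(1)[OF S]])
 finally show ?case .
 next
 case (Suc k)
 then have "(\<Sum>a<n. dact d (elem (n + 2 * k) a) (Yk n d k (upd p k a) x)) : S"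
 by (intro fs.subspace_sum[OF stableD(1)[OF S]] stableD(3)[OF S] elem_so) simp
 then show ?case using Yk_step[OF n x, of k p] Suc.prems by simp
 qed
 from this[of d 0] have "Yk n d d 0 x : S" by simp
 moreover have "Yk n d d 0 x = x"
 proof (rule klin_eqI[OF klin_Yk klin_id])
 fix w assume "w : keys x"
 then have "w : Wd d" using supp_onD[OF x(1)] by (auto simp: Wl_def)
 then have "mix n d d w = w" by (intro Wd_eqI[of _ d]) (simp_all add: mix_def Wd_def)
 then show "Yk n d d 0 (sg w) = sg w" by (simp add: Yk_def agr_def)
 qed
 ultimately show ?thesis by simp
qed

text \<open>Replacing all letters turns \<open>z\<close> into \<open>bw n d\<close> times a nonzero
  \<open>alp\<close>. The tensors that right multiplication by \<open>alp\<close> carries into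
  \<open>S\<close> form a stable subspace containing \<open>bw n d\<close>, hence contain every
  traceless tensor.\<close>

lemma generation:
 assumes S: "stable d S" and z: "z : S" "z ~= 0" and c: "c : An d" "z * c = fscale ka z"
 obtains alp where "alp : An d" "alp ~= 0" "alp * c = fscale ka alp" "!!x. x : Tl d ==> x * alp : S"
proof -
 obtain a where a: "lookup z a ~= 0" using z(2) poly_mapping_eqI[of z 0] by auto
 have zT: "z : Tn d" by (rule stableD(2)[OF S z(1)])
 have aW: "a : Wd d" using a lookup_supp_on[OF zT] by auto
 let ?alp = "%z. \<Sum>s\<in>Pm d. single s (lookup z (a + s))"
 have alp: "?alp z : An d" for z :: "'k fna" by (intro supp_on_closed single_supp_on)
 have lookalp: "lookup (?alp z) s = (if s : Pm d then lookup z (a + s) else 0)" for z :: "'k fna" and s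
 by (simp add: lookup_sum lookup_single when_def)
 have "?alp z ~= 0"
 proof
 assume "?alp z = 0"
 then have "lookup (?alp z) 0 = 0" by simp
 then show False using a by (simp only: lookalp) simp
 qed
 moreover have "?alp z * c = fscale ka (?alp z)"
 proof -
 have kalp: "klin ?alp"
 by (rule klinI) (rule poly_mapping_eqI, simp add: lookup_sum lookup_add lookup_single when_def)+
 have "?alp z * c = ?alp (z * c)"
 proof (rule klin_eqI[OF klin_mult_left klin_comp[OF kalp klin_mult_left]])
 fix s assume "s : keys c"
 then have s: "s : Pm d" by (rule supp_onD[OF c(1)])
 show "?alp z * sg s = ?alp (z * sg s)"
 proof (rule poly_mapping_eqI)
 fix t
 have "t + pinv s : Pm d \<longleftrightarrow> t : Pm d"
 using Pm_add[of t d "pinv s"] Pm_add[of "t + pinv s" d s] s by (auto simp: add.assoc)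
 then show "lookup (?alp z * sg s) t = lookup (?alp (z * sg s)) t"
 unfolding lookup_mult_sg[OF s, of "?alp z"] lookalp by (simp add: lookup_mult_sg[OF s] add.assoc)
 qed
 qed
 then show ?thesis using klinD(2)[OF kalp, of ka z] by (simp only: c(2))
 qed
 moreover have "x * ?alp z : S" if x: "x : Tl d" for x
 proof -
 have "x : Tn d" using x by (simp add: Tl_def)
 then obtain m1 where m1: "even m1" "0 <= m1" "x : supp_on (Wl m1 d)" by (rule letters_bound)
 \<comment> \<open>The bound \<open>n\<close> is chosen for \<open>x\<close> and \<open>z\<close>
   together; the group algebra element depends on \<open>z\<close> and \<open>a\<close> only, so it
   serves all \<open>x\<close>.\<close>
 obtain n where n: "even n" "m1 <= n" "z : supp_on (Wl n d)" by (rule letters_bound[OF zT])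
 have xn: "x : supp_on (Wl n d)"
 by (rule supp_on_mono[OF _ m1(3)]) (use n(2) in \<open>auto simp: Wl_def\<close>)
 have an: "a : Wl n d" using a lookup_supp_on[OF n(3)] by auto
 have b: "sg (bw n d) * ?alp z : S"
 using stable_Pk[OF S z(1), of n "app a" d] Pk_full[OF n(1,3) an] by simp
 let ?S = "{y : Tn d. y * ?alp z : S}"
 have "stable d ?S"
 unfolding stable_def
 proof (intro conjI ballI)
 show "fs.subspace ?S"
 using stableD(1)[OF S] by (auto simp: fs.subspace_def distrib_right fscale_mult_left)
 fix X y assume X: "X : so_inf scale Q" and y: "y : ?S"
 have "dact d X y * ?alp z = dact d X (y * ?alp z)"
 by (rule dact_mult[OF so_linear(1)[OF X] _ alp, symmetric]) (use y in simp)
 then show "dact d X y : ?S" using stableD(3)[OF S X] y by simp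
 qed auto
 from stable_Tl[OF n(1) this _ xn x] show ?thesis using b by simp
 qed
 ultimately show ?thesis using that[OF alp] by blast
qed

text \<open>Nondegeneracy of \<open>tau\<close> allows \<open>alp\<close> to be multiplied on the
  left into a nonzero multiple of \<open>cS q\<close>. Right multiplication keeps \<open>x\<close>
  traceless, so this factor can be inserted before \<open>alp\<close>.\<close>

lemma stable_simple:
 assumes q: "is_partition q" and S: "stable (sum_list q) S" and z: "z : S" "z ~= 0"
 and SG: "S \<subseteq> (%x. x * cS q) ` Tn (sum_list q)"
 and x: "x : Tl (sum_list q)" "x : (%x. x * cS q) ` Tn (sum_list q)"
 shows "x : S"
proof -
 let ?d = "sum_list q"
 obtain ka where k: "ka ~= 0" "cS q * cS q = fscale ka (cS q :: 'k fna)" using cS_square[OF q] by metis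
 have sq: "y * cS q = fscale ka y" if "y : (%x :: 'k fna. x * cS q) ` Tn ?d" for y
 using that by (auto simp: mult.assoc k fscale_mult_right)
 obtain alp where alp: "alp : An ?d" "alp ~= 0" "alp * cS q = fscale ka alp" "!!x. x : Tl ?d ==> x * alp : S"
 using generation[OF S z cS_An sq] SG z(1) by blast
 obtain y where y: "y : An ?d" "tau (alp * y) ~= 0" by (rule tau_nondegenerate[OF alp(1,2)])
 obtain \<mu> where m: "cS q * (y * alp) * cS q = fscale \<mu> (cS q :: 'k fna)" using cS_x_cS[OF q An_mult[OF y(1) alp(1)]] by blast
 have cya: "cS q * y * alp = fscale (\<mu> / ka) (cS q)"
 proof -
 have "fscale ka (cS q * y * alp) = cS q * y * (alp * cS q)" by (simp add: alp(3) fscale_mult_right)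
 also have "\<dots> = fscale \<mu> (cS q)" using m by (simp add: mult.assoc)
 finally have "fscale (inverse ka) (fscale ka (cS q * y * alp)) = fscale (inverse ka) (fscale \<mu> (cS q))" by simp
 then show ?thesis using k(1) by (simp add: field_simps)
 qed
 \<comment> \<open>Otherwise cyclicity of the trace together with
   \<open>alp * cS q = fscale ka alp\<close> would give \<open>tau (y * alp) = 0\<close>.\<close>
 have "\<mu> ~= 0"
 proof
 assume "\<mu> = 0"
 then have "tau (cS q * (y * alp)) = 0" using cya by (simp add: mult.assoc)
 then have "tau (y * alp * cS q) = 0" using tau_commute[OF cS_An An_mult[OF y(1) alp(1)]] by simp
 then have "tau (y * alp) = 0" using k(1) by (simp add: mult.assoc alp(3) fscale_mult_right)
 then show False using y(2) tau_commute[OF y(1) alp(1)] by simp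
 qed
 have "x * (cS q * y) : Tl ?d" using x(1) An_mult[OF cS_An y(1)] unfolding Tl_Fl by (rule Fl_mult)
 then have "x * (cS q * y) * alp : S" by (rule alp(4))
 also have "x * (cS q * y) * alp = fscale (\<mu> / ka) (x * cS q)"
 using cya by (simp add: mult.assoc fscale_mult_right)
 also have "\<dots> = fscale \<mu> x" using k(1) by (simp add: sq[OF x(2)])
 finally have "fscale (inverse \<mu>) (fscale \<mu> x) : S" by (rule fs.subspace_scale[OF stableD(1)[OF S]])
 then show ?thesis using \<open>\<mu> ~= 0\<close> by simp
qed

text \<open>All letters of \<open>bw 0 d\<close> are even, so no two are partners and the word is
  traceless; as they are distinct, multiplication by \<open>cS q\<close> does not kill it.\<close>

lemma Tl_nonzero:
 assumes "is_partition q"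
 shows "\<exists>x\<in>Tl (sum_list q). x : (%x :: 'k fna. x * cS q) ` Tn (sum_list q) & x ~= 0"
proof -
 let ?d = "sum_list q" and ?b = "bw 0 (sum_list q)"
 have b: "sg ?b : Tl ?d"
 proof -
 have "app ?b j ~= star (app ?b i)" if "i < ?d" "j < ?d" for i j
 proof
 assume "app ?b j = star (app ?b i)"
 then have "even (star (2 * i))" using that by (simp add: bw_def) (metis dvd_triv_left)
 then show False by (simp add: even_star)
 qed
 then show ?thesis by (simp add: Tl_def Con_sg)
 qed
 have "sg ?b * cS q : Tl ?d" using b cS_An unfolding Tl_Fl by (rule Fl_mult)
 moreover have "lookup (sg ?b * cS q :: 'k fna) (?b + 0) = tau (cS q)"
 unfolding tau_def by (rule lookup_bw[OF cS_An Pm_0])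
 then have "sg ?b * cS q ~= (0 :: 'k fna)" by auto
 moreover have "sg ?b * cS q : (%x :: 'k fna. x * cS q) ` Tn ?d" by simp
 ultimately show ?thesis by blast
qed

text \<open>A nonzero \<open>r\<close>-fold contraction leaves \<open>f\<close> letters. Replacing
  them by \<open>f\<close> new letters commutes with contractions: after \<open>r + 1\<close> of
  these there are too few letters to replace, while the chosen \<open>r\<close>-fold one stays
  nonzero by \<open>Pk_full\<close>.\<close>

lemma stable_essential:
 assumes S: "stable d S" and z: "z : S" "z \<notin> Fl d r"
 shows "\<exists>y\<in>S. y : Fl d (Suc r) & y \<notin> Fl d r"
proof -
 have zT: "z : Tn d" by (rule stableD(2)[OF S z(1)])
 obtain f s where f: "d = f + 2 * r" "s : Pm d" "Phi f r (z * sg s) ~= 0"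
 using z(2) FlI[OF zT] by blast
 obtain n where n: "even n" "0 <= n" "z : supp_on (Wl n d)" by (rule letters_bound[OF zT])
 have Ph: "Phi e r' (z * sg t) : supp_on (Wl n e)" if e: "d = e + 2 * r'" and t: "t : Pm d" for e r' t
 proof -
 have "Phi e r' (z * sg t) = (\<Sum>w\<in>keys z. fscale (lookup z w) (Phi e r' (sg w * sg t)))"
 by (rule klin_expand[OF klin_comp[OF klin_Phi klin_mult_right]])
 also have "\<dots> : supp_on (Wl n e)"
 proof (intro supp_on_closed)
 fix w assume "w : keys z"
 then have w: "w : Wd d" "!!i. i < d ==> app w i < n" using supp_onD[OF n(3)] by (auto simp: Wl_def)
 have "app (w + t) i < n" if "i < d" for i using w(2)[OF Pm_less[OF t that]] by simp
 moreover have "w + t : Wd (e + 2 * r')" using w t e by simp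
 ultimately show "Phi e r' (sg w * sg t) : supp_on (Wl n e)" using e by (simp add: sg_mult Phi_sg Wl_def)
 qed
 finally show ?thesis .
 qed
 let ?u = "Phi f r (z * sg s)"
 have u: "?u : supp_on (Wl n f)" by (rule Ph[OF f(1,2)])
 obtain a where a: "lookup ?u a ~= 0" using f(3) poly_mapping_eqI[of ?u 0] by auto
 have an: "a : Wl n f" using a lookup_supp_on[OF u] by auto
 then have an': "!!j. j < f ==> app a j < n" by (auto simp: Wl_def)
 let ?y = "Pk d n (app a) f z"
 have Py: "Phi e r' (?y * sg t) = Pk e n (app a) f (Phi e r' (z * sg t))" if e: "d = e + 2 * r'" and t: "t : Pm d" for e r' t
 proof -
 have tA: "sg t : An d" using t by simp
 have zt: "z * sg t : Tn (e + 2 * r')" using Tn_mult[OF zT tA] e by simp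
 have "Phi e r' (?y * sg t) = Phi e r' (Pk d n (app a) f (z * sg t))" by (simp only: Pk_mult[OF zT tA])
 then show ?thesis using Pk_Phi[OF zt, of n "app a" f] e by simp
 qed
 have "?y : S" by (rule stable_Pk[OF S z(1)])
 moreover have "?y : Fl d (Suc r)"
 proof (rule FlI)
 show "?y : Tn d" by (rule Pk_Tn[OF zT])
 fix e t assume e: "d = e + 2 * Suc r" and t: "t : Pm d"
 show "Phi e (Suc r) (?y * sg t) = 0"
 unfolding Py[OF e t] by (rule Pk_kill[OF n(1) Ph[OF e t] an']) (use e f(1) in simp_all)
 qed
 moreover have "?y \<notin> Fl d r"
 proof
 assume "?y : Fl d r"
 then have "Phi f r (?y * sg s) = 0" using Fl_An[of ?y f r "sg s"] f by simp
 then have "Pk f n (app a) f ?u = 0" using Py[OF f(1,2)] by simp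
 then have 0: "sg (bw n f) * (\<Sum>s\<in>Pm f. single s (lookup ?u (a + s))) = 0" (is "_ * ?alp = 0")
 using Pk_full[OF n(1) u an] by simp
 have alp: "?alp : An f" by (intro supp_on_closed single_supp_on)
 have "lookup ?alp 0 = lookup (sg (bw n f) * ?alp) (bw n f + 0)"
 by (rule lookup_bw[OF alp Pm_0, symmetric])
 then have "lookup ?alp 0 = 0" unfolding 0 by simp
 then show False using a by (simp add: lookup_sum lookup_single when_def)
 qed
 ultimately show ?thesis by blast
qed

end

section \<open>Lifting along contractions\<close>

lemma PmI:
 assumes "!!i. i < d ==> f i < d" "inj_on f {..<d}" "!!i. \<not> i < d ==> f i = i"
 shows "Fn f : Pm d"
proof -
 have "f ` {..<d} \<subseteq> {..<d}" using assms(1) by auto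
 then have "f ` {..<d} = {..<d}" by (rule endo_inj_surj[OF finite_lessThan _ assms(2)])
 then have "bij_betw f {..<d} {..<d}" using assms(2) by (simp add: bij_betw_def)
 then show ?thesis unfolding Pm_def by (simp, intro bij_imp_permutes) (simp_all add: assms(3))
qed

lemma Pm_inj: "s : Pm d ==> app s i = app s j \<longleftrightarrow> i = j"
 using permutes_inj[OF Pm_app, of s d] by (simp add: inj_eq)

text \<open>Consecutive letters, in contrast to \<open>bw\<close>: for even \<open>n\<close>
  neighbours are partners, so the contraction of this word along \<open>star\<close> is one.\<close>

definition nuw :: "nat => nat => fn" where
 "nuw n m = Fn (%j. if j < m then n + j else j)"

abbreviation Ut :: "nat => nat => nat => ('k::field) fna => 'k fna" where
 "Ut n e r t \<equiv> Cat e (2 * r) t (sg (nuw n (2 * r)))"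

lemma app_catw: "app (catw e f u v) j = (if j < e then app u j else if j < e + f then app v (j - e) else j)"
 by (simp add: catw_def)

lemma klin_Phi_Ut: "klin (%t. Phi f m (Ut n e r t * x))"
 by (rule klin_comp[OF klin_Phi klin_comp[OF klin_mult_right klin_bil_left]])

text \<open>
 The letters of \<open>nuw\<close> do not occur in \<open>t\<close>, so a contraction that meets a position of \<open>t\<close>
 pairs two positions of \<open>t\<close>, and this vanishes as \<open>t\<close> is traceless.
\<close>

lemma Phi_lift_0:
 fixes t :: "('k::field) fna"
 assumes n: "even n" and t: "t : supp_on (Wl n e)" "t : Tl e" and fm: "f + 2 * m = e + 2 * r"
 and g: "g : Pm (e + 2 * r)" and j: "j < 2 * m" "app g (f + j) < e"
 shows "Phi f m (Ut n e r t * sg g) = 0"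
proof -
 let ?P = "app g (f + j)" and ?P' = "app g (f + star j)" and ?W = "%v. catw e (2 * r) v (nuw n (2 * r)) + g"
 have sj: "star j < 2 * m" using star_less[of "2 * m" j] j by simp
 have PP: "?P ~= ?P'" by (simp add: Pm_inj[OF g] star_neq[symmetric])
 have W: "?W v : Wd (f + 2 * m)" for v unfolding fm by (rule Wd_add[OF catw_Wd g])
 have WP: "app (?W v) (f + j) = app v ?P" for v using j(2) by (simp add: app_catw)
 note k = klin_Phi_Ut[where f=f and m=m and n=n and e=e and r=r and x="sg g :: 'k fna"]
 show ?thesis
 proof (cases "?P' < e")
 case False
 have P'd: "?P' < e + 2 * r" by (rule Pm_less[OF g]) (use sj fm in linarith)
 have "Phi f m (Ut n e r t * sg g) = (%_. 0) t"
 proof (rule klin_eqI[OF k klin_zero])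
 fix v assume "v : keys t"
 then have "v : Wl n e" by (rule supp_onD[OF t(1)])
 then have "star (app (?W v) (f + j)) < n" using j(2) star_less[OF n] unfolding WP by (simp add: Wl_def)
 moreover have "n <= app (?W v) (f + star j)"
 proof -
 have "?P' - e < 2 * r" using False P'd by linarith
 then have "app (?W v) (f + star j) = n + (?P' - e)" using False P'd by (simp add: app_catw nuw_def)
 then show ?thesis by linarith
 qed
 ultimately have "app (?W v) (f + star j) ~= star (app (?W v) (f + j))" by linarith
 then have "\<not> (\<forall>i<2 * m. app (?W v) (f + star i) = star (app (?W v) (f + i)))" using j(1) by blast
 then show "Phi f m (Ut n e r (sg v) * sg g) = 0"
 by (simp only: bil_single sg_mult mult_1 Phi_sg[OF W] if_False)
 qed
 then show ?thesis .
 next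
 case True
 define C where "C u \<longleftrightarrow> (\<forall>i<2 * m. i ~= j --> i ~= star j --> app (?W u) (f + star i) = star (app (?W u) (f + i)))" for u
 let ?L = "lin_ext (%u. if C u then sg (trc f (?W u)) else 0) :: 'k fna => 'k fna"
 have WP': "app (?W v) (f + star j) = app v ?P'" for v using True by (simp add: app_catw)
 have "Phi f m (Ut n e r t * sg g) = ?L (Con ?P ?P' t)"
 proof (rule klin_eqI[OF k klin_comp[OF klin_lin_ext klin_Con]])
 fix v assume "v : keys t"
 let ?u = "upd (upd v ?P 0) ?P' 0"
 have same: "app (?W ?u) i = app (?W v) i" if "i ~= f + j" "i ~= f + star j" for i
 using that by (simp add: app_catw Pm_inj[OF g])
 have "C ?u \<longleftrightarrow> C v"
 proof -
 have "app (?W ?u) (f + i) = app (?W v) (f + i)" "app (?W ?u) (f + star i) = app (?W v) (f + star i)"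
 if "i ~= j" "i ~= star j" for i
 using that star_swap[of i j] by (intro same; simp add: star_eq_iff; metis star_star)+
 then show ?thesis unfolding C_def by metis
 qed
 moreover have "trc f (?W ?u) = trc f (?W v)"
 by (rule fn_eqI) (use same in simp)
 ultimately have "?L (Con ?P ?P' (sg v)) = (if app v ?P' = star (app v ?P) & C v then sg (trc f (?W v)) else 0)"
 by (simp add: Con_sg klinD[OF klin_lin_ext])
 moreover have "(\<forall>i<2 * m. app (?W v) (f + star i) = star (app (?W v) (f + i))) \<longleftrightarrow> app v ?P' = star (app v ?P) & C v"
 proof
 assume a: "\<forall>i<2 * m. app (?W v) (f + star i) = star (app (?W v) (f + i))"
 have "app v ?P' = star (app v ?P)" using a[rule_format, OF j(1)] unfolding WP WP' .
 then show "app v ?P' = star (app v ?P) & C v" using a unfolding C_def by blast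
 next
 assume a: "app v ?P' = star (app v ?P) & C v"
 show "\<forall>i<2 * m. app (?W v) (f + star i) = star (app (?W v) (f + i))"
 proof (intro allI impI)
 fix i assume i: "i < 2 * m"
 consider "i = j" | "i = star j" | "i ~= j" "i ~= star j" by blast
 then show "app (?W v) (f + star i) = star (app (?W v) (f + i))"
 proof cases
 case 1
 show ?thesis unfolding 1 WP WP' using a by simp
 next
 case 2
 have "app v ?P = star (app v ?P')" using conjunct1[OF a] by simp
 then show ?thesis unfolding 2 star_star WP WP' .
 next
 case 3
 then show ?thesis using conjunct2[OF a] i unfolding C_def by blast
 qed
 qed
 qed
 ultimately show "Phi f m (Ut n e r (sg v) * sg g) = ?L (Con ?P ?P' (sg v))"
 by (simp only: bil_single sg_mult mult_1 Phi_sg[OF W])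
 qed
 also have "Con ?P ?P' t = 0" using t(2) j(2) True PP by (simp add: Tl_def)
 finally show ?thesis by (simp add: klinD[OF klin_lin_ext])
 qed
qed

lemma Phi_Cat:
 assumes y: "y : Tn e" and v: "v : Wd (2 * r)"
 shows "Phi e r (Cat e (2 * r) y (sg v)) = (if \<forall>j<2 * r. app v (star j) = star (app v j) then y else 0)"
proof -
 define C where "C \<longleftrightarrow> (\<forall>j<2 * r. app v (star j) = star (app v j))"
 have "Phi e r (Cat e (2 * r) y (sg v)) = (%y. if C then y else 0) y"
 proof (rule klin_eqI[OF klin_comp[OF klin_Phi klin_bil_left]])
 show "klin (%y. if C then y else 0)" by (cases C) (simp_all add: klin_id klin_zero)
 fix u assume "u : keys y"
 then have u: "u : Wd e" by (rule supp_onD[OF y])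
 have "trc e (catw e (2 * r) u v) = u"
 by (rule Wd_eqI[OF Wd_trc u]) (simp add: app_catw)
 moreover have "(\<forall>j<2 * r. app (catw e (2 * r) u v) (e + star j) = star (app (catw e (2 * r) u v) (e + j))) \<longleftrightarrow> C"
 unfolding C_def by (simp add: app_catw star_less)
 ultimately show "Phi e r (Cat e (2 * r) (sg u) (sg v)) = (if C then sg u else 0)"
 by (simp only: bil_single mult_1 Phi_sg[OF catw_Wd])
 qed
 then show ?thesis by (simp only: C_def)
qed

definition inK :: "nat => nat => fn => bool" where
 "inK e r g \<longleftrightarrow> (\<exists>s\<in>Pm e. \<exists>h\<in>Hs r. g = bxw e s h)"

text \<open>Restriction of a group algebra element to the block permutations with hyperoctahedral
  second block, which is then forgotten.\<close>

definition Rr :: "nat => nat => ('k::field) fna => 'k fna" where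
 "Rr e r = lin_ext (%g. if inK e r g then sg (trc e g) else 0)"

lemma klin_Rr: "klin (Rr e r)"
 unfolding Rr_def by (rule klin_lin_ext)

lemma Rr_sg: "Rr e r (sg g) = (if inK e r g then sg (trc e g) else 0)"
 by (simp add: Rr_def)

lemma trc_bxw: "s : Pm e ==> trc e (bxw e s h) = s"
 by (rule Wd_eqI[OF Wd_trc Pm_Wd]) (simp_all add: bxw_def)

lemma HsD: "h : Hs r ==> h : Pm (2 * r)"
 by (simp add: Hs_def)

text \<open>A permutation that maps the last block into itself maps it onto itself, by finiteness,
  and so preserves the first block as well.\<close>

lemma Pm_block:
 assumes g: "g : Pm (e + m)" and ge: "!!j. j < m ==> e <= app g (e + j)"
 obtains s h where "s : Pm e" "h : Pm m" "g = bxw e s h"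
proof -
 let ?H = "{e..<e + m}"
 have hi: "app g i : ?H" if "i : ?H" for i
 proof -
 have i: "e + (i - e) = i" "i - e < m" using that by auto
 show ?thesis using ge[OF i(2)] Pm_less[OF g, of i] that unfolding i(1) by simp
 qed
 have surj: "app g ` ?H = ?H"
 by (rule endo_inj_surj) (use hi Pm_inj[OF g] in \<open>auto simp: inj_on_def\<close>)
 have lo: "app g i < e" if i: "i < e" for i
 proof (rule ccontr)
 assume "\<not> app g i < e"
 then have "app g i : ?H" using Pm_less[OF g, of i] i by simp
 then obtain l where "l : ?H" "app g i = app g l" using surj by blast
 then show False using Pm_inj[OF g] i by simp
 qed
 define s where "s = Fn (%i. if i < e then app g i else i)"
 define h where "h = Fn (%j. if j < m then app g (e + j) - e else j)"
 have "s : Pm e" unfolding s_def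
 by (rule PmI) (use lo Pm_inj[OF g] in \<open>auto simp: inj_on_def\<close>)
 moreover have "h : Pm m" unfolding h_def
 proof (rule PmI)
 show "(if j < m then app g (e + j) - e else j) < m" if "j < m" for j
 using hi[of "e + j"] that by auto
 show "inj_on (%j. if j < m then app g (e + j) - e else j) {..<m}"
 proof (rule inj_onI)
 fix i j assume ij: "i : {..<m}" "j : {..<m}"
 "(if i < m then app g (e + i) - e else i) = (if j < m then app g (e + j) - e else j)"
 then have "app g (e + i) = app g (e + j)" using ge[of i] ge[of j] by simp
 then show "i = j" using Pm_inj[OF g, of "e + i" "e + j"] by simp
 qed
 qed simp
 moreover have "g = bxw e s h"
 proof (rule fn_eqI)
 fix i
 consider "i < e" | j where "i = e + j" "j < m" | j where "i = e + j" "\<not> j < m"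
 by (metis le_Suc_ex linorder_not_less)
 then show "app g i = app (bxw e s h) i"
 proof cases
 case 2
 then show ?thesis using ge[of j] by (simp add: bxw_def h_def)
 next
 case 3
 then show ?thesis using permutes_not_in[OF Pm_app[OF g], of i] by (simp add: bxw_def h_def)
 qed (simp add: bxw_def s_def)
 qed
 ultimately show ?thesis by (rule that)
qed

text \<open>By \<open>Phi_lift_0\<close> only permutations preserving the last block survive. On
  these the contraction of \<open>nuw\<close> tests membership of the second factor in the
  hyperoctahedral group.\<close>

lemma Phi_lift:
 fixes t :: "('k::field) fna"
 assumes n: "even n" and t: "t : supp_on (Wl n e)" "t : Tl e" and x: "x : An (e + 2 * r)"
 shows "Phi e r (Ut n e r t * x) = t * Rr e r x"
proof (rule klin_eqI[OF klin_comp[OF klin_Phi klin_mult_left] klin_comp[OF klin_mult_left klin_Rr]])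
 fix g assume "g : keys x"
 then have g: "g : Pm (e + 2 * r)" by (rule supp_onD[OF x])
 show "Phi e r (Ut n e r t * sg g) = t * Rr e r (sg g)"
 proof (cases "\<exists>j<2 * r. app g (e + j) < e")
 case True
 then obtain j where j: "j < 2 * r" "app g (e + j) < e" by blast
 then have "\<not> inK e r g" by (auto simp: inK_def bxw_def)
 then show ?thesis using Phi_lift_0[OF n t refl g j] by (simp add: Rr_sg)
 next
 case False
 then obtain s h where sh: "s : Pm e" "h : Pm (2 * r)" "g = bxw e s h"
 using Pm_block[OF g] by (metis not_le_imp_less)
 have tT: "t : Tn e" using t(2) by (simp add: Tl_def)
 have nW: "nuw n (2 * r) : Wd (2 * r)" by (simp add: nuw_def Wd_def)
 have "Ut n e r t * sg g = Ut n e r t * Bx e (sg s) (sg h)" by (simp add: sh)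
 also have "\<dots> = Cat e (2 * r) (t * sg s) (sg (nuw n (2 * r)) * sg h)" by (rule Cat_Bx) (use sh in simp_all)
 finally have "Ut n e r t * sg g = Cat e (2 * r) (t * sg s) (sg (nuw n (2 * r) + h))" by (simp only: sg_mult)
 then have P: "Phi e r (Ut n e r t * sg g) =
 (if \<forall>j<2 * r. app (nuw n (2 * r) + h) (star j) = star (app (nuw n (2 * r) + h) j) then t * sg s else 0)"
 using Phi_Cat[OF Tn_mult[OF tT single_supp_on[OF sh(1)]] Wd_add[OF nW sh(2)]] by simp
 have c1: "app (nuw n (2 * r) + h) (star j) = star (app (nuw n (2 * r) + h) j) \<longleftrightarrow> app h (star j) = star (app h j)"
 if j: "j < 2 * r" for j
 proof -
 have "app h j < 2 * r" "app h (star j) < 2 * r" using Pm_less[OF sh(2)] j star_less[of "2 * r" j] by auto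
 then show ?thesis by (simp add: nuw_def star_add_even[OF n])
 qed
 have c2: "(\<forall>j<2 * r. app h (star j) = star (app h j)) \<longleftrightarrow> h : Hs r"
 proof
 assume a: "\<forall>j<2 * r. app h (star j) = star (app h j)"
 have "app h (star j) = star (app h j)" for j
 proof (cases "j < 2 * r")
 case False
 then have "\<not> star j < 2 * r" by (simp add: star_less)
 then show ?thesis using False permutes_not_in[OF Pm_app[OF sh(2)]] by simp
 qed (use a in blast)
 then show "h : Hs r" using sh(2) by (simp add: Hs_def)
 qed (simp add: Hs_def)
 have c3: "inK e r g \<longleftrightarrow> h : Hs r"
 proof
 assume "inK e r g"
 then obtain s' h' where s': "h' : Hs r" "bxw e s h = bxw e s' h'" using sh(3) by (auto simp: inK_def)
 have "app h j = app h' j" for j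
 using arg_cong[OF s'(2), of "%w. app w (e + j)"] by (simp add: bxw_def)
 then have "h = h'" by (rule fn_eqI)
 then show "h : Hs r" using s'(1) by simp
 qed (use sh in \<open>auto simp: inK_def\<close>)
 have "(\<forall>j<2 * r. app (nuw n (2 * r) + h) (star j) = star (app (nuw n (2 * r) + h) j)) \<longleftrightarrow> inK e r g"
 unfolding c3 c2[symmetric] using c1 by blast
 then show ?thesis unfolding P Rr_sg using trc_bxw[OF sh(1), of h] sh(3) by simp
 qed
qed

lemma Hs_0 [simp]: "0 : Hs r"
 by (simp add: Hs_def)

lemma inK_add:
 assumes "inK e r f" "inK e r g"
 shows "inK e r (f + g)"
proof -
 obtain s h where f: "s : Pm e" "h : Hs r" "f = bxw e s h" using assms(1) unfolding inK_def by blast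
 obtain s' h' where g: "s' : Pm e" "h' : Hs r" "g = bxw e s' h'" using assms(2) unfolding inK_def by blast
 have "h + h' : Hs r" using f g subgrpD[OF subgrp_Hs[of r]] by auto
 moreover have "f + g = bxw e (s + s') (h + h')" unfolding f(3) g(3) by (rule bxw_bxw[OF g(1)])
 ultimately show ?thesis using Pm_add[OF f(1) g(1)] unfolding inK_def by blast
qed

lemma inK_left:
 assumes s: "s : Pm e" and h: "h : Hs r"
 shows "inK e r (bxw e s h + g) \<longleftrightarrow> inK e r g" "inK e r (g + bxw e s h) \<longleftrightarrow> inK e r g"
proof -
 let ?k = "bxw e s h" and ?k' = "bxw e (pinv s) (pinv h)"
 have h': "pinv h : Hs r" using h subgrpD[OF subgrp_Hs[of r]] by auto
 have inv: "?k' + ?k = 0" "?k + ?k' = 0"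
 using s HsD[OF h] bxw_bxw[OF s] bxw_bxw[OF Pm_pinv[OF s]]
 by (simp_all add: pinv_left[OF s] pinv_right[OF s] pinv_left[OF HsD[OF h]] pinv_right[OF HsD[OF h]])
 have kK: "inK e r ?k" and kK': "inK e r ?k'" unfolding inK_def using s h h' Pm_pinv[OF s] by blast+
 have e1: "?k' + (?k + g) = g" unfolding add.assoc[symmetric] inv by simp
 have e2: "g + ?k + ?k' = g" unfolding add.assoc inv by simp
 show "inK e r (?k + g) \<longleftrightarrow> inK e r g"
 proof
 assume "inK e r (?k + g)"
 from inK_add[OF kK' this] show "inK e r g" unfolding e1 .
 qed (rule inK_add[OF kK])
 show "inK e r (g + ?k) \<longleftrightarrow> inK e r g"
 proof
 assume "inK e r (g + ?k)"
 from inK_add[OF this kK'] show "inK e r g" unfolding e2 .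
 qed (rule inK_add[OF _ kK])
qed

lemma Rr_Bx_sg:
 assumes s: "s : Pm e" and h: "h : Hs r"
 shows "Rr e r (sg (bxw e s h) * y) = sg s * Rr e r y" "Rr e r (y * sg (bxw e s h)) = Rr e r y * sg s"
proof -
 have tr: "trc e (bxw e s h + g) = s + trc e g" "trc e (g + bxw e s h) = trc e g + s" if gK: "inK e r g" for g
 proof -
 obtain s' h' where s': "s' : Pm e" "h' : Hs r" "g = bxw e s' h'" using gK unfolding inK_def by blast
 show "trc e (bxw e s h + g) = s + trc e g" "trc e (g + bxw e s h) = trc e g + s"
 unfolding s'(3) bxw_bxw[OF s'(1)] bxw_bxw[OF s] by (simp_all add: trc_bxw s s')
 qed
 show "Rr e r (sg (bxw e s h) * y) = sg s * Rr e r y"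
 by (rule klin_eqI[OF klin_comp[OF klin_Rr klin_mult_left] klin_comp[OF klin_mult_left klin_Rr]])
 (simp add: sg_mult Rr_sg inK_left[OF s h] tr)
 show "Rr e r (y * sg (bxw e s h)) = Rr e r y * sg s"
 by (rule klin_eqI[OF klin_comp[OF klin_Rr klin_mult_right] klin_comp[OF klin_mult_right klin_Rr]])
 (simp add: sg_mult Rr_sg inK_left[OF s h] tr)
qed

lemma Rr_Bx:
 assumes a: "a : An e" and h: "h : Hs r"
 shows "Rr e r (Bx e a (sg h) * y) = a * Rr e r y" "Rr e r (y * Bx e a (sg h)) = Rr e r y * a"
proof -
 show "Rr e r (Bx e a (sg h) * y) = a * Rr e r y"
 by (rule klin_eqI[OF klin_comp[OF klin_Rr klin_comp[OF klin_mult_right klin_bil_left]] klin_mult_right])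
 (use supp_onD[OF a] in \<open>simp add: Rr_Bx_sg h\<close>)
 show "Rr e r (y * Bx e a (sg h)) = Rr e r y * a"
 by (rule klin_eqI[OF klin_comp[OF klin_Rr klin_comp[OF klin_mult_left klin_bil_left]] klin_mult_left])
 (use supp_onD[OF a] in \<open>simp add: Rr_Bx_sg h\<close>)
qed

lemma Rr_hS:
 fixes a :: "('k::field) fna"
 assumes a: "a : An e"
 shows "Rr e r (Bx e a (hS r) * y) = fscale (of_nat (card (Hs r))) (a * Rr e r y)"
 "Rr e r (y * Bx e a (hS r)) = fscale (of_nat (card (Hs r))) (Rr e r y * a)"
proof -
 have c: "(\<Sum>h\<in>Hs r. z) = fscale (of_nat (card (Hs r))) z" for z :: "'k fna"
 using fs.scale_sum_left[of "%_. 1" "Hs r" z] unfolding fs.scale_one by simp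
 have B: "Bx e a (hS r) = (\<Sum>h\<in>Hs r. Bx e a (sg h))"
 by (simp add: hS_def gsum_def klinD[OF klin_bil_right])
 have "Rr e r (Bx e a (hS r) * y) = (\<Sum>h\<in>Hs r. Rr e r (Bx e a (sg h) * y))"
 unfolding B by (simp only: sum_distrib_right klinD(6)[OF klin_Rr])
 also have "\<dots> = (\<Sum>h\<in>Hs r. a * Rr e r y)" by (rule sum.cong[OF refl]) (rule Rr_Bx(1)[OF a])
 finally show "Rr e r (Bx e a (hS r) * y) = fscale (of_nat (card (Hs r))) (a * Rr e r y)" by (simp only: c)
 have "Rr e r (y * Bx e a (hS r)) = (\<Sum>h\<in>Hs r. Rr e r (y * Bx e a (sg h)))"
 unfolding B by (simp only: sum_distrib_left klinD(6)[OF klin_Rr])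
 also have "\<dots> = (\<Sum>h\<in>Hs r. Rr e r y * a)" by (rule sum.cong[OF refl]) (rule Rr_Bx(2)[OF a])
 finally show "Rr e r (y * Bx e a (hS r)) = fscale (of_nat (card (Hs r))) (Rr e r y * a)" by (simp only: c)
qed

lemma Rr_An: "Rr e r y : An e"
 unfolding Rr_def lin_ext_def by (intro supp_on_closed) (auto simp: inK_def trc_bxw)

lemma finite_Hs [simp]: "finite (Hs r)"
 by (rule finite_subset[OF _ finite_Pm[of "2 * r"]]) (auto simp: Hs_def)

lemma card_Hs: "(of_nat (card (Hs r)) :: 'k::field_char_0) ~= 0"
 using Hs_0[of r] by (simp only: of_nat_eq_0_iff card_0_eq[OF finite_Hs]) blast

lemma fq_right:
 assumes h: "h : Hs r"
 shows "(fq q r :: ('k::field) fna) * sg (bxw (sum_list q) 0 h) = fq q r"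
proof -
 have B: "sg (bxw (sum_list q) 0 h) = Bx (sum_list q) (sg 0) (sg h :: 'k fna)"
 by (simp only: bil_single mult_1)
 have "(fq q r :: 'k fna) * Bx (sum_list q) (sg 0) (sg h) = Bx (sum_list q) (cS q * sg 0) (hS r * sg h)"
 unfolding fq_def by (rule Bx_Bx) (rule single_supp_on, rule Pm_0)
 also have "\<dots> = fq q r" by (simp add: hS_right[OF h] fq_def)
 finally show ?thesis by (simp only: B)
qed

text \<open>Invariance makes the coefficient of \<open>y\<close> constant on the hyperoctahedral
  block, equal to its value at the identity.\<close>

lemma tau_Rr:
 fixes y :: "('k::field) fna"
 assumes y: "!!h. h : Hs r ==> y * sg (bxw e 0 h) = y"
 shows "tau (Rr e r y) = of_nat (card (Hs r)) * tau y"
proof -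
 let ?B = "bxw e 0 ` Hs r"
 have B: "inK e r g & trc e g = 0 \<longleftrightarrow> g : ?B" for g
 by (auto simp: inK_def trc_bxw)
 have look: "lookup y g = tau y" if "g : ?B" for g
 proof -
 obtain h where h: "h : Hs r" "g = bxw e 0 h" using \<open>g : ?B\<close> by blast
 have h': "pinv h : Hs r" using h subgrpD[OF subgrp_Hs[of r]] by auto
 have P: "bxw e 0 (pinv h) : Pm (e + 2 * r)" by (intro bxw_Pm Pm_0 HsD h')
 have "bxw e 0 (pinv h) + g = 0"
 using h HsD[OF h(1)] by (simp add: bxw_bxw)
 then have "pinv (bxw e 0 (pinv h)) + (bxw e 0 (pinv h) + g) = pinv (bxw e 0 (pinv h))" by simp
 then have "g = pinv (bxw e 0 (pinv h))" using P by (simp add: add.assoc[symmetric])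
 then have "lookup y g = lookup (y * sg (bxw e 0 (pinv h))) 0"
 by (simp add: lookup_mult_sg[OF P])
 then show ?thesis using y[OF h'] by (simp add: tau_def)
 qed
 have "tau (Rr e r y) = (\<Sum>g\<in>keys y. if g : ?B then tau y else 0)"
 unfolding Rr_def lin_ext_def tau_linear
 proof (rule sum.cong[OF refl])
 fix g
 show "lookup y g * tau (if inK e r g then sg (trc e g) else 0) = (if g : ?B then tau y else 0)"
 using look[of g] unfolding B[symmetric] by (auto simp: tau_def lookup_single when_def)
 qed
 also have "\<dots> = (\<Sum>g\<in>keys y \<inter> ?B. tau y)"
 by (rule sum.inter_restrict[symmetric]) simp
 also have "\<dots> = (\<Sum>g\<in>?B. tau y)"
 proof (cases "tau y = 0")
 case False
 then have "?B \<subseteq> keys y" using look by (auto simp: in_keys_iff)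
 then show ?thesis by (simp add: Int_absorb1)
 qed simp
 also have "\<dots> = of_nat (card (Hs r)) * tau y"
 proof -
 have "inj_on (bxw e 0) (Hs r)"
 proof (rule inj_onI)
 fix h h' assume e: "bxw e 0 h = bxw e 0 h'"
 have "app h j = app h' j" for j
 using arg_cong[OF e, of "%w. app w (e + j)"] by (simp add: bxw_def)
 then show "h = h'" by (rule fn_eqI)
 qed
 then show ?thesis by (simp add: card_image)
 qed
 finally show ?thesis .
qed

text \<open>\<open>Rr\<close> takes the product into the corner between \<open>cS q\<close> and
  \<open>cS q'\<close>, which is zero or a line; in the latter case \<open>tau\<close> reads off the
  scalar.\<close>

lemma Rr_fq:
 fixes z :: "('k::{field, field_char_0}) fna"
 assumes q: "q : parts e" "q' : parts e" and y: "y = fq q r * z * fq q' r"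
 shows "Rr e r y = (if q = q' then fscale (of_nat (card (Hs r)) * tau y) (cS q) else 0)"
proof -
 have sz: "sum_list q = e" "sum_list q' = e" and P: "is_partition q" "is_partition q'" using q by (auto simp: parts_iff)
 have R: "Rr e r y = fscale (of_nat (card (Hs r)) * of_nat (card (Hs r))) (cS q * Rr e r z * cS q')"
 unfolding y fq_def sz using q by (simp add: Rr_hS cS_parts fscale_mult_left)
 show ?thesis
 proof (cases "q = q'")
 case False
 have "cS q * Rr e r z * cS q' = 0" by (rule cS_orthogonal[OF P sz Rr_An False])
 then show ?thesis unfolding R using False by simp
 next
 case True
 obtain ka where "cS q * Rr e r z * cS q = fscale ka (cS q :: 'k fna)"
 using cS_x_cS[OF P(1), of "Rr e r z"] Rr_An[of e r z] sz by auto
 then obtain \<mu> where m: "Rr e r y = fscale \<mu> (cS q)" unfolding R True[symmetric] by auto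
 then have "\<mu> = tau (Rr e r y)" by simp
 also have "\<dots> = of_nat (card (Hs r)) * tau y"
 by (rule tau_Rr) (simp add: y mult.assoc fq_right[of _ r q', unfolded sz])
 finally show ?thesis using m True by simp
 qed
qed

lemma fq_square:
 assumes "is_partition q"
 obtains ka :: "'k::{field, field_char_0}" where "ka ~= 0" "fq q r * fq q r = fscale ka (fq q r)"
proof -
 obtain n :: 'k where n: "n ~= 0" "cS q * cS q = fscale n (cS q)" using cS_square[OF assms] by metis
 have "fq q r * fq q r = fscale (of_nat (card (Hs r)) * n) (fq q r)"
 unfolding fq_def by (simp add: Bx_Bx n hS_square klinD[OF klin_bil_left] klinD[OF klin_bil_right] mult.commute)
 then show ?thesis using n(1) card_Hs by (intro that[of "of_nat (card (Hs r)) * n"]) simp_all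
qed

text \<open>As in \<open>dual_corner\<close>: \<open>cS p\<close> and \<open>fq q r\<close> are
  idempotent up to nonzero factors, so inserting them does not spoil the nondegeneracy of
  \<open>tau\<close>.\<close>

lemma dual_fq:
 fixes alp :: "nat => ('k::{field, field_char_0}) fna"
 assumes p: "p : parts (e + 2 * r)" and q: "q : parts e" and ind: "lin_indep {..<m} alp"
 and alp: "!!k. k < m ==> alp k : cAe (e + 2 * r) p (fq q r)"
 shows "\<exists>be. (\<forall>i<m. be i : (%a. fq q r * a * cS p) ` An (e + 2 * r)) &
 (\<forall>i<m. \<forall>j<m. tau (be i * alp j) = (if i = j then 1 else 0))"
proof -
 let ?d = "e + 2 * r" and ?X = "(%a. fq q r * a * cS p) ` An (e + 2 * r)"
 have pp: "is_partition p" and sp: "sum_list p = ?d" and qp: "is_partition q" and sq: "sum_list q = e"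
 using p q by (auto simp: parts_iff)
 have fA: "fq q r : An ?d" for r' using fq_An[of q r] sq by simp
 have cA: "(cS p :: 'k fna) : An ?d" by (rule cS_parts[OF p])
 obtain n :: 'k where n: "n ~= 0" "cS p * cS p = fscale n (cS p)" using cS_square[OF pp] by metis
 obtain ka :: 'k where k: "ka ~= 0" "fq q r * fq q r = fscale ka (fq q r)" by (rule fq_square[OF qp])
 have X: "fs.subspace ?X"
 by (rule fs2.linear_subspace_image[OF klin_sandwich subspace_supp_on])
 have nd: "\<exists>x\<in>?X. tau (x * (\<Sum>i<m. fscale (z i) (alp i))) ~= 0" if nz: "(\<Sum>i<m. fscale (z i) (alp i)) ~= 0" for z
 proof -
 let ?w = "\<Sum>i<m. fscale (z i) (alp i)"
 have sub: "fs.subspace (cAe ?d p (fq q r :: 'k fna))"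
 by (rule fs2.linear_subspace_image[OF klin_sandwich subspace_supp_on])
 have "?w : cAe ?d p (fq q r)"
 by (intro fs.subspace_sum[OF sub] fs.subspace_scale[OF sub]) (use alp in auto)
 then obtain a where a: "a : An ?d" "?w = cS p * a * fq q r" by blast
 have wA: "?w : An ?d" unfolding a(2) by (intro An_mult cA a fA)
 obtain y where y: "y : An ?d" "tau (?w * y) ~= 0" by (rule tau_nondegenerate[OF wA nz])
 have e1: "cS p * ?w = fscale n ?w" unfolding a(2) by (simp add: mult.assoc[symmetric] n fscale_mult_left)
 have e2: "?w * fq q r = fscale ka ?w" unfolding a(2) by (simp add: mult.assoc k fscale_mult_right)
 have "tau (fq q r * y * cS p * ?w) = n * tau (fq q r * (y * ?w))"
 by (simp only: mult.assoc e1 fscale_mult_right tau_linear)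
 also have "tau (fq q r * (y * ?w)) = tau (y * ?w * fq q r)"
 by (rule tau_commute[OF fA An_mult[OF y(1) wA]])
 also have "\<dots> = ka * tau (y * ?w)" by (simp only: mult.assoc e2 fscale_mult_right tau_linear)
 also have "tau (y * ?w) = tau (?w * y)" by (rule tau_commute[OF y(1) wA])
 finally have "tau (fq q r * y * cS p * ?w) ~= 0" using n k y(2) by simp
 then show ?thesis using y(1) by blast
 qed
 have "\<exists>x. (\<forall>i\<in>{..<m}. x i : ?X) & (\<forall>i\<in>{..<m}. \<forall>j\<in>{..<m}. tau (x i * alp j) = (if i = j then 1 else 0))"
 by (rule dual_basis[OF finite_lessThan X nd ind])
 then show ?thesis by (simp only: Ball_def lessThan_iff)
qed

lemma common_letters:
 assumes "finite F" "F \<subseteq> Tn e"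
 shows "\<exists>n. even n & F \<subseteq> supp_on (Wl n e)"
 using assms
proof (induction F)
 case empty
 show ?case by (rule exI[of _ 0]) simp
next
 case (insert t F)
 then obtain n where n: "even n" "F \<subseteq> supp_on (Wl n e)" by auto
 have "t : Tn e" using insert.prems by simp
 then obtain n' where n': "even n'" "n <= n'" "t : supp_on (Wl n' e)" by (rule letters_bound)
 have "Wl n e \<subseteq> Wl n' e" using n'(2) by (auto simp: Wl_def)
 then have "F \<subseteq> supp_on (Wl n' e)" using n(2) supp_on_mono by blast
 then show ?case using n' by auto
qed

text \<open>Contracting \<open>r + 1\<close> pairs uses \<open>2 * r + 2\<close> positions, but only
  \<open>2 * r\<close> carry letters of \<open>nuw\<close>; some contracted position lies in
  \<open>t\<close>.\<close>

lemma Ut_Fl: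
 fixes t :: "('k::field) fna"
 assumes n: "even n" and t: "t : supp_on (Wl n e)" "t : Tl e" and b: "b : An (e + 2 * r)"
 shows "Ut n e r t * b : Fl (e + 2 * r) (Suc r)"
proof (rule FlI)
 have tT: "t : Tn e" using t(2) by (simp add: Tl_def)
 have "Ut n e r t : Tn (e + 2 * r)"
 by (rule bil_supp_on[OF tT, of _ UNIV]) (auto simp: supp_on_def)
 then show "Ut n e r t * b : Tn (e + 2 * r)" using b by (rule Tn_mult)
 fix f s assume f: "e + 2 * r = f + 2 * Suc r" and s: "s : Pm (e + 2 * r)"
 have bs: "b * sg s : An (e + 2 * r)" by (intro An_mult b single_supp_on s)
 have "Phi f (Suc r) (Ut n e r t * (b * sg s)) = (%_. 0) (b * sg s)"
 proof (rule klin_eqI[OF klin_comp[OF klin_Phi klin_mult_left] klin_zero])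
 fix g assume "g : keys (b * sg s)"
 then have g: "g : Pm (e + 2 * r)" by (rule supp_onD[OF bs])
 have "\<exists>j<2 * Suc r. app g (f + j) < e"
 proof (rule ccontr)
 assume a: "\<not> (\<exists>j<2 * Suc r. app g (f + j) < e)"
 have "(%j. app g (f + j)) ` {..<2 * Suc r} \<subseteq> {e..<e + 2 * r}"
 using a Pm_less[OF g] f by auto
 moreover have "inj_on (%j. app g (f + j)) {..<2 * Suc r}"
 by (rule inj_onI) (simp add: Pm_inj[OF g])
 ultimately have "card {..<2 * Suc r} <= card {e..<e + 2 * r}" by (intro card_inj_on_le) auto
 then show False by simp
 qed
 then obtain j where j: "j < 2 * Suc r" "app g (f + j) < e" by blast
 show "Phi f (Suc r) (Ut n e r t * sg g) = 0" by (rule Phi_lift_0[OF n t f[symmetric] g j])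
 qed
 then show "Phi f (Suc r) (Ut n e r t * b * sg s) = 0" by (simp only: mult.assoc)
qed

text \<open>The preimage is assembled from the tensors \<open>t q k\<close> filled up with
  contracting pairs and multiplied by the dual elements \<open>be q k\<close>. By
  \<open>Phi_lift\<close> its contraction after multiplication by \<open>alp q' k'\<close> is
  governed by \<open>Rr\<close> of \<open>be q k * alp q' k'\<close>, and duality leaves one
  term.\<close>

lemma lifting:
 fixes alp t :: "nat list => nat => ('k::{field, field_char_0}) fna"
 assumes p: "p : parts (e + 2 * r)" and ind: "!!q. q : parts e ==> lin_indep {..<m q} (alp q)"
 and alp: "!!q k. q : parts e ==> k < m q ==> alp q k : cAe (e + 2 * r) p (fq q r)"
 and t: "!!q k. q : parts e ==> k < m q ==> t q k : Tl e \<inter> rmul (Tn e) (cS q)"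
 shows "\<exists>x\<in>Fl (e + 2 * r) (Suc r) \<inter> rmul (Tn (e + 2 * r)) (cS p).
 \<forall>q\<in>parts e. \<forall>k<m q. Phi e r (x * alp q k) = t q k"
proof -
 let ?d = "e + 2 * r" and ?N = "of_nat (card (Hs r)) :: 'k"
 have "\<forall>q\<in>parts e. \<exists>be. (\<forall>i<m q. be i : (%a. fq q r * a * cS p) ` An ?d) &
 (\<forall>i<m q. \<forall>j<m q. tau (be i * alp q j) = (if i = j then 1 else 0))"
 using dual_fq[OF p _ ind alp] by blast
 from bchoice[OF this] obtain be where "\<forall>q\<in>parts e. (\<forall>i<m q. be q i : (%a. fq q r * a * cS p) ` An ?d) &
 (\<forall>i<m q. \<forall>j<m q. tau (be q i * alp q j) = (if i = j then 1 else 0))" ..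
 then have be: "!!q i. q : parts e ==> i < m q ==> be q i : (%a. fq q r * a * cS p) ` An ?d"
 "!!q i j. q : parts e ==> i < m q ==> j < m q ==> tau (be q i * alp q j) = (if i = j then 1 else 0)"
 by blast+
 have "\<forall>q\<in>parts e. \<exists>n::'k. n ~= 0 & cS q * cS q = fscale n (cS q)"
 using cS_square[where 'k='k] by (metis parts_iff)
 from bchoice[OF this] obtain ka :: "nat list => 'k" where ka: "\<forall>q\<in>parts e. ka q ~= 0 & cS q * cS q = fscale (ka q) (cS q)" ..
 let ?J = "SIGMA q:parts e. {..<m q}"
 have fJ: "finite ?J" by (intro finite_SigmaI finite_parts finite_lessThan)
 \<comment> \<open>A common bound lets the same new letters serve all the given tensors.\<close>
 have "\<exists>n. even n & (%(q, k). t q k) ` ?J \<subseteq> supp_on (Wl n e)"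
 by (rule common_letters) (use fJ t in \<open>auto simp: Tl_def\<close>)
 then obtain n where n: "even n" "!!q k. q : parts e ==> k < m q ==> t q k : supp_on (Wl n e)" by fastforce
 have cA: "(cS p :: 'k fna) : An ?d" by (rule cS_parts[OF p])
 have fA: "(fq q r :: 'k fna) : An ?d" if "q : parts e" for q
 proof -
 have sq: "sum_list q = e" using that by (simp add: parts_iff)
 show ?thesis by (rule fq_An[of q r, unfolded sq])
 qed
 have beA: "be q i : An ?d" if "q : parts e" "i < m q" for q i
 using be(1)[OF that] fA[OF that(1)] cA by auto
 have alpA: "alp q i : An ?d" if "q : parts e" "i < m q" for q i
 using alp[OF that] fA[OF that(1)] cA by auto
 \<comment> \<open>The order \<open>?N\<close> of the hyperoctahedral group enters through
   \<open>Rr_fq\<close> and \<open>ka q\<close> through \<open>t q k * cS q\<close>; the coefficient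
   cancels both.\<close>
 let ?x = "\<Sum>q\<in>parts e. \<Sum>k<m q. fscale (inverse (?N * ka q)) (Ut n e r (t q k) * be q k)"
 have xF: "?x : Fl ?d (Suc r)"
 by (intro fs.subspace_sum[OF subspace_Fl] fs.subspace_scale[OF subspace_Fl] Ut_Fl n beA)
 (use t in auto)
 have sub: "fs.subspace (rmul (Tn ?d) (cS p :: 'k fna))"
 by (rule fs2.linear_subspace_image[OF klin_mult_right subspace_supp_on])
 have xp: "?x : rmul (Tn ?d) (cS p)"
 proof (intro fs.subspace_sum[OF sub] fs.subspace_scale[OF sub])
 fix q k assume q: "q : parts e" and k: "k : {..<m q}"
 then obtain a where a: "a : An ?d" "be q k = fq q r * a * cS p" using be(1)[OF q] by blast
 have "Ut n e r (t q k) : Tn ?d"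
 by (rule bil_supp_on[of _ "Wd e" _ UNIV]) (use t[OF q] k in \<open>auto simp: supp_on_def Tl_def\<close>)
 then have "Ut n e r (t q k) * (fq q r * a) : Tn ?d" using fA[OF q] a(1) by (intro Tn_mult An_mult)
 then show "Ut n e r (t q k) * be q k : rmul (Tn ?d) (cS p)" unfolding a(2) by (simp add: mult.assoc[symmetric])
 qed
 have "Phi e r (?x * alp q' k') = t q' k'" if q': "q' : parts e" and k': "k' < m q'" for q' k'
 proof -
 have trm: "Phi e r (Ut n e r (t q k) * be q k * alp q' k') = (if q = q' then if k = k' then fscale (?N * ka q) (t q k) else 0 else 0)"
 if q: "q : parts e" and k: "k < m q" for q k
 proof -
 obtain a where a: "a : An ?d" "be q k = fq q r * a * cS p" using be(1)[OF q k] by blast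
 obtain a' where a': "a' : An ?d" "alp q' k' = cS p * a' * fq q' r" using alp[OF q' k'] by blast
 have y: "be q k * alp q' k' = fq q r * (a * cS p * cS p * a') * fq q' r" by (simp add: a(2) a'(2) mult.assoc)
 have tT: "t q k : Tl e" "t q k : rmul (Tn e) (cS q)" using t[OF q k] by auto
 have tc: "t q k * cS q = fscale (ka q) (t q k)"
 using tT(2) ka[rule_format, OF q] by (auto simp: mult.assoc fscale_mult_right)
 have "Phi e r (Ut n e r (t q k) * be q k * alp q' k') = t q k * Rr e r (be q k * alp q' k')"
 unfolding mult.assoc[of _ "be q k"] by (rule Phi_lift[OF n(1) n(2)[OF q k] tT(1)]) (intro An_mult beA q k alpA q' k')
 also have "\<dots> = t q k * (if q = q' then fscale (?N * tau (be q k * alp q' k')) (cS q) else 0)"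
 unfolding Rr_fq[OF q q' y] ..
 also have "\<dots> = (if q = q' then if k = k' then fscale (?N * ka q) (t q k) else 0 else 0)"
 using be(2)[OF q k, of k'] k' tc by (auto simp: fscale_mult_right)
 finally show ?thesis .
 qed
 have "Phi e r (?x * alp q' k') = (\<Sum>q\<in>parts e. \<Sum>k<m q. fscale (inverse (?N * ka q)) (Phi e r (Ut n e r (t q k) * be q k * alp q' k')))"
 by (simp only: sum_distrib_right fscale_mult_left klinD[OF klin_Phi])
 also have "\<dots> = (\<Sum>q\<in>parts e. \<Sum>k<m q. if q = q' then if k = k' then t q k else 0 else 0)"
 proof (intro sum.cong refl)
 fix q k assume q: "q : parts e" and k: "k : {..<m q}"
 have nz: "?N * ka q ~= 0" using card_Hs ka q by simp
 show "fscale (inverse (?N * ka q)) (Phi e r (Ut n e r (t q k) * be q k * alp q' k')) =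
 (if q = q' then if k = k' then t q k else 0 else 0)"
 using trm[OF q, of k] k
 by (simp only: lessThan_iff left_inverse[OF nz] if_distrib[of "fscale (inverse (?N * ka q))"] fs.scale_scale fs.scale_one fs.scale_zero_right if_cancel)
 qed
 also have "\<dots> = (\<Sum>q\<in>parts e. if q = q' then \<Sum>k<m q. if k = k' then t q k else 0 else 0)"
 by (intro sum.cong refl) auto
 also have "\<dots> = t q' k'" using q' k' by (simp add: finite_parts)
 finally show ?thesis .
 qed
 then show ?thesis using xF xp by blast
qed

text \<open>Multiplication by \<open>fq q r\<close> tests the contractions of \<open>x\<close>
  against \<open>cS q\<close>; by completeness in degree \<open>e\<close> all shapes
  \<open>q\<close> together detect everything.\<close>

lemma layer_kernel:
 fixes x :: "('k::{field, field_char_0}) fna"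
 assumes x: "x : Tn (e + 2 * r)"
 and 0: "!!q a. q : parts e ==> a : An (e + 2 * r) ==> Phi e r (x * a * fq q r) = 0"
 shows "x : Fl (e + 2 * r) r"
proof (rule FlI[OF x])
 let ?d = "e + 2 * r"
 fix f s assume f: "?d = f + 2 * r" and s: "s : Pm ?d"
 let ?y = "Phi e r (x * sg s)"
 have sub: "fs.subspace {b. ?y * b = 0}"
 by (auto simp: fs.subspace_def distrib_left fscale_mult_right)
 have "?y * (a * cS q * b) = 0" if q: "q : parts e" and ab: "a : An e" "b : An e" for q a b
 proof -
 have xs: "x * sg s : Tn ?d" by (intro Tn_mult x single_supp_on s)
 have B: "Bx e a (sg 0) : An ?d" by (rule Bx_An[OF ab(1)]) (simp del: sg_0)
 have "fscale (of_nat (card (Hs r))) (?y * a * cS q) = fscale (of_nat (card (Hs r))) (Phi e r (x * sg s * Bx e a (sg 0)) * cS q)"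
 by (simp only: Phi_Bx[OF xs ab(1) Hs_0])
 also have "\<dots> = Phi e r (x * sg s * Bx e a (sg 0) * Bx e (cS q) (hS r))"
 by (rule Phi_Bx_hS[OF Tn_mult[OF xs B] cS_parts[OF q], symmetric])
 also have "\<dots> = Phi e r (x * (sg s * Bx e a (sg 0)) * fq q r)"
 using q by (simp only: fq_def mult.assoc parts_iff)
 also have "\<dots> = 0" by (rule 0[OF q]) (intro An_mult B single_supp_on s)
 finally have "?y * a * cS q = 0" using card_Hs[of r, where 'k='k] by (simp del: of_nat_eq_0_iff)
 then have "?y * a * cS q * b = 0" by simp
 then show ?thesis by (simp only: mult.assoc)
 qed
 then have "{a * cS q * b |q a b. q : parts e & a : An e & b : An e} \<subseteq> {b. ?y * b = 0}" by blast
 then have "fs.span {a * cS q * b |q a b. q : parts e & a : An e & b : An e} \<subseteq> {b. ?y * b = 0}"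
 using sub by (rule fs.span_minimal)
 from subsetD[OF this completeness] have "?y * 1 = 0" by simp
 then show "Phi f r (x * sg s) = 0" using f by simp
qed

section \<open>The socle filtration\<close>

context hyperbolic_space
begin

text \<open>The way back from coordinates; all modules below are cut out of the tensor power by a
  subspace of words.\<close>

definition subc :: "nat => 'k fna set => ('k, 'v) tensor set" where
 "subc d T = {A : rcarr (tpow scale d). psi d A : T}"

abbreviation so :: "('v => 'v) set" where
 "so \<equiv> so_inf scale Q"

abbreviation Vq :: "nat list => 'k fna set" where
 "Vq q \<equiv> rmul (Tn (sum_list q)) (cS q)"

abbreviation Msub :: "nat => 'k fna set => ('k, 'v => 'v, ('k, 'v) tensor) rep" where
 "Msub d T \<equiv> sub_rep (tpow scale d) (subc d T)"

lemma subc_surj: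
 assumes "x : T" "T \<subseteq> Tn d"
 shows "\<exists>A. A : subc d T & psi d A = x"
proof -
 obtain A where "A : rcarr (tpow scale d)" "psi d A = x" using psi_surj[OF subsetD[OF assms(2,1)]] by blast
 then show ?thesis using assms(1) by (intro exI[of _ A]) (simp add: subc_def)
qed

lemma subc_psi:
 assumes "S \<subseteq> rcarr (tpow scale d)"
 shows "subc d (psi d ` S) = S"
proof
 show "S \<subseteq> subc d (psi d ` S)" using assms by (auto simp: subc_def)
 show "subc d (psi d ` S) \<subseteq> S"
 proof
 fix A assume "A : subc d (psi d ` S)"
 then obtain B where B: "A : rcarr (tpow scale d)" "B : S" "psi d A = psi d B" by (auto simp: subc_def)
 then have "A = B" using assms by (intro inj_onD[OF psi_inj]) auto
 then show "A : S" using B(2) by simp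
 qed
qed

lemma subcI: "A : rcarr (tpow scale d) ==> psi d A : T ==> A : subc d T"
 by (simp add: subc_def)

lemma subcD: "A : subc d T ==> A : rcarr (tpow scale d)" "A : subc d T ==> psi d A : T"
 by (simp_all add: subc_def)

section \<open>The modules of the theorem as transported subspaces\<close>

lemma schur_subc: "schur_functor scale q = subc (sum_list q) (Vq q)"
 using psi_schur[of q] subc_psi[of "schur_functor scale q" "sum_list q"] by simp

lemma Gamma_gl_eq: "Gamma_gl scale q = Msub (sum_list q) (Vq q)"
 by (simp add: Gamma_gl_def schur_subc)

lemma Gamma_so_eq: "Gamma_so scale Q q = Msub (sum_list q) (Tl (sum_list q) \<inter> Vq q)"
proof -
 have "traceless scale Q (sum_list q) \<inter> subc (sum_list q) (Vq q) = subc (sum_list q) (Tl (sum_list q) \<inter> Vq q)"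
 using traceless_psi[of _ "sum_list q"] by (auto simp: subc_def)
 then show ?thesis by (simp add: Gamma_so_def schur_subc)
qed

lemma stable_Int: "stable d S ==> stable d T ==> stable d (S \<inter> T)"
 by (auto simp: stable_def fs.subspace_def)

lemma stable_Fl: "stable d (Fl d r)"
 unfolding stable_def using subspace_Fl dact_Fl Fl_Tn by blast

lemma stable_V: "stable (sum_list q) (Vq q)"
 unfolding stable_def
proof (intro conjI ballI subsetI)
 show "fs.subspace (Vq q)" by (rule fs2.linear_subspace_image[OF klin_mult_right subspace_supp_on])
 show "x : Tn (sum_list q)" if "x : Vq q" for x using that by (auto intro!: Tn_mult)
 fix X x assume X: "X : so" and x: "x : Vq q"
 then obtain y where y: "y : Tn (sum_list q)" "x = y * cS q" by blast
 have "dact (sum_list q) X x = dact (sum_list q) X y * cS q"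
 unfolding y(2) by (rule dact_mult[OF so_linear(1)[OF X] y(1) cS_An])
 then show "dact (sum_list q) X x : Vq q" by simp
qed

lemma stable_Tl_V: "stable (sum_list q) (Tl (sum_list q) \<inter> Vq q)"
 unfolding Tl_Fl by (intro stable_Int stable_Fl stable_V)

lemma act_psi:
 assumes "X : so" "A : rcarr (tpow scale d)"
 shows "ract (tpow scale d) X A : rcarr (tpow scale d)" "psi d (ract (tpow scale d) X A) = dact d X (psi d A)"
 using psi_act[OF so_linear(1)[OF assms(1)] assms(2)] by auto

lemma submod_subc:
 assumes U: "stable d U" "U \<subseteq> T"
 shows "submod so (Msub d T) (subc d U)"
 unfolding submod_def
proof (intro conjI ballI allI)
 show "subc d U \<subseteq> rcarr (Msub d T)" using U(2) by (auto simp: subc_def)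
 show "rzero (Msub d T) : subc d U" using fs.subspace_0[OF stableD(1)[OF U(1)]] psi_zero[of d] by (simp add: subc_def)
 show "radd (Msub d T) A B : subc d U" if "A : subc d U" "B : subc d U" for A B
 using that fs.subspace_add[OF stableD(1)[OF U(1)]] psi_add[of A d B] by (simp add: subc_def)
 show "rscale (Msub d T) c A : subc d U" if "A : subc d U" for c A
 using that fs.subspace_scale[OF stableD(1)[OF U(1)]] psi_scale[of A d c] by (simp add: subc_def)
 show "ract (Msub d T) X A : subc d U" if "X : so" "A : subc d U" for X A
 using that stableD(3)[OF U(1)] act_psi[of X A d] by (simp add: subc_def)
qed

text \<open>Together with \<open>submod_subc\<close> this makes submodules the same as stable
  subspaces of coordinates.\<close>

lemma submod_psi:
 assumes S: "submod so (Msub d T) S"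
 shows "stable d (psi d ` S)" "psi d ` S \<subseteq> T" "S = subc d (psi d ` S)"
proof -
 have c: "S \<subseteq> rcarr (tpow scale d)" "S \<subseteq> subc d T" using submodD(1)[OF S] subcD by auto
 note cc = subsetD[OF c(1)]
 show "S = subc d (psi d ` S)" by (rule subc_psi[OF c(1), symmetric])
 show "psi d ` S \<subseteq> T" using c(2) subcD(2) by blast
 have add: "psi d A + psi d B : psi d ` S" if "A : S" "B : S" for A B
 using psi_add[OF cc[OF that(1)] cc[OF that(2)]] submodD(3)[OF S that]
 by (intro image_eqI[of _ _ "radd (tpow scale d) A B"]) simp_all
 have scl: "fscale c' (psi d A) : psi d ` S" if "A : S" for A c'
 using psi_scale[OF cc[OF that], of c'] submodD(4)[OF S that, of c']
 by (intro image_eqI[of _ _ "rscale (tpow scale d) c' A"]) simp_all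
 have z: "0 : psi d ` S" using psi_zero(2)[of d] submodD(2)[OF S] by (intro image_eqI[of _ _ "rzero (tpow scale d)"]) auto
 have act: "dact d X (psi d A) : psi d ` S" if "X : so" "A : S" for X A
 using act_psi(2)[OF that(1) cc[OF that(2)]] submodD(5)[OF S that]
 by (intro image_eqI[of _ _ "ract (tpow scale d) X A"]) simp_all
 show "stable d (psi d ` S)"
 unfolding stable_def fs.subspace_def using add scl z act by auto
qed

lemma lrep_subc:
 assumes T: "stable d T"
 shows "lrep so (Msub d T)"
proof (rule lrep_realized[where \<psi>="psi d" and s=fscale and \<rho>="dact d"])
 note sm = submod_subc[OF T order_refl]
 show "inj_on (psi d) (rcarr (Msub d T))" using psi_inj[of d] by (rule inj_on_subset) (auto simp: subc_def)
 show "rzero (Msub d T) : rcarr (Msub d T)" using submodD(2)[OF sm] by simp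
 show "psi d (rzero (Msub d T)) = 0" using psi_zero by simp
 show "radd (Msub d T) A B : rcarr (Msub d T) & psi d (radd (Msub d T) A B) = psi d A + psi d B"
 if "A : rcarr (Msub d T)" "B : rcarr (Msub d T)" for A B
 using that submodD(3)[OF sm, of A B] psi_add[of A d B] subcD by simp
 show "rscale (Msub d T) c A : rcarr (Msub d T) & psi d (rscale (Msub d T) c A) = fscale c (psi d A)"
 if "A : rcarr (Msub d T)" for c A
 using that submodD(4)[OF sm, of A c] psi_scale[of A d c] subcD by simp
 show "ract (Msub d T) X A : rcarr (Msub d T) & psi d (ract (Msub d T) X A) = dact d X (psi d A)"
 if "X : so" "A : rcarr (Msub d T)" for X A
 using that submodD(5)[OF sm, of X A] act_psi[of X A d] subcD by simp
qed (simp_all add: klinD[OF klin_dact] fs.scale_right_distrib)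

lemma nonzero_psi:
 assumes "submod so (Msub d T) S" "S ~= {rzero (Msub d T)}"
 obtains z where "z : psi d ` S" "z ~= 0"
proof -
 have "rzero (tpow scale d) : S" using submodD(2)[OF assms(1)] by simp
 then obtain A where A: "A : S" "A ~= rzero (tpow scale d)" using assms(2) by auto
 have "A : rcarr (tpow scale d)" using submodD(1)[OF assms(1) A(1)] subcD by simp
 then show ?thesis using that[of "psi d A"] A psi_eq_0 by blast
qed

lemma Gamma_so_simple:
 assumes q: "is_partition q"
 shows "simple_rep so (Gamma_so scale Q q)"
 unfolding Gamma_so_eq simple_rep_def
proof (intro conjI allI impI)
 let ?d = "sum_list q" and ?T = "Tl (sum_list q) \<inter> Vq q"
 have TT: "?T \<subseteq> Tn ?d" by (auto simp: Tl_def)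
 obtain x where x: "x : ?T" "x ~= 0" using Tl_nonzero[OF q] by blast
 from subc_surj[OF x(1) TT] obtain A where A: "A : subc ?d ?T" "psi ?d A = x" by (elim exE conjE)
 then have "A ~= rzero (tpow scale ?d)" using x(2) psi_zero by auto
 then show "rcarr (Msub ?d ?T) ~= {rzero (Msub ?d ?T)}" using A(1) by auto
 fix S assume S: "submod so (Msub ?d ?T) S"
 show "S = {rzero (Msub ?d ?T)} \<or> S = rcarr (Msub ?d ?T)"
 proof (cases "S = {rzero (Msub ?d ?T)}")
 case False
 then obtain z where z: "z : psi ?d ` S" "z ~= 0" by (rule nonzero_psi[OF S])
 have SV: "psi ?d ` S \<subseteq> Vq q" using submod_psi(2)[OF S] by (rule order_trans) (rule Int_lower2)
 have "?T \<subseteq> psi ?d ` S"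
 by (rule subsetI, rule stable_simple[OF q submod_psi(1)[OF S] z SV]) (erule IntD1, erule IntD2)
 with submod_psi(2)[OF S] have e: "psi ?d ` S = ?T" by (rule equalityI)
 have "S = subc ?d ?T" using submod_psi(3)[OF S] unfolding e .
 then show ?thesis by simp
 qed simp
qed

text \<open>Every nonzero submodule contains the whole traceless part, so two of them always share a
  nonzero vector.\<close>

lemma Gamma_gl_indecomposable:
 assumes p: "is_partition p"
 shows "indecomposable_rep so (Gamma_gl scale p)"
 unfolding Gamma_gl_eq indecomposable_rep_def
proof (intro conjI notI)
 let ?d = "sum_list p" and ?M = "Msub (sum_list p) (Vq p)"
 obtain x where x: "x : Tl ?d" "x : Vq p" "x ~= 0" using Tl_nonzero[OF p] by blast
 have "Vq p \<subseteq> Tn ?d" using stableD(2)[OF stable_V] by blast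
 from subc_surj[OF x(2) this] obtain A where A: "A : subc ?d (Vq p)" "psi ?d A = x" by (elim exE conjE)
 then have A0: "A ~= rzero (tpow scale ?d)" using x(3) psi_zero by auto
 then show "rcarr ?M = {rzero ?M} ==> False" using A(1) by auto
 \<comment> \<open>Essentiality at \<open>r = 0\<close>, where the smaller term of the filtration is
   zero, finds a nonzero traceless vector in \<open>S\<close>; from there
   \<open>stable_simple\<close> applies.\<close>
 have cont: "A : S" if S: "submod so ?M S" "S ~= {rzero ?M}" for S
 proof -
 obtain z where z: "z : psi ?d ` S" "z ~= 0" by (rule nonzero_psi[OF S])
 obtain y where y: "y : psi ?d ` S" "y : Fl ?d (Suc 0)" "y \<notin> Fl ?d 0"
 using stable_essential[OF submod_psi(1)[OF S(1)] z(1), of 0] z(2) Fl_0 by blast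
 let ?U = "psi ?d ` S \<inter> Tl ?d"
 have U: "stable ?d ?U" unfolding Tl_Fl by (intro stable_Int submod_psi(1)[OF S(1)] stable_Fl)
 have yU: "y : ?U" "y ~= 0" using y Fl_0 by (auto simp: Tl_Fl)
 have "x : ?U"
 by (rule stable_simple[OF p U yU _ x(1,2)]) (use submod_psi(2)[OF S(1)] in blast)
 then have "A : subc ?d (psi ?d ` S)" using A subcD(1) by (intro subcI) auto
 then show ?thesis using submod_psi(3)[OF S(1)] by simp
 qed
 assume "\<exists>S S'. submod so ?M S & submod so ?M S' & S ~= {rzero ?M} & S' ~= {rzero ?M} &
 S \<inter> S' = {rzero ?M} & rcarr ?M = {radd ?M a b |a b. a : S & b : S'}"
 then obtain S S' where S: "submod so ?M S & submod so ?M S' & S ~= {rzero ?M} & S' ~= {rzero ?M} &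
 S \<inter> S' = {rzero ?M} & rcarr ?M = {radd ?M a b |a b. a : S & b : S'}"
 by (elim exE)
 note S2 = conjunct2[OF S] note S3 = conjunct2[OF S2] note S4 = conjunct2[OF S3] note S5 = conjunct2[OF S4]
 have "A : S \<inter> S'"
 by (rule IntI[OF cont[OF conjunct1[OF S] conjunct1[OF S3]] cont[OF conjunct1[OF S2] conjunct1[OF S4]]])
 then show False using A0 unfolding conjunct1[OF S5] by simp
qed

text \<open>One index for each copy of a summand: a partition and a counter below its
  multiplicity.\<close>

abbreviation Ix :: "nat list => nat => (nat list \<times> nat) set" where
 "Ix p r \<equiv> SIGMA q:{q. is_partition q}.
 {..<\<Sum>s\<in>{s. is_partition s & sum_list s = r}. lr_coeff q (map ((*) 2) s) p}"

definition ipsi :: "nat => 'k fna => ('k, 'v) tensor" where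
 "ipsi e x = (SOME A. A : rcarr (tpow scale e) & psi e A = x)"

lemma ipsi: "x : Tn e ==> ipsi e x : rcarr (tpow scale e) & psi e (ipsi e x) = x"
 unfolding ipsi_def by (rule someI_ex) (use psi_surj in blast)

lemma Ix_iff:
 assumes p: "is_partition p"
 shows "(q, k) : Ix p r \<longleftrightarrow> is_partition q & sum_list p = sum_list q + 2 * r &
 k < fs.dim (cAe (sum_list p) p (fq q r :: 'k fna))"
proof (cases "is_partition q")
 case True
 have "(\<Sum>s\<in>{s. is_partition s & sum_list s = r}. lr_coeff q (map ((*) 2) s) p) =
 (if p : parts (sum_list q + 2 * r) then fs.dim (cAe (sum_list q + 2 * r) p (fq q r :: 'k fna)) else 0)"
 by (rule multiplicity[OF True])
 then show ?thesis using True p by (auto simp: parts_iff)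
qed simp

text \<open>The component at \<open>(q, k)\<close> multiplies by the \<open>k\<close>-th basis
  element of the corner between \<open>cS p\<close> and \<open>fq q r\<close> and then contracts
  \<open>r\<close> pairs. Surjectivity is \<open>lifting\<close>, the kernel is
  \<open>layer_kernel\<close>, and essentiality is \<open>stable_essential\<close>.\<close>

lemma layer_step:
 assumes p: "is_partition p"
 shows "\<exists>P. layer so (Msub (sum_list p) (Vq p)) (subc (sum_list p) (Fl (sum_list p) r \<inter> Vq p))
 (subc (sum_list p) (Fl (sum_list p) (Suc r) \<inter> Vq p)) (Ix p r) (%(q, k). Gamma_so scale Q q) P"
proof -
 let ?d = "sum_list p" and ?V = "Vq p" and ?D = "%(q, k :: nat). Gamma_so scale Q q"
 let ?M = "Msub ?d ?V" and ?N = "subc ?d (Fl ?d r \<inter> ?V)" and ?F = "subc ?d (Fl ?d (Suc r) \<inter> ?V)"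
 let ?m = "%q. fs.dim (cAe ?d p (fq q r :: 'k fna))"
 define alp where "alp q = (SOME y :: nat => 'k fna. lin_indep {..<?m q} y & fs.span (y ` {..<?m q}) = cAe ?d p (fq q r) &
 (\<forall>i<?m q. y i : cAe ?d p (fq q r)))" for q
 have alp': "lin_indep {..<?m q} (alp q) & fs.span (alp q ` {..<?m q}) = cAe ?d p (fq q r) & (\<forall>i<?m q. alp q i : cAe ?d p (fq q r))" for q
 proof -
 have "\<exists>y :: nat => 'k fna. lin_indep {..<?m q} y & fs.span (y ` {..<?m q}) = cAe ?d p (fq q r) &
 (\<forall>i<?m q. y i : cAe ?d p (fq q r))"
 by (rule fin_dim_basis[OF fin_dim_cAe]) blast
 from someI_ex[OF this] show ?thesis unfolding alp_def .
 qed
 have alp: "lin_indep {..<?m q} (alp q)" "fs.span (alp q ` {..<?m q}) = cAe ?d p (fq q r)" "k < ?m q ==> alp q k : cAe ?d p (fq q r)" for q k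
 using alp'[of q] by blast+
 define y where "y i A = Phi (sum_list (fst i)) r (psi ?d A * alp (fst i) (snd i))" for i A
 define P where "P i A = ipsi (sum_list (fst i)) (y i A)" for i A
 have Di: "?D i = Msub (sum_list (fst i)) (Tl (sum_list (fst i)) \<inter> Vq (fst i))" for i
 by (cases i) (simp add: Gamma_so_eq)
 have I: "is_partition (fst i)" "?d = sum_list (fst i) + 2 * r" "snd i < ?m (fst i)" if "i : Ix p r" for i
 proof -
 have "(fst i, snd i) : Ix p r" using that by simp
 note c = iffD1[OF Ix_iff[OF p] this]
 show "is_partition (fst i)" by (rule conjunct1[OF c])
 show "?d = sum_list (fst i) + 2 * r" by (rule conjunct1[OF conjunct2[OF c]])
 show "snd i < ?m (fst i)" by (rule conjunct2[OF conjunct2[OF c]])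
 qed
 have VT: "?V \<subseteq> Tn ?d" using stableD(2)[OF stable_V] by blast
 have F: "psi ?d A : Fl ?d (Suc r)" "psi ?d A : ?V" "A : rcarr (tpow scale ?d)" if "A : ?F" for A
 by (rule IntD1[OF subcD(2)[OF that]], rule IntD2[OF subcD(2)[OF that]], rule subcD(1)[OF that])
 have fA: "(fq q r :: 'k fna) : An ?d" if "?d = sum_list q + 2 * r" for q unfolding that by (rule fq_An)
 have cA: "(cS p :: 'k fna) : An ?d" by (rule cS_An)
 have alpA: "alp (fst i) (snd i) : An ?d" if i: "i : Ix p r" for i
 proof -
 obtain a where "a : An ?d" "alp (fst i) (snd i) = cS p * a * fq (fst i) r" using alp(3)[OF I(3)[OF i]] by blast
 then show ?thesis using fA[OF I(2)[OF i]] cA by simp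
 qed
 have yT: "y i A : Tl (sum_list (fst i)) \<inter> Vq (fst i)" if i: "i : Ix p r" and A: "A : ?F" for i A
 proof
 let ?e = "sum_list (fst i)"
 note d = I(2)[OF i]
 show "y i A : Tl ?e" unfolding y_def
 by (rule Phi_Tl) (use F(1)[OF A] alpA[OF i] d in simp_all)
 obtain a where a: "a : An ?d" "alp (fst i) (snd i) = cS p * a * fq (fst i) r" using alp(3)[OF I(3)[OF i]] by blast
 let ?x = "psi ?d A * (cS p * a)"
 have x: "?x : Tn (?e + 2 * r)" unfolding d[symmetric] by (intro Tn_mult An_mult psi_Tn cA a(1))
 have "y i A = Phi ?e r (?x * Bx ?e (cS (fst i)) (hS r))" unfolding y_def a(2) fq_def by (simp only: mult.assoc)
 also have "\<dots> = fscale (of_nat (card (Hs r))) (Phi ?e r ?x) * cS (fst i)"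
 unfolding Phi_Bx_hS[OF x cS_An] by (simp only: fscale_mult_left)
 finally show "y i A : Vq (fst i)" using Phi_Tn[OF x] by (simp only:) (rule image_eqI[OF refl], simp)
 qed
 have yTn: "y i A : Tn (sum_list (fst i))" if i: "i : Ix p r" and A: "A : ?F" for i A
 using yT[OF i A] by (simp add: Tl_def)
 have P: "P i A : rcarr (tpow scale (sum_list (fst i)))" "psi (sum_list (fst i)) (P i A) = y i A" if i: "i : Ix p r" and A: "A : ?F" for i A
 unfolding P_def using ipsi[OF yTn[OF i A]] by auto
 have P_eqI: "P i A = B" if i: "i : Ix p r" and A: "A : ?F" and B: "B : rcarr (tpow scale (sum_list (fst i)))" "psi (sum_list (fst i)) B = y i A" for i A B
 using inj_onD[OF psi_inj[of "sum_list (fst i)"], of "P i A" B] P[OF i A] B by simp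
 have smF: "submod so ?M ?F" and smN: "submod so ?M ?N"
 by (rule submod_subc[OF stable_Int[OF stable_Fl stable_V]], blast)+
 have "layer so ?M ?N ?F (Ix p r) ?D P"
 proof (intro layer.intro lrep_quot.intro lrep_quot_axioms.intro layer_axioms.intro)
 show "lrep so ?M" by (rule lrep_subc[OF stable_V])
 show "submod so ?M ?N" by (rule smN)
 show "submod so ?M ?F" by (rule smF)
 show "?N \<subseteq> ?F"
 proof
 fix A assume "A : ?N"
 note A = subcD[OF this]
 show "A : ?F" by (rule subcI[OF A(1) IntI[OF Fl_mono[OF IntD1[OF A(2)]] IntD2[OF A(2)]]])
 qed
 show "finite (Ix p r)"
 proof (rule finite_subset)
 show "Ix p r \<subseteq> (SIGMA q:parts (?d - 2 * r). {..<?m q})"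
 proof
 fix i assume "i : Ix p r"
 from I[OF this] show "i : (SIGMA q:parts (?d - 2 * r). {..<?m q})"
 by (cases i) (simp add: parts_iff)
 qed
 show "finite (SIGMA q:parts (?d - 2 * r). {..<?m q})" by (intro finite_SigmaI finite_parts finite_lessThan)
 qed
 fix i assume i: "i : Ix p r"
 let ?e = "sum_list (fst i)"
 show "lrep so (?D i)" unfolding Di by (rule lrep_subc[OF stable_Tl_V])
 show "simple_rep so (?D i)" using Gamma_so_simple[OF I(1)[OF i]] by (cases i) simp
 fix A assume A: "A : ?F"
 note AC = F(3)[OF A]
 show "P i A : rcarr (?D i)" unfolding Di using P[OF i A] yT[OF i A] by (simp add: subc_def)
 show "P i (rscale ?M c A) = rscale (?D i) c (P i A)" for c
 proof (rule P_eqI[OF i submodD(4)[OF smF A]])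
 note s = psi_scale[OF P(1)[OF i A], of c] psi_scale[OF AC, of c]
 show "rscale (?D i) c (P i A) : rcarr (tpow scale ?e)" unfolding Di using s by simp
 show "psi ?e (rscale (?D i) c (P i A)) = y i (rscale ?M c A)"
 unfolding Di using s P(2)[OF i A] by (simp add: y_def fscale_mult_left klinD[OF klin_Phi])
 qed
 show "P i (radd ?M A B) = radd (?D i) (P i A) (P i B)" if B: "B : ?F" for B
 proof (rule P_eqI[OF i submodD(3)[OF smF A B]])
 note s = psi_add[OF P(1)[OF i A] P(1)[OF i B]] psi_add[OF AC F(3)[OF B]]
 show "radd (?D i) (P i A) (P i B) : rcarr (tpow scale ?e)" unfolding Di using s by simp
 show "psi ?e (radd (?D i) (P i A) (P i B)) = y i (radd ?M A B)"
 unfolding Di using s P(2)[OF i A] P(2)[OF i B] by (simp add: y_def distrib_right klinD[OF klin_Phi])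
 qed
 show "P i (ract ?M X A) = ract (?D i) X (P i A)" if X: "X : so" for X
 proof (rule P_eqI[OF i submodD(5)[OF smF X A]])
 note s = act_psi[OF X P(1)[OF i A]] act_psi[OF X AC]
 show "ract (?D i) X (P i A) : rcarr (tpow scale ?e)" unfolding Di using s by simp
 have xT: "psi ?d A * alp (fst i) (snd i) : Tn (?e + 2 * r)"
 using Tn_mult[OF psi_Tn alpA[OF i]] I(2)[OF i] by simp
 have "y i (ract ?M X A) = Phi ?e r (dact ?d X (psi ?d A * alp (fst i) (snd i)))"
 using s(4) dact_mult[OF so_linear(1)[OF X] psi_Tn alpA[OF i]] by (simp add: y_def)
 also have "\<dots> = dact ?e X (y i A)" using dact_Phi[OF X xT] I(2)[OF i] by (simp add: y_def)
 finally show "psi ?e (ract (?D i) X (P i A)) = y i (ract ?M X A)"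
 unfolding Di using s P(2)[OF i A] by simp
 qed
 next
 fix f assume f: "!!i. i : Ix p r ==> f i : rcarr (?D i)"
 show "\<exists>A\<in>?F. \<forall>i\<in>Ix p r. P i A = f i"
 proof (cases "2 * r <= ?d")
 \<comment> \<open>There is no room for \<open>r\<close> contractions, hence no summand, and zero is
   a preimage.\<close>
 case False
 then have "Ix p r = {}" using I(2) by fastforce
 then show ?thesis using submodD(2)[OF smF] by blast
 next
 case True
 define e where "e = ?d - 2 * r"
 have d: "?d = e + 2 * r" using True by (simp add: e_def)
 have mem: "(q, k) : Ix p r \<longleftrightarrow> q : parts e & k < ?m q" for q k
 unfolding Ix_iff[OF p] parts_iff using d by auto
 have ft: "psi e (f (q, k)) : Tl e \<inter> rmul (Tn e) (cS q)" "f (q, k) : rcarr (tpow scale e)" if "q : parts e" "k < ?m q" for q k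
 proof -
 have sq: "sum_list q = e" using that(1) by (simp add: parts_iff)
 have "f (q, k) : rcarr (Gamma_so scale Q q)" using f[of "(q, k)"] that mem[of q k] by simp
 then have "f (q, k) : subc e (Tl e \<inter> rmul (Tn e) (cS q))" unfolding Gamma_so_eq sq by simp
 note c = subcD[OF this]
 show "psi e (f (q, k)) : Tl e \<inter> rmul (Tn e) (cS q)" by (rule c(2))
 show "f (q, k) : rcarr (tpow scale e)" by (rule c(1))
 qed
 have "\<exists>x\<in>Fl (e + 2 * r) (Suc r) \<inter> rmul (Tn (e + 2 * r)) (cS p).
 \<forall>q\<in>parts e. \<forall>k<?m q. Phi e r (x * alp q k) = psi e (f (q, k))"
 by (rule lifting[where t="%q k. psi e (f (q, k))"])
 (use alp(1,3) ft(1) p d in \<open>simp_all only: parts_iff simp_thms\<close>)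
 then obtain x where x: "x : Fl ?d (Suc r) \<inter> ?V" "!!q k. q : parts e ==> k < ?m q ==> Phi e r (x * alp q k) = psi e (f (q, k))"
 unfolding d by blast
 have xT: "x : Tn ?d" using x(1) VT by blast
 let ?A = "ipsi ?d x"
 have A: "?A : ?F" using ipsi[OF xT] x(1) by (intro subcI) simp_all
 have "P i ?A = f i" if i: "i : Ix p r" for i
 proof -
 obtain q k where qk: "i = (q, k)" by (cases i)
 have m: "q : parts e" "k < ?m q" using i mem qk by auto
 then have "sum_list q = e" by (simp add: parts_iff)
 then show ?thesis
 using ipsi[OF xT] x(2)[OF m] ft(2)[OF m] by (intro P_eqI[OF i A]) (simp_all add: qk y_def)
 qed
 then show ?thesis using A by blast
 qed
 next
 fix A assume A: "A : ?F"
 let ?x = "psi ?d A"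
 have iff: "P i A = rzero (?D i) \<longleftrightarrow> y i A = 0" if i: "i : Ix p r" for i
 unfolding Di using psi_eq_0[OF P(1)[OF i A]] P(2)[OF i A] by simp
 show "(\<forall>i\<in>Ix p r. P i A = rzero (?D i)) \<longleftrightarrow> A : ?N"
 proof
 assume "A : ?N"
 then have "y i A = 0" if i: "i : Ix p r" for i
 unfolding y_def by (intro Fl_An) (use alpA[OF i] I(2)[OF i] in \<open>simp_all add: subc_def\<close>)
 then show "\<forall>i\<in>Ix p r. P i A = rzero (?D i)" using iff by blast
 next
 assume "\<forall>i\<in>Ix p r. P i A = rzero (?D i)"
 then have y0: "y i A = 0" if "i : Ix p r" for i using iff that by blast
 have "?x : Fl ?d r"
 proof (cases "2 * r <= ?d")
 case False
 then show ?thesis by (simp add: Fl_def)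
 next
 case True
 define e where "e = ?d - 2 * r"
 have d: "?d = e + 2 * r" using True by (simp add: e_def)
 obtain ka :: 'k where ka: "ka ~= 0" "cS p * cS p = fscale ka (cS p)" using cS_square[OF p] by metis
 \<comment> \<open>Elements of the Schur functor reproduce under \<open>cS p\<close> up to the
   factor \<open>ka\<close>; testing them against the corner is therefore as good as testing against
   all of the group algebra.\<close>
 have xc: "?x * cS p = fscale ka ?x" using F(2)[OF A] ka(2) by (auto simp: mult.assoc fscale_mult_right)
 have "?x : Fl (e + 2 * r) r"
 proof (rule layer_kernel)
 show "?x : Tn (e + 2 * r)" using psi_Tn[of ?d A] d by simp
 fix q and a :: "'k fna" assume q: "q : parts e" and a: "a : An (e + 2 * r)"
 have sub: "fs.subspace {b. Phi e r (?x * b) = 0}"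
 by (auto simp: fs.subspace_def distrib_left fscale_mult_right klinD[OF klin_Phi])
 have "Phi e r (?x * alp q k) = 0" if "k < ?m q" for k
 proof -
 have sq: "is_partition q" "sum_list q = e" using q by (simp_all add: parts_iff)
 have "(q, k) : Ix p r"
 by (rule iffD2[OF Ix_iff[OF p]]) (use sq d that in \<open>simp only: simp_thms\<close>)
 from y0[OF this] show ?thesis unfolding y_def fst_conv snd_conv sq(2) .
 qed
 then have "fs.span (alp q ` {..<?m q}) \<subseteq> {b. Phi e r (?x * b) = 0}"
 by (intro fs.span_minimal sub) auto
 moreover have "cS p * a * fq q r : fs.span (alp q ` {..<?m q})"
 unfolding alp(2) using a d by (intro imageI) simp
 ultimately have "Phi e r (?x * (cS p * a * fq q r)) = 0" by blast
 also have "?x * (cS p * a * fq q r) = fscale ka (?x * a * fq q r)"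
 by (simp only: mult.assoc[symmetric] xc fscale_mult_left)
 finally show "Phi e r (?x * a * fq q r) = 0" using ka(1) by (simp add: klinD[OF klin_Phi])
 qed
 then show ?thesis using d by simp
 qed
 then show "A : ?N" using F[OF A] by (intro subcI) simp_all
 qed
 next
 fix S assume S: "submod so ?M S" "?N \<subseteq> S" "S ~= ?N"
 then obtain A where A: "A : S" "A \<notin> ?N" by blast
 have "A : subc ?d ?V" if "A : S" for A using submodD(1)[OF S(1) that] by simp
 note SC = subcD[OF this]
 note AC = SC[OF A(1)]
 have "psi ?d A \<notin> Fl ?d r" using A(2) subcI[OF AC(1) IntI[OF _ AC(2)]] by blast
 then obtain z where z: "z : psi ?d ` S" "z : Fl ?d (Suc r)" "z \<notin> Fl ?d r"
 using stable_essential[OF submod_psi(1)[OF S(1)], of "psi ?d A" r] A(1) by blast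
 then obtain B where B: "B : S" "z = psi ?d B" by blast
 have "B : ?F" using z(2) unfolding B(2) by (intro subcI[OF SC(1)[OF B(1)]] IntI SC(2)[OF B(1)])
 moreover have "B \<notin> ?N" using z(3) IntD1[OF subcD(2)[of B]] unfolding B(2) by blast
 ultimately show "\<exists>B\<in>S. B : ?F & B \<notin> ?N" using B(1) by (intro bexI[of _ B] conjI)
 qed
 then show ?thesis by blast
qed

text \<open>Each step of the recursion is \<open>soc_quot\<close> for the layer that starts at the
  previous term.\<close>

lemma soc_filt_eq:
 assumes p: "is_partition p"
 shows "soc_filt so (Gamma_gl scale p) r = subc (sum_list p) (Fl (sum_list p) r \<inter> Vq p)"
proof (induction r)
 case 0
 have "Fl (sum_list p) 0 \<inter> Vq p = {0}"
 proof (rule equalityI; rule subsetI)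
 show "x : {0}" if "x : Fl (sum_list p) 0 \<inter> Vq p" for x using IntD1[OF that] by (simp only: Fl_0 singleton_iff)
 show "x : Fl (sum_list p) 0 \<inter> Vq p" if "x : {0}" for x
 using fs.subspace_0[OF stableD(1)[OF stable_V[of p]]] singletonD[OF that] by (simp only: Int_iff Fl_0 simp_thms)
 qed
 moreover have "subc (sum_list p) {0} = {rzero (tpow scale (sum_list p))}"
 using psi_zero[of "sum_list p"] psi_eq_0[of _ "sum_list p"] by (auto simp: subc_def)
 ultimately show ?case by (simp add: Gamma_gl_eq)
next
 case (Suc r)
 obtain P where "layer so (Msub (sum_list p) (Vq p)) (subc (sum_list p) (Fl (sum_list p) r \<inter> Vq p))
 (subc (sum_list p) (Fl (sum_list p) (Suc r) \<inter> Vq p)) (Ix p r) (%(q, k). Gamma_so scale Q q) P"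
 using layer_step[OF p] by blast
 from layer.soc_quot[OF this] show ?case using Suc by (simp add: Gamma_gl_eq)
qed

end

theorem theorem4p3:
  fixes scale :: "'k::{alg_closed_field, field_char_0} \<Rightarrow> 'v::ab_group_add \<Rightarrow> 'v"
    and Q :: "'v \<Rightarrow> 'v \<Rightarrow> 'k"
    and p :: "nat list" and d :: nat
  assumes "countable_orthogonal_space scale Q"
    and "is_partition p" and "sum_list p = d" and "d > 0"
  shows "indecomposable_rep (so_inf scale Q) (Gamma_gl scale p) \<and>
    (\<forall>r. rep_iso (so_inf scale Q)
       (soc_layer (so_inf scale Q) (Gamma_gl scale p) (r + 1))
       (direct_sum_rep
          (SIGMA q:{q. is_partition q}.
             {..<\<Sum>s\<in>{s. is_partition s \<and> sum_list s = r}. lr_coeff q (map ((*) 2) s) p})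
          (\<lambda>(q, k). Gamma_so scale Q q)))"
proof -
  interpret countable_orthogonal_space scale Q by (rule assms(1))
  obtain h where h: "\<forall>a b. Q (h a) (h b) = (if b = star a then 1 else 0)" "span (range h) = UNIV"
    using hyperbolic_basis by blast
  interpret hyperbolic_space scale Q h
    by unfold_locales (use h in simp_all)
  show ?thesis
  proof (intro conjI allI)
    show "indecomposable_rep so (Gamma_gl scale p)" by (rule Gamma_gl_indecomposable[OF assms(2)])
    fix r
    obtain P where "layer so (Msub (sum_list p) (Vq p)) (subc (sum_list p) (Fl (sum_list p) r \<inter> Vq p))
      (subc (sum_list p) (Fl (sum_list p) (Suc r) \<inter> Vq p)) (Ix p r) (\<lambda>(q, k). Gamma_so scale Q q) P"
      using layer_step[OF assms(2)] by blast
    \<comment> \<open>With index \<open>r + 1\<close> the layer is term \<open>r + 1\<close> of the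
      socle filtration modulo term \<open>r\<close>, so it carries the \<open>r\<close>-fold
      contractions.\<close>
    from layer.layer_iso[OF this]
    show "rep_iso so (soc_layer so (Gamma_gl scale p) (r + 1)) (direct_sum_rep (Ix p r) (\<lambda>(q, k). Gamma_so scale Q q))"
      unfolding soc_layer_def soc_filt_eq[OF assms(2)] by (simp add: soc_filt_eq[OF assms(2)] Gamma_gl_eq)
  qed
qed

end
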